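(* Let $P_0,P_1,\ldots$ give an iterative operadic theory of $n$-categories, and let $n\ge3$. Then the monads $$Q^{(n)}_0,\ldots,Q^{(n)}_{n-1}$$ on $n\text{-}\mathbf{GSet}$ (for parametrised $i$-composition, defined in the context) form a distributive series of monads; that is, they can be equipped with distributive laws $\lambda_{ij}:Q^{(n)}_iQ^{(n)}_j\Rightarrow Q^{(n)}_jQ^{(n)}_i$ for all $n>i>j\ge0$ satisfying the Yang–Baxter equation for all $n>i>j>k\ge0$.
   Context: **Distributive series of monads.** A series of monads $T_0,\dots,T_{n-1}$ on a category $\mathcal C$ equipped with distributive laws $\lambda_{ij}:T_iT_j\Rightarrow T_jT_i$ for all $i>j$ such that for all $i>j>k$ the Yang–Baxter equation holds: $$(\lambda_{jk}T_i)\circ(T_j\lambda_{ik})\circ(\lambda_{ij}T_k)=(T_k\lambda_{ij})\circ(\lambda_{ik}T_j)\circ(T_i\lambda_{jk}):T_iT_jT_k\Rightarrow T_kT_jT_i.$$ **Operads and $(\mathcal V,P)$-categories.** "Operad" in a category $\mathcal V$ with finite products means a classical non-symmetric operad: objects $P(k)$ ($k\ge 0$), a unit $1\to P(1)$ and composition maps $P(m)\times P(k_1)\times\cdots\times P(k_m)\to P(k_1+\cdots+k_m)$, associative and unital. A $\mathcal V$-graph $A$ is a set $A_0$ of objects with an object $A(a,a')\in\mathcal V$ for all $a,a'\in A_0$; morphisms are functions on objects with morphisms $A(a,a')\to B(Fa,Fa')$. They form $\mathcal V\text{-}\mathbf{Gph}$. A $(\mathcal V,P)$-category is a $\mathcal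 V$-graph $A$ with, for all $k\ge0$ and $a_0,\dots,a_k\in A_0$, a morphism $\gamma: P(k)\times A(a_{k-1},a_k)\times\cdots\times A(a_0,a_1)\to A(a_0,a_k)$ (for $k=0$: $P(0)\to A(a,a)$), compatible with the operad structure: the unit of $P$ acts as the identity, and, for a composable string cut into $m$ consecutive blocks, applying $p_i\in P(k_i)$ to the $i$-th block along the string and then $p\in P(m)$ to the results agrees with applying the operadic composite $p(p_1,\dots,p_m)$ to the whole string. Morphisms are $\mathcal V$-graph morphisms commuting with all $\gamma$; the category is $(\mathcal V,P)\text{-}\mathbf{Cat}$. **Iterative operadic theory of $n$-categories.** For all $n\ge0$ a category $\mathcal V_n$ and a contractible operad $P_n$ in $\mathcal V_n$ such that $\mathcal V_0=\mathbf{Set}$ and $\mathcal V_{n+1}=(\mathcal V_n,P_n)\text{-}\mathbf{Cat}$. Contractibility: a set is contractible iff it has exactly one element; an operad is contractible if each $P(k)$ is; a $\mathcal V$-graph $A$ is contractible if $A_0\ne\emptyset$ and every $A(a,a')$ is contractible in $\mathcal V$; a $(\mathcal V,P)$-category is contractible if its underlying $\mathcal V$-graph is. **Globular sets.** $n\text{-}\mathbf{GSet}$, the category of $n$-globular sets, is identified with $n\text{-}\mathbf{Gph}$, where $0\text{-}\mathbf{Gph}=\mathbf{Set}$, $n\text{-}\mathbf{Gph}=((n-1)\text{-}\mathbf{Gph})\text{-}\mathbf{Gph}$. The forgetful functor $U_n:\mathcal V_n\to n\text{-}\mathbf{GSet}$ is $U_0=\mathrm{id}$, and $U_nA$ has objects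 $A_0$ and homs $U_{n-1}(A(a,a'))$. **The monads $Q^{(n)}_i$.** For a presheaf category $\mathcal V$ and operad $R$ in $\mathcal V$, $\mathbf{fc}_{(\mathcal V,R)}$ is the free $(\mathcal V,R)$-category monad on $\mathcal V\text{-}\mathbf{Gph}$: identity on objects, and $$(\mathbf{fc}_{(\mathcal V,R)}A)(a,a')=\coprod_{k\ge0,\ a=a_0,\dots,a_k=a'}R(k)\times A(a_{k-1},a_k)\times\cdots\times A(a_0,a_1),$$ with unit and multiplication from those of $R$. A functor or monad $F$ on $\mathcal V$ induces $F_*$ on $\mathcal V\text{-}\mathbf{Gph}$, the identity on objects and $F$ on hom-objects; $(-)_{i*}$ denotes applying $(-)_*$ $i$ times. For $0\le i<n$, $Q^{(n)}_i=(\mathbf{fc}_{(\mathcal V,R)})_{i*}$ with $\mathcal V=(n-i-1)\text{-}\mathbf{GSet}$ and $R=U_{n-i-1}P_{n-i-1}$. *)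

theory Defs
  imports Main "HOL-Library.FuncSet"
begin

section \<open>Categories, monads and distributive series\<close>

text \<open>Hom-sets need not be disjoint, so functors receive the source and target of the
  morphism they act on.\<close>

record ('o, 'm) cat =
  Ob :: "'o set"
  Hom :: "'o \<Rightarrow> 'o \<Rightarrow> 'm set"
  Id :: "'o \<Rightarrow> 'm"
  Comp :: "'m \<Rightarrow> 'm \<Rightarrow> 'm"

definition category :: "('o, 'm, 'z) cat_scheme \<Rightarrow> bool" where
  "category C \<longleftrightarrow>
     (\<forall>A\<in>Ob C. Id C A \<in> Hom C A A) \<and>
     (\<forall>A\<in>Ob C. \<forall>B\<in>Ob C. \<forall>D\<in>Ob C. \<forall>f\<in>Hom C A B. \<forall>g\<in>Hom C B D. Comp C g f \<in> Hom C A D) \<and>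
     (\<forall>A\<in>Ob C. \<forall>B\<in>Ob C. \<forall>f\<in>Hom C A B. Comp C f (Id C A) = f \<and> Comp C (Id C B) f = f) \<and>
     (\<forall>A\<in>Ob C. \<forall>B\<in>Ob C. \<forall>D\<in>Ob C. \<forall>E\<in>Ob C. \<forall>f\<in>Hom C A B. \<forall>g\<in>Hom C B D. \<forall>h\<in>Hom C D E.
        Comp C h (Comp C g f) = Comp C (Comp C h g) f)"

record ('o, 'm) endo =
  fob :: "'o \<Rightarrow> 'o"
  fmap :: "'o \<Rightarrow> 'o \<Rightarrow> 'm \<Rightarrow> 'm"

definition endofunctor :: "('o, 'm, 'z) cat_scheme \<Rightarrow> ('o, 'm, 'y) endo_scheme \<Rightarrow> bool" where
  "endofunctor C F \<longleftrightarrow>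
     (\<forall>A\<in>Ob C. fob F A \<in> Ob C) \<and>
     (\<forall>A\<in>Ob C. \<forall>B\<in>Ob C. \<forall>f\<in>Hom C A B. fmap F A B f \<in> Hom C (fob F A) (fob F B)) \<and>
     (\<forall>A\<in>Ob C. fmap F A A (Id C A) = Id C (fob F A)) \<and>
     (\<forall>A\<in>Ob C. \<forall>B\<in>Ob C. \<forall>D\<in>Ob C. \<forall>f\<in>Hom C A B. \<forall>g\<in>Hom C B D.
        fmap F A D (Comp C g f) = Comp C (fmap F B D g) (fmap F A B f))"

definition id_endo :: "('o, 'm) endo" where
  "id_endo = \<lparr>fob = (\<lambda>A. A), fmap = (\<lambda>A B f. f)\<rparr>"

definition comp_endo ::
  "('o, 'm, 'y) endo_scheme \<Rightarrow> ('o, 'm, 'z) endo_scheme \<Rightarrow> ('o, 'm) endo" where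
  "comp_endo F G = \<lparr>fob = (\<lambda>A. fob F (fob G A)),
                    fmap = (\<lambda>A B f. fmap F (fob G A) (fob G B) (fmap G A B f))\<rparr>"

definition natural :: "('o, 'm, 'z) cat_scheme \<Rightarrow> ('o, 'm, 'x) endo_scheme \<Rightarrow>
    ('o, 'm, 'y) endo_scheme \<Rightarrow> ('o \<Rightarrow> 'm) \<Rightarrow> bool" where
  "natural C F G t \<longleftrightarrow>
     (\<forall>A\<in>Ob C. t A \<in> Hom C (fob F A) (fob G A)) \<and>
     (\<forall>A\<in>Ob C. \<forall>B\<in>Ob C. \<forall>f\<in>Hom C A B.
        Comp C (t B) (fmap F A B f) = Comp C (fmap G A B f) (t A))"

record ('o, 'm) monad = "('o, 'm) endo" +
  eta :: "'o \<Rightarrow> 'm"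
  mu :: "'o \<Rightarrow> 'm"

definition is_monad :: "('o, 'm, 'z) cat_scheme \<Rightarrow> ('o, 'm) monad \<Rightarrow> bool" where
  "is_monad C T \<longleftrightarrow> endofunctor C T \<and>
     natural C id_endo T (eta T) \<and> natural C (comp_endo T T) T (mu T) \<and>
     (\<forall>A\<in>Ob C.
        Comp C (mu T A) (eta T (fob T A)) = Id C (fob T A) \<and>
        Comp C (mu T A) (fmap T A (fob T A) (eta T A)) = Id C (fob T A) \<and>
        Comp C (mu T A) (mu T (fob T A)) =
          Comp C (mu T A) (fmap T (fob T (fob T A)) (fob T A) (mu T A)))"

text \<open>A distributive law \<open>l : S T \<Rightarrow> T S\<close> in the sense of Beck.\<close>

definition distributive_law :: "('o, 'm, 'z) cat_scheme \<Rightarrow> ('o, 'm) monad \<Rightarrow> ('o, 'm) monad \<Rightarrow>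
    ('o \<Rightarrow> 'm) \<Rightarrow> bool" where
  "distributive_law C S T l \<longleftrightarrow>
     natural C (comp_endo S T) (comp_endo T S) l \<and>
     (\<forall>A\<in>Ob C.
        Comp C (l A) (fmap S A (fob T A) (eta T A)) = eta T (fob S A) \<and>
        Comp C (l A) (eta S (fob T A)) = fmap T A (fob S A) (eta S A) \<and>
        Comp C (l A) (fmap S (fob T (fob T A)) (fob T A) (mu T A)) =
          Comp C (mu T (fob S A))
            (Comp C (fmap T (fob S (fob T A)) (fob T (fob S A)) (l A)) (l (fob T A))) \<and>
        Comp C (l A) (mu S (fob T A)) =
          Comp C (fmap T (fob S (fob S A)) (fob S A) (mu S A))
            (Comp C (l (fob S A)) (fmap S (fob S (fob T A)) (fob T (fob S A)) (l A))))"

definition yang_baxter :: "('o, 'm, 'z) cat_scheme \<Rightarrow> (nat \<Rightarrow> ('o, 'm) monad) \<Rightarrow>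
    (nat \<Rightarrow> nat \<Rightarrow> 'o \<Rightarrow> 'm) \<Rightarrow> nat \<Rightarrow> nat \<Rightarrow> nat \<Rightarrow> bool" where
  "yang_baxter C T l i j k \<longleftrightarrow>
     (\<forall>A\<in>Ob C.
        Comp C (l j k (fob (T i) A))
          (Comp C (fmap (T j) (fob (T i) (fob (T k) A)) (fob (T k) (fob (T i) A)) (l i k A))
            (l i j (fob (T k) A))) =
        Comp C (fmap (T k) (fob (T i) (fob (T j) A)) (fob (T j) (fob (T i) A)) (l i j A))
          (Comp C (l i k (fob (T j) A))
            (fmap (T i) (fob (T j) (fob (T k) A)) (fob (T k) (fob (T j) A)) (l j k A))))"

definition distributive_series :: "('o, 'm, 'z) cat_scheme \<Rightarrow> nat \<Rightarrow> (nat \<Rightarrow> ('o, 'm) monad) \<Rightarrow>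
    (nat \<Rightarrow> nat \<Rightarrow> 'o \<Rightarrow> 'm) \<Rightarrow> bool" where
  "distributive_series C n T l \<longleftrightarrow> category C \<and> (\<forall>i<n. is_monad C (T i)) \<and>
     (\<forall>i j. n > i \<and> i > j \<longrightarrow> distributive_law C (T i) (T j) (l i j)) \<and>
     (\<forall>i j k. n > i \<and> i > j \<and> j > k \<longrightarrow> yang_baxter C T l i j k)"

section \<open>A universe closed under tuples and tagged sums\<close>

text \<open>
  The type \<open>'a elt\<close> plays the role of a universe: \<open>Set\<close> is the category of all subsets of
  \<open>'a elt\<close>. Since \<open>'a\<close> is arbitrary, sets of every cardinality occur.
  \<open>Inj s x\<close> is the copy of \<open>x\<close> in the summand with index \<open>s\<close> of a coproduct; the coproducts
  needed are indexed by strings of objects.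
\<close>

datatype 'a elt = Atom 'a | Tup (untup: "'a elt list") | Inj "'a elt list" "'a elt"

definition tuples :: "'a elt set list \<Rightarrow> 'a elt set" where
  "tuples Xs = {Tup xs | xs. list_all2 (\<in>) xs Xs}"

text \<open>
  One type accommodates the objects of \<open>V\<^sub>n\<close> and of \<open>n-Gph\<close> for all \<open>n\<close>: sets, enriched
  graphs, and enriched graphs with actions, where \<open>acts A as\<close> is the action for the string of
  objects \<open>as = [a\<^sub>0, \<dots>, a\<^sub>k]\<close>. Likewise for morphisms, which carry their set of objects \<open>src\<close>.
  All functions are extensional (restricted to where they are meaningful), so that HOL equality
  is equality of objects and morphisms.
\<close>

datatype 'u mor =
    Fun (src: "'u set") (app: "'u \<Rightarrow> 'u")
  | Gmor (src: "'u set") (app: "'u \<Rightarrow> 'u") (happ: "'u \<times> 'u \<Rightarrow> 'u mor")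

datatype 'u obj =
    Disc (objs: "'u set")
  | Graph (objs: "'u set") (homs: "'u \<times> 'u \<Rightarrow> 'u obj")
  | Alg (objs: "'u set") (homs: "'u \<times> 'u \<Rightarrow> 'u obj") (acts: "'u list \<Rightarrow> 'u mor")

section \<open>Categories with chosen products and coproducts\<close>

record ('o, 'm) fpcat = "('o, 'm) cat" +
  Prod :: "'o list \<Rightarrow> 'o"
  Proj :: "'o list \<Rightarrow> nat \<Rightarrow> 'm"

record ('o, 'm, 'i) bicat = "('o, 'm) fpcat" +
  Coprod :: "'i set \<Rightarrow> ('i \<Rightarrow> 'o) \<Rightarrow> 'o"
  Incl :: "'i set \<Rightarrow> ('i \<Rightarrow> 'o) \<Rightarrow> 'i \<Rightarrow> 'm"

text \<open>The morphism \<open>X \<rightarrow> Prod Bs\<close> with components \<open>fs\<close>.\<close>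

definition tuple :: "('o, 'm, 'z) fpcat_scheme \<Rightarrow> 'o \<Rightarrow> 'o list \<Rightarrow> 'm list \<Rightarrow> 'm" where
  "tuple V X Bs fs = (THE h. h \<in> Hom V X (Prod V Bs) \<and>
     (\<forall>i<length Bs. Comp V (Proj V Bs i) h = fs ! i))"

type_synonym 'a vcat = "('a elt obj, 'a elt mor) fpcat"
type_synonym 'a gcat = "('a elt obj, 'a elt mor, 'a elt list) bicat"

definition set_cat :: "'a gcat" where
  "set_cat = \<lparr>
     Ob = range Disc,
     Hom = (\<lambda>A B. {Fun (objs A) f | f. f \<in> objs A \<rightarrow>\<^sub>E objs B}),
     Id = (\<lambda>A. Fun (objs A) (\<lambda>x\<in>objs A. x)),
     Comp = (\<lambda>g f. Fun (src f) (\<lambda>x\<in>src f. app g (app f x))),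
     Prod = (\<lambda>As. Disc (tuples (map objs As))),
     Proj = (\<lambda>As i. Fun (tuples (map objs As)) (\<lambda>z\<in>tuples (map objs As). untup z ! i)),
     Coprod = (\<lambda>S A. Disc {Inj s x | s x. s \<in> S \<and> x \<in> objs (A s)}),
     Incl = (\<lambda>S A s. Fun (objs (A s)) (\<lambda>x\<in>objs (A s). Inj s x))\<rparr>"

section \<open>Enriched graphs\<close>

definition gr :: "'u obj \<Rightarrow> 'u obj" where
  "gr A = Graph (objs A) (homs A)"

text \<open>These are also applied to objects with actions, whose underlying graph is then meant.\<close>

definition gHom :: "('u obj, 'u mor, 'z) fpcat_scheme \<Rightarrow> 'u obj \<Rightarrow> 'u obj \<Rightarrow> 'u mor set" where
  "gHom V A B = {Gmor (objs A) f F | f F. f \<in> objs A \<rightarrow>\<^sub>E objs B \<and>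
     F \<in> (\<Pi>\<^sub>E e\<in>objs A \<times> objs A. Hom V (homs A e) (homs B (map_prod f f e)))}"

definition gId :: "('u obj, 'u mor, 'z) fpcat_scheme \<Rightarrow> 'u obj \<Rightarrow> 'u mor" where
  "gId V A = Gmor (objs A) (\<lambda>a\<in>objs A. a) (\<lambda>e\<in>objs A \<times> objs A. Id V (homs A e))"

definition gComp :: "('u obj, 'u mor, 'z) fpcat_scheme \<Rightarrow> 'u mor \<Rightarrow> 'u mor \<Rightarrow> 'u mor" where
  "gComp V g f = Gmor (src f) (\<lambda>a\<in>src f. app g (app f a))
     (\<lambda>e\<in>src f \<times> src f. Comp V (happ g (map_prod (app f) (app f) e)) (happ f e))"

definition hom_list :: "'a elt obj list \<Rightarrow> 'a elt \<times> 'a elt \<Rightarrow> 'a elt obj list" where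
  "hom_list As e = map (\<lambda>i. homs (As ! i) (untup (fst e) ! i, untup (snd e) ! i)) [0..<length As]"

definition gProd :: "('a elt obj, 'a elt mor, 'z) fpcat_scheme \<Rightarrow> 'a elt obj list \<Rightarrow> 'a elt obj" where
  "gProd V As = (let T = tuples (map objs As) in
     Graph T (\<lambda>e\<in>T \<times> T. Prod V (hom_list As e)))"

definition gProj :: "('a elt obj, 'a elt mor, 'z) fpcat_scheme \<Rightarrow> 'a elt obj list \<Rightarrow> nat \<Rightarrow>
    'a elt mor" where
  "gProj V As i = (let T = tuples (map objs As) in
     Gmor T (\<lambda>z\<in>T. untup z ! i) (\<lambda>e\<in>T \<times> T. Proj V (hom_list As e) i))"

text \<open>In a coproduct of graphs, the hom between different summands is initial.\<close>

definition gCoprod :: "'a gcat \<Rightarrow> 'a elt list set \<Rightarrow> ('a elt list \<Rightarrow> 'a elt obj) \<Rightarrow> 'a elt obj" where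
  "gCoprod V S A = (let T = {Inj s x | s x. s \<in> S \<and> x \<in> objs (A s)} in
     Graph T (\<lambda>e\<in>T \<times> T. case e of (Inj s x, Inj s' x') \<Rightarrow>
       if s = s' then homs (A s) (x, x') else Coprod V {} (\<lambda>_. undefined)))"

definition gIncl :: "'a gcat \<Rightarrow> 'a elt list set \<Rightarrow> ('a elt list \<Rightarrow> 'a elt obj) \<Rightarrow> 'a elt list \<Rightarrow>
    'a elt mor" where
  "gIncl V S A s = Gmor (objs (A s)) (\<lambda>x\<in>objs (A s). Inj s x)
     (\<lambda>e\<in>objs (A s) \<times> objs (A s). Id V (homs (A s) e))"

definition gph :: "'a gcat \<Rightarrow> 'a gcat" where
  "gph V = \<lparr>
     Ob = {Graph X H | X H. H \<in> X \<times> X \<rightarrow>\<^sub>E Ob V},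
     Hom = gHom V, Id = gId V, Comp = gComp V, Prod = gProd V, Proj = gProj V,
     Coprod = gCoprod V, Incl = gIncl V\<rparr>"

definition nGSet :: "nat \<Rightarrow> 'a gcat" where
  "nGSet n = (gph ^^ n) set_cat"

section \<open>Operads\<close>

text \<open>
  Diagrams built from products are expressed by generalised elements \<open>X \<rightarrow> A\<close>, for all
  objects \<open>X\<close>.
\<close>

record ('o, 'm) operad =
  ar :: "nat \<Rightarrow> 'o"
  opunit :: 'm
  opcomp :: "nat list \<Rightarrow> 'm"

definition unit_elt :: "('o, 'm, 'z) fpcat_scheme \<Rightarrow> ('o, 'm) operad \<Rightarrow> 'o \<Rightarrow> 'm" where
  "unit_elt V P X = Comp V (opunit P) (tuple V X [] [])"

text \<open>The composite \<open>p(p\<^sub>1, \<dots>, p\<^sub>m)\<close>, where each \<open>p\<^sub>i\<close> is given together with its arity.\<close>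

definition comp_elt :: "('o, 'm, 'z) fpcat_scheme \<Rightarrow> ('o, 'm) operad \<Rightarrow> 'o \<Rightarrow> 'm \<Rightarrow>
    (nat \<times> 'm) list \<Rightarrow> 'm" where
  "comp_elt V P X p ps = Comp V (opcomp P (map fst ps))
     (tuple V X (ar P (length ps) # map (ar P \<circ> fst) ps) (p # map snd ps))"

definition is_operad :: "('o, 'm, 'z) fpcat_scheme \<Rightarrow> ('o, 'm) operad \<Rightarrow> bool" where
  "is_operad V P \<longleftrightarrow>
     (\<forall>k. ar P k \<in> Ob V) \<and>
     opunit P \<in> Hom V (Prod V []) (ar P 1) \<and>
     (\<forall>ks. opcomp P ks \<in> Hom V (Prod V (ar P (length ks) # map (ar P) ks)) (ar P (sum_list ks))) \<and>
     (\<forall>X\<in>Ob V. \<forall>k. \<forall>p\<in>Hom V X (ar P k).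
        comp_elt V P X (unit_elt V P X) [(k, p)] = p \<and>
        comp_elt V P X p (replicate k (1, unit_elt V P X)) = p) \<and>
     (\<forall>X\<in>Ob V. \<forall>p ps qss.
        p \<in> Hom V X (ar P (length ps)) \<and>
        list_all2 (\<lambda>(k, q) qs. q \<in> Hom V X (ar P k) \<and> length qs = k \<and>
          (\<forall>(l, r)\<in>set qs. r \<in> Hom V X (ar P l))) ps qss \<longrightarrow>
        comp_elt V P X (comp_elt V P X p ps) (concat qss) =
        comp_elt V P X p
          (map2 (\<lambda>(k, q) qs. (sum_list (map fst qs), comp_elt V P X q qs)) ps qss))"

section \<open>Words: generalised elements of \<open>P(k) \<times> A(a\<^sub>k\<^sub>-\<^sub>1,a\<^sub>k) \<times> \<dots> \<times> A(a\<^sub>0,a\<^sub>1)\<close>\<close>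

definition strings :: "'u obj \<Rightarrow> 'u list set" where
  "strings A = {as. as \<noteq> [] \<and> set as \<subseteq> objs A}"

definition paths :: "'u obj \<Rightarrow> 'u \<times> 'u \<Rightarrow> 'u list set" where
  "paths A e = {as \<in> strings A. hd as = fst e \<and> last as = snd e}"

definition steps :: "'u list \<Rightarrow> ('u \<times> 'u) list" where
  "steps as = zip as (tl as)"

definition factors :: "('u obj, 'u mor) operad \<Rightarrow> 'u obj \<Rightarrow> 'u list \<Rightarrow> 'u obj list" where
  "factors P A as = ar P (length as - 1) # rev (map (homs A) (steps as))"

text \<open>
  A word at stage \<open>X\<close> is \<open>(as, p, xs)\<close> with \<open>as = [a\<^sub>0, \<dots>, a\<^sub>k]\<close>, \<open>p : X \<rightarrow> P(k)\<close> and
  \<open>xs = [x\<^sub>1, \<dots>, x\<^sub>k]\<close>, \<open>x\<^sub>i : X \<rightarrow> A(a\<^sub>i\<^sub>-\<^sub>1, a\<^sub>i)\<close>. In a nested word, \<open>x\<^sub>i\<close> is replaced by a word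
  from \<open>a\<^sub>i\<^sub>-\<^sub>1\<close> to \<open>a\<^sub>i\<close>.
\<close>

type_synonym 'u word = "'u list \<times> 'u mor \<times> 'u mor list"
type_synonym 'u nested = "'u list \<times> 'u mor \<times> 'u word list"

definition words :: "('u obj, 'u mor, 'z) fpcat_scheme \<Rightarrow> ('u obj, 'u mor) operad \<Rightarrow> 'u obj \<Rightarrow>
    'u obj \<Rightarrow> 'u \<times> 'u \<Rightarrow> 'u word set" where
  "words V P A X e = {(as, p, xs). as \<in> paths A e \<and> p \<in> Hom V X (ar P (length as - 1)) \<and>
     list_all2 (\<lambda>d x. x \<in> Hom V X (homs A d)) (steps as) xs}"

definition nested_words :: "('u obj, 'u mor, 'z) fpcat_scheme \<Rightarrow> ('u obj, 'u mor) operad \<Rightarrow>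
    'u obj \<Rightarrow> 'u obj \<Rightarrow> 'u \<times> 'u \<Rightarrow> 'u nested set" where
  "nested_words V P A X e = {(as, p, ws). as \<in> paths A e \<and> p \<in> Hom V X (ar P (length as - 1)) \<and>
     list_all2 (\<lambda>d w. w \<in> words V P A X d) (steps as) ws}"

text \<open>Concatenate the inner strings along the outer one, composing the operations in \<open>P\<close>.\<close>

definition flatten :: "('u obj, 'u mor, 'z) fpcat_scheme \<Rightarrow> ('u obj, 'u mor) operad \<Rightarrow>
    'u obj \<Rightarrow> 'u nested \<Rightarrow> 'u word" where
  "flatten V P X = (\<lambda>(as, p, ws).
     (hd as # concat (map (\<lambda>(bs, q, xs). tl bs) ws),
      comp_elt V P X p (map (\<lambda>(bs, q, xs). (length bs - 1, q)) ws),
      concat (map (\<lambda>(bs, q, xs). xs) ws)))"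

definition map_word :: "('u obj, 'u mor, 'z) fpcat_scheme \<Rightarrow> 'u mor \<Rightarrow> 'u word \<Rightarrow> 'u word" where
  "map_word V f = (\<lambda>(as, p, xs).
     (map (app f) as, p, map2 (\<lambda>d x. Comp V (happ f d) x) (steps as) xs))"

definition word_elt :: "('u obj, 'u mor, 'z) fpcat_scheme \<Rightarrow> ('u obj, 'u mor) operad \<Rightarrow>
    'u obj \<Rightarrow> 'u obj \<Rightarrow> 'u word \<Rightarrow> 'u mor" where
  "word_elt V P A X = (\<lambda>(as, p, xs). tuple V X (factors P A as) (p # rev xs))"

section \<open>\<open>(V,P)\<close>-categories\<close>

definition act :: "('u obj, 'u mor, 'z) fpcat_scheme \<Rightarrow> ('u obj, 'u mor) operad \<Rightarrow>
    'u obj \<Rightarrow> 'u obj \<Rightarrow> 'u word \<Rightarrow> 'u mor" where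
  "act V P A X w = Comp V (acts A (fst w)) (word_elt V P A X w)"

definition vpOb :: "('u obj, 'u mor, 'z) fpcat_scheme \<Rightarrow> ('u obj, 'u mor) operad \<Rightarrow>
    'u obj set" where
  "vpOb V P = {A. \<exists>S H g. A = Alg S H g \<and>
     H \<in> S \<times> S \<rightarrow>\<^sub>E Ob V \<and>
     g \<in> (\<Pi>\<^sub>E as\<in>strings A. Hom V (Prod V (factors P A as)) (H (hd as, last as))) \<and>
     (\<forall>X\<in>Ob V. \<forall>a\<in>S. \<forall>b\<in>S. \<forall>x\<in>Hom V X (H (a, b)).
        act V P A X ([a, b], unit_elt V P X, [x]) = x) \<and>
     (\<forall>X\<in>Ob V. \<forall>e\<in>S \<times> S. \<forall>(as, p, ws)\<in>nested_words V P A X e.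
        act V P A X (as, p, map (act V P A X) ws) = act V P A X (flatten V P X (as, p, ws)))}"

definition vpHom :: "('u obj, 'u mor, 'z) fpcat_scheme \<Rightarrow> ('u obj, 'u mor) operad \<Rightarrow>
    'u obj \<Rightarrow> 'u obj \<Rightarrow> 'u mor set" where
  "vpHom V P A B = {f \<in> gHom V A B.
     \<forall>X\<in>Ob V. \<forall>e\<in>objs A \<times> objs A. \<forall>w\<in>words V P A X e.
       Comp V (happ f e) (act V P A X w) = act V P B X (map_word V f w)}"

text \<open>The product is the product of the underlying graphs, with the unique structure for which
  the projections are morphisms.\<close>

definition vpProd :: "('a elt obj, 'a elt mor, 'z) fpcat_scheme \<Rightarrow>
    ('a elt obj, 'a elt mor) operad \<Rightarrow> 'a elt obj list \<Rightarrow> 'a elt obj" where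
  "vpProd V P As = (THE A. A \<in> vpOb V P \<and> gr A = gProd V As \<and>
     (\<forall>i<length As. gProj V As i \<in> vpHom V P A (As ! i)))"

definition vp_cat :: "'a vcat \<Rightarrow> ('a elt obj, 'a elt mor) operad \<Rightarrow> 'a vcat" where
  "vp_cat V P = \<lparr>
     Ob = vpOb V P, Hom = vpHom V P, Id = gId V, Comp = gComp V,
     Prod = vpProd V P, Proj = gProj V\<rparr>"

section \<open>Iterative operadic theories of \<open>n\<close>-categories\<close>

primrec VV :: "(nat \<Rightarrow> ('a elt obj, 'a elt mor) operad) \<Rightarrow> nat \<Rightarrow> 'a vcat" where
  "VV P 0 = fpcat.truncate set_cat"
| "VV P (Suc n) = vp_cat (VV P n) (P n)"

primrec contractible :: "nat \<Rightarrow> 'u obj \<Rightarrow> bool" where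
  "contractible 0 A \<longleftrightarrow> (\<exists>!x. x \<in> objs A)"
| "contractible (Suc n) A \<longleftrightarrow> objs A \<noteq> {} \<and> (\<forall>e\<in>objs A \<times> objs A. contractible n (homs A e))"

definition iterative_operadic_theory :: "(nat \<Rightarrow> ('a elt obj, 'a elt mor) operad) \<Rightarrow> bool" where
  "iterative_operadic_theory P \<longleftrightarrow>
     (\<forall>n. is_operad (VV P n) (P n) \<and> (\<forall>k. contractible n (ar (P n) k)))"

primrec U :: "nat \<Rightarrow> 'u obj \<Rightarrow> 'u obj" where
  "U 0 A = A"
| "U (Suc n) A = Graph (objs A) (\<lambda>e\<in>objs A \<times> objs A. U n (homs A e))"

text \<open>
  On morphisms, the forgetful functor \<open>U\<^sub>n : V\<^sub>n \<rightarrow> n-GSet\<close> changes nothing: a morphism of \<open>V\<^sub>n\<close>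
  is represented by its underlying morphism of \<open>n\<close>-globular sets. It preserves the chosen
  products strictly, so the structure maps of an operad are retained as well.
\<close>

definition U_operad :: "nat \<Rightarrow> ('u obj, 'u mor) operad \<Rightarrow> ('u obj, 'u mor) operad" where
  "U_operad n P = P\<lparr>ar := (\<lambda>k. U n (ar P k))\<rparr>"

section \<open>The monads\<close>

definition fc_ob :: "'a gcat \<Rightarrow> ('a elt obj, 'a elt mor) operad \<Rightarrow> 'a elt obj \<Rightarrow> 'a elt obj" where
  "fc_ob V R A = Graph (objs A) (\<lambda>e\<in>objs A \<times> objs A.
     Coprod V (paths A e) (\<lambda>as. Prod V (factors R A as)))"

text \<open>The generalised element of \<open>(fc A)(a,a')\<close> given by a word from \<open>a\<close> to \<open>a'\<close>. Such elements
  determine morphisms out of \<open>(fc A)(a,a')\<close> and, by distributivity of products over coproducts,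
  nested ones determine morphisms out of \<open>(fc (fc A))(a,a')\<close>.\<close>

definition fc_elt :: "'a gcat \<Rightarrow> ('a elt obj, 'a elt mor) operad \<Rightarrow> 'a elt obj \<Rightarrow> 'a elt obj \<Rightarrow>
    'a elt word \<Rightarrow> 'a elt mor" where
  "fc_elt V R A X w = (let as = fst w in
     Comp V (Incl V (paths A (hd as, last as)) (\<lambda>as. Prod V (factors R A as)) as)
       (word_elt V R A X w))"

definition fc :: "'a gcat \<Rightarrow> ('a elt obj, 'a elt mor) operad \<Rightarrow>
    ('a elt obj, 'a elt mor) monad" where
  "fc V R = \<lparr>
     fob = fc_ob V R,
     fmap = (\<lambda>A B f. Gmor (objs A) (app f) (\<lambda>e\<in>objs A \<times> objs A.
       THE h. h \<in> Hom V (homs (fc_ob V R A) e) (homs (fc_ob V R B) (map_prod (app f) (app f) e)) \<and>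
         (\<forall>X\<in>Ob V. \<forall>w\<in>words V R A X e.
            Comp V h (fc_elt V R A X w) = fc_elt V R B X (map_word V f w)))),
     eta = (\<lambda>A. Gmor (objs A) (\<lambda>a\<in>objs A. a) (\<lambda>e\<in>objs A \<times> objs A.
       let X = homs A e in fc_elt V R A X ([fst e, snd e], unit_elt V R X, [Id V X]))),
     mu = (\<lambda>A. Gmor (objs A) (\<lambda>a\<in>objs A. a) (\<lambda>e\<in>objs A \<times> objs A.
       THE h. h \<in> Hom V (homs (fc_ob V R (fc_ob V R A)) e) (homs (fc_ob V R A) e) \<and>
         (\<forall>X\<in>Ob V. \<forall>(as, p, ws)\<in>nested_words V R A X e.
            Comp V h (fc_elt V R (fc_ob V R A) X (as, p, map (fc_elt V R A X) ws)) =
            fc_elt V R A X (flatten V R X (as, p, ws)))))\<rparr>"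

definition star :: "('u obj, 'u mor) monad \<Rightarrow> ('u obj, 'u mor) monad" where
  "star T = \<lparr>
     fob = (\<lambda>A. Graph (objs A) (\<lambda>e\<in>objs A \<times> objs A. fob T (homs A e))),
     fmap = (\<lambda>A B f. Gmor (objs A) (app f) (\<lambda>e\<in>objs A \<times> objs A.
       fmap T (homs A e) (homs B (map_prod (app f) (app f) e)) (happ f e))),
     eta = (\<lambda>A. Gmor (objs A) (\<lambda>a\<in>objs A. a) (\<lambda>e\<in>objs A \<times> objs A. eta T (homs A e))),
     mu = (\<lambda>A. Gmor (objs A) (\<lambda>a\<in>objs A. a) (\<lambda>e\<in>objs A \<times> objs A. mu T (homs A e)))\<rparr>"

definition Q :: "(nat \<Rightarrow> ('a elt obj, 'a elt mor) operad) \<Rightarrow> nat \<Rightarrow> nat \<Rightarrow>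
    ('a elt obj, 'a elt mor) monad" where
  "Q P n i = (let m = n - i - 1 in (star ^^ i) (fc (nGSet m) (U_operad m (P m))))"

end

theory Submission
  imports Defs
begin

text \<open>
  For \<open>i > 0\<close> the monad \<open>Q\<^sub>i\<close> is a monad \<open>S\<close> of one dimension lower applied homwise, so everything
  reduces to the laws of \<open>star S\<close> over \<open>Q\<^sub>0 = fc V R\<close>, where \<open>R = U P\<close>. Since \<open>S\<close> preserves
  coproducts, \<open>S (fc A)(a, b)\<close> is a coproduct of objects \<open>S (R(k) \<times> A(a\<^sub>k\<^sub>-\<^sub>1, a\<^sub>k) \<times> \<dots>)\<close>, and the law applies
  \<open>S\<close> to the projections, followed by an action \<open>\<alpha> : S (R(k)) \<rightarrow> R(k)\<close>. This action exists because \<open>P(k)\<close> is an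
  object of \<open>V\<^sub>m\<close>, and the operad structure maps respect it because they are morphisms of \<open>V\<^sub>m\<close>.
  The Yang--Baxter equation for \<open>i > j > 0\<close> and \<open>k = 0\<close> then amounts to the compatibility of two such
  actions with the law between their monads; when the second is the action of \<open>fc\<close>, this says that
  composition in a \<open>(V, P)\<close>-category is a morphism of \<open>V\<close>.
\<close>

section \<open>Categories with products\<close>

text \<open>Equations are checked on generalised elements at globes. Because a globe is connected, a
  map from it into a coproduct meets exactly one summand; so homs of \<open>fc A\<close> are
  described by words, and preservation of coproducts (\<open>pres\<close>) puts each element of
  \<open>S\<close> of such a hom into the form \<open>S w\<close> after some
  \<open>z : X -> S Y\<close>, with \<open>w\<close> a word at a stage \<open>Y\<close>. Products
  need not be preserved: the law uses only the comparison from \<open>S\<close> of a product to the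
  product of the \<open>S\<close>-images.

  Actions on the objects P(k) alone would not survive the induction. It carries algebra structures
  on all objects of V_m, natural in the morphisms of V_m (\<open>algs\<close>) and compatible in
  pairs with the laws (\<open>alg_compat\<close>). In the next dimension the old structures act
  homwise, and the new one, for \<open>fc\<close>, is composition in the category.

  One obstacle is that the axioms of operads and categories in V_m speak of stages in V_m, whereas
  the monads live on globular sets, where other stages exist. Data at such a stage are restrictions
  of universal data at a product formed in V_m, and the axioms are transferred along these
  restrictions.\<close>

definition arr :: "('o, 'm, 'z) cat_scheme \<Rightarrow> 'm \<Rightarrow> 'o \<Rightarrow> 'o \<Rightarrow> bool" where
  "arr C f A B \<longleftrightarrow> A \<in> Ob C \<and> B \<in> Ob C \<and> f \<in> Hom C A B"

lemma arr_ob1: "arr C f A B \<Longrightarrow> A \<in> Ob C" and arr_ob2: "arr C f A B \<Longrightarrow> B \<in> Ob C"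
  by (simp_all add: arr_def)

text \<open>\<open>prod_univ\<close> is exactly what makes the description in \<open>tuple\<close>
  denote; for the empty list it says that \<open>Prod V []\<close> is terminal.\<close>

locale prodcat =
  fixes V :: "('o, 'm, 'z) fpcat_scheme"
  assumes cat: "category V"
    and prod_ob: "set As \<subseteq> Ob V \<Longrightarrow> Prod V As \<in> Ob V"
    and proj_hom: "set As \<subseteq> Ob V \<Longrightarrow> i < length As \<Longrightarrow>
      Proj V As i \<in> Hom V (Prod V As) (As ! i)"
    and prod_univ: "X \<in> Ob V \<Longrightarrow> list_all2 (\<lambda>f A. arr V f X A) fs As \<Longrightarrow>
      \<exists>!h. h \<in> Hom V X (Prod V As) \<and> (\<forall>i<length As. Comp V (Proj V As i) h = fs ! i)"
begin

abbreviation comp (infixr "\<cdot>" 70) where "comp \<equiv> Comp V"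

lemma comp_arr: "arr V f A B \<Longrightarrow> arr V g B D \<Longrightarrow> arr V (g \<cdot> f) A D"
  using cat unfolding category_def arr_def by blast

lemma assoc: "arr V f A B \<Longrightarrow> arr V g B D \<Longrightarrow> arr V h D E \<Longrightarrow> (h \<cdot> g) \<cdot> f = h \<cdot> g \<cdot> f"
  using cat unfolding category_def arr_def by metis

lemma id_arr: "A \<in> Ob V \<Longrightarrow> arr V (Id V A) A A"
  using cat unfolding category_def arr_def by blast

lemma id_right: "arr V f A B \<Longrightarrow> f \<cdot> Id V A = f"
  and id_left: "arr V f A B \<Longrightarrow> Id V B \<cdot> f = f"
  using cat unfolding category_def arr_def by blast+

section \<open>Generalised elements of products\<close>

definition els :: "'o \<Rightarrow> 'm list \<Rightarrow> 'o list \<Rightarrow> bool" where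
  "els X fs Bs \<longleftrightarrow> X \<in> Ob V \<and> list_all2 (\<lambda>f B. arr V f X B) fs Bs"

lemma els_ob: "els X fs Bs \<Longrightarrow> set Bs \<subseteq> Ob V"
  unfolding els_def list_all2_conv_all_nth arr_def by (auto simp: in_set_conv_nth)

lemma els_length: "els X fs Bs \<Longrightarrow> length fs = length Bs"
  unfolding els_def by (auto dest: list_all2_lengthD)

lemma els_nth: "els X fs Bs \<Longrightarrow> i < length Bs \<Longrightarrow> arr V (fs ! i) X (Bs ! i)"
  unfolding els_def by (auto dest: list_all2_nthD2)

lemma els_Nil [simp]: "els X [] [] \<longleftrightarrow> X \<in> Ob V"
  by (simp add: els_def)

lemma els_Cons [simp]: "els X (f # fs) (B # Bs) \<longleftrightarrow> arr V f X B \<and> els X fs Bs"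
  by (auto simp: els_def)

lemma els_rev [simp]: "els X (rev fs) (rev Bs) \<longleftrightarrow> els X fs Bs"
  by (simp add: els_def)

lemma els_comp: "els X fs Bs \<Longrightarrow> arr V g Y X \<Longrightarrow> els Y (map (\<lambda>f. f \<cdot> g) fs) Bs"
  unfolding els_def list_all2_conv_all_nth by (auto intro: comp_arr arr_ob1)

lemma tuple_props:
  assumes "els X fs Bs"
  shows "tuple V X Bs fs \<in> Hom V X (Prod V Bs) \<and>
    (\<forall>i<length Bs. Proj V Bs i \<cdot> tuple V X Bs fs = fs ! i)"
  unfolding tuple_def by (rule theI', rule prod_univ) (use assms in \<open>auto simp: els_def\<close>)

lemma tuple_arr: "els X fs Bs \<Longrightarrow> arr V (tuple V X Bs fs) X (Prod V Bs)"
  using tuple_props els_ob prod_ob by (auto simp: arr_def els_def)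

lemma proj_tuple: "els X fs Bs \<Longrightarrow> i < length Bs \<Longrightarrow> Proj V Bs i \<cdot> tuple V X Bs fs = fs ! i"
  using tuple_props by blast

lemma proj_arr: "set Bs \<subseteq> Ob V \<Longrightarrow> i < length Bs \<Longrightarrow> arr V (Proj V Bs i) (Prod V Bs) (Bs ! i)"
  using proj_hom prod_ob nth_mem by (auto simp: arr_def)

lemma tuple_unique:
  assumes h: "arr V h X (Prod V Bs)" and "els X fs Bs"
    and "\<And>i. i < length Bs \<Longrightarrow> Proj V Bs i \<cdot> h = fs ! i"
  shows "h = tuple V X Bs fs"
  using prod_univ[of X fs Bs] assms tuple_props[OF assms(2)] unfolding els_def arr_def by blast

lemma els_proj_comp:
  assumes "arr V h X (Prod V Bs)" "set Bs \<subseteq> Ob V"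
  shows "els X (map (\<lambda>i. Proj V Bs i \<cdot> h) [0..<length Bs]) Bs"
  using assms unfolding els_def list_all2_conv_all_nth
  by (auto intro: comp_arr proj_arr arr_ob1)

lemma tuple_surj:
  assumes "arr V h X (Prod V Bs)" "set Bs \<subseteq> Ob V"
  shows "h = tuple V X Bs (map (\<lambda>i. Proj V Bs i \<cdot> h) [0..<length Bs])"
  by (rule tuple_unique[OF assms(1) els_proj_comp[OF assms]]) simp

lemma tuple_eqI:
  assumes "arr V h X (Prod V Bs)" "arr V k X (Prod V Bs)" "set Bs \<subseteq> Ob V"
    and "\<And>i. i < length Bs \<Longrightarrow> Proj V Bs i \<cdot> h = Proj V Bs i \<cdot> k"
  shows "h = k"
  using tuple_unique[OF assms(1) els_proj_comp[OF assms(2,3)]] tuple_surj[OF assms(2,3)] assms(4)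
  by simp

lemma tuple_inj:
  assumes "els X fs Bs" "els X gs Bs" "tuple V X Bs fs = tuple V X Bs gs"
  shows "fs = gs"
  using assms els_length proj_tuple by (metis nth_equalityI)

lemma tuple_comp:
  assumes f: "els X fs Bs" and g: "arr V g Y X"
  shows "tuple V X Bs fs \<cdot> g = tuple V Y Bs (map (\<lambda>f. f \<cdot> g) fs)"
proof (rule tuple_unique[OF comp_arr[OF g tuple_arr[OF f]] els_comp[OF f g]])
  fix i assume i: "i < length Bs"
  have "Proj V Bs i \<cdot> tuple V X Bs fs \<cdot> g = (Proj V Bs i \<cdot> tuple V X Bs fs) \<cdot> g"
    using assoc[OF g tuple_arr[OF f] proj_arr[OF els_ob[OF f] i]] by simp
  then show "Proj V Bs i \<cdot> tuple V X Bs fs \<cdot> g = map (\<lambda>f. f \<cdot> g) fs ! i"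
    using proj_tuple[OF f i] i els_length[OF f] by simp
qed

text \<open>The generic element of the product: at the stage \<open>Prod V Bs\<close> itself, the
  projections are the universal list of elements.\<close>

definition projs :: "'o list \<Rightarrow> 'm list" where
  "projs Bs = map (Proj V Bs) [0..<length Bs]"

lemma els_projs: "set Bs \<subseteq> Ob V \<Longrightarrow> els (Prod V Bs) (projs Bs) Bs"
  unfolding els_def projs_def list_all2_conv_all_nth by (auto intro: proj_arr prod_ob)

lemma tuple_projs:
  assumes "set Bs \<subseteq> Ob V"
  shows "tuple V (Prod V Bs) Bs (projs Bs) = Id V (Prod V Bs)"
proof (rule tuple_unique[symmetric, OF id_arr[OF prod_ob[OF assms]] els_projs[OF assms]])
  fix i assume "i < length Bs"
  then show "Proj V Bs i \<cdot> Id V (Prod V Bs) = projs Bs ! i"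
    using id_right[OF proj_arr[OF assms]] by (simp add: projs_def)
qed

end

section \<open>Probes and coproducts\<close>

text \<open>The elements of \<open>B\<close> at probes are the disjoint union of those of the
  \<open>A i\<close>. This form of being a coproduct refers to maps into \<open>B\<close> only,
  which is what computing with words needs; in a \<open>nice\<close> category \<open>cotuple\<close>
  recovers the maps out of \<open>B\<close>.\<close>

definition cocone :: "('o, 'm, 'z) cat_scheme \<Rightarrow> 'o set \<Rightarrow> 'i set \<Rightarrow> ('i \<Rightarrow> 'o) \<Rightarrow> ('i \<Rightarrow> 'm) \<Rightarrow>
    'o \<Rightarrow> bool" where
  "cocone V G I A u B \<longleftrightarrow> B \<in> Ob V \<and> (\<forall>i\<in>I. arr V (u i) (A i) B) \<and>
     (\<forall>X\<in>G. \<forall>x. arr V x X B \<longrightarrow>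
       (\<exists>!(i, y). i \<in> I \<and> arr V y X (A i) \<and> x = Comp V (u i) y))"

lemma coconeI:
  assumes "B \<in> Ob V" "\<And>i. i \<in> I \<Longrightarrow> arr V (u i) (A i) B"
    and "\<And>X x. X \<in> G \<Longrightarrow> arr V x X B \<Longrightarrow> \<exists>i y. i \<in> I \<and> arr V y X (A i) \<and> x = Comp V (u i) y"
    and "\<And>X i y j z. X \<in> G \<Longrightarrow> i \<in> I \<Longrightarrow> j \<in> I \<Longrightarrow> arr V y X (A i) \<Longrightarrow> arr V z X (A j) \<Longrightarrow>
      Comp V (u i) y = Comp V (u j) z \<Longrightarrow> i = j \<and> y = z"
  shows "cocone V G I A u B"
  unfolding cocone_def
proof (intro conjI ballI allI impI)
  fix X x assume X: "X \<in> G" "arr V x X B"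
  then obtain i y where y: "i \<in> I" "arr V y X (A i)" "x = Comp V (u i) y"
    using assms(3) by blast
  show "\<exists>!(i, y). i \<in> I \<and> arr V y X (A i) \<and> x = Comp V (u i) y"
    by (rule ex1I[of _ "(i, y)"]) (use y X assms(4) in auto)
qed (use assms in auto)

lemma cocone_arr: "cocone V G I A u B \<Longrightarrow> i \<in> I \<Longrightarrow> arr V (u i) (A i) B"
  by (simp add: cocone_def)

lemma cocone_ob: "cocone V G I A u B \<Longrightarrow> B \<in> Ob V"
  by (simp add: cocone_def)

lemma cocone_ex:
  assumes "cocone V G I A u B" "X \<in> G" "arr V x X B"
  obtains i y where "i \<in> I" "arr V y X (A i)" "x = Comp V (u i) y"
  using assms unfolding cocone_def by blast

lemma cocone_inj:
  assumes c: "cocone V G I A u B" and X: "X \<in> G" and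
    i: "i \<in> I" "arr V y X (A i)" and j: "j \<in> I" "arr V z X (A j)"
    and eq: "Comp V (u i) y = Comp V (u j) z" and x: "arr V (Comp V (u i) y) X B"
  shows "i = j \<and> y = z"
proof -
  have "\<exists>!(i', y'). i' \<in> I \<and> arr V y' X (A i') \<and> Comp V (u i) y = Comp V (u i') y'"
    using c X x unfolding cocone_def by blast
  then have "(i, y) = (j, z)"
    by (rule ex1E) (use i j eq in \<open>metis (mono_tags, lifting) case_prodI\<close>)
  then show ?thesis by simp
qed

text \<open>The probes \<open>G\<close> are the globes: a globular set is determined by its cells, which are the
  maps from globes, and a globe is connected.\<close>

locale nice = prodcat V for V :: "('o, 'm, 'i) bicat" +
  fixes G :: "'o set"
  assumes probe_ob: "G \<subseteq> Ob V"
    and coprod_cocone: "(\<And>i. i \<in> I \<Longrightarrow> A i \<in> Ob V) \<Longrightarrow>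
      cocone V G I A (Incl V I A) (Coprod V I A)"
    and probe_ext: "arr V h B C \<Longrightarrow> arr V k B C \<Longrightarrow>
      (\<And>X x. X \<in> G \<Longrightarrow> arr V x X B \<Longrightarrow> Comp V h x = Comp V k x) \<Longrightarrow> h = k"
    and density: "B \<in> Ob V \<Longrightarrow> C \<in> Ob V \<Longrightarrow>
      (\<And>X x. X \<in> G \<Longrightarrow> arr V x X B \<Longrightarrow> arr V (\<phi> X x) X C) \<Longrightarrow>
      (\<And>X Y x g. X \<in> G \<Longrightarrow> Y \<in> G \<Longrightarrow> arr V x X B \<Longrightarrow> arr V g Y X \<Longrightarrow>
        \<phi> Y (Comp V x g) = Comp V (\<phi> X x) g) \<Longrightarrow>
      \<exists>h. arr V h B C \<and> (\<forall>X\<in>G. \<forall>x. arr V x X B \<longrightarrow> Comp V h x = \<phi> X x)"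
begin

lemma probeD: "X \<in> G \<Longrightarrow> X \<in> Ob V"
  using probe_ob by blast

lemma cocone_inj':
  assumes c: "cocone V G I A u B" and X: "X \<in> G" and
    i: "i \<in> I" "arr V y X (A i)" and j: "j \<in> I" "arr V z X (A j)"
    and eq: "u i \<cdot> y = u j \<cdot> z"
  shows "i = j \<and> y = z"
  using cocone_inj[OF c X i j eq] comp_arr[OF i(2) cocone_arr[OF c i(1)]] by blast

text \<open>A probe element of \<open>B\<close> determines its summand \<open>i\<close> and its
  component \<open>y\<close> there. Sending it to \<open>f i\<close> after \<open>y\<close> is
  natural, because restriction to another probe does not change the summand; \<open>density\<close>
  then supplies the map.\<close>

lemma cotuple:
  assumes c: "cocone V G I A u B" and C: "C \<in> Ob V"
    and f: "\<And>i. i \<in> I \<Longrightarrow> arr V (f i) (A i) C"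
  shows "\<exists>h. arr V h B C \<and> (\<forall>i\<in>I. h \<cdot> u i = f i)"
proof -
  define dec where "dec X x = (THE (i, y). i \<in> I \<and> arr V y X (A i) \<and> x = u i \<cdot> y)" for X x
  have dec: "dec X (u i \<cdot> y) = (i, y)" if "X \<in> G" "i \<in> I" "arr V y X (A i)" for X i y
    unfolding dec_def
    by (rule the_equality) (use that cocone_inj'[OF c that(1)] in \<open>auto dest: sym\<close>)
  define \<phi> where "\<phi> X x = (case dec X x of (i, y) \<Rightarrow> f i \<cdot> y)" for X x
  have \<phi>: "\<phi> X (u i \<cdot> y) = f i \<cdot> y" if "X \<in> G" "i \<in> I" "arr V y X (A i)" for X i y
    using dec[OF that] by (simp add: \<phi>_def)
  have "\<exists>h. arr V h B C \<and> (\<forall>X\<in>G. \<forall>x. arr V x X B \<longrightarrow> h \<cdot> x = \<phi> X x)"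
  proof (rule density[OF cocone_ob[OF c] C])
    fix X x assume "X \<in> G" "arr V x X B"
    then show "arr V (\<phi> X x) X C"
      using cocone_ex[OF c, of X x] \<phi> f by (metis comp_arr)
  next
    fix X Y x g assume X: "X \<in> G" and Y: "Y \<in> G" and "arr V x X B" and g: "arr V g Y X"
    then obtain i y where y: "i \<in> I" "arr V y X (A i)" "x = u i \<cdot> y"
      using cocone_ex[OF c] by metis
    have "x \<cdot> g = u i \<cdot> (y \<cdot> g)"
      using y assoc[OF g y(2) cocone_arr[OF c y(1)]] by simp
    then show "\<phi> Y (x \<cdot> g) = \<phi> X x \<cdot> g"
      using \<phi>[OF X y(1,2)] \<phi>[OF Y y(1) comp_arr[OF g y(2)]] assoc[OF g y(2) f[OF y(1)]] y(3)
      by simp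
  qed
  then obtain h where h: "arr V h B C" "\<And>X x. X \<in> G \<Longrightarrow> arr V x X B \<Longrightarrow> h \<cdot> x = \<phi> X x"
    by blast
  have "h \<cdot> u i = f i" if i: "i \<in> I" for i
  proof (rule probe_ext[OF comp_arr[OF cocone_arr[OF c i] h(1)] f[OF i]])
    fix X x assume X: "X \<in> G" "arr V x X (A i)"
    have "(h \<cdot> u i) \<cdot> x = h \<cdot> u i \<cdot> x" by (rule assoc[OF X(2) cocone_arr[OF c i] h(1)])
    also have "\<dots> = f i \<cdot> x"
      using h(2)[OF X(1) comp_arr[OF X(2) cocone_arr[OF c i]]] \<phi>[OF X(1) i X(2)] by simp
    finally show "(h \<cdot> u i) \<cdot> x = f i \<cdot> x" .
  qed
  with h(1) show ?thesis by blast
qed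

end

section \<open>Strings and words\<close>

lemma list_all2_concat:
  "list_all2 (\<lambda>xs ys. list_all2 R xs ys) xss yss \<Longrightarrow> list_all2 R (concat xss) (concat yss)"
  by (induction rule: list_all2_induct) (auto intro: list_all2_appendI)

lemma list_all2_ex2: "list_all2 R xs ys \<Longrightarrow> y \<in> set ys \<Longrightarrow> \<exists>x\<in>set xs. R x y"
  by (induction rule: list_all2_induct) auto

lemma list_all2_swap: "list_all2 (\<lambda>x y. R y x) xs ys \<longleftrightarrow> list_all2 R ys xs"
  by (auto simp: list_all2_conv_all_nth)

lemma steps_simps [simp]:
  "steps [] = []" "steps [a] = []" "steps (a # b # as) = (a, b) # steps (b # as)"
  by (simp_all add: steps_def)

lemma length_steps [simp]: "length (steps as) = length as - 1"
  by (simp add: steps_def)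

lemma set_steps: "d \<in> set (steps as) \<Longrightarrow> d \<in> set as \<times> set as"
  by (induction as rule: induct_list012) auto

lemma steps_map: "steps (map f as) = map (map_prod f f) (steps as)"
  by (induction as rule: induct_list012) auto

lemma steps_append: "as \<noteq> [] \<Longrightarrow> steps (as @ bs) = steps as @ steps (last as # bs)"
  by (induction as rule: induct_list012) auto

text \<open>Each inner string begins at the object where its predecessor ends, so its first entry is
  dropped to avoid a repetition.\<close>

definition graft :: "'u list \<Rightarrow> 'u list list \<Rightarrow> 'u list" where
  "graft as bss = hd as # concat (map tl bss)"

definition fits :: "'u list \<Rightarrow> 'u list list \<Rightarrow> bool" where
  "fits as bss \<longleftrightarrow> as \<noteq> [] \<and>
     list_all2 (\<lambda>d bs. bs \<noteq> [] \<and> hd bs = fst d \<and> last bs = snd d) (steps as) bss"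

text \<open>Induction on the outer string, splitting off the first inner string \<open>bs\<close>.
  Its last object is the head of what remains, so \<open>steps_append\<close> glues the steps
  without a gap. A string of length \<open>k + 1\<close> has \<open>k\<close> steps, hence arities
  add up.\<close>

lemma graft_props:
  assumes "fits as bss"
  shows "last (graft as bss) = last as \<and> steps (graft as bss) = concat (map steps bss) \<and>
    length (graft as bss) - 1 = sum_list (map (\<lambda>bs. length bs - 1) bss)"
  using assms
proof (induction as arbitrary: bss rule: induct_list012)
  case (3 a b as)
  then obtain bs bss' where bss: "bss = bs # bss'" "bs \<noteq> []" "hd bs = a" "last bs = b"
    and f: "fits (b # as) bss'"
    by (auto simp: fits_def list_all2_Cons1)
  then have bs: "bs = a # tl bs" by (cases bs) auto
  have s: "graft (a # b # as) bss = bs @ tl (graft (b # as) bss')"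
    using bs bss by (simp add: graft_def)
  have h: "graft (b # as) bss' = last bs # tl (graft (b # as) bss')"
    using bss by (simp add: graft_def)
  obtain t where t: "graft (b # as) bss' = last bs # t" using h by blast
  \<comment> \<open>The remaining tail \<open>t\<close> may be empty; then the last object is that
    of \<open>bs\<close>.\<close>
  have l: "last (bs @ tl (graft (b # as) bss')) = last (graft (b # as) bss')"
    unfolding t using bss(2) by (cases t) auto
  show ?case
    using 3(2)[OF f] l s h bss(1,2) steps_append[OF bss(2), of "tl (graft (b # as) bss')"]
    by (cases bs) (auto simp: graft_def)
qed (auto simp: fits_def graft_def)

lemma hd_graft [simp]: "hd (graft as bss) = hd as" and graft_not_Nil [simp]: "graft as bss \<noteq> []"
  by (simp_all add: graft_def)

lemma pathsD: "as \<in> paths A e \<Longrightarrow> as \<noteq> [] \<and> set as \<subseteq> objs A \<and> hd as = fst e \<and> last as = snd e \<and>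
    e \<in> objs A \<times> objs A"
  unfolding paths_def strings_def using hd_in_set[of as] last_in_set[of as]
  by (cases e) (auto simp: subset_iff)

lemma pathsI: "as \<noteq> [] \<Longrightarrow> set as \<subseteq> objs A \<Longrightarrow> (hd as, last as) = e \<Longrightarrow> as \<in> paths A e"
  unfolding paths_def strings_def by auto

lemma paths_e: "as \<in> paths A e \<Longrightarrow> (hd as, last as) = e"
  using pathsD by (metis prod.collapse)

lemma fits_paths:
  assumes "as \<noteq> []" "list_all2 (\<lambda>d bs. bs \<in> paths A d) (steps as) bss"
  shows "fits as bss"
  unfolding fits_def using assms(1) list_all2_mono[OF assms(2)] pathsD by (metis (mono_tags, lifting))

lemma graft_paths:
  assumes as: "as \<in> paths A e" and b: "list_all2 (\<lambda>d bs. bs \<in> paths A d) (steps as) bss"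
  shows "graft as bss \<in> paths A e"
proof -
  note p = pathsD[OF as]
  have "set (tl bs) \<subseteq> objs A" if "bs \<in> set bss" for bs
  proof -
    obtain d where "bs \<in> paths A d"
      using list_all2_ex2[OF b \<open>bs \<in> set bss\<close>] by blast
    then show ?thesis using pathsD by (metis list.set_sel(2) subset_iff)
  qed
  then have "set (graft as bss) \<subseteq> objs A"
    using p by (auto simp: graft_def)
  then show ?thesis
    using graft_props[OF fits_paths[OF _ b]] p by (intro pathsI) auto
qed

lemma paths_steps: "as \<in> paths A e \<Longrightarrow> d \<in> set (steps as) \<Longrightarrow> d \<in> objs A \<times> objs A"
  using pathsD set_steps by fastforce

lemma paths_map:
  assumes "as \<in> paths A e" "\<And>a. a \<in> objs A \<Longrightarrow> f a \<in> objs B"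
  shows "map f as \<in> paths B (map_prod f f e)"
  using pathsD[OF assms(1)] assms(2) by (intro pathsI) (auto simp: hd_map last_map)

definition vgraph :: "('u obj, 'm, 'z) cat_scheme \<Rightarrow> 'u obj \<Rightarrow> bool" where
  "vgraph V A \<longleftrightarrow> (\<forall>e\<in>objs A \<times> objs A. homs A e \<in> Ob V)"

lemma vgraphD: "vgraph V A \<Longrightarrow> a \<in> objs A \<Longrightarrow> b \<in> objs A \<Longrightarrow> homs A (a, b) \<in> Ob V"
  and vgraphD': "vgraph V A \<Longrightarrow> e \<in> objs A \<times> objs A \<Longrightarrow> homs A e \<in> Ob V"
  by (auto simp: vgraph_def)

section \<open>Change of stage, and transport of words along graph maps\<close>

definition restr_word :: "('o, 'u mor, 'z) cat_scheme \<Rightarrow> 'u mor \<Rightarrow> 'u word \<Rightarrow> 'u word" where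
  "restr_word V g = (\<lambda>(as, p, xs). (as, Comp V p g, map (\<lambda>x. Comp V x g) xs))"

definition restr_nested :: "('o, 'u mor, 'z) cat_scheme \<Rightarrow> 'u mor \<Rightarrow> 'u nested \<Rightarrow> 'u nested" where
  "restr_nested V g = (\<lambda>(as, p, ws). (as, Comp V p g, map (restr_word V g) ws))"

definition map_nested :: "('u obj, 'u mor, 'z) fpcat_scheme \<Rightarrow> 'u mor \<Rightarrow> 'u nested \<Rightarrow> 'u nested" where
  "map_nested V f = (\<lambda>(as, p, ws). (map (app f) as, p, map (map_word V f) ws))"

lemma fst_restr_word [simp]: "fst (restr_word V g w) = fst w"
  by (simp add: restr_word_def split: prod.splits)

lemma fst_map_word [simp]: "fst (map_word V f w) = map (app f) (fst w)"
  by (simp add: map_word_def split: prod.splits)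

lemma gHomD:
  assumes "f \<in> gHom V A B" "vgraph V A" "vgraph V B"
  shows "src f = objs A" "\<And>a. a \<in> objs A \<Longrightarrow> app f a \<in> objs B"
    "app f \<in> objs A \<rightarrow>\<^sub>E objs B"
    "\<And>e. e \<in> objs A \<times> objs A \<Longrightarrow>
      arr V (happ f e) (homs A e) (homs B (map_prod (app f) (app f) e))"
    "happ f \<in> extensional (objs A \<times> objs A)" "f = Gmor (src f) (app f) (happ f)"
  using assms by (auto simp: gHom_def arr_def vgraph_def PiE_def Pi_def)

text \<open>Typing of the structure maps without the operad laws. It is separated from
  \<open>operadic\<close> because the restriction lemmas proved here serve for the underlying operad
  while its laws are still being established.\<close>

locale preoperad = prodcat V for V :: "('u obj, 'u mor, 'z) fpcat_scheme" +
  fixes P :: "('u obj, 'u mor) operad"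
  assumes ar_ob: "ar P k \<in> Ob V"
    and opunit_arr: "arr V (opunit P) (Prod V []) (ar P 1)"
    and opcomp_arr: "arr V (opcomp P ks) (Prod V (ar P (length ks) # map (ar P) ks)) (ar P (sum_list ks))"
begin

lemma comp_els:
  assumes "arr V p X (ar P (length ps))" "\<And>k q. (k, q) \<in> set ps \<Longrightarrow> arr V q X (ar P k)"
  shows "els X (p # map snd ps) (ar P (length ps) # map (ar P \<circ> fst) ps)"
  using assms(1) assms(2)[of "fst kq" "snd kq" for kq]
  by (auto simp: els_def list_all2_map1 list_all2_map2 intro: arr_ob1 intro!: list.rel_refl_strong)

lemma comp_elt_arr:
  assumes "arr V p X (ar P (length ps))" "\<And>k q. (k, q) \<in> set ps \<Longrightarrow> arr V q X (ar P k)"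
  shows "arr V (comp_elt V P X p ps) X (ar P (sum_list (map fst ps)))"
  unfolding comp_elt_def using opcomp_arr[of "map fst ps"] tuple_arr[OF comp_els[OF assms]]
  by (auto intro: comp_arr)

lemma comp_elt_restr:
  assumes "arr V p X (ar P (length ps))" "\<And>k q. (k, q) \<in> set ps \<Longrightarrow> arr V q X (ar P k)" "arr V g Y X"
  shows "comp_elt V P X p ps \<cdot> g = comp_elt V P Y (p \<cdot> g) (map (\<lambda>(k, q). (k, q \<cdot> g)) ps)"
proof -
  let ?B = "ar P (length ps) # map (ar P \<circ> fst) ps"
  have "(opcomp P (map fst ps) \<cdot> tuple V X ?B (p # map snd ps)) \<cdot> g =
      opcomp P (map fst ps) \<cdot> tuple V X ?B (p # map snd ps) \<cdot> g"
    using opcomp_arr[of "map fst ps"] tuple_arr[OF comp_els[OF assms(1,2)]]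
    by (intro assoc[OF assms(3)]) auto
  also have "\<dots> = opcomp P (map fst ps) \<cdot> tuple V Y ?B (p \<cdot> g # map (\<lambda>q. q \<cdot> g) (map snd ps))"
    using tuple_comp[OF comp_els[OF assms(1,2)] assms(3)] by simp
  finally show ?thesis
    by (simp add: comp_elt_def comp_def case_prod_beta)
qed

lemma unit_elt_arr: "X \<in> Ob V \<Longrightarrow> arr V (unit_elt V P X) X (ar P 1)"
  unfolding unit_elt_def using opunit_arr tuple_arr[of X "[]" "[]"] by (auto intro: comp_arr)

lemma unit_elt_restr: "arr V g Y X \<Longrightarrow> unit_elt V P X \<cdot> g = unit_elt V P Y"
  unfolding unit_elt_def
  using assoc[OF _ tuple_arr[of X "[]" "[]"] opunit_arr, of g Y] tuple_comp[of X "[]" "[]" g Y]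
  by (auto dest: arr_ob2)

end

locale operadic = prodcat V for V :: "('u obj, 'u mor, 'z) fpcat_scheme" +
  fixes P :: "('u obj, 'u mor) operad"
  assumes operad: "is_operad V P"

sublocale operadic \<subseteq> preoperad
  using operad prod_ob[of "[]"] prod_ob[of "ar P (length ks) # map (ar P) ks" for ks]
  by unfold_locales (auto simp: is_operad_def arr_def)

context operadic
begin

text \<open>All homs along a path of a graph over \<open>V\<close> are objects of \<open>V\<close>,
  so membership in \<open>Hom\<close> may be strengthened to \<open>arr\<close>.\<close>

lemma words_iff:
  assumes "vgraph V A" "X \<in> Ob V"
  shows "(as, p, xs) \<in> words V P A X e \<longleftrightarrow> as \<in> paths A e \<and> arr V p X (ar P (length as - 1)) \<and>
    list_all2 (\<lambda>d x. arr V x X (homs A d)) (steps as) xs"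
proof -
  have "list_all2 (\<lambda>d x. x \<in> Hom V X (homs A d)) (steps as) xs \<longleftrightarrow>
     list_all2 (\<lambda>d x. arr V x X (homs A d)) (steps as) xs" if "as \<in> paths A e"
    using paths_steps[OF that] vgraphD'[OF assms(1)] assms(2)
    by (intro list.rel_cong refl) (auto simp: arr_def)
  then show ?thesis
    using ar_ob assms by (auto simp: words_def arr_def)
qed

lemma nested_words_iff:
  assumes "X \<in> Ob V"
  shows "(as, p, ws) \<in> nested_words V P A X e \<longleftrightarrow> as \<in> paths A e \<and>
    arr V p X (ar P (length as - 1)) \<and> list_all2 (\<lambda>d w. w \<in> words V P A X d) (steps as) ws"
  using ar_ob assms by (auto simp: nested_words_def arr_def)

text \<open>\<open>factors\<close> lists the homs from the last step back to the first, whereas a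
  word lists its letters along the string; hence the \<open>rev\<close>.\<close>

lemma word_els:
  assumes "vgraph V A" "X \<in> Ob V" "(as, p, xs) \<in> words V P A X e"
  shows "els X (p # rev xs) (factors P A as)"
  using assms words_iff[OF assms(1,2)]
  by (cases e) (auto simp: factors_def els_def list_all2_map2 list_all2_swap[of _ xs])

lemma word_of_els:
  assumes "vgraph V A" "as \<in> paths A e" "els X (p # xs) (factors P A as)"
  shows "(as, p, rev xs) \<in> words V P A X e"
proof -
  have "els X xs (rev (map (homs A) (steps as)))" using assms by (simp add: factors_def)
  then have "els X (rev xs) (map (homs A) (steps as))" using els_rev[of X "rev xs"] by simp
  then have "list_all2 (\<lambda>d x. arr V x X (homs A d)) (steps as) (rev xs)"
    by (simp add: els_def list_all2_map2 list_all2_swap[of _ "rev xs"])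
  then show ?thesis using assms by (subst words_iff) (auto simp: factors_def els_def)
qed

lemma factors_ob: "vgraph V A \<Longrightarrow> as \<in> paths A e \<Longrightarrow> set (factors P A as) \<subseteq> Ob V"
  using ar_ob paths_steps[of as A e] vgraphD'[of V A] by (auto simp: factors_def)

lemma word_elt_arr:
  assumes "vgraph V A" "X \<in> Ob V" "w \<in> words V P A X e"
  shows "arr V (word_elt V P A X w) X (Prod V (factors P A (fst w)))"
  using tuple_arr[OF word_els[OF assms(1,2)]] assms by (cases w) (auto simp: word_elt_def)

lemma words_restr:
  assumes "vgraph V A" "w \<in> words V P A X e" "arr V g Y X"
  shows "restr_word V g w \<in> words V P A Y e"
  using assms words_iff[OF assms(1)] unfolding restr_word_def
  by (cases w) (auto simp: arr_ob1[OF assms(3)] arr_ob2[OF assms(3)] list_all2_map2 intro: comp_arr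
      elim!: list_all2_mono)

lemma word_elt_restr:
  assumes "vgraph V A" "w \<in> words V P A X e" "arr V g Y X"
  shows "word_elt V P A X w \<cdot> g = word_elt V P A Y (restr_word V g w)"
  using tuple_comp[OF word_els[OF assms(1)] assms(3)] assms(2) arr_ob2[OF assms(3)]
  by (cases w) (auto simp: word_elt_def restr_word_def rev_map)

text \<open>The components of \<open>h\<close> are the operation followed by the letters in reverse
  order, so a map into the product of the factors is the same thing as a word along
  \<open>as\<close>.\<close>

lemma word_elt_surj:
  assumes A: "vgraph V A" and as: "as \<in> paths A e" and h: "arr V h X (Prod V (factors P A as))"
  obtains w where "w \<in> words V P A X e" "fst w = as" "h = word_elt V P A X w"
proof -
  define fs where "fs = map (\<lambda>i. Proj V (factors P A as) i \<cdot> h) [0..<length (factors P A as)]"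
  note ob = factors_ob[OF A as]
  have e: "els X fs (factors P A as)" unfolding fs_def by (rule els_proj_comp[OF h ob])
  then have "fs \<noteq> []" by (auto simp: factors_def els_def)
  then obtain p xs where fs: "fs = p # xs" by (cases fs) auto
  show ?thesis
  proof
    show "(as, p, rev xs) \<in> words V P A X e" using word_of_els[OF A as] e fs by simp
    show "h = word_elt V P A X (as, p, rev xs)"
      using tuple_surj[OF h ob] fs unfolding word_elt_def fs_def by simp
  qed simp
qed

lemma word_elt_inj:
  assumes "vgraph V A" "X \<in> Ob V" "w \<in> words V P A X e" "w' \<in> words V P A X e'" "fst w = fst w'"
    and "word_elt V P A X w = word_elt V P A X w'"
  shows "w = w'"
proof -
  obtain as p xs p' xs' where w: "w = (as, p, xs)" "w' = (as, p', xs')"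
    using assms(5) by (metis prod.collapse)
  have "p # rev xs = p' # rev xs'"
    by (rule tuple_inj[OF word_els word_els]) (use assms w in \<open>auto simp: word_elt_def\<close>)
  then show ?thesis using w by simp
qed

text \<open>The word at the stage \<open>Prod V (factors P A as)\<close> given by the projections: every word along
  \<open>as\<close> is a restriction of it.\<close>

definition uword :: "'u obj \<Rightarrow> 'u list \<Rightarrow> 'u word" where
  "uword A as = (let ps = projs (factors P A as) in (as, hd ps, rev (tl ps)))"

lemma uword:
  assumes A: "vgraph V A" and as: "as \<in> paths A e"
  shows "uword A as \<in> words V P A (Prod V (factors P A as)) e" "fst (uword A as) = as"
    "word_elt V P A (Prod V (factors P A as)) (uword A as) = Id V (Prod V (factors P A as))"
proof -
  have "projs (factors P A as) \<noteq> []" by (simp add: projs_def factors_def)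
  then have e: "projs (factors P A as) = hd (projs (factors P A as)) # tl (projs (factors P A as))"
    by simp
  show "uword A as \<in> words V P A (Prod V (factors P A as)) e"
    unfolding uword_def Let_def using els_projs[OF factors_ob[OF A as]] e
    by (intro word_of_els[OF A as]) simp
  show "fst (uword A as) = as" by (simp add: uword_def Let_def)
  show "word_elt V P A (Prod V (factors P A as)) (uword A as) = Id V (Prod V (factors P A as))"
    using tuple_projs[OF factors_ob[OF A as]] e by (simp add: uword_def word_elt_def Let_def)
qed

text \<open>The Yoneda argument: \<open>word_elt\<close> is the map into the product that classifies
  \<open>w\<close>, and the universal word, whose own classifying map is the identity, pulls back
  along it to \<open>w\<close>.\<close>

lemma restr_uword:
  assumes A: "vgraph V A" and X: "X \<in> Ob V" and w: "w \<in> words V P A X e"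
  shows "restr_word V (word_elt V P A X w) (uword A (fst w)) = w"
proof -
  have as: "fst w \<in> paths A e" using w by (auto simp: words_def)
  note a = word_elt_arr[OF A X w]
  note u = uword[OF A as]
  show ?thesis
    by (rule word_elt_inj[OF A X words_restr[OF A u(1) a] w])
      (use u id_left[OF a] word_elt_restr[OF A u(1) a] in auto)
qed

lemma comp_unit_left: "arr V p X (ar P k) \<Longrightarrow> comp_elt V P X (unit_elt V P X) [(k, p)] = p"
  and comp_unit_right: "arr V p X (ar P k) \<Longrightarrow> comp_elt V P X p (replicate k (1, unit_elt V P X)) = p"
  using operad by (auto simp: is_operad_def arr_def)

lemma comp_assoc:
  assumes "arr V p X (ar P (length ps))"
    and "list_all2 (\<lambda>(k, q) qs. arr V q X (ar P k) \<and> length qs = k \<and>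
          (\<forall>(l, r)\<in>set qs. arr V r X (ar P l))) ps qss"
  shows "comp_elt V P X (comp_elt V P X p ps) (concat qss) = comp_elt V P X p
          (map2 (\<lambda>(k, q) qs. (sum_list (map fst qs), comp_elt V P X q qs)) ps qss)"
proof -
  have "X \<in> Ob V" using assms(1) by (rule arr_ob1)
  moreover have "list_all2 (\<lambda>(k, q) qs. q \<in> Hom V X (ar P k) \<and> length qs = k \<and>
          (\<forall>(l, r)\<in>set qs. r \<in> Hom V X (ar P l))) ps qss"
    using assms(2) by (rule list_all2_mono) (auto simp: arr_def)
  ultimately show ?thesis
    using operad assms(1) unfolding is_operad_def arr_def by blast
qed

lemma flatten_eq:
  "flatten V P X (as, p, ws) = (graft as (map fst ws),
     comp_elt V P X p (map (\<lambda>w. (length (fst w) - 1, fst (snd w))) ws), concat (map (snd \<circ> snd) ws))"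
  unfolding flatten_def graft_def split_def by (simp add: comp_def)

lemma nested_paths:
  assumes "list_all2 (\<lambda>d w. w \<in> words V P A X d) ds ws"
  shows "list_all2 (\<lambda>d bs. bs \<in> paths A d) ds (map fst ws)"
  using assms by (auto simp: list_all2_map2 words_def elim!: list_all2_mono)

lemma nested_arr:
  assumes A: "vgraph V A" and X: "X \<in> Ob V" and ws: "list_all2 (\<lambda>d w. w \<in> words V P A X d) ds ws"
    and "w \<in> set ws"
  shows "arr V (fst (snd w)) X (ar P (length (fst w) - 1))"
proof -
  obtain d where "w \<in> words V P A X d"
    using list_all2_ex2[OF ws assms(4)] by blast
  then show ?thesis using words_iff[OF A X] by (cases w) auto
qed

text \<open>The composite operation has as arity the sum of the inner arities, which
  \<open>graft_props\<close> identifies with the number of steps of the grafted string.\<close>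

lemma flatten_words:
  assumes A: "vgraph V A" and X: "X \<in> Ob V" and n: "(as, p, ws) \<in> nested_words V P A X e"
  shows "flatten V P X (as, p, ws) \<in> words V P A X e"
proof -
  have as: "as \<in> paths A e" and p: "arr V p X (ar P (length as - 1))"
    and ws: "list_all2 (\<lambda>d w. w \<in> words V P A X d) (steps as) ws"
    using n nested_words_iff[OF X] by auto
  have f: "fits as (map fst ws)"
    using fits_paths[OF _ nested_paths[OF ws]] pathsD[OF as] by blast
  have len: "length ws = length as - 1" using ws by (auto dest: list_all2_lengthD)
  have "arr V (comp_elt V P X p (map (\<lambda>w. (length (fst w) - 1, fst (snd w))) ws)) X
      (ar P (sum_list (map fst (map (\<lambda>w. (length (fst w) - 1, fst (snd w))) ws))))"
    using p len nested_arr[OF A X ws] by (intro comp_elt_arr) auto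
  moreover have "list_all2 (\<lambda>d x. arr V x X (homs A d)) (concat (map steps (map fst ws)))
     (concat (map (snd \<circ> snd) ws))"
  proof (rule list_all2_concat)
    have "list_all2 (\<lambda>d x. arr V x X (homs A d)) (steps (fst w)) (snd (snd w))"
      if "w \<in> set ws" for w
    proof -
      obtain d where "w \<in> words V P A X d"
        using list_all2_ex2[OF ws \<open>w \<in> set ws\<close>] by blast
      then show ?thesis using words_iff[OF A X] by (cases w) auto
    qed
    then show "list_all2 (list_all2 (\<lambda>d x. arr V x X (homs A d))) (map steps (map fst ws))
       (map (snd \<circ> snd) ws)"
      by (auto simp: list_all2_conv_all_nth)
  qed
  ultimately show ?thesis
    unfolding flatten_eq using words_iff[OF A X] graft_paths[OF as nested_paths[OF ws]]
      graft_props[OF f] by (simp add: comp_def)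
qed

lemma nested_restr:
  assumes "vgraph V A" "n \<in> nested_words V P A X e" "arr V g Y X"
  shows "restr_nested V g n \<in> nested_words V P A Y e"
  using assms nested_words_iff arr_ob1[OF assms(3)] arr_ob2[OF assms(3)] unfolding restr_nested_def
  by (cases n) (auto simp: list_all2_map2 intro: comp_arr words_restr elim!: list_all2_mono)

lemma flatten_restr:
  assumes A: "vgraph V A" and n: "n \<in> nested_words V P A X e" and g: "arr V g Y X"
  shows "restr_word V g (flatten V P X n) = flatten V P Y (restr_nested V g n)"
proof -
  obtain as p ws where n': "n = (as, p, ws)" by (metis prod.collapse)
  note X = arr_ob2[OF g]
  have as: "as \<in> paths A e" and p: "arr V p X (ar P (length as - 1))"
    and ws: "list_all2 (\<lambda>d w. w \<in> words V P A X d) (steps as) ws"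
    using n n' nested_words_iff[OF X] by auto
  have len: "length ws = length as - 1" using ws by (auto dest: list_all2_lengthD)
  have "comp_elt V P X p (map (\<lambda>w. (length (fst w) - 1, fst (snd w))) ws) \<cdot> g =
     comp_elt V P Y (p \<cdot> g) (map (\<lambda>(k, q). (k, q \<cdot> g)) (map (\<lambda>w. (length (fst w) - 1, fst (snd w))) ws))"
    using p len nested_arr[OF A X ws] g by (intro comp_elt_restr) auto
  then show ?thesis
    unfolding n' restr_nested_def
    by (simp add: flatten_eq restr_word_def comp_def map_concat case_prod_beta)
qed

lemma map_word_words:
  assumes A: "vgraph V A" and B: "vgraph V B" and X: "X \<in> Ob V" and f: "f \<in> gHom V A B"
    and w: "w \<in> words V P A X e"
  shows "map_word V f w \<in> words V P B X (map_prod (app f) (app f) e)"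
proof -
  obtain as p xs where w': "w = (as, p, xs)" by (metis prod.collapse)
  note d = w[unfolded w' words_iff[OF A X]]
  have "list_all2 (\<lambda>d x. arr V x X (homs B d)) (steps (map (app f) as))
     (map2 (\<lambda>d x. happ f d \<cdot> x) (steps as) xs)"
    unfolding list_all2_conv_all_nth
  proof (intro conjI allI impI)
    show "length (steps (map (app f) as)) = length (map2 (\<lambda>d x. happ f d \<cdot> x) (steps as) xs)"
      using d by (auto simp: steps_map dest: list_all2_lengthD)
    fix i assume "i < length (steps (map (app f) as))"
    then have i: "i < length (steps as)" "i < length xs"
      using d by (auto simp: steps_map dest: list_all2_lengthD)
    then have "arr V (xs ! i) X (homs A (steps as ! i))"
      using d by (auto simp: list_all2_conv_all_nth)
    moreover have "steps as ! i \<in> objs A \<times> objs A"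
      using i paths_steps d nth_mem by blast
    ultimately show "arr V (map2 (\<lambda>d x. happ f d \<cdot> x) (steps as) xs ! i) X
        (homs B (steps (map (app f) as) ! i))"
      using i gHomD(4)[OF f A B] by (auto simp: steps_map intro: comp_arr)
  qed
  then show ?thesis
    using d paths_map[of as A e "app f" B] gHomD(2)[OF f A B] w' words_iff[OF B X]
    by (auto simp: map_word_def)
qed

lemma map_word_restr:
  assumes A: "vgraph V A" and B: "vgraph V B" and f: "f \<in> gHom V A B"
    and w: "w \<in> words V P A X e" and g: "arr V g Y X"
  shows "restr_word V g (map_word V f w) = map_word V f (restr_word V g w)"
proof -
  obtain as p xs where w': "w = (as, p, xs)" by (metis prod.collapse)
  note d = w[unfolded w' words_iff[OF A arr_ob2[OF g]]]
  have "map (\<lambda>x. x \<cdot> g) (map2 (\<lambda>d x. happ f d \<cdot> x) (steps as) xs) =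
      map2 (\<lambda>d x. happ f d \<cdot> x) (steps as) (map (\<lambda>x. x \<cdot> g) xs)"
  proof (rule nth_equalityI)
    fix i assume "i < length (map (\<lambda>x. x \<cdot> g) (map2 (\<lambda>d x. happ f d \<cdot> x) (steps as) xs))"
    then have i: "i < length (steps as)" "i < length xs" by auto
    then have "arr V (xs ! i) X (homs A (steps as ! i))"
      using d by (auto simp: list_all2_conv_all_nth)
    moreover have "steps as ! i \<in> objs A \<times> objs A"
      using i paths_steps d nth_mem by blast
    ultimately show "map (\<lambda>x. x \<cdot> g) (map2 (\<lambda>d x. happ f d \<cdot> x) (steps as) xs) ! i =
        map2 (\<lambda>d x. happ f d \<cdot> x) (steps as) (map (\<lambda>x. x \<cdot> g) xs) ! i"
      using i assoc[OF g _ gHomD(4)[OF f A B]] by simp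
  qed simp
  then show ?thesis by (simp add: w' restr_word_def map_word_def)
qed

lemma map_nested_words:
  assumes A: "vgraph V A" and B: "vgraph V B" and X: "X \<in> Ob V" and f: "f \<in> gHom V A B"
    and n: "n \<in> nested_words V P A X e"
  shows "map_nested V f n \<in> nested_words V P B X (map_prod (app f) (app f) e)"
proof -
  obtain as p ws where n': "n = (as, p, ws)" by (metis prod.collapse)
  note d = n[unfolded n' nested_words_iff[OF X]]
  show ?thesis
    using d paths_map[of as A e "app f" B] gHomD(2)[OF f A B] map_word_words[OF A B X f]
      nested_words_iff[OF X]
    by (auto simp: n' map_nested_def steps_map list_all2_map1 list_all2_map2 elim!: list_all2_mono)
qed

lemma flatten_map:
  assumes A: "vgraph V A" and X: "X \<in> Ob V" and n: "n \<in> nested_words V P A X e"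
  shows "flatten V P X (map_nested V f n) = map_word V f (flatten V P X n)"
proof -
  obtain as p ws where n': "n = (as, p, ws)" by (metis prod.collapse)
  note d = n[unfolded n' nested_words_iff[OF X]]
  have as: "as \<in> paths A e" and ws: "list_all2 (\<lambda>d w. w \<in> words V P A X d) (steps as) ws"
    using d by auto
  have f: "fits as (map fst ws)"
    using fits_paths[OF _ nested_paths[OF ws]] pathsD[OF as] by blast
  \<comment> \<open>Equal lengths inside every block allow \<open>zip\<close> to be distributed over
    \<open>concat\<close>.\<close>
  have l: "length (steps (fst w)) = length (snd (snd w))" if "w \<in> set ws" for w
  proof -
    obtain d where "w \<in> words V P A X d"
      using list_all2_ex2[OF ws \<open>w \<in> set ws\<close>] by blast
    then show ?thesis by (cases w) (auto simp: words_def dest: list_all2_lengthD)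
  qed
  have "concat (map (\<lambda>w. map2 (\<lambda>d x. happ f d \<cdot> x) (steps (fst w)) (snd (snd w))) ws) =
     map2 (\<lambda>d x. happ f d \<cdot> x) (concat (map steps (map fst ws))) (concat (map (snd \<circ> snd) ws))"
    using l by (induction ws) (auto simp: comp_def zip_append)
  moreover have "graft (map (app f) as) (map (map (app f)) (map fst ws)) =
      map (app f) (graft as (map fst ws))"
    using pathsD[OF as] by (simp add: graft_def hd_map map_concat comp_def map_tl)
  ultimately show ?thesis
    using graft_props[OF f]
    by (simp add: n' map_nested_def flatten_eq map_word_def comp_def case_prod_beta)
qed

end

lemma map_word_comp:
  fixes V :: "('u obj, 'u mor, 'z) fpcat_scheme"
  assumes "operadic V P" and A: "vgraph V A" and B: "vgraph V B" and D: "vgraph V D"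
    and X: "X \<in> Ob V" and f: "f \<in> gHom V A B" and g: "g \<in> gHom V B D" and w: "w \<in> words V P A X e"
  shows "map_word V (gComp V g f) w = map_word V g (map_word V f w)"
proof -
  interpret operadic V P by fact
  obtain as p xs where w': "w = (as, p, xs)" by (metis prod.collapse)
  note d = w[unfolded w' words_iff[OF A X]]
  have "map2 (\<lambda>d x. happ (gComp V g f) d \<cdot> x) (steps as) xs =
      map2 (\<lambda>d x. happ g d \<cdot> x) (steps (map (app f) as)) (map2 (\<lambda>d x. happ f d \<cdot> x) (steps as) xs)"
  proof (rule nth_equalityI)
    fix i assume "i < length (map2 (\<lambda>d x. happ (gComp V g f) d \<cdot> x) (steps as) xs)"
    then have i: "i < length (steps as)" "i < length xs" by auto
    then have x: "arr V (xs ! i) X (homs A (steps as ! i))"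
      using d by (auto simp: list_all2_conv_all_nth)
    have s: "steps as ! i \<in> objs A \<times> objs A"
      using i paths_steps d nth_mem by blast
    then have "map_prod (app f) (app f) (steps as ! i) \<in> objs B \<times> objs B"
      using gHomD(2)[OF f A B] by (auto simp: mem_Times_iff)
    then have "(happ (gComp V g f) (steps as ! i)) \<cdot> xs ! i =
       happ g (map_prod (app f) (app f) (steps as ! i)) \<cdot> happ f (steps as ! i) \<cdot> xs ! i"
      using s gHomD(1)[OF f A B] assoc[OF x gHomD(4)[OF f A B] gHomD(4)[OF g B D]]
      by (simp add: gComp_def)
    then show "map2 (\<lambda>d x. happ (gComp V g f) d \<cdot> x) (steps as) xs ! i =
      map2 (\<lambda>d x. happ g d \<cdot> x) (steps (map (app f) as)) (map2 (\<lambda>d x. happ f d \<cdot> x) (steps as) xs) ! i"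
      using i by (auto simp: steps_map)
  qed (simp add: steps_map)
  moreover have "map (app (gComp V g f)) as = map (app g) (map (app f) as)"
    using d pathsD[of as A e] gHomD(1)[OF f A B] by (auto simp: gComp_def)
  ultimately show ?thesis by (simp add: w' map_word_def)
qed

lemma map_word_id:
  fixes V :: "('u obj, 'u mor, 'z) fpcat_scheme"
  assumes "operadic V P" and A: "vgraph V A" and X: "X \<in> Ob V" and w: "w \<in> words V P A X e"
  shows "map_word V (gId V A) w = w"
proof -
  interpret operadic V P by fact
  obtain as p xs where w': "w = (as, p, xs)" by (metis prod.collapse)
  note d = w[unfolded w' words_iff[OF A X]]
  have "map2 (\<lambda>d x. happ (gId V A) d \<cdot> x) (steps as) xs = xs"
  proof (rule nth_equalityI)
    show l: "length (map2 (\<lambda>d x. happ (gId V A) d \<cdot> x) (steps as) xs) = length xs"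
      using d by (auto dest: list_all2_lengthD)
    fix i assume "i < length (map2 (\<lambda>d x. happ (gId V A) d \<cdot> x) (steps as) xs)"
    then have i: "i < length (steps as)" "i < length xs" by auto
    then have x: "arr V (xs ! i) X (homs A (steps as ! i))"
      using d by (auto simp: list_all2_conv_all_nth)
    have s: "steps as ! i \<in> objs A \<times> objs A"
      using i paths_steps d nth_mem by blast
    show "map2 (\<lambda>d x. happ (gId V A) d \<cdot> x) (steps as) xs ! i = xs ! i"
      using s x i id_left[OF x] by (simp add: gId_def)
  qed
  moreover have "map (app (gId V A)) as = as"
    using d pathsD[of as A e] by (intro map_idI) (auto simp: gId_def)
  ultimately show ?thesis by (simp add: w' map_word_def)
qed

section \<open>Enriched graphs\<close>

text \<open>Two different targets are allowed: a morphism records only its source, and its functions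
  are extensional.\<close>

lemma gmor_eqI:
  assumes "f \<in> gHom V A B" "g \<in> gHom V A C" "\<And>a. a \<in> objs A \<Longrightarrow> app f a = app g a"
    and "\<And>e. e \<in> objs A \<times> objs A \<Longrightarrow> happ f e = happ g e"
  shows "f = g"
proof -
  obtain f1 F g1 G' where f: "f = Gmor (objs A) f1 F" "f1 \<in> objs A \<rightarrow>\<^sub>E objs B"
      "F \<in> extensional (objs A \<times> objs A)"
    and g: "g = Gmor (objs A) g1 G'" "g1 \<in> objs A \<rightarrow>\<^sub>E objs C" "G' \<in> extensional (objs A \<times> objs A)"
    using assms(1,2) by (auto simp: gHom_def PiE_def)
  have "f1 = g1"
    by (rule extensionalityI[of _ "objs A"]) (use assms(3) f g in \<open>auto simp: PiE_def\<close>)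
  moreover have "F = G'"
    by (rule extensionalityI[OF f(3) g(3)]) (use assms(4) f g in auto)
  ultimately show ?thesis using f g by simp
qed

lemma gHomI:
  assumes "\<And>a. a \<in> objs A \<Longrightarrow> f a \<in> objs B"
    and "\<And>a b. a \<in> objs A \<Longrightarrow> b \<in> objs A \<Longrightarrow> arr V (F (a, b)) (homs A (a, b)) (homs B (f a, f b))"
  shows "Gmor (objs A) (restrict f (objs A)) (restrict F (objs A \<times> objs A)) \<in> gHom V A B"
  using assms by (auto simp: gHom_def arr_def)

lemma gHomI':
  assumes "f \<in> objs A \<rightarrow>\<^sub>E objs B"
    and "\<And>a b. a \<in> objs A \<Longrightarrow> b \<in> objs A \<Longrightarrow> arr V (F (a, b)) (homs A (a, b)) (homs B (f a, f b))"
  shows "Gmor (objs A) f (restrict F (objs A \<times> objs A)) \<in> gHom V A B"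
  using assms by (auto simp: gHom_def arr_def)

lemma gHom_ob:
  assumes "f \<in> gHom V A B"
  shows "src f = objs A" "\<And>a. a \<in> objs A \<Longrightarrow> app f a \<in> objs B"
  using assms by (auto simp: gHom_def)

lemma happ_arr:
  assumes "f \<in> gHom V A B" "vgraph V A" "vgraph V B" "a \<in> objs A" "b \<in> objs A"
  shows "arr V (happ f (a, b)) (homs A (a, b)) (homs B (app f a, app f b))"
  using gHomD(4)[OF assms(1-3), of "(a, b)"] assms(4,5) by simp

lemma app_gComp [simp]: "a \<in> src f \<Longrightarrow> app (gComp V g f) a = app g (app f a)"
  and src_gComp [simp]: "src (gComp V g f) = src f"
  and happ_gComp [simp]: "a \<in> src f \<Longrightarrow> b \<in> src f \<Longrightarrow>
    happ (gComp V g f) (a, b) = Comp V (happ g (app f a, app f b)) (happ f (a, b))"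
  and app_gId [simp]: "a \<in> objs A \<Longrightarrow> app (gId V A) a = a"
  and src_gId [simp]: "src (gId V A) = objs A"
  and happ_gId [simp]: "a \<in> objs A \<Longrightarrow> b \<in> objs A \<Longrightarrow> happ (gId V A) (a, b) = Id V (homs A (a, b))"
  by (simp_all add: gComp_def gId_def)

locale gphs = prodcat V for V :: "('u obj, 'u mor, 'z) fpcat_scheme"
begin

abbreviation "vg \<equiv> vgraph V"

lemma gComp_hom:
  assumes "f \<in> gHom V A B" "g \<in> gHom V B D" "vg A" "vg B" "vg D"
  shows "gComp V g f \<in> gHom V A D"
  unfolding gComp_def gHom_ob(1)[OF assms(1)]
  using happ_arr[OF assms(1,3,4)] happ_arr[OF assms(2,4,5)] gHom_ob[OF assms(1)] gHom_ob[OF assms(2)]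
  by (intro gHomI) (auto intro!: comp_arr[OF happ_arr[OF assms(1,3,4)]])

lemma gId_hom: "vg A \<Longrightarrow> gId V A \<in> gHom V A A"
  unfolding gId_def by (rule gHomI) (auto intro: id_arr vgraphD)

lemma gComp_id:
  assumes "f \<in> gHom V A B" "vg A" "vg B"
  shows "gComp V f (gId V A) = f" "gComp V (gId V B) f = f"
  using gHom_ob[OF assms(1)] id_left[OF happ_arr[OF assms]] id_right[OF happ_arr[OF assms]]
  by (auto intro!: gmor_eqI[OF gComp_hom assms(1)] assms gId_hom)

lemma gComp_assoc:
  assumes f: "f \<in> gHom V A B" and g: "g \<in> gHom V B D" and h: "h \<in> gHom V D E"
    and v: "vg A" "vg B" "vg D" "vg E"
  shows "gComp V h (gComp V g f) = gComp V (gComp V h g) f"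
proof (rule gmor_eqI[of _ V A E _ E])
  fix e assume "e \<in> objs A \<times> objs A"
  then show "happ (gComp V h (gComp V g f)) e = happ (gComp V (gComp V h g) f) e"
    using gHom_ob[OF f] gHom_ob[OF g] v
      assoc[OF happ_arr[OF f v(1,2)] happ_arr[OF g v(2,3)] happ_arr[OF h v(3,4)]]
    by (cases e) simp
qed (use assms gHom_ob[OF f] gHom_ob[OF g] in \<open>auto intro: gComp_hom\<close>)

end

section \<open>Products of enriched graphs\<close>

lemma tuples_iff: "z \<in> tuples Xs \<longleftrightarrow> (\<exists>xs. z = Tup xs \<and> list_all2 (\<in>) xs Xs)"
  by (auto simp: tuples_def)

lemma tuples_nth: "z \<in> tuples (map objs As) \<Longrightarrow> i < length As \<Longrightarrow> untup z ! i \<in> objs (As ! i)"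
  by (auto simp: tuples_iff list_all2_conv_all_nth)

lemma tuples_eqI:
  assumes "z \<in> tuples Xs" "z' \<in> tuples Xs" "\<And>i. i < length Xs \<Longrightarrow> untup z ! i = untup z' ! i"
  shows "z = z'"
  using assms by (auto simp: tuples_iff list_all2_conv_all_nth intro: nth_equalityI)

locale vgphs = gphs V for V :: "('a elt obj, 'a elt mor, 'z) fpcat_scheme"
begin

definition ghoms :: "'a elt obj \<Rightarrow> 'a elt mor list \<Rightarrow> 'a elt obj list \<Rightarrow> bool" where
  "ghoms X fs As \<longleftrightarrow> list_all2 (\<lambda>f A. vg A \<and> f \<in> gHom V X A) fs As"

lemma objs_gProd [simp]: "objs (gProd V As) = tuples (map objs As)"
  by (simp add: gProd_def Let_def)

lemma homs_gProd [simp]: "z \<in> tuples (map objs As) \<Longrightarrow> z' \<in> tuples (map objs As) \<Longrightarrow>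
    homs (gProd V As) (z, z') = Prod V (hom_list As (z, z'))"
  by (simp add: gProd_def Let_def)

lemma length_hom_list [simp]: "length (hom_list As e) = length As"
  by (simp add: hom_list_def)

lemma nth_hom_list [simp]: "i < length As \<Longrightarrow>
    hom_list As (z, z') ! i = homs (As ! i) (untup z ! i, untup z' ! i)"
  by (simp add: hom_list_def)

lemma hom_list_ob:
  assumes "\<And>A. A \<in> set As \<Longrightarrow> vg A" "z \<in> tuples (map objs As)" "z' \<in> tuples (map objs As)"
  shows "set (hom_list As (z, z')) \<subseteq> Ob V"
  using assms tuples_nth[of _ As] by (auto simp: hom_list_def intro!: vgraphD)

lemma gProd_vg: "(\<And>A. A \<in> set As \<Longrightarrow> vg A) \<Longrightarrow> vg (gProd V As)"
  unfolding vgraph_def[of V "gProd V As"] by (auto intro!: prod_ob dest: hom_list_ob[THEN subsetD, rotated 3])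

lemma app_gProj [simp]: "z \<in> tuples (map objs As) \<Longrightarrow> app (gProj V As i) z = untup z ! i"
  and happ_gProj [simp]: "z \<in> tuples (map objs As) \<Longrightarrow> z' \<in> tuples (map objs As) \<Longrightarrow>
    happ (gProj V As i) (z, z') = Proj V (hom_list As (z, z')) i"
  by (simp_all add: gProj_def Let_def)

lemma gProj_hom:
  assumes "\<And>A. A \<in> set As \<Longrightarrow> vg A" "i < length As"
  shows "gProj V As i \<in> gHom V (gProd V As) (As ! i)"
  unfolding gProj_def Let_def objs_gProd[symmetric]
proof (rule gHomI)
  fix z z' assume z: "z \<in> objs (gProd V As)" "z' \<in> objs (gProd V As)"
  show "arr V (Proj V (hom_list As (z, z')) i) (homs (gProd V As) (z, z'))
      (homs (As ! i) (untup z ! i, untup z' ! i))"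
    using proj_arr[OF hom_list_ob[where As = As and z = z and z' = z', OF assms(1)]] z assms(2)
    by simp
qed (use assms tuples_nth in auto)

definition gtuple :: "'a elt obj \<Rightarrow> 'a elt obj list \<Rightarrow> 'a elt mor list \<Rightarrow> 'a elt mor" where
  "gtuple X As fs = (let t = (\<lambda>x. Tup (map (\<lambda>f. app f x) fs)) in
     Gmor (objs X) (\<lambda>x\<in>objs X. t x)
       (\<lambda>e\<in>objs X \<times> objs X. tuple V (homs X e) (hom_list As (map_prod t t e)) (map (\<lambda>f. happ f e) fs)))"

lemma ghoms_tup: "ghoms X fs As \<Longrightarrow> x \<in> objs X \<Longrightarrow>
    Tup (map (\<lambda>f. app f x) fs) \<in> tuples (map objs As)"
  using gHom_ob(2) unfolding ghoms_def tuples_iff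
  by (auto simp: list_all2_map1 list_all2_map2 elim!: list_all2_mono)

lemma ghoms_els:
  assumes "ghoms X fs As" "vg X" "x \<in> objs X" "y \<in> objs X"
  shows "els (homs X (x, y)) (map (\<lambda>f. happ f (x, y)) fs)
    (hom_list As (Tup (map (\<lambda>f. app f x) fs), Tup (map (\<lambda>f. app f y) fs)))"
  using assms vgraphD unfolding ghoms_def els_def list_all2_conv_all_nth
  by (auto intro!: happ_arr[of _ V X])

lemma ghoms_vg: "ghoms X fs As \<Longrightarrow> A \<in> set As \<Longrightarrow> vg A"
  unfolding ghoms_def by (auto dest: list_all2_ex2)

lemma ghoms_length: "ghoms X fs As \<Longrightarrow> length fs = length As"
  unfolding ghoms_def by (rule list_all2_lengthD)

lemma ghoms_nth: "ghoms X fs As \<Longrightarrow> i < length As \<Longrightarrow> vg (As ! i) \<and> fs ! i \<in> gHom V X (As ! i)"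
  unfolding ghoms_def by (auto simp: list_all2_conv_all_nth)

lemma gtuple_hom:
  assumes g: "ghoms X fs As" and X: "vg X"
  shows "gtuple X As fs \<in> gHom V X (gProd V As)"
  unfolding gtuple_def Let_def
  using ghoms_tup[OF g] tuple_arr[OF ghoms_els[OF g X]] by (intro gHomI) auto

lemma gProj_gtuple:
  assumes g: "ghoms X fs As" and X: "vg X" and i: "i < length As"
  shows "gComp V (gProj V As i) (gtuple X As fs) = fs ! i"
proof -
  have vA: "\<And>A. A \<in> set As \<Longrightarrow> vg A" using ghoms_vg[OF g] .
  note t = gtuple_hom[OF g X]
  show ?thesis
  proof (rule gmor_eqI)
    show "gComp V (gProj V As i) (gtuple X As fs) \<in> gHom V X (As ! i)"
      using gComp_hom[OF t gProj_hom[OF vA i] X gProd_vg[OF vA]] ghoms_nth[OF g i] by blast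
    show "fs ! i \<in> gHom V X (As ! i)" using ghoms_nth[OF g i] by blast
  qed (use gHom_ob[OF t] i ghoms_length[OF g] ghoms_tup[OF g] proj_tuple[OF ghoms_els[OF g X]]
      in \<open>auto simp: gtuple_def Let_def\<close>)
qed

lemma gProd_eqI:
  assumes h: "h \<in> gHom V X (gProd V As)" and k: "k \<in> gHom V X (gProd V As)" and X: "vg X"
    and vA: "\<And>A. A \<in> set As \<Longrightarrow> vg A"
    and eq: "\<And>i. i < length As \<Longrightarrow> gComp V (gProj V As i) h = gComp V (gProj V As i) k"
  shows "h = k"
proof -
  note oh = gHom_ob[OF h] and ok = gHom_ob[OF k] and G = gProd_vg[OF vA]
  have o: "app h x = app k x" if x: "x \<in> objs X" for x
  proof (rule tuples_eqI[of _ "map objs As"])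
    fix i assume "i < length (map objs As)"
    then have "app (gComp V (gProj V As i) h) x = app (gComp V (gProj V As i) k) x"
      using eq by simp
    then show "untup (app h x) ! i = untup (app k x) ! i"
      using oh ok x by simp
  qed (use oh ok x in auto)
  show ?thesis
  proof (rule gmor_eqI[OF h k])
    fix e assume "e \<in> objs X \<times> objs X"
    then obtain x y where e: "e = (x, y)" and x: "x \<in> objs X" "y \<in> objs X" by blast
    have T: "app h x \<in> tuples (map objs As)" "app h y \<in> tuples (map objs As)" using oh x by auto
    show "happ h e = happ k e"
      unfolding e
    proof (rule tuple_eqI)
      show "arr V (happ h (x, y)) (homs X (x, y)) (Prod V (hom_list As (app h x, app h y)))"
        using happ_arr[OF h X G x] T by simp
      show "arr V (happ k (x, y)) (homs X (x, y)) (Prod V (hom_list As (app h x, app h y)))"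
        using happ_arr[OF k X G x] T o x by simp
      show "set (hom_list As (app h x, app h y)) \<subseteq> Ob V" by (rule hom_list_ob[OF vA T])
      fix i assume "i < length (hom_list As (app h x, app h y))"
      then have "happ (gComp V (gProj V As i) h) (x, y) = happ (gComp V (gProj V As i) k) (x, y)"
        using eq by simp
      then show "Proj V (hom_list As (app h x, app h y)) i \<cdot> happ h (x, y) =
          Proj V (hom_list As (app h x, app h y)) i \<cdot> happ k (x, y)"
        using oh ok x o T by simp
    qed
  qed (rule o)
qed

end

section \<open>Sets and globular sets\<close>

text \<open>The single probe is a one-point set, so elements at it are ordinary elements of a set
  and any function on them is a morphism.\<close>

lemma set_cat_nice: "nice (set_cat :: 'a gcat) {Disc {Tup []}}"
proof
  let ?S = "set_cat :: 'a gcat"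
  have eqI: "h = k" if "h \<in> Hom ?S X Y" "k \<in> Hom ?S X Y" "\<And>x. x \<in> objs X \<Longrightarrow> app h x = app k x"
    for h k X Y
    using that by (auto simp: set_cat_def intro: PiE_ext)
  show "category ?S"
    unfolding category_def
  proof (intro conjI)
    show "\<forall>A\<in>Ob ?S. \<forall>B\<in>Ob ?S. \<forall>f\<in>Hom ?S A B.
        Comp ?S f (Id ?S A) = f \<and> Comp ?S (Id ?S B) f = f"
      by (auto simp: set_cat_def intro!: extensionalityI[OF restrict_extensional]) (auto simp: PiE_def)
  qed (auto simp: set_cat_def intro!: restrict_ext dest: PiE_mem)
  show "Prod ?S As \<in> Ob ?S" for As by (simp add: set_cat_def)
  show "Proj ?S As i \<in> Hom ?S (Prod ?S As) (As ! i)" if "i < length As" for As i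
    using that tuples_nth by (auto simp: set_cat_def)
  show "\<exists>!h. h \<in> Hom ?S X (Prod ?S As) \<and> (\<forall>i<length As. Comp ?S (Proj ?S As i) h = fs ! i)"
    if f: "list_all2 (\<lambda>f A. arr ?S f X A) fs As" for X fs As
  proof (rule ex1I, intro conjI allI impI)
    let ?h = "Fun (objs X) (\<lambda>x\<in>objs X. Tup (map (\<lambda>f. app f x) fs))"
    have n: "fs ! i \<in> Hom ?S X (As ! i)" if "i < length As" for i
      using f that by (auto simp: list_all2_conv_all_nth arr_def)
    have l: "length fs = length As" using f by (rule list_all2_lengthD)
    have t: "Tup (map (\<lambda>f. app f x) fs) \<in> tuples (map objs As)" if "x \<in> objs X" for x
      using n that l by (auto simp: tuples_iff list_all2_conv_all_nth set_cat_def) fastforce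
    then show h: "?h \<in> Hom ?S X (Prod ?S As)"
      by (auto simp: set_cat_def)
    show "Comp ?S (Proj ?S As i) ?h = fs ! i" if i: "i < length As" for i
      using n[OF i] t i l by (auto simp: set_cat_def fun_eq_iff PiE_def extensional_def)
    fix h assume k: "h \<in> Hom ?S X (Prod ?S As) \<and> (\<forall>i<length As. Comp ?S (Proj ?S As i) h = fs ! i)"
    show "h = ?h"
    proof (rule eqI[OF _ h])
      fix x assume x: "x \<in> objs X"
      show "app h x = app ?h x"
      proof (rule tuples_eqI[of _ "map objs As"])
        show "app h x \<in> tuples (map objs As)" using k x by (auto simp: set_cat_def)
        show "app ?h x \<in> tuples (map objs As)" using t x by simp
        fix i assume "i < length (map objs As)"
        then have i: "i < length As" by simp
        then have "app (Comp ?S (Proj ?S As i) h) x = app (fs ! i) x" using k by simp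
        then show "untup (app h x) ! i = untup (app ?h x) ! i"
          using k x i l by (auto simp: set_cat_def split: if_splits)
      qed
    qed (use k in blast)
  qed
  show "{Disc {Tup []}} \<subseteq> Ob ?S" by (simp add: set_cat_def)
  have ptarr: "arr ?S (Fun {Tup []} (\<lambda>y\<in>{Tup []}. b)) (Disc {Tup []}) B" if "b \<in> objs B" "B \<in> Ob ?S" for b B
    using that by (auto simp: arr_def set_cat_def)
  have pt: "\<exists>b\<in>objs B. x = Fun {Tup []} (\<lambda>y\<in>{Tup []}. b)" if "arr ?S x (Disc {Tup []}) B" for x B
    using that by (auto simp: arr_def set_cat_def fun_eq_iff PiE_def extensional_def
        intro!: bexI[of _ "app x (Tup [])"])
  show "cocone ?S {Disc {Tup []}} I A (Incl ?S I A) (Coprod ?S I A)"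
    if A: "\<And>i. i \<in> I \<Longrightarrow> A i \<in> Ob ?S" for I A
  proof (rule coconeI)
    show "Coprod ?S I A \<in> Ob ?S" by (simp add: set_cat_def)
    show i: "arr ?S (Incl ?S I A i) (A i) (Coprod ?S I A)" if "i \<in> I" for i
      using that A[OF that] by (auto simp: arr_def set_cat_def)
    show "\<exists>i y. i \<in> I \<and> arr ?S y X (A i) \<and> x = Comp ?S (Incl ?S I A i) y"
      if X: "X \<in> {Disc {Tup []}}" and x: "arr ?S x X (Coprod ?S I A)" for X x
    proof -
      obtain b where b: "b \<in> objs (Coprod ?S I A)" "x = Fun {Tup []} (\<lambda>y\<in>{Tup []}. b)"
        using pt[of x] X x by auto
      then obtain i a where "i \<in> I" "a \<in> objs (A i)" "b = Inj i a" by (auto simp: set_cat_def)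
      then show ?thesis
        using b X ptarr[OF _ A, of a i]
        by (intro exI[of _ i] exI[of _ "Fun {Tup []} (\<lambda>y\<in>{Tup []}. a)"])
          (auto simp: set_cat_def fun_eq_iff)
    qed
    show "i = j \<and> y = z"
      if X: "X \<in> {Disc {Tup []}}" and ij: "i \<in> I" "j \<in> I" and y: "arr ?S y X (A i)"
        and z: "arr ?S z X (A j)" and eq: "Comp ?S (Incl ?S I A i) y = Comp ?S (Incl ?S I A j) z"
      for X i y j z
    proof -
      obtain a b where a: "a \<in> objs (A i)" "y = Fun {Tup []} (\<lambda>y\<in>{Tup []}. a)"
        and b: "b \<in> objs (A j)" "z = Fun {Tup []} (\<lambda>y\<in>{Tup []}. b)"
        using pt y z X by blast
      have "app (Comp ?S (Incl ?S I A i) y) (Tup []) = app (Comp ?S (Incl ?S I A j) z) (Tup [])"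
        using eq by simp
      then show ?thesis using a b by (auto simp: set_cat_def)
    qed
  qed
  show "h = k" if h: "arr ?S h B C" and k: "arr ?S k B C"
    and eq: "\<And>X x. X \<in> {Disc {Tup []}} \<Longrightarrow> arr ?S x X B \<Longrightarrow> Comp ?S h x = Comp ?S k x" for h k B C
  proof (rule eqI)
    fix x assume x: "x \<in> objs B"
    have "Comp ?S h (Fun {Tup []} (\<lambda>y\<in>{Tup []}. x)) = Comp ?S k (Fun {Tup []} (\<lambda>y\<in>{Tup []}. x))"
      using eq ptarr[OF x] h by (auto simp: arr_def)
    then have "app (Comp ?S h (Fun {Tup []} (\<lambda>y\<in>{Tup []}. x))) (Tup []) =
        app (Comp ?S k (Fun {Tup []} (\<lambda>y\<in>{Tup []}. x))) (Tup [])" by simp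
    then show "app h x = app k x" by (simp add: set_cat_def)
  qed (use h k in \<open>auto simp: arr_def\<close>)
  show "\<exists>h. arr ?S h B C \<and> (\<forall>X\<in>{Disc {Tup []}}. \<forall>x. arr ?S x X B \<longrightarrow> Comp ?S h x = \<phi> X x)"
    if B: "B \<in> Ob ?S" "C \<in> Ob ?S"
    and \<phi>: "\<And>X x. X \<in> {Disc {Tup []}} \<Longrightarrow> arr ?S x X B \<Longrightarrow> arr ?S (\<phi> X x) X C" for B C \<phi>
  proof (intro exI conjI ballI allI impI)
    let ?h = "Fun (objs B) (\<lambda>b\<in>objs B. app (\<phi> (Disc {Tup []}) (Fun {Tup []} (\<lambda>y\<in>{Tup []}. b))) (Tup []))"
    have "app (\<phi> (Disc {Tup []}) (Fun {Tup []} (\<lambda>y\<in>{Tup []}. b))) (Tup []) \<in> objs C" if "b \<in> objs B" for b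
      using pt[OF \<phi>[OF _ ptarr[OF that B(1)]]] by auto
    then show h: "arr ?S ?h B C" using B by (auto simp: arr_def set_cat_def)
    fix X x assume X: "X \<in> {Disc {Tup []}}" "arr ?S x X B"
    then obtain b where b: "b \<in> objs B" "x = Fun {Tup []} (\<lambda>y\<in>{Tup []}. b)" using pt by blast
    then obtain c where c: "c \<in> objs C" "\<phi> X x = Fun {Tup []} (\<lambda>y\<in>{Tup []}. c)"
      using pt \<phi> X by blast
    then show "Comp ?S ?h x = \<phi> X x" using b X by (auto simp: set_cat_def fun_eq_iff)
  qed
qed

locale enriching = nice V G + vgphs V for V :: "'a gcat" and G
begin

lemma gOb_vg: "A \<in> Ob (gph V) \<Longrightarrow> vg A"
  by (auto simp: gph_def vgraph_def PiE_def Pi_def)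

lemma gOb_I: "A = Graph S (restrict H (S \<times> S)) \<Longrightarrow> (\<And>a b. a \<in> S \<Longrightarrow> b \<in> S \<Longrightarrow> H (a, b) \<in> Ob V) \<Longrightarrow>
    A \<in> Ob (gph V)"
  by (auto simp: gph_def)

lemma gph_simps [simp]: "Hom (gph V) = gHom V" "Comp (gph V) = gComp V" "Id (gph V) = gId V"
   "Prod (gph V) = gProd V" "Proj (gph V) = gProj V" "Coprod (gph V) = gCoprod V"
   "Incl (gph V) = gIncl V"
  by (simp_all add: gph_def)

lemma garr_iff: "arr (gph V) f A B \<longleftrightarrow> A \<in> Ob (gph V) \<and> B \<in> Ob (gph V) \<and> f \<in> gHom V A B"
  by (simp add: arr_def)

lemma gProd_ob: "set As \<subseteq> Ob (gph V) \<Longrightarrow> gProd V As \<in> Ob (gph V)"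
  unfolding gProd_def Let_def
  by (intro gOb_I[OF refl] prod_ob hom_list_ob) (auto intro: gOb_vg)

lemma gph_prodcat: "prodcat (gph V)"
proof
  show "category (gph V)"
    unfolding category_def
    using gComp_hom gId_hom gComp_id gComp_assoc gOb_vg by (auto simp: gComp_assoc)
  show "Prod (gph V) As \<in> Ob (gph V)" if "set As \<subseteq> Ob (gph V)" for As
    using gProd_ob[OF that] by simp
  show "Proj (gph V) As i \<in> Hom (gph V) (Prod (gph V) As) (As ! i)"
    if "set As \<subseteq> Ob (gph V)" "i < length As" for As i
    using gProj_hom[OF _ that(2)] that gOb_vg by auto
  fix X As fs assume X: "X \<in> Ob (gph V)" and fs: "list_all2 (\<lambda>f A. arr (gph V) f X A) fs As"
  have g: "ghoms X fs As"
    unfolding ghoms_def using fs by (rule list_all2_mono) (auto simp: garr_iff gOb_vg)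
  show "\<exists>!h. h \<in> Hom (gph V) X (Prod (gph V) As) \<and>
      (\<forall>i<length As. Comp (gph V) (Proj (gph V) As i) h = fs ! i)"
    using gtuple_hom[OF g gOb_vg[OF X]] gProj_gtuple[OF g gOb_vg[OF X]]
      gProd_eqI[OF _ _ gOb_vg[OF X] ghoms_vg[OF g]]
    by (intro ex1I[of _ "gtuple X As fs"]) auto
qed

end

section \<open>Probes in the category of enriched graphs\<close>

lemma cocone_empty: "cocone V G {} A u B \<longleftrightarrow> B \<in> Ob V \<and> (\<forall>X\<in>G. \<forall>x. \<not> arr V x X B)"
  by (auto simp: cocone_def)

context enriching
begin

abbreviation "p0 \<equiv> Tup [] :: 'a elt"
abbreviation "p1 \<equiv> Tup [Tup []] :: 'a elt"

definition ini :: "'a elt obj" where "ini = Coprod V {} (\<lambda>_. undefined)"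

definition absurd :: "'a elt obj \<Rightarrow> 'a elt mor" where "absurd C = (SOME h. arr V h ini C)"

lemma ini_cocone: "cocone V G ({} :: 'a elt list set) A u ini"
  using coprod_cocone[of "{}" "\<lambda>_. undefined"] by (simp add: ini_def cocone_empty)

lemma ini_ob: "ini \<in> Ob V"
  using ini_cocone by (rule cocone_ob)

lemma absurd_arr: "C \<in> Ob V \<Longrightarrow> arr V (absurd C) ini C"
  unfolding absurd_def by (rule someI_ex) (use cotuple[OF ini_cocone] in blast)

text \<open>Two maps out of \<open>ini\<close> agree on all its probe elements, since there are
  none.\<close>

lemma absurd_unique: "arr V h ini C \<Longrightarrow> h = absurd C"
  using ini_cocone by (intro probe_ext[OF _ absurd_arr[OF arr_ob2]]) (auto simp: cocone_empty)

text \<open>The probes in \<open>gph V\<close>: a single point, and two points with hom \<open>X\<close> from the first to the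
  second and all other homs initial.\<close>

definition pt :: "'a elt obj" where
  "pt = Graph {p0} (\<lambda>e\<in>{p0} \<times> {p0}. ini)"

definition susp :: "'a elt obj \<Rightarrow> 'a elt obj" where
  "susp X = Graph {p0, p1} (\<lambda>e\<in>{p0, p1} \<times> {p0, p1}. if e = (p0, p1) then X else ini)"

definition gpoint :: "'a elt obj \<Rightarrow> 'a elt \<Rightarrow> 'a elt mor" where
  "gpoint A a = Gmor {p0} (\<lambda>z\<in>{p0}. a) (\<lambda>e\<in>{p0} \<times> {p0}. absurd (homs A (a, a)))"

definition garrow :: "'a elt obj \<Rightarrow> 'a elt \<Rightarrow> 'a elt \<Rightarrow> 'a elt mor \<Rightarrow> 'a elt mor" where
  "garrow A a b x = (let f = (\<lambda>z. if z = p0 then a else b) in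
     Gmor {p0, p1} (restrict f {p0, p1})
       (\<lambda>e\<in>{p0, p1} \<times> {p0, p1}. if e = (p0, p1) then x else absurd (homs A (map_prod f f e))))"

definition gprobes :: "'a elt obj set" where
  "gprobes = insert pt (susp ` G)"

lemma pt_ob: "pt \<in> Ob (gph V)" and susp_ob: "X \<in> Ob V \<Longrightarrow> susp X \<in> Ob (gph V)"
  unfolding pt_def susp_def
  by (rule gOb_I[OF refl], use ini_ob in simp, rule gOb_I[OF refl], use ini_ob in simp)

lemma objs_pt [simp]: "objs pt = {p0}" and objs_susp [simp]: "objs (susp X) = {p0, p1}"
  and homs_pt [simp]: "homs pt (p0, p0) = ini"
  and homs_susp [simp]: "homs (susp X) (p0, p1) = X" "homs (susp X) (p0, p0) = ini"
    "homs (susp X) (p1, p0) = ini" "homs (susp X) (p1, p1) = ini"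
  by (simp_all add: pt_def susp_def)

lemma app_gpoint [simp]: "app (gpoint A a) p0 = a" and src_gpoint [simp]: "src (gpoint A a) = {p0}"
  and app_garrow [simp]: "app (garrow A a b x) p0 = a" "app (garrow A a b x) p1 = b"
  and src_garrow [simp]: "src (garrow A a b x) = {p0, p1}"
  and happ_garrow [simp]: "happ (garrow A a b x) (p0, p1) = x"
  by (simp_all add: gpoint_def garrow_def Let_def)

lemma gpoint_hom: "vg A \<Longrightarrow> a \<in> objs A \<Longrightarrow> gpoint A a \<in> gHom V pt A"
  unfolding gpoint_def objs_pt[symmetric]
  by (rule gHomI) (auto intro: absurd_arr vgraphD)

lemma garrow_hom:
  assumes "vg A" "a \<in> objs A" "b \<in> objs A" "arr V x X (homs A (a, b))"
  shows "garrow A a b x \<in> gHom V (susp X) A"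
  unfolding garrow_def Let_def objs_susp[symmetric, of X]
  by (rule gHomI) (use assms absurd_arr vgraphD[OF assms(1)] in auto)

text \<open>The only hom of \<open>pt\<close> is \<open>ini\<close>, so the hom component of a map
  is forced and a map out of \<open>pt\<close> amounts to an object of \<open>A\<close>.\<close>

lemma gpoint_all:
  assumes "f \<in> gHom V pt A" "vg A"
  shows "app f p0 \<in> objs A \<and> f = gpoint A (app f p0)"
proof
  show o: "app f p0 \<in> objs A" using gHom_ob[OF assms(1)] by simp
  show "f = gpoint A (app f p0)"
    by (rule gmor_eqI[OF assms(1) gpoint_hom[OF assms(2) o]])
      (use happ_arr[OF assms(1) gOb_vg[OF pt_ob] assms(2), of p0 p0] absurd_unique
        in \<open>auto simp: gpoint_def\<close>)
qed

text \<open>Three of the four homs of \<open>susp X\<close> are \<open>ini\<close>, so those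
  components are forced. What remains is a pair of objects and one element of the hom between
  them.\<close>

lemma garrow_all:
  assumes f: "f \<in> gHom V (susp X) A" and A: "vg A" and X: "X \<in> Ob V"
  shows "app f p0 \<in> objs A \<and> app f p1 \<in> objs A \<and>
    arr V (happ f (p0, p1)) X (homs A (app f p0, app f p1)) \<and>
    f = garrow A (app f p0) (app f p1) (happ f (p0, p1))"
proof (intro conjI)
  note h = happ_arr[OF f gOb_vg[OF susp_ob[OF X]] A]
  show o: "app f p0 \<in> objs A" "app f p1 \<in> objs A" using gHom_ob[OF f] by auto
  show a: "arr V (happ f (p0, p1)) X (homs A (app f p0, app f p1))"
    using h[of p0 p1] by simp
  show "f = garrow A (app f p0) (app f p1) (happ f (p0, p1))"
    by (rule gmor_eqI[OF f garrow_hom[OF A o a]])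
      (use h[of p0 p0] h[of p1 p0] h[of p1 p1] absurd_unique in \<open>auto simp: garrow_def Let_def\<close>)
qed

lemma gpoint_inj: "gpoint A a = gpoint A' a' \<Longrightarrow> a = a'"
  using app_gpoint by metis

lemma garrow_inj:
  assumes "garrow A a b x = garrow A' a' b' x'"
  shows "a = a' \<and> b = b' \<and> x = x'"
  using arg_cong[OF assms, of "\<lambda>f. app f p0"] arg_cong[OF assms, of "\<lambda>f. app f p1"]
    arg_cong[OF assms, of "\<lambda>f. happ f (p0, p1)"] by simp

lemma comp_gpoint:
  assumes h: "h \<in> gHom V A B" and A: "vg A" and B: "vg B" and a: "a \<in> objs A"
  shows "gComp V h (gpoint A a) = gpoint B (app h a)"
proof -
  have "gComp V h (gpoint A a) \<in> gHom V pt B"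
    by (rule gComp_hom[OF gpoint_hom[OF A a] h gOb_vg[OF pt_ob] A B])
  from gpoint_all[OF this B] show ?thesis by simp
qed

lemma comp_garrow:
  assumes h: "h \<in> gHom V A B" and A: "vg A" and B: "vg B" and a: "a \<in> objs A" "b \<in> objs A"
    and x: "arr V x X (homs A (a, b))"
  shows "gComp V h (garrow A a b x) = garrow B (app h a) (app h b) (happ h (a, b) \<cdot> x)"
proof -
  note X = arr_ob1[OF x]
  have "gComp V h (garrow A a b x) \<in> gHom V (susp X) B"
    by (rule gComp_hom[OF garrow_hom[OF A a x] h gOb_vg[OF susp_ob[OF X]] A B])
  from garrow_all[OF this B X] show ?thesis by simp
qed

lemma gprobe_cases:
  assumes "X \<in> gprobes" "arr (gph V) x X A"
  obtains (pt) a where "X = pt" "a \<in> objs A" "x = gpoint A a"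
  | (susp) Y a b y where "X = susp Y" "Y \<in> G" "a \<in> objs A" "b \<in> objs A"
      "arr V y Y (homs A (a, b))" "x = garrow A a b y"
  using assms gpoint_all[of x A] garrow_all[of x _ A] gOb_vg[of A] probeD
  unfolding gprobes_def garr_iff by blast

lemma gpoint_arr: "A \<in> Ob (gph V) \<Longrightarrow> a \<in> objs A \<Longrightarrow> arr (gph V) (gpoint A a) pt A"
  using gpoint_hom gOb_vg pt_ob by (simp add: garr_iff)

lemma garrow_arr:
  assumes "A \<in> Ob (gph V)" "a \<in> objs A" "b \<in> objs A" "arr V x X (homs A (a, b))"
  shows "arr (gph V) (garrow A a b x) (susp X) A"
  using assms garrow_hom gOb_vg susp_ob arr_ob1[OF assms(4)] by (simp add: garr_iff)

text \<open>Coproducts of graphs in terms of \<open>V\<close>: the objects form a disjoint union, a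
  hom inside a summand keeps its probe elements, and a hom between summands has none. The clause on
  homs inside a summand is written as a \<open>cocone\<close> over the one-element index set
  \<open>{[]}\<close> of strings, so that \<open>pres\<close> applies to it directly.\<close>

definition gcocone_cond :: "'i set \<Rightarrow> ('i \<Rightarrow> 'a elt obj) \<Rightarrow> ('i \<Rightarrow> 'a elt mor) \<Rightarrow> 'a elt obj \<Rightarrow> bool" where
  "gcocone_cond I A u B \<longleftrightarrow>
    (\<forall>b\<in>objs B. \<exists>i\<in>I. \<exists>a\<in>objs (A i). b = app (u i) a) \<and>
    (\<forall>i\<in>I. \<forall>j\<in>I. \<forall>a\<in>objs (A i). \<forall>b\<in>objs (A j). app (u i) a = app (u j) b \<longrightarrow> i = j \<and> a = b) \<and>
    (\<forall>i\<in>I. \<forall>a\<in>objs (A i). \<forall>b\<in>objs (A i). cocone V G {[] :: 'a elt list} (\<lambda>_. homs (A i) (a, b))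
       (\<lambda>_. happ (u i) (a, b)) (homs B (app (u i) a, app (u i) b))) \<and>
    (\<forall>i\<in>I. \<forall>j\<in>I. i \<noteq> j \<longrightarrow> (\<forall>a\<in>objs (A i). \<forall>b\<in>objs (A j). \<forall>X\<in>G. \<forall>x.
       \<not> arr V x X (homs B (app (u i) a, app (u j) b))))"

text \<open>The probe \<open>pt\<close> tests objects and the probes \<open>susp X\<close> test homs
  together with their end points; this splits the coproduct condition into the clauses on objects
  and on homs.\<close>

lemma gcocone_iff:
  "cocone (gph V) gprobes I A u B \<longleftrightarrow>
    B \<in> Ob (gph V) \<and> (\<forall>i\<in>I. arr (gph V) (u i) (A i) B) \<and> gcocone_cond I A u B"
proof (intro iffI conjI)
  interpret g: prodcat "gph V" by (rule gph_prodcat)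
  assume c: "cocone (gph V) gprobes I A u B"
  show B: "B \<in> Ob (gph V)" using c by (rule cocone_ob)
  have u: "arr (gph V) (u i) (A i) B" if "i \<in> I" for i using c that by (rule cocone_arr)
  then show "\<forall>i\<in>I. arr (gph V) (u i) (A i) B" by blast
  have uh: "u i \<in> gHom V (A i) B" "vg (A i)" "A i \<in> Ob (gph V)" if "i \<in> I" for i
    using u[OF that] by (auto simp: garr_iff gOb_vg)
  note vB = gOb_vg[OF B]
  have inj: "i = j \<and> y = z"
    if "X \<in> gprobes" "i \<in> I" "arr (gph V) y X (A i)" "j \<in> I" "arr (gph V) z X (A j)"
      "gComp V (u i) y = gComp V (u j) z" for X i j y z
    using cocone_inj[OF c that(1-5)] that(6) g.comp_arr[OF that(3) u[OF that(2)]] by simp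
  \<comment> \<open>Testing with \<open>susp X\<close> shows that an element of a hom of
    \<open>B\<close> comes from a single summand, and both of its end points with it.\<close>
  have lift: "\<exists>i\<in>I. \<exists>a'\<in>objs (A i). \<exists>b'\<in>objs (A i). \<exists>y. arr V y X (homs (A i) (a', b')) \<and>
      a = app (u i) a' \<and> b = app (u i) b' \<and> x = happ (u i) (a', b') \<cdot> y"
    if X: "X \<in> G" and ab: "a \<in> objs B" "b \<in> objs B" and x: "arr V x X (homs B (a, b))" for X a b x
  proof -
    have Xp: "susp X \<in> gprobes" using X by (simp add: gprobes_def)
    obtain i y where i: "i \<in> I" and y: "arr (gph V) y (susp X) (A i)"
        and eq: "garrow B a b x = gComp V (u i) y"
      using cocone_ex[OF c Xp garrow_arr[OF B ab x]] by auto
    obtain a' b' y' where y': "a' \<in> objs (A i)" "b' \<in> objs (A i)" "y = garrow (A i) a' b' y'"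
        "arr V y' X (homs (A i) (a', b'))"
      using garrow_all[of y X "A i"] y uh(2)[OF i] probeD[OF X] by (auto simp: garr_iff)
    have "garrow B a b x = garrow B (app (u i) a') (app (u i) b') (happ (u i) (a', b') \<cdot> y')"
      using comp_garrow[OF uh(1,2)[OF i] vB y'(1,2,4)] eq y'(3) by simp
    then show ?thesis using garrow_inj i y' by metis
  qed
  have pinj: "i = j \<and> a = b"
    if "i \<in> I" "j \<in> I" "a \<in> objs (A i)" "b \<in> objs (A j)" "app (u i) a = app (u j) b" for i j a b
  proof -
    have "i = j \<and> gpoint (A i) a = gpoint (A j) b"
      using that comp_gpoint[OF uh(1,2)[OF that(1)] vB that(3)]
        comp_gpoint[OF uh(1,2)[OF that(2)] vB that(4)] gpoint_arr uh(3)
      by (intro inj[of pt]) (auto simp: gprobes_def)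
    then show ?thesis using gpoint_inj by blast
  qed
  show "gcocone_cond I A u B"
    unfolding gcocone_cond_def
  proof (intro conjI ballI allI impI)
    fix b assume b: "b \<in> objs B"
    obtain i y where i: "i \<in> I" and y: "arr (gph V) y pt (A i)" and eq: "gpoint B b = gComp V (u i) y"
      using cocone_ex[OF c _ gpoint_arr[OF B b]] by (auto simp: gprobes_def)
    obtain a where a: "a \<in> objs (A i)" "y = gpoint (A i) a"
      using gpoint_all[of y "A i"] y uh(2)[OF i] by (auto simp: garr_iff)
    then have "gpoint B b = gpoint B (app (u i) a)"
      using comp_gpoint[OF uh(1,2)[OF i] vB] eq by simp
    then show "\<exists>i\<in>I. \<exists>a\<in>objs (A i). b = app (u i) a" using gpoint_inj i a by blast
  next
    fix i j a b assume "i \<in> I" "j \<in> I" "a \<in> objs (A i)" "b \<in> objs (A j)" "app (u i) a = app (u j) b"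
    from pinj[OF this] show "i = j" "a = b" by auto
  next
    fix i a b assume i: "i \<in> I" and ab: "a \<in> objs (A i)" "b \<in> objs (A i)"
    note o = gHom_ob(2)[OF uh(1)[OF i]]
    show "cocone V G {[] :: 'a elt list} (\<lambda>_. homs (A i) (a, b)) (\<lambda>_. happ (u i) (a, b))
        (homs B (app (u i) a, app (u i) b))"
    proof (rule coconeI)
      show "homs B (app (u i) a, app (u i) b) \<in> Ob V" using vgraphD[OF vB] o ab by blast
      show "arr V (happ (u i) (a, b)) (homs (A i) (a, b)) (homs B (app (u i) a, app (u i) b))"
        by (rule happ_arr[OF uh(1,2)[OF i] vB ab])
      fix X x assume X: "X \<in> G" and x: "arr V x X (homs B (app (u i) a, app (u i) b))"
      show "\<exists>j y. j \<in> {[]} \<and> arr V y X (homs (A i) (a, b)) \<and> x = happ (u i) (a, b) \<cdot> y"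
      proof -
        obtain j a' b' y where j: "j \<in> I" "a' \<in> objs (A j)" "b' \<in> objs (A j)"
            "arr V y X (homs (A j) (a', b'))" "app (u i) a = app (u j) a'" "app (u i) b = app (u j) b'"
            "x = happ (u j) (a', b') \<cdot> y"
          using lift[OF X o[OF ab(1)] o[OF ab(2)] x] by blast
        then have "i = j \<and> a = a'" "i = j \<and> b = b'"
          using pinj[OF i j(1) ab(1) j(2)] pinj[OF i j(1) ab(2) j(3)] by blast+
        then show ?thesis using j by auto
      qed
    next
      fix X y z and k l :: "'a elt list"
      assume X: "X \<in> G" and y: "arr V y X (homs (A i) (a, b))" and z: "arr V z X (homs (A i) (a, b))"
        and eq: "happ (u i) (a, b) \<cdot> y = happ (u i) (a, b) \<cdot> z" and "k \<in> {[]}" "l \<in> {[]}"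
      have "garrow (A i) a b y = garrow (A i) a b z"
        using inj[OF _ i garrow_arr[OF uh(3)[OF i] ab y] i garrow_arr[OF uh(3)[OF i] ab z]] X eq
          comp_garrow[OF uh(1,2)[OF i] vB ab y] comp_garrow[OF uh(1,2)[OF i] vB ab z]
        by (simp add: gprobes_def)
      then show "k = l \<and> y = z" using garrow_inj \<open>k \<in> {[]}\<close> \<open>l \<in> {[]}\<close> by blast
    qed
  next
    fix i j a b X x
    assume ij: "i \<in> I" "j \<in> I" "i \<noteq> j" and ab: "a \<in> objs (A i)" "b \<in> objs (A j)" and X: "X \<in> G"
    show "\<not> arr V x X (homs B (app (u i) a, app (u j) b))"
      using lift[OF X gHom_ob(2)[OF uh(1)[OF ij(1)] ab(1)] gHom_ob(2)[OF uh(1)[OF ij(2)] ab(2)], of x]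
        pinj ij ab by metis
  qed
next
  assume *: "B \<in> Ob (gph V) \<and> (\<forall>i\<in>I. arr (gph V) (u i) (A i) B) \<and> gcocone_cond I A u B"
  then have B: "B \<in> Ob (gph V)" and u: "\<And>i. i \<in> I \<Longrightarrow> arr (gph V) (u i) (A i) B"
    and c: "gcocone_cond I A u B" by auto
  have uh: "u i \<in> gHom V (A i) B" "vg (A i)" "A i \<in> Ob (gph V)" if "i \<in> I" for i
    using u[OF that] by (auto simp: garr_iff gOb_vg)
  note vB = gOb_vg[OF B] and c' = c[unfolded gcocone_cond_def]
  have surj: "\<exists>i\<in>I. \<exists>a\<in>objs (A i). b = app (u i) a" if "b \<in> objs B" for b
    using c'[THEN conjunct1] that by blast
  have inj: "i = j \<and> a = b"
    if "i \<in> I" "j \<in> I" "a \<in> objs (A i)" "b \<in> objs (A j)" "app (u i) a = app (u j) b" for i j a b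
    using c'[THEN conjunct2, THEN conjunct1] that by blast
  have hc: "cocone V G {[] :: 'a elt list} (\<lambda>_. homs (A i) (a, b))
       (\<lambda>_. happ (u i) (a, b)) (homs B (app (u i) a, app (u i) b))"
    if "i \<in> I" "a \<in> objs (A i)" "b \<in> objs (A i)" for i a b
    using c'[THEN conjunct2, THEN conjunct2, THEN conjunct1] that by blast
  have ne: "i = j"
    if "i \<in> I" "j \<in> I" "a \<in> objs (A i)" "b \<in> objs (A j)" "X \<in> G"
      "arr V x X (homs B (app (u i) a, app (u j) b))" for i j a b X x
    using c'[THEN conjunct2, THEN conjunct2, THEN conjunct2] that by blast
  show "cocone (gph V) gprobes I A u B"
  proof (rule coconeI[OF B u])
    fix X x assume "X \<in> gprobes" "arr (gph V) x X B"
    then show "\<exists>i y. i \<in> I \<and> arr (gph V) y X (A i) \<and> x = Comp (gph V) (u i) y"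
    proof (cases rule: gprobe_cases)
      case (pt b)
      then obtain i a where i: "i \<in> I" "a \<in> objs (A i)" "b = app (u i) a" using surj by blast
      then show ?thesis using pt gpoint_arr[OF uh(3)[OF i(1)] i(2)] comp_gpoint[OF uh(1,2)[OF i(1)] vB i(2)]
        by (intro exI[of _ i] exI[of _ "gpoint (A i) a"]) auto
    next
      case (susp Y a b y)
      obtain i a' where i: "i \<in> I" "a' \<in> objs (A i)" "a = app (u i) a'" using surj susp(3) by blast
      obtain j b' where j: "j \<in> I" "b' \<in> objs (A j)" "b = app (u j) b'" using surj susp(4) by blast
      \<comment> \<open>The end points of an arrow lie in the same summand, since homs between
        different summands have no probe elements.\<close>
      have "i = j" using ne[OF i(1) j(1) i(2) j(2) susp(2)] susp(5) i(3) j(3) by simp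
      then have b': "b' \<in> objs (A i)" "b = app (u i) b'" using j by auto
      obtain y' where y': "arr V y' Y (homs (A i) (a', b'))" "y = happ (u i) (a', b') \<cdot> y'"
        using cocone_ex[OF hc[OF i(1,2) b'(1)] susp(2)] susp(5) i(3) b'(2) by auto
      then show ?thesis
        using i susp garrow_arr[OF uh(3)[OF i(1)] i(2) b'(1) y'(1)] b'(2)
          comp_garrow[OF uh(1,2)[OF i(1)] vB i(2) b'(1) y'(1)]
        by (intro exI[of _ i] exI[of _ "garrow (A i) a' b' y'"]) auto
    qed
  next
    fix X i y j z
    assume X: "X \<in> gprobes" and i: "i \<in> I" and j: "j \<in> I" and y: "arr (gph V) y X (A i)"
      and z: "arr (gph V) z X (A j)" and eq: "Comp (gph V) (u i) y = Comp (gph V) (u j) z"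
    from X y show "i = j \<and> y = z"
    proof (cases rule: gprobe_cases)
      case (pt a)
      obtain b where b: "b \<in> objs (A j)" "z = gpoint (A j) b"
        using z gpoint_all[of z "A j"] uh(2)[OF j] pt(1) by (auto simp: garr_iff)
      have "app (u i) a = app (u j) b"
        using eq pt b comp_gpoint[OF uh(1,2)[OF i] vB pt(2)] comp_gpoint[OF uh(1,2)[OF j] vB b(1)]
          gpoint_inj by auto
      then show ?thesis using inj[OF i j pt(2) b(1)] pt b by simp
    next
      case (susp Y a b y')
      obtain c d z' where z': "c \<in> objs (A j)" "d \<in> objs (A j)" "z = garrow (A j) c d z'"
          "arr V z' Y (homs (A j) (c, d))"
        using z garrow_all[of z Y "A j"] uh(2)[OF j] susp(1) probeD[OF susp(2)] by (auto simp: garr_iff)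
      have e: "app (u i) a = app (u j) c \<and> app (u i) b = app (u j) d \<and>
          happ (u i) (a, b) \<cdot> y' = happ (u j) (c, d) \<cdot> z'"
        using eq susp z' comp_garrow[OF uh(1,2)[OF i] vB susp(3-5)]
          comp_garrow[OF uh(1,2)[OF j] vB z'(1,2,4)] by (intro garrow_inj) simp
      have "i = j \<and> a = c" "i = j \<and> b = d"
        using inj[OF i j susp(3) z'(1)] inj[OF i j susp(4) z'(2)] e by auto
      moreover have "y' = z'"
        using cocone_inj'[OF hc[OF i susp(3,4)] susp(2) _ susp(5), of "[]" "[]" z'] calculation e z'(4)
        by auto
      ultimately show ?thesis using susp z' by simp
    qed
  qed
qed

lemma gCoprod_cocone:
  assumes A: "\<And>i. i \<in> I \<Longrightarrow> A i \<in> Ob (gph V)"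
  shows "cocone (gph V) gprobes I A (gIncl V I A) (gCoprod V I A)"
  unfolding gcocone_iff
proof (intro conjI ballI)
  let ?B = "gCoprod V I A"
  have o: "objs ?B = {Inj s x | s x. s \<in> I \<and> x \<in> objs (A s)}" by (simp add: gCoprod_def Let_def)
  have h1: "homs ?B (Inj s x, Inj s y) = homs (A s) (x, y)"
    if "s \<in> I" "x \<in> objs (A s)" "y \<in> objs (A s)" for s x y
    using that by (simp add: gCoprod_def Let_def)
  have h2: "homs ?B (Inj s x, Inj t y) = ini"
    if "s \<in> I" "x \<in> objs (A s)" "t \<in> I" "y \<in> objs (A t)" "s \<noteq> t" for s t x y
    using that by (simp add: gCoprod_def Let_def ini_def)
  have a: "app (gIncl V I A s) x = Inj s x" if "x \<in> objs (A s)" for s x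
    using that by (simp add: gIncl_def)
  have ha: "happ (gIncl V I A s) (x, y) = Id V (homs (A s) (x, y))"
    if "x \<in> objs (A s)" "y \<in> objs (A s)" for s x y
    using that by (simp add: gIncl_def)
  have hob: "homs (A s) (x, y) \<in> Ob V" if "s \<in> I" "x \<in> objs (A s)" "y \<in> objs (A s)" for s x y
    using vgraphD[OF gOb_vg[OF A]] that by blast
  show B: "?B \<in> Ob (gph V)"
    unfolding gCoprod_def Let_def
    by (rule gOb_I[OF refl]) (use hob ini_ob in \<open>auto simp: ini_def\<close>)
  show "arr (gph V) (gIncl V I A i) (A i) ?B" if i: "i \<in> I" for i
    unfolding garr_iff using A[OF i] B
  proof (intro conjI)
    show "gIncl V I A i \<in> gHom V (A i) ?B"
      unfolding gIncl_def by (rule gHomI) (use i o h1 hob in \<open>auto intro: id_arr\<close>)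
  qed
  show "gcocone_cond I A (gIncl V I A) ?B"
    unfolding gcocone_cond_def
  proof (intro conjI ballI allI impI)
    fix b assume "b \<in> objs ?B"
    then show "\<exists>i\<in>I. \<exists>y\<in>objs (A i). b = app (gIncl V I A i) y" using o a by auto
  next
    fix i x y assume i: "i \<in> I" "x \<in> objs (A i)" "y \<in> objs (A i)"
    have 1: "homs ?B (app (gIncl V I A i) x, app (gIncl V I A i) y) = homs (A i) (x, y)"
      using i a h1 by simp
    show "cocone V G {[] :: 'a elt list} (\<lambda>_. homs (A i) (x, y)) (\<lambda>_. happ (gIncl V I A i) (x, y))
        (homs ?B (app (gIncl V I A i) x, app (gIncl V I A i) y))"
      unfolding 1 ha[OF i(2,3)]
      by (rule coconeI) (use hob[OF i] id_arr id_left in auto)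
  next
    fix i j x y X z assume "i \<in> I" "j \<in> I" "i \<noteq> j" "x \<in> objs (A i)" "y \<in> objs (A j)" "X \<in> G"
    then show "\<not> arr V z X (homs ?B (app (gIncl V I A i) x, app (gIncl V I A j) y))"
      using a h2 ini_cocone by (auto simp: cocone_empty)
  qed (use a in auto)
qed

text \<open>This raises the dimension: density and the description of coproducts by probe elements
  pass from \<open>V\<close> to graphs over \<open>V\<close>, so the construction can be iterated up
  to any \<open>nGSet n\<close>.\<close>

lemma gph_nice: "nice (gph V) gprobes"
proof -
  interpret g: prodcat "gph V" by (rule gph_prodcat)
  show ?thesis
  proof
    show "gprobes \<subseteq> Ob (gph V)"
      using pt_ob susp_ob probeD by (auto simp: gprobes_def)
    show "cocone (gph V) gprobes I A (Incl (gph V) I A) (Coprod (gph V) I A)"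
      if "\<And>i. i \<in> I \<Longrightarrow> A i \<in> Ob (gph V)" for I A
      using gCoprod_cocone[of I A] that by simp
    show "h = k" if h: "arr (gph V) h B C" and k: "arr (gph V) k B C"
      and eq: "\<And>X x. X \<in> gprobes \<Longrightarrow> arr (gph V) x X B \<Longrightarrow> Comp (gph V) h x = Comp (gph V) k x"
      for h k B C
    proof -
      have hh: "h \<in> gHom V B C" and kh: "k \<in> gHom V B C" and B: "B \<in> Ob (gph V)" "vg B" "vg C"
        using h k by (auto simp: garr_iff gOb_vg)
      have o: "app h b = app k b" if b: "b \<in> objs B" for b
        using eq[OF _ gpoint_arr[OF B(1) b]] comp_gpoint[OF hh B(2,3) b] comp_gpoint[OF kh B(2,3) b]
          gpoint_inj by (auto simp: gprobes_def)
      show ?thesis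
      proof (rule gmor_eqI[OF hh kh o])
        fix e assume "e \<in> objs B \<times> objs B"
        then obtain a b where e: "e = (a, b)" "a \<in> objs B" "b \<in> objs B" by blast
        show "happ h e = happ k e"
          unfolding e
        proof (rule probe_ext)
          show "arr V (happ h (a, b)) (homs B (a, b)) (homs C (app h a, app h b))"
            by (rule happ_arr[OF hh B(2,3) e(2,3)])
          show "arr V (happ k (a, b)) (homs B (a, b)) (homs C (app h a, app h b))"
            using happ_arr[OF kh B(2,3) e(2,3)] o e by simp
          fix X x assume X: "X \<in> G" and x: "arr V x X (homs B (a, b))"
          show "happ h (a, b) \<cdot> x = happ k (a, b) \<cdot> x"
            using eq[OF _ garrow_arr[OF B(1) e(2,3) x]] X garrow_inj
              comp_garrow[OF hh B(2,3) e(2,3) x] comp_garrow[OF kh B(2,3) e(2,3) x]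
            by (auto simp: gprobes_def)
        qed
      qed
    qed
    show "\<exists>h. arr (gph V) h B C \<and>
        (\<forall>X\<in>gprobes. \<forall>x. arr (gph V) x X B \<longrightarrow> Comp (gph V) h x = \<phi> X x)"
      if BC: "B \<in> Ob (gph V)" "C \<in> Ob (gph V)"
        and \<phi>: "\<And>X x. X \<in> gprobes \<Longrightarrow> arr (gph V) x X B \<Longrightarrow> arr (gph V) (\<phi> X x) X C"
        and nat: "\<And>X Y x g. X \<in> gprobes \<Longrightarrow> Y \<in> gprobes \<Longrightarrow> arr (gph V) x X B \<Longrightarrow>
          arr (gph V) g Y X \<Longrightarrow> \<phi> Y (Comp (gph V) x g) = Comp (gph V) (\<phi> X x) g"
      for B C \<phi>
    proof -
      note v = BC[THEN gOb_vg]
      have Gp: "pt \<in> gprobes" "\<And>X. X \<in> G \<Longrightarrow> susp X \<in> gprobes" by (auto simp: gprobes_def)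
      \<comment> \<open>The values of \<open>\<phi>\<close> at points form the map on
        objects.\<close>
      define f where "f b = app (\<phi> pt (gpoint B b)) p0" for b
      have f: "f b \<in> objs C \<and> \<phi> pt (gpoint B b) = gpoint C (f b)" if "b \<in> objs B" for b
        using gpoint_all[OF _ v(2)] \<phi>[OF Gp(1) gpoint_arr[OF BC(1) that]]
        by (auto simp: f_def garr_iff)
      \<comment> \<open>The values at suspended probes form, for each pair of objects, the family to
        which \<open>density\<close> of \<open>V\<close> is applied.\<close>
      define \<psi> where "\<psi> a b X x = happ (\<phi> (susp X) (garrow B a b x)) (p0, p1)" for a b X x
      have \<psi>: "arr V (\<psi> a b X x) X (homs C (f a, f b)) \<and>
          \<phi> (susp X) (garrow B a b x) = garrow C (f a) (f b) (\<psi> a b X x)"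
        if X: "X \<in> G" and ab: "a \<in> objs B" "b \<in> objs B" and x: "arr V x X (homs B (a, b))" for a b X x
      proof -
        note X' = probeD[OF X] and xa = garrow_arr[OF BC(1) ab x]
        let ?y = "\<phi> (susp X) (garrow B a b x)"
        have y: "arr (gph V) ?y (susp X) C" by (rule \<phi>[OF Gp(2)[OF X] xa])
        then have y': "?y \<in> gHom V (susp X) C" by (simp add: garr_iff)
        \<comment> \<open>Naturality along the two points of \<open>susp X\<close> forces the image
          of an arrow to have the images of its end points as end points.\<close>
        have pc: "app ?y p = f c" if p: "p \<in> {p0, p1}" and c: "c = app (garrow B a b x) p" for p c
        proof -
          have cB: "c \<in> objs B" using p c ab by auto
          have "gpoint C (f c) = \<phi> pt (gComp V (garrow B a b x) (gpoint (susp X) p))"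
            using comp_gpoint[of "garrow B a b x" "susp X" B p] xa v gOb_vg[OF susp_ob[OF X']] p c f[OF cB]
            by (simp add: garr_iff)
          also have "\<dots> = gComp V ?y (gpoint (susp X) p)"
            using nat[OF Gp(2)[OF X] Gp(1) xa gpoint_arr[OF susp_ob[OF X'], of p]] p by simp
          also have "\<dots> = gpoint C (app ?y p)"
            using comp_gpoint[OF y' gOb_vg[OF susp_ob[OF X']] v(2), of p] p by simp
          finally show ?thesis using gpoint_inj by metis
        qed
        show ?thesis
          using garrow_all[OF y' v(2) X'] pc[of p0 a] pc[of p1 b] by (simp add: \<psi>_def)
      qed
      have "\<exists>h. arr V h (homs B (a, b)) (homs C (f a, f b)) \<and>
          (\<forall>X\<in>G. \<forall>x. arr V x X (homs B (a, b)) \<longrightarrow> h \<cdot> x = \<psi> a b X x)"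
        if ab: "a \<in> objs B" "b \<in> objs B" for a b
      proof (rule density)
        show "homs B (a, b) \<in> Ob V" "homs C (f a, f b) \<in> Ob V"
          using vgraphD[OF v(1)] vgraphD[OF v(2)] f ab by auto
        show "arr V (\<psi> a b X x) X (homs C (f a, f b))" if "X \<in> G" "arr V x X (homs B (a, b))" for X x
          using \<psi> that ab by blast
        fix X Y x g assume X: "X \<in> G" and Y: "Y \<in> G" and x: "arr V x X (homs B (a, b))"
          and g: "arr V g Y X"
        note X' = probeD[OF X]
        \<comment> \<open>A map \<open>g\<close> of probes suspends to a map of the new probes;
          naturality of \<open>\<phi>\<close> along it is the naturality of \<open>\<psi>\<close>
          that \<open>density\<close> asks for.\<close>
        have g': "arr (gph V) (garrow (susp X) p0 p1 g) (susp Y) (susp X)"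
          by (rule garrow_arr[OF susp_ob[OF X']]) (use g in auto)
        have "\<phi> (susp Y) (gComp V (garrow B a b x) (garrow (susp X) p0 p1 g)) =
            gComp V (\<phi> (susp X) (garrow B a b x)) (garrow (susp X) p0 p1 g)"
          using nat[OF Gp(2)[OF X] Gp(2)[OF Y] garrow_arr[OF BC(1) ab x] g'] by simp
        also have "gComp V (garrow B a b x) (garrow (susp X) p0 p1 g) = garrow B a b (x \<cdot> g)"
          using comp_garrow[OF garrow_hom[OF v(1) ab x] gOb_vg[OF susp_ob[OF X']] v(1), of p0 p1 g Y] g
          by simp
        also have "gComp V (\<phi> (susp X) (garrow B a b x)) (garrow (susp X) p0 p1 g) =
            garrow C (f a) (f b) (\<psi> a b X x \<cdot> g)"
          using comp_garrow[OF garrow_hom[of C "f a" "f b" "\<psi> a b X x" X]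
             gOb_vg[OF susp_ob[OF X']] v(2), of p0 p1 g Y]
            \<psi>[OF X ab x] f ab g v(2) by simp
        finally show "\<psi> a b Y (x \<cdot> g) = \<psi> a b X x \<cdot> g"
          using \<psi>[OF Y ab comp_arr[OF g x]] garrow_inj by metis
      qed
      then obtain F where F: "\<And>a b. a \<in> objs B \<Longrightarrow> b \<in> objs B \<Longrightarrow>
          arr V (F (a, b)) (homs B (a, b)) (homs C (f a, f b)) \<and>
          (\<forall>X\<in>G. \<forall>x. arr V x X (homs B (a, b)) \<longrightarrow> F (a, b) \<cdot> x = \<psi> a b X x)"
        by (metis (no_types) old.prod.case)
      let ?h = "Gmor (objs B) (restrict f (objs B)) (restrict F (objs B \<times> objs B))"
      have h: "?h \<in> gHom V B C" by (rule gHomI) (use f F in auto)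
      have "Comp (gph V) ?h x = \<phi> X x" if "X \<in> gprobes" "arr (gph V) x X B" for X x
        using that
      proof (cases rule: gprobe_cases)
        case (pt a)
        then show ?thesis using comp_gpoint[OF h v] f by simp
      next
        case (susp Y a b y)
        then show ?thesis using comp_garrow[OF h v susp(3-5)] \<psi>[OF susp(2-5)] F by simp
      qed
      moreover have "arr (gph V) ?h B C" using h BC by (simp add: garr_iff)
      ultimately show ?thesis by blast
    qed
  qed
qed

end

section \<open>The free category monad\<close>

context nice
begin

text \<open>A map out of \<open>B\<close> may be prescribed on any kind of natural data \<open>W\<close> that describes the
  elements of \<open>B\<close> at probes uniquely.\<close>

lemma data_rec:
  fixes W :: "'o \<Rightarrow> 'w set"
  assumes BC: "B \<in> Ob V" "C \<in> Ob V"
    and elt: "\<And>X w. X \<in> Ob V \<Longrightarrow> w \<in> W X \<Longrightarrow> arr V (elt X w) X B"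
    and restr: "\<And>X Y w g. w \<in> W X \<Longrightarrow> arr V g Y X \<Longrightarrow> r g w \<in> W Y \<and> elt X w \<cdot> g = elt Y (r g w)"
    and surj: "\<And>X x. X \<in> G \<Longrightarrow> arr V x X B \<Longrightarrow> \<exists>w\<in>W X. x = elt X w"
    and inj: "\<And>X w w'. X \<in> G \<Longrightarrow> w \<in> W X \<Longrightarrow> w' \<in> W X \<Longrightarrow> elt X w = elt X w' \<Longrightarrow> w = w'"
    and \<Phi>: "\<And>X w. X \<in> Ob V \<Longrightarrow> w \<in> W X \<Longrightarrow> arr V (\<Phi> X w) X C"
    and nat: "\<And>X Y w g. w \<in> W X \<Longrightarrow> arr V g Y X \<Longrightarrow> \<Phi> X w \<cdot> g = \<Phi> Y (r g w)"
  shows "\<exists>!h. h \<in> Hom V B C \<and> (\<forall>X\<in>Ob V. \<forall>w\<in>W X. h \<cdot> elt X w = \<Phi> X w)"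
proof -
  define inv where "inv X x = (SOME w. w \<in> W X \<and> x = elt X w)" for X x
  have inv: "inv X (elt X w) = w" if "X \<in> G" "w \<in> W X" for X w
    unfolding inv_def by (rule some_equality) (use inj that in auto)
  have "\<exists>h. arr V h B C \<and> (\<forall>X\<in>G. \<forall>x. arr V x X B \<longrightarrow> h \<cdot> x = \<Phi> X (inv X x))"
  proof (rule density[OF BC])
    fix X x assume "X \<in> G" "arr V x X B"
    then show "arr V (\<Phi> X (inv X x)) X C" using surj inv \<Phi> probeD by metis
  next
    fix X Y x g assume X: "X \<in> G" "Y \<in> G" and x: "arr V x X B" and g: "arr V g Y X"
    obtain w where "w \<in> W X" "x = elt X w" using surj[OF X(1) x] by blast
    then show "\<Phi> Y (inv Y (x \<cdot> g)) = \<Phi> X (inv X x) \<cdot> g"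
      using restr[OF _ g] nat[OF _ g] inv X by simp
  qed
  then obtain h where h: "arr V h B C" "\<And>X x. X \<in> G \<Longrightarrow> arr V x X B \<Longrightarrow> h \<cdot> x = \<Phi> X (inv X x)"
    by blast
  have hG: "h \<cdot> elt X w = \<Phi> X w" if "X \<in> G" "w \<in> W X" for X w
    using h(2)[OF that(1) elt[OF probeD[OF that(1)] that(2)]] inv[OF that] by simp
  \<comment> \<open>So far the equation holds at probes. At an arbitrary stage \<open>X\<close> it
    is tested by restriction along all maps from probes into \<open>X\<close>.\<close>
  have "h \<cdot> elt X w = \<Phi> X w" if X: "X \<in> Ob V" and w: "w \<in> W X" for X w
  proof (rule probe_ext[OF comp_arr[OF elt[OF X w] h(1)] \<Phi>[OF X w]])
    fix Z g assume Z: "Z \<in> G" and g: "arr V g Z X"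
    have "(h \<cdot> elt X w) \<cdot> g = h \<cdot> elt Z (r g w)"
      using assoc[OF g elt[OF X w] h(1)] restr[OF w g] by simp
    also have "\<dots> = \<Phi> X w \<cdot> g" using hG[OF Z] restr[OF w g] nat[OF w g] by simp
    finally show "(h \<cdot> elt X w) \<cdot> g = \<Phi> X w \<cdot> g" .
  qed
  moreover have "k = h" if k: "k \<in> Hom V B C" "\<forall>X\<in>Ob V. \<forall>w\<in>W X. k \<cdot> elt X w = \<Phi> X w" for k
  proof (rule probe_ext[OF _ h(1)])
    show "arr V k B C" using k BC by (simp add: arr_def)
    fix X x assume X: "X \<in> G" and x: "arr V x X B"
    obtain w where "w \<in> W X" "x = elt X w" using surj[OF X x] by blast
    then show "k \<cdot> x = h \<cdot> x" using k(2) hG X probeD by auto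
  qed
  ultimately show ?thesis using h(1) by (intro ex1I[of _ h]) (simp_all add: arr_def)
qed

end

lemma concat_concat_map: "concat (concat (map f xs)) = concat (map (\<lambda>x. concat (f x)) xs)"
  by (induction xs) auto

lemma strings_cong: "objs A = objs B \<Longrightarrow> strings A = strings B"
  and paths_cong: "objs A = objs B \<Longrightarrow> paths A = paths B"
  by (auto simp: strings_def paths_def fun_eq_iff)

lemma gHom_map_prod:
  assumes "f \<in> gHom V A B" "e \<in> objs A \<times> objs A"
  shows "map_prod (app f) (app f) e \<in> objs B \<times> objs B"
  using assms gHom_ob(2) by (auto simp: mem_Times_iff)

section \<open>Elements of free categories as words and nested words\<close>

locale freecat = enriching V G + operadic V R
  for V :: "'a gcat" and G and R
begin

abbreviation "F \<equiv> fc_ob V R"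

lemma objs_F [simp]: "objs (F A) = objs A"
  and homs_F: "e \<in> objs A \<times> objs A \<Longrightarrow>
    homs (F A) e = Coprod V (paths A e) (\<lambda>as. Prod V (factors R A as))"
  by (simp_all add: fc_ob_def)

lemma paths_F [simp]: "paths (F A) = paths A"
  by (rule paths_cong) simp

lemma F_cocone:
  assumes "vg A" "e \<in> objs A \<times> objs A"
  shows "cocone V G (paths A e) (\<lambda>as. Prod V (factors R A as))
    (Incl V (paths A e) (\<lambda>as. Prod V (factors R A as))) (homs (F A) e)"
  unfolding homs_F[OF assms(2)] by (rule coprod_cocone) (rule prod_ob[OF factors_ob[OF assms(1)]])

lemma F_vg: "vg A \<Longrightarrow> vg (F A)"
  unfolding vgraph_def[of V "F A"] using F_cocone cocone_ob by fastforce

lemma F_ob: "vg A \<Longrightarrow> F A \<in> Ob (gph V)"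
  unfolding fc_ob_def by (rule gOb_I[OF refl]) (use F_vg[of A] in \<open>auto simp: vgraph_def fc_ob_def\<close>)

abbreviation "felt \<equiv> fc_elt V R"

lemma words_pathsD: "w \<in> words V R A X e \<Longrightarrow> fst w \<in> paths A e \<and> e \<in> objs A \<times> objs A"
  using pathsD[of "fst w" A e] by (auto simp: words_def)

lemma felt_eq:
  assumes "w \<in> words V R A X e"
  shows "felt A X w = Incl V (paths A e) (\<lambda>as. Prod V (factors R A as)) (fst w) \<cdot> word_elt V R A X w"
  using paths_e[OF words_pathsD[OF assms, THEN conjunct1]] by (simp add: fc_elt_def Let_def)

lemma felt_arr:
  assumes "vg A" "X \<in> Ob V" "w \<in> words V R A X e"
  shows "arr V (felt A X w) X (homs (F A) e)"
  unfolding felt_eq[OF assms(3)]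
  by (rule comp_arr[OF word_elt_arr[OF assms] cocone_arr[OF F_cocone[OF assms(1)]]])
    (use words_pathsD[OF assms(3)] in blast)+

lemma felt_restr:
  assumes "vg A" "w \<in> words V R A X e" "arr V g Y X"
  shows "felt A X w \<cdot> g = felt A Y (restr_word V g w)"
  unfolding felt_eq[OF assms(2)] felt_eq[OF words_restr[OF assms]]
  using words_pathsD[OF assms(2)] assoc[OF assms(3) word_elt_arr[OF assms(1) arr_ob2[OF assms(3)] assms(2)]
      cocone_arr[OF F_cocone[OF assms(1)]]] word_elt_restr[OF assms] by simp

text \<open>A probe element of the coproduct lies over one string. At a general stage an element may
  be spread over several summands, hence the restriction to \<open>G\<close>.\<close>

lemma felt_surj:
  assumes "vg A" "X \<in> G" "arr V x X (homs (F A) e)" "e \<in> objs A \<times> objs A"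
  shows "\<exists>w\<in>words V R A X e. x = felt A X w"
proof -
  obtain as y where as: "as \<in> paths A e" "arr V y X (Prod V (factors R A as))"
      "x = Incl V (paths A e) (\<lambda>as. Prod V (factors R A as)) as \<cdot> y"
    using cocone_ex[OF F_cocone[OF assms(1,4)] assms(2,3)] by blast
  obtain w where "w \<in> words V R A X e" "fst w = as" "y = word_elt V R A X w"
    using word_elt_surj[OF assms(1) as(1,2)] by blast
  then show ?thesis using felt_eq as(3) by metis
qed

lemma felt_inj:
  assumes A: "vg A" and X: "X \<in> G" and w: "w \<in> words V R A X e" "w' \<in> words V R A X e"
    and eq: "felt A X w = felt A X w'"
  shows "w = w'"
proof -
  note a = word_elt_arr[OF A probeD[OF X]]
  have "fst w = fst w' \<and> word_elt V R A X w = word_elt V R A X w'"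
    using cocone_inj'[OF F_cocone[OF A] X _ a[OF w(1)] _ a[OF w(2)]] words_pathsD w eq felt_eq by metis
  then show ?thesis using word_elt_inj[OF A probeD[OF X] w] by blast
qed

text \<open>Presents the coproduct injection as the element given by a word, so that statements
  about injections become statements about words.\<close>

lemma felt_uword:
  assumes "vg A" "as \<in> paths A e"
  shows "felt A (Prod V (factors R A as)) (uword A as) =
    Incl V (paths A e) (\<lambda>as. Prod V (factors R A as)) as"
proof -
  note e = pathsD[OF assms(2), THEN conjunct2, THEN conjunct2, THEN conjunct2, THEN conjunct2]
  show ?thesis
    using felt_eq[OF uword(1)[OF assms]] uword(2,3)[OF assms]
      id_right[OF cocone_arr[OF F_cocone[OF assms(1) e] assms(2)]] by simp
qed

lemma F_rec:
  assumes A: "vg A" and e: "e \<in> objs A \<times> objs A" and C: "C \<in> Ob V"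
    and \<Phi>: "\<And>X w. X \<in> Ob V \<Longrightarrow> w \<in> words V R A X e \<Longrightarrow> arr V (\<Phi> X w) X C"
    and nat: "\<And>X Y w g. w \<in> words V R A X e \<Longrightarrow> arr V g Y X \<Longrightarrow>
      \<Phi> X w \<cdot> g = \<Phi> Y (restr_word V g w)"
  shows "\<exists>!h. h \<in> Hom V (homs (F A) e) C \<and>
    (\<forall>X\<in>Ob V. \<forall>w\<in>words V R A X e. h \<cdot> felt A X w = \<Phi> X w)"
  by (rule data_rec[where r = "restr_word V"])
    (use vgraphD'[OF F_vg[OF A]] e C felt_arr[OF A] words_restr[OF A] felt_restr[OF A]
      felt_surj[OF A _ _ e] felt_inj[OF A] \<Phi> nat in auto)

definition wnest :: "'a elt obj \<Rightarrow> 'a elt obj \<Rightarrow> 'a elt nested \<Rightarrow> 'a elt word" where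
  "wnest A X = (\<lambda>(as, p, ws). (as, p, map (felt A X) ws))"

abbreviation nelt :: "'a elt obj \<Rightarrow> 'a elt obj \<Rightarrow> 'a elt nested \<Rightarrow> 'a elt mor" where
  "nelt A X n \<equiv> felt (F A) X (wnest A X n)"

lemma wnest_words:
  assumes A: "vg A" and X: "X \<in> Ob V" and n: "n \<in> nested_words V R A X e"
  shows "wnest A X n \<in> words V R (F A) X e"
proof -
  obtain as p ws where n': "n = (as, p, ws)" by (metis prod.collapse)
  show ?thesis
    using n[unfolded n' nested_words_iff[OF X]] felt_arr[OF A X]
    by (auto simp: n' wnest_def words_iff[OF F_vg[OF A] X] list_all2_map2 elim!: list_all2_mono)
qed

lemma restr_wnest:
  assumes A: "vg A" and n: "n \<in> nested_words V R A X e" and g: "arr V g Y X"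
  shows "restr_word V g (wnest A X n) = wnest A Y (restr_nested V g n)"
proof -
  obtain as p ws where n': "n = (as, p, ws)" by (metis prod.collapse)
  have "felt A X w \<cdot> g = felt A Y (restr_word V g w)" if w: "w \<in> set ws" for w
  proof -
    have "list_all2 (\<lambda>d w. w \<in> words V R A X d) (steps as) ws"
      using n n' nested_words_iff[OF arr_ob2[OF g]] by blast
    from list_all2_ex2[OF this w] obtain d where "w \<in> words V R A X d" by blast
    then show ?thesis by (rule felt_restr[OF A _ g])
  qed
  then show ?thesis by (simp add: n' wnest_def restr_word_def restr_nested_def)
qed

text \<open>At a probe, each letter of a word of \<open>F A\<close> is an element of a coproduct and
  is therefore itself given by a word.\<close>

lemma wnest_surj:
  assumes A: "vg A" and X: "X \<in> G" and w: "w \<in> words V R (F A) X e"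
  shows "\<exists>n\<in>nested_words V R A X e. w = wnest A X n"
proof -
  obtain as p xs where w': "w = (as, p, xs)" by (metis prod.collapse)
  note d = w[unfolded w' words_iff[OF F_vg[OF A] probeD[OF X]]]
  have x: "\<exists>v\<in>words V R A X d. x = felt A X v"
    if "d \<in> objs A \<times> objs A" "arr V x X (homs (F A) d)" for d x
    using felt_surj[OF A X] that by blast
  have "\<exists>ws. list_all2 (\<lambda>d w. w \<in> words V R A X d) (steps as) ws \<and> xs = map (felt A X) ws"
  proof -
    have "list_all2 (\<lambda>d x. arr V x X (homs (F A) d)) (steps as) xs" "set (steps as) \<subseteq> objs A \<times> objs A"
      using d paths_steps by fastforce+
    then show ?thesis
    proof (induction rule: list_all2_induct)
      case (Cons d ds x xs)
      then obtain ws v where "list_all2 (\<lambda>d w. w \<in> words V R A X d) ds ws" "xs = map (felt A X) ws"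
        "v \<in> words V R A X d" "x = felt A X v" using x by force
      then show ?case by (intro exI[of _ "v # ws"]) simp
    qed simp
  qed
  then obtain ws where "list_all2 (\<lambda>d w. w \<in> words V R A X d) (steps as) ws" "xs = map (felt A X) ws"
    by blast
  then show ?thesis
    using d by (intro bexI[of _ "(as, p, ws)"])
      (auto simp: w' wnest_def nested_words_iff[OF probeD[OF X]])
qed

lemma wnest_inj:
  assumes A: "vg A" and X: "X \<in> G" and n: "n \<in> nested_words V R A X e" "n' \<in> nested_words V R A X e"
    and eq: "wnest A X n = wnest A X n'"
  shows "n = n'"
proof -
  obtain as p ws ws' where n': "n = (as, p, ws)" "n' = (as, p, ws')" "map (felt A X) ws = map (felt A X) ws'"
    using eq by (cases n; cases n') (auto simp: wnest_def)
  have l: "list_all2 (\<lambda>d w. w \<in> words V R A X d) (steps as) ws"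
      "list_all2 (\<lambda>d w. w \<in> words V R A X d) (steps as) ws'"
    using n n' nested_words_iff[OF probeD[OF X]] by auto
  have "ws = ws'"
  proof (rule nth_equalityI)
    show len: "length ws = length ws'" using n'(3) map_eq_imp_length_eq by blast
    fix i assume i: "i < length ws"
    then have "felt A X (ws ! i) = felt A X (ws' ! i)" using n'(3) len by (metis nth_map)
    then show "ws ! i = ws' ! i"
      using felt_inj[OF A X, of "ws ! i" "steps as ! i" "ws' ! i"] l i len
      by (auto simp: list_all2_conv_all_nth)
  qed
  then show ?thesis using n' by simp
qed

lemma nelt_arr:
  assumes "vg A" "X \<in> Ob V" "n \<in> nested_words V R A X e"
  shows "arr V (nelt A X n) X (homs (F (F A)) e)"
  by (rule felt_arr[OF F_vg[OF assms(1)] assms(2) wnest_words[OF assms]])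

lemma nelt_restr:
  assumes "vg A" "n \<in> nested_words V R A X e" "arr V g Y X"
  shows "nelt A X n \<cdot> g = nelt A Y (restr_nested V g n)"
  using felt_restr[OF F_vg[OF assms(1)] wnest_words[OF assms(1) arr_ob2[OF assms(3)] assms(2)] assms(3)]
    restr_wnest[OF assms] by simp

lemma nelt_surj:
  assumes "vg A" "X \<in> G" "arr V x X (homs (F (F A)) e)" "e \<in> objs A \<times> objs A"
  shows "\<exists>n\<in>nested_words V R A X e. x = nelt A X n"
  using felt_surj[OF F_vg[OF assms(1)] assms(2,3)] wnest_surj[OF assms(1,2)] assms(4) by fastforce

lemma nelt_inj:
  assumes "vg A" "X \<in> G" "n \<in> nested_words V R A X e" "n' \<in> nested_words V R A X e"
    "nelt A X n = nelt A X n'"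
  shows "n = n'"
  using assms felt_inj[OF F_vg[OF assms(1)] assms(2)] wnest_words probeD wnest_inj by metis

lemma FF_rec:
  assumes A: "vg A" and e: "e \<in> objs A \<times> objs A" and C: "C \<in> Ob V"
    and \<Phi>: "\<And>X w. X \<in> Ob V \<Longrightarrow> w \<in> nested_words V R A X e \<Longrightarrow> arr V (\<Phi> X w) X C"
    and nat: "\<And>X Y w g. w \<in> nested_words V R A X e \<Longrightarrow> arr V g Y X \<Longrightarrow>
      \<Phi> X w \<cdot> g = \<Phi> Y (restr_nested V g w)"
  shows "\<exists>!h. h \<in> Hom V (homs (F (F A)) e) C \<and>
    (\<forall>X\<in>Ob V. \<forall>w\<in>nested_words V R A X e. h \<cdot> nelt A X w = \<Phi> X w)"
  by (rule data_rec[where r = "restr_nested V"])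
    (use vgraphD'[OF F_vg[OF F_vg[OF A]]] e C nelt_arr[OF A] nested_restr[OF A] nelt_restr[OF A]
      nelt_surj[OF A _ _ e] nelt_inj[OF A] \<Phi> nat in auto)

section \<open>Functor, unit and multiplication on words\<close>

abbreviation "fcm \<equiv> fc V R"

lemma fob_fc [simp]: "fob fcm = F"
  by (simp add: fc_def)

text \<open>\<open>F_rec\<close> resolves the definite description in \<open>fmap\<close>, the
  naturality in the stage being \<open>map_word_restr\<close>. The formula on words is how the
  functor is computed from here on.\<close>

lemma fmap_fc:
  assumes f: "f \<in> gHom V A B" and A: "vg A" and B: "vg B"
  shows "fmap fcm A B f \<in> gHom V (F A) (F B)" "app (fmap fcm A B f) = app f"
    "X \<in> Ob V \<Longrightarrow> w \<in> words V R A X e \<Longrightarrow>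
      happ (fmap fcm A B f) e \<cdot> felt A X w = felt B X (map_word V f w)"
proof -
  have h: "\<exists>!h. h \<in> Hom V (homs (F A) e) (homs (F B) (map_prod (app f) (app f) e)) \<and>
      (\<forall>X\<in>Ob V. \<forall>w\<in>words V R A X e. h \<cdot> felt A X w = felt B X (map_word V f w))"
    if e: "e \<in> objs A \<times> objs A" for e
  proof (rule F_rec[OF A e])
    show "homs (F B) (map_prod (app f) (app f) e) \<in> Ob V"
      using vgraphD'[OF F_vg[OF B]] gHom_map_prod[OF f e] by simp
    show "arr V (felt B X (map_word V f w)) X (homs (F B) (map_prod (app f) (app f) e))"
      if "X \<in> Ob V" "w \<in> words V R A X e" for X w
      by (rule felt_arr[OF B that(1) map_word_words[OF A B that(1) f that(2)]])
    show "felt B X (map_word V f w) \<cdot> g = felt B Y (map_word V f (restr_word V g w))"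
      if "w \<in> words V R A X e" "arr V g Y X" for X Y w g
      using felt_restr[OF B map_word_words[OF A B arr_ob2[OF that(2)] f that(1)] that(2)]
        map_word_restr[OF A B f that] by simp
  qed
  show "app (fmap fcm A B f) = app f" by (simp add: fc_def)
  have H: "happ (fmap fcm A B f) e \<in> Hom V (homs (F A) e) (homs (F B) (map_prod (app f) (app f) e)) \<and>
      (\<forall>X\<in>Ob V. \<forall>w\<in>words V R A X e. happ (fmap fcm A B f) e \<cdot> felt A X w = felt B X (map_word V f w))"
    if e: "e \<in> objs A \<times> objs A" for e
  proof -
    have "happ (fmap fcm A B f) e = (THE h. h \<in> Hom V (homs (F A) e) (homs (F B) (map_prod (app f) (app f) e)) \<and>
      (\<forall>X\<in>Ob V. \<forall>w\<in>words V R A X e. h \<cdot> felt A X w = felt B X (map_word V f w)))"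
      using e by (simp add: fc_def)
    then show ?thesis using theI'[OF h[OF e]] by simp
  qed
  have "app f \<in> objs A \<rightarrow>\<^sub>E objs B" using f by (auto simp: gHom_def)
  then show "fmap fcm A B f \<in> gHom V (F A) (F B)"
    using H vgraphD'[OF F_vg[OF A]] vgraphD'[OF F_vg[OF B]] gHom_map_prod[OF f]
    by (auto simp: fc_def gHom_def)
  show "happ (fmap fcm A B f) e \<cdot> felt A X w = felt B X (map_word V f w)"
    if "X \<in> Ob V" "w \<in> words V R A X e"
    using H[of e] words_pathsD[OF that(2)] that by blast
qed

lemma eta_word:
  assumes A: "vg A" and ab: "a \<in> objs A" "b \<in> objs A" and x: "arr V x X (homs A (a, b))"
  shows "([a, b], unit_elt V R X, [x]) \<in> words V R A X (a, b)"
  unfolding words_iff[OF A arr_ob1[OF x]]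
  using ab x unit_elt_arr[OF arr_ob1[OF x]] by (auto intro!: pathsI)

lemma eta_fc:
  assumes A: "vg A"
  shows "eta fcm A \<in> gHom V A (F A)" "a \<in> objs A \<Longrightarrow> app (eta fcm A) a = a"
    "a \<in> objs A \<Longrightarrow> b \<in> objs A \<Longrightarrow> arr V x X (homs A (a, b)) \<Longrightarrow>
      happ (eta fcm A) (a, b) \<cdot> x = felt A X ([a, b], unit_elt V R X, [x])"
proof -
  have w: "([a, b], unit_elt V R (homs A (a, b)), [Id V (homs A (a, b))]) \<in>
      words V R A (homs A (a, b)) (a, b)" if "a \<in> objs A" "b \<in> objs A" for a b
    by (rule eta_word[OF A that id_arr[OF vgraphD[OF A that]]])
  show "eta fcm A \<in> gHom V A (F A)"
    unfolding fc_def monad.simps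
    by (rule gHomI) (use felt_arr[OF A _ w] vgraphD[OF A] in \<open>auto simp: Let_def\<close>)
  show "app (eta fcm A) a = a" if "a \<in> objs A" using that by (simp add: fc_def)
  show "happ (eta fcm A) (a, b) \<cdot> x = felt A X ([a, b], unit_elt V R X, [x])"
    if "a \<in> objs A" "b \<in> objs A" "arr V x X (homs A (a, b))"
    using felt_restr[OF A w[OF that(1,2)] that(3)] that id_left[OF that(3)] unit_elt_restr[OF that(3)]
    by (simp add: fc_def Let_def restr_word_def)
qed

lemma mu_fc:
  assumes A: "vg A"
  shows "mu fcm A \<in> gHom V (F (F A)) (F A)" "a \<in> objs A \<Longrightarrow> app (mu fcm A) a = a"
    "X \<in> Ob V \<Longrightarrow> n \<in> nested_words V R A X e \<Longrightarrow>
      happ (mu fcm A) e \<cdot> nelt A X n = felt A X (flatten V R X n)"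
proof -
  have h: "\<exists>!h. h \<in> Hom V (homs (F (F A)) e) (homs (F A) e) \<and>
      (\<forall>X\<in>Ob V. \<forall>n\<in>nested_words V R A X e. h \<cdot> nelt A X n = felt A X (flatten V R X n))"
    if e: "e \<in> objs A \<times> objs A" for e
  proof (rule FF_rec[OF A e])
    show "homs (F A) e \<in> Ob V" using vgraphD'[OF F_vg[OF A]] e by simp
    show "arr V (felt A X (flatten V R X n)) X (homs (F A) e)"
      if "X \<in> Ob V" "n \<in> nested_words V R A X e" for X n
      using felt_arr[OF A that(1)] flatten_words[OF A that(1)] that(2) by (cases n) auto
    show "felt A X (flatten V R X n) \<cdot> g = felt A Y (flatten V R Y (restr_nested V g n))"
      if "n \<in> nested_words V R A X e" "arr V g Y X" for X Y n g
    proof -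
      have "flatten V R X n \<in> words V R A X e"
        using flatten_words[OF A arr_ob2[OF that(2)]] that(1) by (cases n) auto
      then show ?thesis using felt_restr[OF A _ that(2)] flatten_restr[OF A that] by simp
    qed
  qed
  \<comment> \<open>Matches the pattern in the definition of \<open>mu\<close> with
    \<open>wnest\<close>.\<close>
  have wn: "(case n of (as, p, ws) \<Rightarrow> h \<cdot> felt (F A) X (as, p, map (felt A X) ws) =
      felt A X (flatten V R X (as, p, ws))) \<longleftrightarrow> h \<cdot> nelt A X n = felt A X (flatten V R X n)" for n h X
    by (cases n) (simp add: wnest_def)
  show "app (mu fcm A) a = a" if "a \<in> objs A" using that by (simp add: fc_def)
  have H: "happ (mu fcm A) e \<in> Hom V (homs (F (F A)) e) (homs (F A) e) \<and>
      (\<forall>X\<in>Ob V. \<forall>n\<in>nested_words V R A X e. happ (mu fcm A) e \<cdot> nelt A X n = felt A X (flatten V R X n))"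
    if e: "e \<in> objs A \<times> objs A" for e
  proof -
    have "happ (mu fcm A) e = (THE h. h \<in> Hom V (homs (F (F A)) e) (homs (F A) e) \<and>
      (\<forall>X\<in>Ob V. \<forall>n\<in>nested_words V R A X e. h \<cdot> nelt A X n = felt A X (flatten V R X n)))"
      using e by (simp add: fc_def wn)
    then show ?thesis using theI'[OF h[OF e]] by simp
  qed
  show "mu fcm A \<in> gHom V (F (F A)) (F A)"
    using H by (auto simp: fc_def gHom_def)
  show "happ (mu fcm A) e \<cdot> nelt A X n = felt A X (flatten V R X n)"
    if "X \<in> Ob V" "n \<in> nested_words V R A X e"
  proof -
    have "e \<in> objs A \<times> objs A" using that(2) pathsD[of "fst n" A e] by (auto simp: nested_words_def)
    then show ?thesis using H that by blast
  qed
qed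

text \<open>On strings and letters both sides are the same concatenation; on operations they agree
  by the associativity of the operad.\<close>

lemma flatten_flatten:
  assumes A: "vg A" and X: "X \<in> Ob V" and as: "as \<in> paths A e" and p: "arr V p X (ar R (length as - 1))"
    and ms: "list_all2 (\<lambda>d m. m \<in> nested_words V R A X d) (steps as) ms"
  shows "flatten V R X (graft as (map fst ms),
      comp_elt V R X p (map (\<lambda>m. (length (fst m) - 1, fst (snd m))) ms), concat (map (snd \<circ> snd) ms)) =
    flatten V R X (as, p, map (flatten V R X) ms)"
proof -
  have m: "arr V (fst (snd m)) X (ar R (length (fst m) - 1)) \<and>
      length (snd (snd m)) = length (fst m) - 1 \<and> fits (fst m) (map fst (snd (snd m))) \<and>
      (\<forall>w\<in>set (snd (snd m)). arr V (fst (snd w)) X (ar R (length (fst w) - 1)))"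
    if m: "m \<in> set ms" for m
  proof -
    obtain d where d: "m \<in> nested_words V R A X d" using list_all2_ex2[OF ms m] by blast
    obtain bs q ws where m': "m = (bs, q, ws)" by (metis prod.collapse)
    note n = d[unfolded m' nested_words_iff[OF X]]
    then have ws: "list_all2 (\<lambda>d w. w \<in> words V R A X d) (steps bs) ws" by blast
    show ?thesis
      using n nested_arr[OF A X ws] fits_paths[OF _ nested_paths[OF ws]] pathsD[of bs A d]
      by (auto simp: m' dest: list_all2_lengthD)
  qed
  have len: "length ms = length as - 1" using ms by (auto dest: list_all2_lengthD)
  let ?qs = "map (\<lambda>m. (length (fst m) - 1, fst (snd m))) ms"
  let ?rs = "map (\<lambda>m. map (\<lambda>w. (length (fst w) - 1, fst (snd w))) (snd (snd m))) ms"
  have "comp_elt V R X (comp_elt V R X p ?qs) (concat ?rs) = comp_elt V R X p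
          (map2 (\<lambda>(k, q) qs. (sum_list (map fst qs), comp_elt V R X q qs)) ?qs ?rs)"
    using m p len by (intro comp_assoc) (auto simp: list_all2_map1 list_all2_map2 intro!: list.rel_refl_strong)
  \<comment> \<open>On one side the arities are read off from grafted strings, on the other they are
    sums of inner arities.\<close>
  moreover have "length (graft (fst m) (map fst (snd (snd m)))) - 1 =
      (\<Sum>w\<leftarrow>snd (snd m). length (fst w) - 1)" if "m \<in> set ms" for m
    using graft_props[of "fst m" "map fst (snd (snd m))"] m[OF that] by (simp add: comp_def)
  ultimately show ?thesis
    by (simp add: flatten_eq[of _ "fst m" "fst (snd m)" "snd (snd m)" for m, unfolded prod.collapse]
        flatten_eq map2_map_map comp_def graft_def map_concat concat_concat_map zip_map_map zip_same_conv_map case_prod_beta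
        cong: map_cong)
qed

end

text \<open>It suffices to consider coproducts indexed by strings: strings of strings will be encoded as
  strings by means of \<open>Tup\<close>.\<close>

definition pres :: "'a gcat \<Rightarrow> 'a elt obj set \<Rightarrow> ('a elt obj, 'a elt mor) monad \<Rightarrow> bool" where
  "pres V G S \<longleftrightarrow> (\<forall>(I :: 'a elt list set) A u B. cocone V G I A u B \<longrightarrow>
     cocone V G I (\<lambda>i. fob S (A i)) (\<lambda>i. fmap S (A i) B (u i)) (fob S B))"

lemma presD:
  fixes V :: "'a gcat" and I :: "'a elt list set"
  assumes "pres V G S" "cocone V G I A u B"
  shows "cocone V G I (\<lambda>i. fob S (A i)) (\<lambda>i. fmap S (A i) B (u i)) (fob S B)"
  using assms unfolding pres_def by blast

section \<open>Equality tests on probe elements\<close>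

context enriching
begin

lemma happ_comp:
  assumes "f \<in> gHom V A B" "g \<in> gHom V B D" "vg A" "vg B" "vg D" "a \<in> objs A" "b \<in> objs A"
    and "arr V x X (homs A (a, b))"
  shows "happ (gComp V g f) (a, b) \<cdot> x = happ g (app f a, app f b) \<cdot> happ f (a, b) \<cdot> x"
proof -
  have "app f a \<in> objs B" "app f b \<in> objs B" using gHom_ob[OF assms(1)] assms(6,7) by auto
  then show ?thesis
    using gHom_ob[OF assms(1)] assms(6,7)
      assoc[OF assms(8) happ_arr[OF assms(1,3,4,6,7)] happ_arr[OF assms(2,4,5)]] by simp
qed

lemma gext:
  assumes h: "h \<in> gHom V A B" and k: "k \<in> gHom V A B" and A: "vg A" and B: "vg B"
    and o: "\<And>a. a \<in> objs A \<Longrightarrow> app h a = app k a"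
    and eq: "\<And>a b X x. a \<in> objs A \<Longrightarrow> b \<in> objs A \<Longrightarrow> X \<in> G \<Longrightarrow> arr V x X (homs A (a, b)) \<Longrightarrow>
      happ h (a, b) \<cdot> x = happ k (a, b) \<cdot> x"
  shows "h = k"
proof (rule gmor_eqI[OF h k o])
  fix e assume "e \<in> objs A \<times> objs A"
  then obtain a b where e: "e = (a, b)" "a \<in> objs A" "b \<in> objs A" by blast
  show "happ h e = happ k e"
    unfolding e(1)
  proof (rule probe_ext[OF happ_arr[OF h A B e(2,3)]])
    show "arr V (happ k (a, b)) (homs A (a, b)) (homs B (app h a, app h b))"
      using happ_arr[OF k A B e(2,3)] o[OF e(2)] o[OF e(3)] by simp
  qed (rule eq[OF e(2,3)])
qed

end

context freecat
begin

lemma F_gext: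
  assumes "h \<in> gHom V (F A) B" "k \<in> gHom V (F A) B" "vg A" "vg B"
    and "\<And>a. a \<in> objs A \<Longrightarrow> app h a = app k a"
    and "\<And>a b X w. a \<in> objs A \<Longrightarrow> b \<in> objs A \<Longrightarrow> X \<in> G \<Longrightarrow> X \<in> Ob V \<Longrightarrow> w \<in> words V R A X (a, b) \<Longrightarrow>
      happ h (a, b) \<cdot> felt A X w = happ k (a, b) \<cdot> felt A X w"
  shows "h = k"
  using assms(1,2) F_vg[OF assms(3)] assms(4)
proof (rule gext)
  fix a b X x assume ab: "a \<in> objs (F A)" "b \<in> objs (F A)" and X: "X \<in> G"
    and x: "arr V x X (homs (F A) (a, b))"
  obtain w where "w \<in> words V R A X (a, b)" "x = felt A X w"
    using felt_surj[OF assms(3) X x] ab by auto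
  then show "happ h (a, b) \<cdot> x = happ k (a, b) \<cdot> x" using assms(6) ab X probeD by simp
qed (use assms(5) in simp)

lemma FF_gext:
  assumes "h \<in> gHom V (F (F A)) B" "k \<in> gHom V (F (F A)) B" "vg A" "vg B"
    and "\<And>a. a \<in> objs A \<Longrightarrow> app h a = app k a"
    and "\<And>a b X w. a \<in> objs A \<Longrightarrow> b \<in> objs A \<Longrightarrow> X \<in> G \<Longrightarrow> X \<in> Ob V \<Longrightarrow>
      w \<in> nested_words V R A X (a, b) \<Longrightarrow> happ h (a, b) \<cdot> nelt A X w = happ k (a, b) \<cdot> nelt A X w"
  shows "h = k"
proof (rule F_gext[OF assms(1,2) F_vg[OF assms(3)] assms(4)])
  fix a b X w assume ab: "a \<in> objs (F A)" "b \<in> objs (F A)" and X: "X \<in> G" "X \<in> Ob V"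
    and w: "w \<in> words V R (F A) X (a, b)"
  obtain n where "n \<in> nested_words V R A X (a, b)" "w = wnest A X n"
    using wnest_surj[OF assms(3) X(1) w] by blast
  then show "happ h (a, b) \<cdot> felt (F A) X w = happ k (a, b) \<cdot> felt (F A) X w"
    using assms(6) ab X by simp
qed (use assms(5) in simp)

lemma words_xs:
  assumes "vg A" "X \<in> Ob V" "(as, p, xs) \<in> words V R A X e" "i < length xs"
  shows "steps as ! i = (as ! i, as ! Suc i) \<and> as ! i \<in> objs A \<and> as ! Suc i \<in> objs A \<and>
    i < length (steps as) \<and> arr V (xs ! i) X (homs A (as ! i, as ! Suc i))"
proof -
  note d = assms(3)[unfolded words_iff[OF assms(1,2)]]
  have i: "i < length (steps as)" "arr V (xs ! i) X (homs A (steps as ! i))"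
    using d assms(4) by (auto simp: list_all2_conv_all_nth)
  have s: "steps as ! i = (as ! i, as ! Suc i)"
    using i(1) by (simp add: steps_def nth_tl)
  have "set as \<subseteq> objs A" using d pathsD by blast
  then have "as ! i \<in> objs A" "as ! Suc i \<in> objs A"
    using i(1) by (auto simp: subset_iff)
  then show ?thesis using i s by simp
qed

lemma map_word_wnest:
  assumes f: "f \<in> gHom V A B" and A: "vg A" and B: "vg B" and X: "X \<in> Ob V"
    and n: "n \<in> nested_words V R A X e"
  shows "map_word V (fmap fcm A B f) (wnest A X n) = wnest B X (map_nested V f n)"
proof -
  obtain as p ws where n': "n = (as, p, ws)" by (metis prod.collapse)
  have ws: "list_all2 (\<lambda>d w. w \<in> words V R A X d) (steps as) ws"
    using n n' nested_words_iff[OF X] by blast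
  have "map2 (\<lambda>d x. happ (fmap fcm A B f) d \<cdot> x) (steps as) (map (felt A X) ws) =
      map (felt B X) (map (map_word V f) ws)"
    using ws by (induction rule: list_all2_induct) (auto simp: fmap_fc(3)[OF f A B X])
  then show ?thesis
    by (simp add: n' wnest_def map_word_def map_nested_def fmap_fc(2)[OF f A B])
qed

section \<open>The monad laws, and preservation of coproducts\<close>

lemma fc_endofunctor: "endofunctor (gph V) fcm"
proof -
  have "fmap fcm A A (gId V A) = gId V (F A)" if A: "vg A" for A
  proof (rule F_gext[OF fmap_fc(1)[OF gId_hom[OF A] A A] gId_hom[OF F_vg[OF A]] A F_vg[OF A]])
    fix a b X w assume ab: "a \<in> objs A" "b \<in> objs A" and X: "X \<in> G" "X \<in> Ob V"
      and w: "w \<in> words V R A X (a, b)"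
    show "happ (fmap fcm A A (gId V A)) (a, b) \<cdot> felt A X w = happ (gId V (F A)) (a, b) \<cdot> felt A X w"
      using fmap_fc(3)[OF gId_hom[OF A] A A X(2) w] map_word_id[OF operadic_axioms A X(2) w] ab
        id_left[OF felt_arr[OF A X(2) w]] by simp
  qed (use fmap_fc(2)[OF gId_hom[OF A] A A] in simp)
  moreover have "fmap fcm A D (gComp V g f) = gComp V (fmap fcm B D g) (fmap fcm A B f)"
    if A: "vg A" and B: "vg B" and D: "vg D" and f: "f \<in> gHom V A B" and g: "g \<in> gHom V B D"
    for A B D f g
  proof -
    note gf = gComp_hom[OF f g A B D]
    note F' = fmap_fc(1)[OF f A B] fmap_fc(1)[OF g B D]
    show ?thesis
    proof (rule F_gext[OF fmap_fc(1)[OF gf A D] gComp_hom[OF F' F_vg[OF A] F_vg[OF B] F_vg[OF D]] A F_vg[OF D]])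
      fix a assume "a \<in> objs A"
      then show "app (fmap fcm A D (gComp V g f)) a = app (gComp V (fmap fcm B D g) (fmap fcm A B f)) a"
        using fmap_fc(2)[OF f A B] fmap_fc(2)[OF g B D] fmap_fc(2)[OF gf A D] gHom_ob[OF f]
          gHom_ob[OF F'(1)] by simp
    next
      fix a b X w assume ab: "a \<in> objs A" "b \<in> objs A" and X: "X \<in> G" "X \<in> Ob V"
        and w: "w \<in> words V R A X (a, b)"
      have mw: "map_word V f w \<in> words V R B X (app f a, app f b)"
        using map_word_words[OF A B X(2) f w] by simp
      show "happ (fmap fcm A D (gComp V g f)) (a, b) \<cdot> felt A X w =
          happ (gComp V (fmap fcm B D g) (fmap fcm A B f)) (a, b) \<cdot> felt A X w"
        using happ_comp[OF F' F_vg[OF A] F_vg[OF B] F_vg[OF D] _ _ felt_arr[OF A X(2) w]] ab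
          fmap_fc(2,3)[OF f A B] fmap_fc(3)[OF g B D X(2) mw] fmap_fc(3)[OF gf A D X(2) w] X w
          map_word_comp[OF operadic_axioms A B D X(2) f g w] by simp
    qed
  qed
  ultimately show ?thesis
    unfolding endofunctor_def using gOb_vg F_ob fmap_fc(1) by auto
qed

lemma fc_eta_natural: "natural (gph V) id_endo fcm (eta fcm)"
proof -
  have "gComp V (eta fcm B) f = gComp V (fmap fcm A B f) (eta fcm A)"
    if A: "vg A" and B: "vg B" and f: "f \<in> gHom V A B" for A B f
  proof (rule gext[OF _ _ A F_vg[OF B]])
    note eA = eta_fc[OF A] and eB = eta_fc[OF B] and ff = fmap_fc[OF f A B]
    show "gComp V (eta fcm B) f \<in> gHom V A (F B)"
      by (rule gComp_hom[OF f eB(1) A B F_vg[OF B]])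
    show "gComp V (fmap fcm A B f) (eta fcm A) \<in> gHom V A (F B)"
      by (rule gComp_hom[OF eA(1) ff(1) A F_vg[OF A] F_vg[OF B]])
    show "app (gComp V (eta fcm B) f) a = app (gComp V (fmap fcm A B f) (eta fcm A)) a"
      if "a \<in> objs A" for a
      using that gHom_ob[OF f] gHom_ob[OF eA(1)] eA(2) eB(2) ff(2) by simp
    fix a b X x assume ab: "a \<in> objs A" "b \<in> objs A" and X: "X \<in> G" and x: "arr V x X (homs A (a, b))"
    have fab: "app f a \<in> objs B" "app f b \<in> objs B" using gHom_ob[OF f] ab by auto
    have fx: "arr V (happ f (a, b) \<cdot> x) X (homs B (app f a, app f b))"
      by (rule comp_arr[OF x happ_arr[OF f A B ab]])
    have "happ (gComp V (eta fcm B) f) (a, b) \<cdot> x =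
        felt B X ([app f a, app f b], unit_elt V R X, [happ f (a, b) \<cdot> x])"
      using happ_comp[OF f eB(1) A B F_vg[OF B] ab x] eB(3)[OF fab fx] by simp
    also have "\<dots> = happ (gComp V (fmap fcm A B f) (eta fcm A)) (a, b) \<cdot> x"
      using happ_comp[OF eA(1) ff(1) A F_vg[OF A] F_vg[OF B] ab x] eA(2) eA(3)[OF ab x] ab
        ff(3)[OF probeD[OF X] eta_word[OF A ab x]]
      by (simp add: map_word_def)
    finally show "happ (gComp V (eta fcm B) f) (a, b) \<cdot> x =
        happ (gComp V (fmap fcm A B f) (eta fcm A)) (a, b) \<cdot> x" .
  qed
  then show ?thesis
    unfolding natural_def id_endo_def using gOb_vg F_ob eta_fc(1) by auto
qed

lemma fc_mu_natural: "natural (gph V) (comp_endo fcm fcm) fcm (mu fcm)"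
proof -
  have "gComp V (mu fcm B) (fmap fcm (F A) (F B) (fmap fcm A B f)) = gComp V (fmap fcm A B f) (mu fcm A)"
    if A: "vg A" and B: "vg B" and f: "f \<in> gHom V A B" for A B f
  proof (rule FF_gext[OF _ _ A F_vg[OF B]])
    note mA = mu_fc[OF A] and mB = mu_fc[OF B] and ff = fmap_fc[OF f A B]
    note fff = fmap_fc[OF ff(1) F_vg[OF A] F_vg[OF B]]
    note vA = F_vg[OF A] F_vg[OF F_vg[OF A]] and vB = F_vg[OF B] F_vg[OF F_vg[OF B]]
    show "gComp V (mu fcm B) (fmap fcm (F A) (F B) (fmap fcm A B f)) \<in> gHom V (F (F A)) (F B)"
      by (rule gComp_hom[OF fff(1) mB(1) vA(2) vB(2) vB(1)])
    show "gComp V (fmap fcm A B f) (mu fcm A) \<in> gHom V (F (F A)) (F B)"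
      by (rule gComp_hom[OF mA(1) ff(1) vA(2) vA(1) vB(1)])
    show "app (gComp V (mu fcm B) (fmap fcm (F A) (F B) (fmap fcm A B f))) a =
        app (gComp V (fmap fcm A B f) (mu fcm A)) a" if "a \<in> objs A" for a
      using that gHom_ob[OF fff(1)] gHom_ob[OF mA(1)] gHom_ob[OF f] mA(2) mB(2) ff(2) fff(2) by simp
    fix a b X n assume ab: "a \<in> objs A" "b \<in> objs A" and X: "X \<in> G" "X \<in> Ob V"
      and n: "n \<in> nested_words V R A X (a, b)"
    note ne = nelt_arr[OF A X(2) n]
    have mn: "map_nested V f n \<in> nested_words V R B X (app f a, app f b)"
      using map_nested_words[OF A B X(2) f n] by simp
    have fl: "flatten V R X n \<in> words V R A X (a, b)"
      using flatten_words[OF A X(2)] n by (cases n) auto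
    have "happ (gComp V (mu fcm B) (fmap fcm (F A) (F B) (fmap fcm A B f))) (a, b) \<cdot> nelt A X n =
        happ (mu fcm B) (app f a, app f b) \<cdot> nelt B X (map_nested V f n)"
      using happ_comp[OF fff(1) mB(1) vA(2) vB(2) vB(1) _ _ ne] ab fff(2) ff(2)
        fff(3)[OF X(2) wnest_words[OF A X(2) n]] map_word_wnest[OF f A B X(2) n] by simp
    also have "\<dots> = felt B X (map_word V f (flatten V R X n))"
      using mB(3)[OF X(2) mn] flatten_map[OF A X(2) n] by simp
    also have "\<dots> = happ (gComp V (fmap fcm A B f) (mu fcm A)) (a, b) \<cdot> nelt A X n"
      using happ_comp[OF mA(1) ff(1) vA(2) vA(1) vB(1) _ _ ne] ab mA(2) mA(3)[OF X(2) n]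
        ff(3)[OF X(2) fl] by simp
    finally show "happ (gComp V (mu fcm B) (fmap fcm (F A) (F B) (fmap fcm A B f))) (a, b) \<cdot> nelt A X n =
        happ (gComp V (fmap fcm A B f) (mu fcm A)) (a, b) \<cdot> nelt A X n" .
  qed
  then show ?thesis
    unfolding natural_def comp_endo_def using gOb_vg F_ob F_vg mu_fc(1) by auto
qed

text \<open>The unit turns \<open>w\<close> into a nested word whose only block is \<open>w\<close>;
  flattening returns \<open>w\<close> by the left unit law of the operad.\<close>

lemma fc_unit_left:
  assumes A: "vg A"
  shows "gComp V (mu fcm A) (eta fcm (F A)) = gId V (F A)"
proof (rule F_gext[OF _ gId_hom[OF F_vg[OF A]] A F_vg[OF A]])
  note e = eta_fc[OF F_vg[OF A]] and m = mu_fc[OF A] and v = F_vg[OF A] F_vg[OF F_vg[OF A]]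
  show "gComp V (mu fcm A) (eta fcm (F A)) \<in> gHom V (F A) (F A)"
    by (rule gComp_hom[OF e(1) m(1) v(1,2,1)])
  show "app (gComp V (mu fcm A) (eta fcm (F A))) a = app (gId V (F A)) a" if "a \<in> objs A" for a
    using that gHom_ob[OF e(1)] e(2) m(2) by simp
  fix a b X w assume ab: "a \<in> objs A" "b \<in> objs A" and X: "X \<in> G" "X \<in> Ob V"
    and w: "w \<in> words V R A X (a, b)"
  obtain as p xs where w': "w = (as, p, xs)" by (metis prod.collapse)
  note d = w[unfolded w' words_iff[OF A X(2)]]
  have n: "([a, b], unit_elt V R X, [w]) \<in> nested_words V R A X (a, b)"
    unfolding nested_words_iff[OF X(2)] using ab w unit_elt_arr[OF X(2)] by (auto intro!: pathsI)
  have "graft [a, b] [as] = as" using d pathsD[of as A "(a, b)"] by (cases as) (auto simp: graft_def)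
  then have fl: "flatten V R X ([a, b], unit_elt V R X, [w]) = w"
    using comp_unit_left[of p X "length as - 1"] d by (simp add: w' flatten_eq)
  have "happ (gComp V (mu fcm A) (eta fcm (F A))) (a, b) \<cdot> felt A X w =
      happ (mu fcm A) (a, b) \<cdot> nelt A X ([a, b], unit_elt V R X, [w])"
    using happ_comp[OF e(1) m(1) v(1,2,1) _ _ felt_arr[OF A X(2) w]] ab e(2)
      e(3)[OF _ _ felt_arr[OF A X(2) w]] by (simp add: wnest_def)
  also have "\<dots> = felt A X w" using m(3)[OF X(2) n] fl by simp
  also have "\<dots> = happ (gId V (F A)) (a, b) \<cdot> felt A X w"
    using id_left[OF felt_arr[OF A X(2) w]] ab by simp
  finally show "happ (gComp V (mu fcm A) (eta fcm (F A))) (a, b) \<cdot> felt A X w =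
      happ (gId V (F A)) (a, b) \<cdot> felt A X w" .
qed

lemma graft_steps: "as \<noteq> [] \<Longrightarrow> graft as (map (\<lambda>d. [fst d, snd d]) (steps as)) = as"
  by (induction as rule: induct_list012) (auto simp: graft_def)

text \<open>Every letter becomes a block of its own carrying the operadic unit. Grafting these
  two-object strings restores the string (\<open>graft_steps\<close>), and the right unit law
  restores the operation.\<close>

lemma fc_unit_right:
  assumes A: "vg A"
  shows "gComp V (mu fcm A) (fmap fcm A (F A) (eta fcm A)) = gId V (F A)"
proof (rule F_gext[OF _ gId_hom[OF F_vg[OF A]] A F_vg[OF A]])
  note v = F_vg[OF A] F_vg[OF F_vg[OF A]]
  note e = eta_fc[OF A] and m = mu_fc[OF A]
  note f = fmap_fc[OF e(1) A v(1)]
  show "gComp V (mu fcm A) (fmap fcm A (F A) (eta fcm A)) \<in> gHom V (F A) (F A)"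
    by (rule gComp_hom[OF f(1) m(1) v(1,2,1)])
  show "app (gComp V (mu fcm A) (fmap fcm A (F A) (eta fcm A))) a = app (gId V (F A)) a"
    if "a \<in> objs A" for a
    using that gHom_ob[OF f(1)] e(2) m(2) f(2) by simp
  fix a b X w assume ab: "a \<in> objs A" "b \<in> objs A" and X: "X \<in> G" "X \<in> Ob V"
    and w: "w \<in> words V R A X (a, b)"
  obtain as p xs where w': "w = (as, p, xs)" by (metis prod.collapse)
  note d = w[unfolded w' words_iff[OF A X(2)]]
  note as = pathsD[of as A "(a, b)", OF d[THEN conjunct1]]
  let ?ws = "map2 (\<lambda>d x. ([fst d, snd d], unit_elt V R X, [x])) (steps as) xs"
  have xs: "length xs = length as - 1" using d by (auto dest: list_all2_lengthD)
  have l2: "list_all2 (\<lambda>d w. w \<in> words V R A X d) (steps as) ?ws"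
    unfolding list_all2_conv_all_nth
    using words_xs[OF A X(2) w[unfolded w']] eta_word[OF A] xs by auto
  then have n: "(as, p, ?ws) \<in> nested_words V R A X (a, b)"
    using d nested_words_iff[OF X(2)] by blast
  have mw: "map_word V (eta fcm A) w = wnest A X (as, p, ?ws)"
  proof -
    have "map2 (\<lambda>d x. happ (eta fcm A) d \<cdot> x) (steps as) xs = map (felt A X) ?ws"
      by (rule nth_equalityI) (use words_xs[OF A X(2) w[unfolded w']] e(3) xs in auto)
    moreover have "map (app (eta fcm A)) as = as" using as e(2) by (intro map_idI) auto
    ultimately show ?thesis by (simp add: w' wnest_def map_word_def)
  qed
  have "map fst ?ws = map (\<lambda>d. [fst d, snd d]) (steps as)"
    using xs by (intro nth_equalityI) auto
  moreover have "map (\<lambda>w. (length (fst w) - 1, fst (snd w))) ?ws = replicate (length as - 1) (1, unit_elt V R X)"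
    using xs by (intro nth_equalityI) auto
  moreover have "concat (map (snd \<circ> snd) ?ws) = xs"
  proof -
    have "concat (map (snd \<circ> snd) (map2 (\<lambda>d x. ([fst d, snd d], unit_elt V R X, [x])) ds xs)) = xs"
      if "length ds = length xs" for ds :: "('a elt \<times> 'a elt) list"
      using that by (induction ds xs rule: list_induct2) auto
    then show ?thesis using xs by simp
  qed
  ultimately have fl: "flatten V R X (as, p, ?ws) = w"
    using graft_steps[of as] as comp_unit_right[of p X "length as - 1"] d by (simp add: flatten_eq w')
  have "happ (gComp V (mu fcm A) (fmap fcm A (F A) (eta fcm A))) (a, b) \<cdot> felt A X w =
      happ (mu fcm A) (a, b) \<cdot> nelt A X (as, p, ?ws)"
    using happ_comp[OF f(1) m(1) v(1,2,1) _ _ felt_arr[OF A X(2) w]] ab e(2) f(2)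
      f(3)[OF X(2) w] mw by simp
  also have "\<dots> = felt A X w" using m(3)[OF X(2) n] fl by simp
  also have "\<dots> = happ (gId V (F A)) (a, b) \<cdot> felt A X w"
    using id_left[OF felt_arr[OF A X(2) w]] ab by simp
  finally show "happ (gComp V (mu fcm A) (fmap fcm A (F A) (eta fcm A))) (a, b) \<cdot> felt A X w =
      happ (gId V (F A)) (a, b) \<cdot> felt A X w" .
qed

text \<open>At a probe, an element of \<open>F (F (F A))\<close> is an operation applied to a list
  \<open>ms\<close> of nested words. One side merges the two outer layers first, giving
  \<open>?n1\<close>, the other the two inner layers; \<open>flatten_flatten\<close> compares the
  results.\<close>

lemma fc_mu_assoc:
  assumes A: "vg A"
  shows "gComp V (mu fcm A) (mu fcm (F A)) = gComp V (mu fcm A) (fmap fcm (F (F A)) (F A) (mu fcm A))"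
proof (rule FF_gext[OF _ _ F_vg[OF A] F_vg[OF A]])
  note v = F_vg[OF A] F_vg[OF F_vg[OF A]] F_vg[OF F_vg[OF F_vg[OF A]]]
  note m = mu_fc[OF A] and m' = mu_fc[OF v(1)]
  note f = fmap_fc[OF m(1) v(2,1)]
  show "gComp V (mu fcm A) (mu fcm (F A)) \<in> gHom V (F (F (F A))) (F A)"
    by (rule gComp_hom[OF m'(1) m(1) v(3,2,1)])
  show "gComp V (mu fcm A) (fmap fcm (F (F A)) (F A) (mu fcm A)) \<in> gHom V (F (F (F A))) (F A)"
    by (rule gComp_hom[OF f(1) m(1) v(3,2,1)])
  show "app (gComp V (mu fcm A) (mu fcm (F A))) a =
      app (gComp V (mu fcm A) (fmap fcm (F (F A)) (F A) (mu fcm A))) a" if "a \<in> objs (F A)" for a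
    using that gHom_ob[OF m'(1)] gHom_ob[OF f(1)] m(2) m'(2) f(2) by simp
  fix a b X n assume ab: "a \<in> objs (F A)" "b \<in> objs (F A)" and X: "X \<in> G" "X \<in> Ob V"
    and n: "n \<in> nested_words V R (F A) X (a, b)"
  obtain as p ws where n': "n = (as, p, ws)" by (metis prod.collapse)
  note d = n[unfolded n' nested_words_iff[OF X(2)]]
  \<comment> \<open>The letters of the blocks are elements of \<open>F A\<close> at the probe
    \<open>X\<close>, so \<open>wnest_surj\<close> decodes each block.\<close>
  have "\<exists>ms. list_all2 (\<lambda>d m. m \<in> nested_words V R A X d) (steps as) ms \<and> ws = map (wnest A X) ms"
  proof -
    have "list_all2 (\<lambda>d w. w \<in> words V R (F A) X d) (steps as) ws" using d by blast
    then show ?thesis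
    proof (induction rule: list_all2_induct)
      case (Cons d ds w ws)
      then obtain ms m where "list_all2 (\<lambda>d m. m \<in> nested_words V R A X d) ds ms" "ws = map (wnest A X) ms"
        "m \<in> nested_words V R A X d" "w = wnest A X m" using wnest_surj[OF A X(1)] by blast
      then show ?case by (intro exI[of _ "m # ms"]) simp
    qed simp
  qed
  then obtain ms where ms: "list_all2 (\<lambda>d m. m \<in> nested_words V R A X d) (steps as) ms"
    and ws: "ws = map (wnest A X) ms" by blast
  have as: "as \<in> paths A (a, b)" and p: "arr V p X (ar R (length as - 1))" using d by auto
  have mflat: "list_all2 (\<lambda>d w. w \<in> words V R A X d) (steps as) (map (flatten V R X) ms)"
    using ms flatten_words[OF A X(2)] by (auto simp: list_all2_map2 elim!: list_all2_mono)
  then have n2: "(as, p, map (flatten V R X) ms) \<in> nested_words V R A X (a, b)"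
    using as p nested_words_iff[OF X(2)] by blast
  let ?n1 = "(graft as (map fst ms), comp_elt V R X p (map (\<lambda>m. (length (fst m) - 1, fst (snd m))) ms),
    concat (map (snd \<circ> snd) ms))"
  have w1: "flatten V R X n = wnest A X ?n1"
    unfolding n' ws flatten_eq by (simp add: wnest_def comp_def map_concat case_prod_beta)
  \<comment> \<open>The outer string and operation are typed by comparison with a nested word
    \<open>k\<close> having the same image; the inner words are checked block by block.\<close>
  have n1: "?n1 \<in> nested_words V R A X (a, b)"
  proof -
    have "flatten V R X n \<in> words V R (F A) X (a, b)"
      using flatten_words[OF v(1) X(2)] n n' by auto
    then obtain k where k: "k \<in> nested_words V R A X (a, b)" "wnest A X ?n1 = wnest A X k"
      using wnest_surj[OF A X(1)] w1 by metis
    have "list_all2 (\<lambda>d w. w \<in> words V R A X d) (concat (map (steps \<circ> fst) ms)) (concat (map (snd \<circ> snd) ms))"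
      using ms
    proof (induction rule: list_all2_induct)
      case (Cons d ds m ms)
      then show ?case using nested_words_iff[OF X(2)] by (cases m) (auto intro!: list_all2_appendI)
    qed simp
    moreover have "fits as (map fst ms)"
    proof (rule fits_paths)
      show "as \<noteq> []" using pathsD[OF as] by blast
      show "list_all2 (\<lambda>d bs. bs \<in> paths A d) (steps as) (map fst ms)"
        using ms by (auto simp: list_all2_map2 nested_words_def elim!: list_all2_mono)
    qed
    ultimately show ?thesis
      using k graft_props[of as "map fst ms"] unfolding nested_words_def wnest_def by auto
  qed
  have mw: "map_word V (mu fcm A) (wnest (F A) X n) = wnest A X (as, p, map (flatten V R X) ms)"
  proof -
    have "map2 (\<lambda>d x. happ (mu fcm A) d \<cdot> x) (steps as) (map (felt (F A) X) (map (wnest A X) ms)) =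
        map (felt A X) (map (flatten V R X) ms)"
      using ms by (induction rule: list_all2_induct) (auto simp: m(3)[OF X(2)])
    moreover have "map (app (mu fcm A)) as = as" using pathsD[OF as] m(2) by (intro map_idI) auto
    ultimately show ?thesis by (simp add: n' ws wnest_def map_word_def)
  qed
  note ne = nelt_arr[OF v(1) X(2) n]
  have "happ (gComp V (mu fcm A) (mu fcm (F A))) (a, b) \<cdot> nelt (F A) X n =
      happ (mu fcm A) (a, b) \<cdot> nelt A X ?n1"
    using happ_comp[OF m'(1) m(1) v(3,2,1) _ _ ne] ab m'(2) m'(3)[OF X(2) n] w1 by simp
  also have "\<dots> = felt A X (flatten V R X ?n1)" by (rule m(3)[OF X(2) n1])
  also have "\<dots> = felt A X (flatten V R X (as, p, map (flatten V R X) ms))"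
    using flatten_flatten[OF A X(2) as p ms] by simp
  also have "\<dots> = happ (mu fcm A) (a, b) \<cdot> nelt A X (as, p, map (flatten V R X) ms)"
    by (rule m(3)[OF X(2) n2, symmetric])
  also have "\<dots> = happ (gComp V (mu fcm A) (fmap fcm (F (F A)) (F A) (mu fcm A))) (a, b) \<cdot> nelt (F A) X n"
    using happ_comp[OF f(1) m(1) v(3,2,1) _ _ ne] ab f(2) m(2)
      f(3)[OF X(2) wnest_words[OF v(1) X(2) n]] mw by simp
  finally show "happ (gComp V (mu fcm A) (mu fcm (F A))) (a, b) \<cdot> nelt (F A) X n =
      happ (gComp V (mu fcm A) (fmap fcm (F (F A)) (F A) (mu fcm A))) (a, b) \<cdot> nelt (F A) X n" .
qed

lemma fc_monad: "is_monad (gph V) fcm"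
  unfolding is_monad_def
  using fc_endofunctor fc_eta_natural fc_mu_natural fc_unit_left fc_unit_right fc_mu_assoc gOb_vg
  by auto

text \<open>Neighbouring objects of a word at a probe are joined by an element of a hom, and homs
  between different summands have none. So a word of \<open>B\<close> stays in the summand of its
  first object and lifts uniquely to that \<open>A i\<close>.\<close>

lemma fc_pres: "pres (gph V) gprobes fcm"
  unfolding pres_def
proof (intro allI impI)
  fix I :: "'a elt list set" and A u B
  assume cc: "cocone (gph V) gprobes I A u B"
  have B: "B \<in> Ob (gph V)" and u: "\<And>i. i \<in> I \<Longrightarrow> arr (gph V) (u i) (A i) B"
    and c: "gcocone_cond I A u B" using cc unfolding gcocone_iff by auto
  have uh: "u i \<in> gHom V (A i) B" "vg (A i)" "A i \<in> Ob (gph V)" if "i \<in> I" for i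
    using u[OF that] by (auto simp: garr_iff gOb_vg)
  note vB = gOb_vg[OF B] and c' = c[unfolded gcocone_cond_def]
  have surj: "\<exists>i\<in>I. \<exists>a\<in>objs (A i). b = app (u i) a" if "b \<in> objs B" for b
    using c'[THEN conjunct1] that by blast
  have inj: "i = j \<and> a = b"
    if "i \<in> I" "j \<in> I" "a \<in> objs (A i)" "b \<in> objs (A j)" "app (u i) a = app (u j) b" for i j a b
    using c'[THEN conjunct2, THEN conjunct1] that by blast
  have hc: "cocone V G {[] :: 'a elt list} (\<lambda>_. homs (A i) (a, b))
       (\<lambda>_. happ (u i) (a, b)) (homs B (app (u i) a, app (u i) b))"
    if "i \<in> I" "a \<in> objs (A i)" "b \<in> objs (A i)" for i a b
    using c'[THEN conjunct2, THEN conjunct2, THEN conjunct1] that by blast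
  have ne: "i = j"
    if "i \<in> I" "j \<in> I" "a \<in> objs (A i)" "b \<in> objs (A j)" "X \<in> G"
      "arr V x X (homs B (app (u i) a, app (u j) b))" for i j a b X x
    using c'[THEN conjunct2, THEN conjunct2, THEN conjunct2] that by blast
  \<comment> \<open>The summand of the first object propagates along the string, one step at a
    time.\<close>
  have lift: "\<exists>as xs. as \<noteq> [] \<and> set as \<subseteq> objs (A i) \<and> hd as = a \<and> bs = map (app (u i)) as \<and>
      list_all2 (\<lambda>d x. arr V x X (homs (A i) d)) (steps as) xs \<and>
      ys = map2 (\<lambda>d x. happ (u i) d \<cdot> x) (steps as) xs"
    if i: "i \<in> I" and X: "X \<in> G" and "bs \<noteq> []" "set bs \<subseteq> objs B" "hd bs = app (u i) a" "a \<in> objs (A i)"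
      "list_all2 (\<lambda>d y. arr V y X (homs B d)) (steps bs) ys" for i X a bs ys
    using that(3-)
  proof (induction bs arbitrary: a ys rule: induct_list012)
    case (2 c)
    then show ?case by (intro exI[of _ "[a]"] exI[of _ "[]"]) auto
  next
    case (3 c c' bs)
    then obtain y ys' where ys: "ys = y # ys'" "arr V y X (homs B (c, c'))"
      "list_all2 (\<lambda>d y. arr V y X (homs B d)) (steps (c' # bs)) ys'" by (auto simp: list_all2_Cons1)
    obtain j a' where a': "j \<in> I" "a' \<in> objs (A j)" "c' = app (u j) a'" using surj 3 by force
    have "i = j" using ne[OF i a'(1) 3(6) a'(2) X] 3(5) ys(2) a'(3) by auto
    with a' have a': "a' \<in> objs (A i)" "c' = app (u i) a'" by auto
    obtain x where x: "arr V x X (homs (A i) (a, a'))" "y = happ (u i) (a, a') \<cdot> x"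
      using cocone_ex[OF hc[OF i 3(6) a'(1)] X] ys(2) 3(5) a'(2) by auto
    have p: "c' # bs \<noteq> []" "set (c' # bs) \<subseteq> objs B" "hd (c' # bs) = app (u i) a'"
      using 3(4) a' by auto
    obtain as xs where as: "as \<noteq> []" "set as \<subseteq> objs (A i)" "hd as = a'" "c' # bs = map (app (u i)) as"
      "list_all2 (\<lambda>d x. arr V x X (homs (A i) d)) (steps as) xs"
      "ys' = map2 (\<lambda>d x. happ (u i) d \<cdot> x) (steps as) xs"
      using 3(2)[OF p a'(1) ys(3)] by (elim exE conjE, elim that)
    have st: "steps (a # as) = (a, a') # steps as" using as(1,3) by (cases as) auto
    have c: "c = app (u i) a" using 3(5) by simp
    show ?case
      by (rule exI[of _ "a # as"], rule exI[of _ "x # xs"], unfold st)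
        (use as(2,4,5,6) ys(1) x c 3(6) in simp)
  qed auto
  \<comment> \<open>The starting object is prescribed in the summand, while the final object
    \<open>b'\<close> results from the lifting.\<close>
  have lw: "\<exists>w b'. w \<in> words V R (A i) X (a, b') \<and> v = map_word V (u i) w \<and> b' \<in> objs (A i) \<and> b = app (u i) b'"
    if i: "i \<in> I" and a: "a \<in> objs (A i)" and X: "X \<in> G" and v: "v \<in> words V R B X (app (u i) a, b)"
    for i X a b v
  proof -
    obtain bs p ys where v': "v = (bs, p, ys)" by (metis prod.collapse)
    note d = v[unfolded v' words_iff[OF vB probeD[OF X]]]
    note bs = pathsD[OF d[THEN conjunct1]]
    obtain as xs where as: "as \<noteq> []" "set as \<subseteq> objs (A i)" "hd as = a" "bs = map (app (u i)) as"
      "list_all2 (\<lambda>d x. arr V x X (homs (A i) d)) (steps as) xs"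
      "ys = map2 (\<lambda>d x. happ (u i) d \<cdot> x) (steps as) xs"
      using lift[OF i X, of bs a ys] d bs a by auto
    have "as \<in> paths (A i) (a, last as)" using as by (intro pathsI) auto
    then have "(as, p, xs) \<in> words V R (A i) X (a, last as)"
      using d as words_iff[OF uh(2)[OF i] probeD[OF X]] by auto
    then show ?thesis
      using as bs last_in_set[OF as(1)]
      by (intro exI[of _ "(as, p, xs)"] exI[of _ "last as"]) (auto simp: v' map_word_def last_map)
  qed
  \<comment> \<open>Strings are recovered because objects embed injectively, letters because the
    cocones on homs inside a summand are injective on probe elements.\<close>
  have mi: "w = w'"
    if i: "i \<in> I" and X: "X \<in> G" and w: "w \<in> words V R (A i) X e" "w' \<in> words V R (A i) X e"
      and eq: "map_word V (u i) w = map_word V (u i) w'" for i X e w w'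
  proof -
    note X' = probeD[OF X]
    obtain as p xs as' p' xs' where w': "w = (as, p, xs)" "w' = (as', p', xs')" by (metis prod.collapse)
    note d = w(1)[unfolded w' words_iff[OF uh(2)[OF i] X']] w(2)[unfolded w' words_iff[OF uh(2)[OF i] X']]
    have s: "set as \<subseteq> objs (A i)" "set as' \<subseteq> objs (A i)" using d pathsD by blast+
    have "inj_on (app (u i)) (set as \<union> set as')"
      using inj[OF i i] s by (meson Un_least inj_onI subset_iff)
    then have as: "as = as'"
      using eq map_inj_on[of "app (u i)" as as'] by (auto simp: w' map_word_def)
    have "xs = xs'"
    proof (rule nth_equalityI)
      show l: "length xs = length xs'" using d as by (auto dest!: list_all2_lengthD)
      fix k assume k: "k < length xs"
      note x = words_xs[OF uh(2)[OF i] X' w(1)[unfolded w'] k]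
        words_xs[OF uh(2)[OF i] X' w(2)[unfolded w'], of k]
      have "map2 (\<lambda>d x. happ (u i) d \<cdot> x) (steps as) xs ! k = map2 (\<lambda>d x. happ (u i) d \<cdot> x) (steps as) xs' ! k"
        using eq as by (simp add: w' map_word_def)
      then have "happ (u i) (as ! k, as ! Suc k) \<cdot> xs ! k = happ (u i) (as ! k, as ! Suc k) \<cdot> xs' ! k"
        using k l x by simp
      then show "xs ! k = xs' ! k"
        using cocone_inj'[OF hc[OF i, of "as ! k" "as ! Suc k"] X, of "[]" "xs ! k" "[]" "xs' ! k"] x k l as
        by auto
    qed
    then show ?thesis using as eq by (simp add: w' map_word_def)
  qed
  show "cocone (gph V) gprobes I (\<lambda>i. fob fcm (A i)) (\<lambda>i. fmap fcm (A i) B (u i)) (fob fcm B)"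
    unfolding gcocone_iff fob_fc
  proof (intro conjI ballI)
    show "F B \<in> Ob (gph V)" by (rule F_ob[OF vB])
    show "arr (gph V) (fmap fcm (A i) B (u i)) (F (A i)) (F B)" if i: "i \<in> I" for i
      using fmap_fc(1)[OF uh(1,2)[OF i] vB] F_ob uh(2)[OF i] vB by (simp add: garr_iff)
    have ap: "app (fmap fcm (A i) B (u i)) = app (u i)" if "i \<in> I" for i
      by (rule fmap_fc(2)[OF uh(1,2)[OF that] vB])
    note fu = fmap_fc(3)[OF uh(1,2) vB]
    show "gcocone_cond I (\<lambda>i. F (A i)) (\<lambda>i. fmap fcm (A i) B (u i)) (F B)"
      unfolding gcocone_cond_def
    proof (intro conjI ballI allI impI)
      fix b assume "b \<in> objs (F B)"
      then show "\<exists>i\<in>I. \<exists>a\<in>objs (F (A i)). b = app (fmap fcm (A i) B (u i)) a" using surj ap by auto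
    next
      fix i j a b assume "i \<in> I" "j \<in> I" "a \<in> objs (F (A i))" "b \<in> objs (F (A j))"
        "app (fmap fcm (A i) B (u i)) a = app (fmap fcm (A j) B (u j)) b"
      then show "i = j" "a = b" using inj[of i j a b] ap by auto
    next
      fix i a b assume i: "i \<in> I" and ab': "a \<in> objs (F (A i))" "b \<in> objs (F (A i))"
      then have ab: "a \<in> objs (A i)" "b \<in> objs (A i)" by auto
      note o = gHom_ob(2)[OF uh(1)[OF i]]
      show "cocone V G {[] :: 'a elt list} (\<lambda>_. homs (F (A i)) (a, b))
         (\<lambda>_. happ (fmap fcm (A i) B (u i)) (a, b))
         (homs (F B) (app (fmap fcm (A i) B (u i)) a, app (fmap fcm (A i) B (u i)) b))"
        unfolding ap[OF i]
      proof (rule coconeI)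
        show "homs (F B) (app (u i) a, app (u i) b) \<in> Ob V"
          by (rule vgraphD[OF F_vg[OF vB]]) (use o ab in auto)
        show "arr V (happ (fmap fcm (A i) B (u i)) (a, b)) (homs (F (A i)) (a, b))
            (homs (F B) (app (u i) a, app (u i) b))"
          using happ_arr[OF fmap_fc(1)[OF uh(1,2)[OF i] vB] F_vg[OF uh(2)[OF i]] F_vg[OF vB] ab']
          by (simp add: ap[OF i])
        fix X x assume X: "X \<in> G" and x: "arr V x X (homs (F B) (app (u i) a, app (u i) b))"
        obtain v where v: "v \<in> words V R B X (app (u i) a, app (u i) b)" "x = felt B X v"
          using felt_surj[OF vB X x] o ab by auto
        obtain w b' where w: "w \<in> words V R (A i) X (a, b')" "v = map_word V (u i) w" "b' \<in> objs (A i)"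
          "app (u i) b = app (u i) b'"
          using lw[OF i ab(1) X v(1)] by blast
        have b': "b' = b" using inj[OF i i ab(2) w(3,4)] by simp
        show "\<exists>k y. k \<in> {[]} \<and> arr V y X (homs (F (A i)) (a, b)) \<and>
            x = happ (fmap fcm (A i) B (u i)) (a, b) \<cdot> y"
          using felt_arr[OF uh(2)[OF i] probeD[OF X] w(1)] fu[OF i i probeD[OF X] w(1)] v(2) w(2)
          unfolding b' by auto
      next
        fix X y z and k l :: "'a elt list"
        assume X: "X \<in> G" and y: "arr V y X (homs (F (A i)) (a, b))" and z: "arr V z X (homs (F (A i)) (a, b))"
          and eq: "happ (fmap fcm (A i) B (u i)) (a, b) \<cdot> y = happ (fmap fcm (A i) B (u i)) (a, b) \<cdot> z"
          and kl: "k \<in> {[]}" "l \<in> {[]}"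
        obtain w w' where w: "w \<in> words V R (A i) X (a, b)" "y = felt (A i) X w"
          "w' \<in> words V R (A i) X (a, b)" "z = felt (A i) X w'"
          using felt_surj[OF uh(2)[OF i] X] y z ab by (metis mem_Sigma_iff)
        have "felt B X (map_word V (u i) w) = felt B X (map_word V (u i) w')"
          using eq w fu[OF i i probeD[OF X]] by simp
        then have "map_word V (u i) w = map_word V (u i) w'"
          using felt_inj[OF vB X] map_word_words[OF uh(2)[OF i] vB probeD[OF X] uh(1)[OF i]] w by blast
        then show "k = l \<and> y = z" using mi[OF i X w(1,3)] w kl by simp
      qed
    next
      fix i j a b X x
      assume ij: "i \<in> I" "j \<in> I" "i \<noteq> j" and ab: "a \<in> objs (F (A i))" "b \<in> objs (F (A j))" and X: "X \<in> G"
      show "\<not> arr V x X (homs (F B) (app (fmap fcm (A i) B (u i)) a, app (fmap fcm (A j) B (u j)) b))"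
      proof
        assume x: "arr V x X (homs (F B) (app (fmap fcm (A i) B (u i)) a, app (fmap fcm (A j) B (u j)) b))"
        have "app (u i) a \<in> objs B" "app (u j) b \<in> objs B"
          using gHom_ob(2)[OF uh(1)] ij ab by auto
        then obtain v where "v \<in> words V R B X (app (u i) a, app (u j) b)"
          using felt_surj[OF vB X x] ap ij by auto
        then obtain b' where "b' \<in> objs (A i)" "app (u j) b = app (u i) b'"
          using lw[OF ij(1) _ X] ab by (metis objs_F)
        then show False using inj[OF ij(2,1)] ab ij by auto
      qed
    qed
  qed
qed

end

section \<open>Applying monads homwise\<close>

locale monad_on = prodcat V for V :: "('o, 'm, 'z) fpcat_scheme" +
  fixes S :: "('o, 'm) monad"
  assumes mon: "is_monad V S"
begin

lemma S_ob: "A \<in> Ob V \<Longrightarrow> fob S A \<in> Ob V"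
  using mon by (auto simp: is_monad_def endofunctor_def)

lemma S_arr: "arr V f A B \<Longrightarrow> arr V (fmap S A B f) (fob S A) (fob S B)"
  using mon by (auto simp: is_monad_def endofunctor_def arr_def)

lemma S_id: "A \<in> Ob V \<Longrightarrow> fmap S A A (Id V A) = Id V (fob S A)"
  using mon by (auto simp: is_monad_def endofunctor_def)

lemma S_comp: "arr V f A B \<Longrightarrow> arr V g B D \<Longrightarrow> fmap S A D (g \<cdot> f) = fmap S B D g \<cdot> fmap S A B f"
  using mon unfolding is_monad_def endofunctor_def arr_def by blast

lemma eta_arr: "A \<in> Ob V \<Longrightarrow> arr V (eta S A) A (fob S A)"
  using mon S_ob by (auto simp: is_monad_def natural_def id_endo_def arr_def)

lemma mu_arr: "A \<in> Ob V \<Longrightarrow> arr V (mu S A) (fob S (fob S A)) (fob S A)"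
  using mon S_ob by (auto simp: is_monad_def natural_def comp_endo_def arr_def)

lemma eta_nat: "arr V f A B \<Longrightarrow> eta S B \<cdot> f = fmap S A B f \<cdot> eta S A"
  using mon by (auto simp: is_monad_def natural_def id_endo_def arr_def)

lemma mu_nat: "arr V f A B \<Longrightarrow>
    mu S B \<cdot> fmap S (fob S A) (fob S B) (fmap S A B f) = fmap S A B f \<cdot> mu S A"
  using mon by (auto simp: is_monad_def natural_def comp_endo_def arr_def)

lemma mu_eta: "A \<in> Ob V \<Longrightarrow> mu S A \<cdot> eta S (fob S A) = Id V (fob S A)"
  and mu_fmap_eta: "A \<in> Ob V \<Longrightarrow> mu S A \<cdot> fmap S A (fob S A) (eta S A) = Id V (fob S A)"
  and mu_mu: "A \<in> Ob V \<Longrightarrow> mu S A \<cdot> mu S (fob S A) =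
    mu S A \<cdot> fmap S (fob S (fob S A)) (fob S A) (mu S A)"
  using mon by (auto simp: is_monad_def)

text \<open>A generalised element \<open>z : X \<rightarrow> S Y\<close> turns elements at stage \<open>Y\<close> into elements of \<open>S _\<close> at
  stage \<open>X\<close>.\<close>

lemma S_comp_elt:
  assumes "arr V f A B" "arr V g B D" "arr V z X (fob S A)"
  shows "fmap S A D (g \<cdot> f) \<cdot> z = fmap S B D g \<cdot> fmap S A B f \<cdot> z"
  using S_comp[OF assms(1,2)] assoc[OF assms(3) S_arr[OF assms(1)] S_arr[OF assms(2)]] by simp

lemma S_elt_arr: "arr V f A B \<Longrightarrow> arr V z X (fob S A) \<Longrightarrow> arr V (fmap S A B f \<cdot> z) X (fob S B)"
  by (rule comp_arr[OF _ S_arr])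

end

lemma objs_star [simp]: "objs (fob (star S) A) = objs A"
  and homs_star [simp]: "a \<in> objs A \<Longrightarrow> b \<in> objs A \<Longrightarrow>
    homs (fob (star S) A) (a, b) = fob S (homs A (a, b))"
  and app_fmap_star [simp]: "app (fmap (star S) A B f) = app f"
  and src_fmap_star [simp]: "src (fmap (star S) A B f) = objs A"
  and happ_fmap_star [simp]: "a \<in> objs A \<Longrightarrow> b \<in> objs A \<Longrightarrow> happ (fmap (star S) A B f) (a, b) =
    fmap S (homs A (a, b)) (homs B (app f a, app f b)) (happ f (a, b))"
  by (simp_all add: star_def)

text \<open>A graph morphism that is the identity on objects and has components \<open>t\<close> on
  homs. Units, multiplications and laws obtained homwise all have this form.\<close>

definition gpt :: "('u obj \<Rightarrow> 'u mor) \<Rightarrow> 'u obj \<Rightarrow> 'u mor" where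
  "gpt t A = Gmor (objs A) (\<lambda>a\<in>objs A. a) (\<lambda>e\<in>objs A \<times> objs A. t (homs A e))"

lemma app_gpt [simp]: "a \<in> objs A \<Longrightarrow> app (gpt t A) a = a"
  and src_gpt [simp]: "src (gpt t A) = objs A"
  and happ_gpt [simp]: "a \<in> objs A \<Longrightarrow> b \<in> objs A \<Longrightarrow> happ (gpt t A) (a, b) = t (homs A (a, b))"
  by (simp_all add: gpt_def)

lemma eta_star [simp]: "eta (star S) = gpt (eta S)" and mu_star [simp]: "mu (star S) = gpt (mu S)"
  by (simp_all add: star_def gpt_def fun_eq_iff)

lemma gComp_eqI:
  assumes "src f = src f'" "\<And>a. a \<in> src f \<Longrightarrow> app g (app f a) = app g' (app f' a)"
    and "\<And>a b. a \<in> src f \<Longrightarrow> b \<in> src f \<Longrightarrow> Comp V (happ g (app f a, app f b)) (happ f (a, b)) =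
      Comp V (happ g' (app f' a, app f' b)) (happ f' (a, b))"
  shows "gComp V g f = gComp V g' f'"
  using assms unfolding gComp_def by (auto intro!: restrict_ext)

lemma gComp_eq_gptI:
  assumes "src f = objs A" "\<And>a. a \<in> objs A \<Longrightarrow> app g (app f a) = a"
    and "\<And>a b. a \<in> objs A \<Longrightarrow> b \<in> objs A \<Longrightarrow> Comp V (happ g (app f a, app f b)) (happ f (a, b)) =
      t (homs A (a, b))"
  shows "gComp V g f = gpt t A"
  using assms unfolding gComp_def gpt_def by (auto intro!: restrict_ext)

lemma gId_gpt: "gId V A = gpt (Id V) A"
  by (simp add: gId_def gpt_def)

locale enriched_monad = enriching V G + monad_on V S for V :: "'a gcat" and G and S
begin

lemma star_ob: "vg A \<Longrightarrow> fob (star S) A \<in> Ob (gph V)"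
  unfolding star_def endo.simps by (rule gOb_I[OF refl]) (auto intro: S_ob vgraphD)

lemma star_vg: "vg A \<Longrightarrow> vg (fob (star S) A)"
  by (rule gOb_vg[OF star_ob])

lemma star_hom:
  assumes "f \<in> gHom V A B" "vg A" "vg B"
  shows "fmap (star S) A B f \<in> gHom V (fob (star S) A) (fob (star S) B)"
proof -
  have "Gmor (objs (fob (star S) A)) (app f) (restrict (\<lambda>e. fmap S (homs A e)
      (homs B (map_prod (app f) (app f) e)) (happ f e)) (objs (fob (star S) A) \<times> objs (fob (star S) A)))
    \<in> gHom V (fob (star S) A) (fob (star S) B)"
    using gHomD(3)[OF assms] gHom_ob[OF assms(1)] S_arr[OF happ_arr[OF assms]]
    by (intro gHomI') auto
  then show ?thesis by (simp add: star_def)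
qed

lemma gpt_hom:
  assumes "vg A" "objs B = objs A" "objs B' = objs A" and "\<And>a b. a \<in> objs A \<Longrightarrow> b \<in> objs A \<Longrightarrow>
    arr V (t (homs A (a, b))) (homs B (a, b)) (homs B' (a, b))"
  shows "gpt t A \<in> gHom V B B'"
  unfolding gpt_def assms(2)[symmetric] by (rule gHomI) (use assms in auto)

lemma star_monad: "is_monad (gph V) (star S)"
  unfolding is_monad_def endofunctor_def natural_def id_endo_def comp_endo_def gph_simps eta_star
    mu_star endo.simps
proof (intro conjI ballI)
  fix A B f assume AB: "A \<in> Ob (gph V)" "B \<in> Ob (gph V)" and f: "f \<in> gHom V A B"
  note A = AB[THEN gOb_vg] and h = happ_arr[OF f AB[THEN gOb_vg]] and o = gHom_ob[OF f]
  show "fmap (star S) A B f \<in> gHom V (fob (star S) A) (fob (star S) B)"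
    by (rule star_hom[OF f A])
  show "gComp V (gpt (eta S) B) f = gComp V (fmap (star S) A B f) (gpt (eta S) A)"
    by (rule gComp_eqI) (use o eta_nat[OF h] in auto)
  show "gComp V (gpt (mu S) B) (fmap (star S) (fob (star S) A) (fob (star S) B) (fmap (star S) A B f)) =
      gComp V (fmap (star S) A B f) (gpt (mu S) A)"
    by (rule gComp_eqI) (use o mu_nat[OF h] in auto)
  fix D g assume D: "D \<in> Ob (gph V)" and g: "g \<in> gHom V B D"
  note gf = gComp_hom[OF f g A gOb_vg[OF D]]
  show "fmap (star S) A D (gComp V g f) = gComp V (fmap (star S) B D g) (fmap (star S) A B f)"
    using o S_comp[OF h happ_arr[OF g A(2) gOb_vg[OF D]]] gHomD(3)[OF gf A(1) gOb_vg[OF D]]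
    by (auto simp: star_def gComp_def intro!: restrict_ext)
next
  fix A assume A: "A \<in> Ob (gph V)"
  note v = gOb_vg[OF A] and H = vgraphD[OF gOb_vg[OF A]]
  show "fob (star S) A \<in> Ob (gph V)" by (rule star_ob[OF v])
  show "fmap (star S) A A (gId V A) = gId V (fob (star S) A)"
    using H S_id by (auto simp: star_def gId_def intro!: restrict_ext)
  show "gpt (eta S) A \<in> gHom V A (fob (star S) A)"
    by (rule gpt_hom[OF v]) (use H eta_arr in auto)
  show "gpt (mu S) A \<in> gHom V (fob (star S) (fob (star S) A)) (fob (star S) A)"
    by (rule gpt_hom[OF v]) (use H mu_arr in auto)
  show "gComp V (gpt (mu S) A) (gpt (eta S) (fob (star S) A)) = gId V (fob (star S) A)"
    unfolding gId_gpt by (rule gComp_eq_gptI) (use H mu_eta in auto)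
  show "gComp V (gpt (mu S) A) (fmap (star S) A (fob (star S) A) (gpt (eta S) A)) = gId V (fob (star S) A)"
    unfolding gId_gpt by (rule gComp_eq_gptI) (use H mu_fmap_eta in auto)
  show "gComp V (gpt (mu S) A) (gpt (mu S) (fob (star S) A)) =
      gComp V (gpt (mu S) A) (fmap (star S) (fob (star S) (fob (star S) A)) (fob (star S) A) (gpt (mu S) A))"
    by (rule gComp_eqI) (use H mu_mu in auto)
qed

text \<open>By \<open>gcocone_iff\<close> a coproduct of graphs amounts to one-element and empty
  coproducts of homs in \<open>V\<close>. That \<open>S\<close> preserves the former settles homs
  inside a summand, that it preserves the latter settles homs between summands.\<close>

lemma star_pres:
  assumes pr: "pres V G S"
  shows "pres (gph V) gprobes (star S)"
  unfolding pres_def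
proof (intro allI impI)
  fix I :: "'a elt list set" and A u B
  assume cc: "cocone (gph V) gprobes I A u B"
  have B: "B \<in> Ob (gph V)" and u: "\<And>i. i \<in> I \<Longrightarrow> arr (gph V) (u i) (A i) B"
    and c: "gcocone_cond I A u B" using cc unfolding gcocone_iff by auto
  have uh: "u i \<in> gHom V (A i) B" "vg (A i)" "A i \<in> Ob (gph V)" if "i \<in> I" for i
    using u[OF that] by (auto simp: garr_iff gOb_vg)
  note vB = gOb_vg[OF B] and c' = c[unfolded gcocone_cond_def]
  show "cocone (gph V) gprobes I (\<lambda>i. fob (star S) (A i)) (\<lambda>i. fmap (star S) (A i) B (u i)) (fob (star S) B)"
    unfolding gcocone_iff
  proof (intro conjI ballI)
    show "fob (star S) B \<in> Ob (gph V)" by (rule star_ob[OF vB])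
    show "arr (gph V) (fmap (star S) (A i) B (u i)) (fob (star S) (A i)) (fob (star S) B)" if "i \<in> I" for i
      using star_hom[OF uh(1,2)[OF that] vB] star_ob[OF vB] star_ob[OF uh(2)[OF that]]
      by (simp add: garr_iff)
    show "gcocone_cond I (\<lambda>i. fob (star S) (A i)) (\<lambda>i. fmap (star S) (A i) B (u i)) (fob (star S) B)"
      unfolding gcocone_cond_def objs_star app_fmap_star
    proof (intro conjI ballI allI impI)
      show "\<exists>i\<in>I. \<exists>a\<in>objs (A i). b = app (u i) a" if "b \<in> objs B" for b
        using c'[THEN conjunct1] that by blast
      show "i = j" "a = b"
        if "i \<in> I" "j \<in> I" "a \<in> objs (A i)" "b \<in> objs (A j)" "app (u i) a = app (u j) b" for i j a b
        using c'[THEN conjunct2, THEN conjunct1] that by blast+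
      show "cocone V G {[] :: 'a elt list} (\<lambda>_. homs (fob (star S) (A i)) (a, b))
          (\<lambda>_. happ (fmap (star S) (A i) B (u i)) (a, b))
          (homs (fob (star S) B) (app (u i) a, app (u i) b))"
        if i: "i \<in> I" and ab: "a \<in> objs (A i)" "b \<in> objs (A i)" for i a b
      proof -
        have "cocone V G {[] :: 'a elt list} (\<lambda>_. homs (A i) (a, b))
            (\<lambda>_. happ (u i) (a, b)) (homs B (app (u i) a, app (u i) b))"
          using c'[THEN conjunct2, THEN conjunct2, THEN conjunct1] i ab by blast
        from presD[OF pr this] show ?thesis
          using ab gHom_ob(2)[OF uh(1)[OF i]] by simp
      qed
      show "\<not> arr V x X (homs (fob (star S) B) (app (u i) a, app (u j) b))"
        if ij: "i \<in> I" "j \<in> I" "i \<noteq> j" and ab: "a \<in> objs (A i)" "b \<in> objs (A j)" and X: "X \<in> G"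
        for i j a b X x
      proof -
        have ob: "app (u i) a \<in> objs B" "app (u j) b \<in> objs B"
          using gHom_ob(2)[OF uh(1)] ij ab by auto
        have "cocone V G ({} :: 'a elt list set) A u (homs B (app (u i) a, app (u j) b))"
          using c'[THEN conjunct2, THEN conjunct2, THEN conjunct2] ij ab vgraphD[OF vB ob]
          by (auto simp: cocone_empty)
        from presD[OF pr this] show ?thesis
          using ob X by (simp add: cocone_empty)
      qed
    qed
  qed
qed

end

section \<open>Distributive laws and Yang--Baxter equations applied homwise\<close>

lemma (in enriching) star_distributive:
  assumes S: "is_monad V S" and T: "is_monad V T" and l: "distributive_law V S T l"
  shows "distributive_law (gph V) (star S) (star T) (gpt l)"
proof -
  interpret S: enriched_monad V G S by unfold_locales (rule S)
  interpret T: enriched_monad V G T by unfold_locales (rule T)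
  note d = l[unfolded distributive_law_def natural_def comp_endo_def endo.simps]
  show ?thesis
    unfolding distributive_law_def natural_def comp_endo_def gph_simps eta_star mu_star endo.simps
  proof (intro conjI ballI)
    fix A assume A: "A \<in> Ob (gph V)"
    note v = gOb_vg[OF A] and H = vgraphD[OF gOb_vg[OF A]]
    show "gpt l A \<in> gHom V (fob (star S) (fob (star T) A)) (fob (star T) (fob (star S) A))"
      by (rule S.gpt_hom[OF v]) (use H d S.S_ob T.S_ob in \<open>auto simp: arr_def\<close>)
    show "gComp V (gpt l A) (fmap (star S) A (fob (star T) A) (gpt (eta T) A)) =
        gpt (eta T) (fob (star S) A)"
      by (rule gComp_eq_gptI) (use H d in auto)
    show "gComp V (gpt l A) (gpt (eta S) (fob (star T) A)) =
        fmap (star T) A (fob (star S) A) (gpt (eta S) A)"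
      using H d by (auto simp: star_def gComp_def gpt_def intro!: restrict_ext)
    show "gComp V (gpt l A) (fmap (star S) (fob (star T) (fob (star T) A)) (fob (star T) A) (gpt (mu T) A)) =
        gComp V (gpt (mu T) (fob (star S) A)) (gComp V (fmap (star T) (fob (star S) (fob (star T) A))
          (fob (star T) (fob (star S) A)) (gpt l A)) (gpt l (fob (star T) A)))"
      by (rule gComp_eqI) (use H d in auto)
    show "gComp V (gpt l A) (gpt (mu S) (fob (star T) A)) =
        gComp V (fmap (star T) (fob (star S) (fob (star S) A)) (fob (star S) A) (gpt (mu S) A))
          (gComp V (gpt l (fob (star S) A)) (fmap (star S) (fob (star S) (fob (star T) A))
            (fob (star T) (fob (star S) A)) (gpt l A)))"
      by (rule gComp_eqI) (use H d in auto)
    fix B f assume B: "B \<in> Ob (gph V)" and f: "f \<in> gHom V A B"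
    note o = gHom_ob[OF f] and h = happ_arr[OF f v gOb_vg[OF B]]
    have "l B' \<cdot> fmap S (fob T A') (fob T B') (fmap T A' B' k) =
        fmap T (fob S A') (fob S B') (fmap S A' B' k) \<cdot> l A'" if "arr V k A' B'" for k A' B'
      using d that by (auto simp: arr_def)
    from this[OF h] show "gComp V (gpt l B) (fmap (star S) (fob (star T) A) (fob (star T) B) (fmap (star T) A B f)) =
        gComp V (fmap (star T) (fob (star S) A) (fob (star S) B) (fmap (star S) A B f)) (gpt l A)"
      by (intro gComp_eqI) (use o in auto)
  qed
qed

text \<open>Stated for three given monads at one object, so that the cases \<open>star\<close> and
  \<open>fc\<close> can be proved before the monads are arranged into an indexed family.\<close>

definition yb_at :: "('o, 'm, 'z) cat_scheme \<Rightarrow> ('o, 'm) monad \<Rightarrow> ('o, 'm) monad \<Rightarrow> ('o, 'm) monad \<Rightarrow>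
    ('o \<Rightarrow> 'm) \<Rightarrow> ('o \<Rightarrow> 'm) \<Rightarrow> ('o \<Rightarrow> 'm) \<Rightarrow> 'o \<Rightarrow> bool" where
  "yb_at C Ti Tj Tk lij lik ljk A \<longleftrightarrow>
        Comp C (ljk (fob Ti A)) (Comp C (fmap Tj (fob Ti (fob Tk A)) (fob Tk (fob Ti A)) (lik A))
            (lij (fob Tk A))) =
        Comp C (fmap Tk (fob Ti (fob Tj A)) (fob Tj (fob Ti A)) (lij A))
          (Comp C (lik (fob Tj A)) (fmap Ti (fob Tj (fob Tk A)) (fob Tk (fob Tj A)) (ljk A)))"

lemma yang_baxter_iff: "yang_baxter C T l i j k \<longleftrightarrow>
    (\<forall>A\<in>Ob C. yb_at C (T i) (T j) (T k) (l i j) (l i k) (l j k) A)"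
  by (simp add: yang_baxter_def yb_at_def)

lemma (in enriching) star_yb:
  assumes "\<And>A. A \<in> Ob V \<Longrightarrow> yb_at V Ti Tj Tk lij lik ljk A" "A \<in> Ob (gph V)"
  shows "yb_at (gph V) (star Ti) (star Tj) (star Tk) (gpt lij) (gpt lik) (gpt ljk) A"
  unfolding yb_at_def gph_simps
  by (rule gComp_eqI) (use vgraphD[OF gOb_vg[OF assms(2)]] assms(1)[unfolded yb_at_def] in auto)

section \<open>The distributive law of a homwise monad over the free category monad\<close>

text \<open>The \<open>al k\<close> are \<open>S\<close>-algebra structures on the
  \<open>R(k)\<close> for which unit and composition of \<open>R\<close> are algebra morphisms. The
  last two conditions say this on elements \<open>z : X -> S Y\<close>, which avoids naming the
  algebra structure on a product.\<close>

locale opalg = freecat V G R + enriched_monad V G S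
  for V :: "'a gcat" and G and R and S +
  fixes al :: "nat \<Rightarrow> 'a elt mor"
  assumes pr: "pres V G S"
    and al_arr: "arr V (al k) (fob S (ar R k)) (ar R k)"
    and al_eta: "Comp V (al k) (eta S (ar R k)) = Id V (ar R k)"
    and al_mu: "Comp V (al k) (mu S (ar R k)) =
      Comp V (al k) (fmap S (fob S (ar R k)) (ar R k) (al k))"
    and al_unit: "arr V z X (fob S Y) \<Longrightarrow> Y \<in> Ob V \<Longrightarrow>
      Comp V (al 1) (Comp V (fmap S Y (ar R 1) (unit_elt V R Y)) z) = unit_elt V R X"
    and al_comp: "arr V p Y (ar R (length ps)) \<Longrightarrow> (\<And>k q. (k, q) \<in> set ps \<Longrightarrow> arr V q Y (ar R k)) \<Longrightarrow>
      arr V z X (fob S Y) \<Longrightarrow>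
      Comp V (al (sum_list (map fst ps)))
        (Comp V (fmap S Y (ar R (sum_list (map fst ps))) (comp_elt V R Y p ps)) z) =
      comp_elt V R X (Comp V (al (length ps)) (Comp V (fmap S Y (ar R (length ps)) p) z))
        (map (\<lambda>(k, q). (k, Comp V (al k) (Comp V (fmap S Y (ar R k) q) z))) ps)"
begin

definition opl :: "nat \<Rightarrow> 'a elt obj \<Rightarrow> 'a elt mor \<Rightarrow> 'a elt mor \<Rightarrow> 'a elt mor" where
  "opl k Y p z = al k \<cdot> fmap S Y (ar R k) p \<cdot> z"

lemma opl_arr: "arr V p Y (ar R k) \<Longrightarrow> arr V z X (fob S Y) \<Longrightarrow> arr V (opl k Y p z) X (ar R k)"
  unfolding opl_def by (rule comp_arr[OF S_elt_arr al_arr])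

lemma opl_restr:
  assumes "arr V p Y (ar R k)" "arr V z X (fob S Y)" "arr V g X' X"
  shows "opl k Y p z \<cdot> g = opl k Y p (z \<cdot> g)"
  unfolding opl_def
  using assoc[OF assms(3) S_elt_arr[OF assms(1,2)] al_arr] assoc[OF assms(3,2) S_arr[OF assms(1)]]
  by simp

lemma opl_comp:
  assumes "arr V t Y Y'" "arr V p Y' (ar R k)" "arr V z X (fob S Y)"
  shows "opl k Y (p \<cdot> t) z = opl k Y' p (fmap S Y Y' t \<cdot> z)"
  unfolding opl_def using S_comp_elt[OF assms] by simp

text \<open>The word of \<open>R\<close>-operations and elements of \<open>S A\<close> obtained from a word at stage \<open>Y\<close> and a
  generalised element \<open>z\<close> of \<open>S Y\<close>.\<close>

definition swd :: "'a elt obj \<Rightarrow> 'a elt mor \<Rightarrow> 'a elt obj \<Rightarrow> 'a elt word \<Rightarrow> 'a elt word" where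
  "swd Y z A = (\<lambda>(as, p, xs). (as, opl (length as - 1) Y p z,
     map2 (\<lambda>d x. fmap S Y (homs A d) x \<cdot> z) (steps as) xs))"

lemma fst_swd [simp]: "fst (swd Y z A w) = fst w"
  by (simp add: swd_def split: prod.splits)

abbreviation "SG \<equiv> fob (star S)"

lemma paths_SG [simp]: "paths (SG A) = paths A"
  by (rule paths_cong) simp

lemma swd_words:
  assumes A: "vg A" and w: "w \<in> words V R A Y e" and z: "arr V z X (fob S Y)" and Y: "Y \<in> Ob V"
  shows "swd Y z A w \<in> words V R (SG A) X e"
proof -
  obtain as p xs where w': "w = (as, p, xs)" by (metis prod.collapse)
  note d = w[unfolded w' words_iff[OF A Y]]
  have xs: "length xs = length as - 1" using d by (auto dest: list_all2_lengthD)
  have "list_all2 (\<lambda>d x. arr V x X (homs (SG A) d)) (steps as)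
      (map2 (\<lambda>d x. fmap S Y (homs A d) x \<cdot> z) (steps as) xs)"
    unfolding list_all2_conv_all_nth
    using words_xs[OF A Y w[unfolded w']] xs S_elt_arr[OF _ z] by auto
  then show ?thesis
    using d opl_arr[OF _ z] by (simp add: w' swd_def words_iff[OF star_vg[OF A] arr_ob1[OF z]])
qed

lemma swd_restr:
  assumes A: "vg A" and w: "w \<in> words V R A Y e" and z: "arr V z X (fob S Y)" and Y: "Y \<in> Ob V"
    and g: "arr V g X' X"
  shows "restr_word V g (swd Y z A w) = swd Y (z \<cdot> g) A w"
proof -
  obtain as p xs where w': "w = (as, p, xs)" by (metis prod.collapse)
  note d = w[unfolded w' words_iff[OF A Y]]
  have xs: "length xs = length as - 1" using d by (auto dest: list_all2_lengthD)
  have "map (\<lambda>x. x \<cdot> g) (map2 (\<lambda>d x. fmap S Y (homs A d) x \<cdot> z) (steps as) xs) =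
      map2 (\<lambda>d x. fmap S Y (homs A d) x \<cdot> (z \<cdot> g)) (steps as) xs"
    by (rule nth_equalityI) (use words_xs[OF A Y w[unfolded w']] xs assoc[OF g z S_arr] in auto)
  then show ?thesis using d opl_restr[OF _ z g] by (simp add: w' swd_def restr_word_def)
qed

text \<open>Dinaturality in the intermediate stage: a restriction of the word can be traded for a
  change of \<open>z\<close>. It allows \<open>Y\<close> to be replaced by the stage of the
  universal word.\<close>

lemma swd_restr2:
  assumes A: "vg A" and w: "w \<in> words V R A Y' e" and z: "arr V z X (fob S Y)" and t: "arr V t Y Y'"
  shows "swd Y z A (restr_word V t w) = swd Y' (fmap S Y Y' t \<cdot> z) A w"
proof -
  note Y = arr_ob1[OF t] arr_ob2[OF t]
  obtain as p xs where w': "w = (as, p, xs)" by (metis prod.collapse)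
  note d = w[unfolded w' words_iff[OF A Y(2)]]
  have xs: "length xs = length as - 1" using d by (auto dest: list_all2_lengthD)
  have "map2 (\<lambda>d x. fmap S Y (homs A d) x \<cdot> z) (steps as) (map (\<lambda>x. x \<cdot> t) xs) =
      map2 (\<lambda>d x. fmap S Y' (homs A d) x \<cdot> (fmap S Y Y' t \<cdot> z)) (steps as) xs"
    by (rule nth_equalityI) (use words_xs[OF A Y(2) w[unfolded w']] xs S_comp_elt[OF t _ z] in auto)
  then show ?thesis using d opl_comp[OF t _ z] by (simp add: w' swd_def restr_word_def)
qed

lemma SF_cocone:
  assumes "vg A" "e \<in> objs A \<times> objs A"
  shows "cocone V G (paths A e) (\<lambda>as. fob S (Prod V (factors R A as)))
    (\<lambda>as. fmap S (Prod V (factors R A as)) (homs (F A) e) (Incl V (paths A e) (\<lambda>as. Prod V (factors R A as)) as))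
    (fob S (homs (F A) e))"
  by (rule presD[OF pr F_cocone[OF assms]])

text \<open>Since \<open>S\<close> preserves the coproduct defining the hom of \<open>F A\<close>, a
  probe element is \<open>S\<close> of an injection applied to some \<open>z\<close>, and the
  injection is the universal word by \<open>felt_uword\<close>.\<close>

lemma SF_surj:
  assumes A: "vg A" and X: "X \<in> G" and x: "arr V x X (fob S (homs (F A) e))" and e: "e \<in> objs A \<times> objs A"
  shows "\<exists>Y w z. Y \<in> Ob V \<and> w \<in> words V R A Y e \<and> arr V z X (fob S Y) \<and>
    x = fmap S Y (homs (F A) e) (felt A Y w) \<cdot> z"
proof -
  obtain as z where as: "as \<in> paths A e" "arr V z X (fob S (Prod V (factors R A as)))"
    "x = fmap S (Prod V (factors R A as)) (homs (F A) e)
      (Incl V (paths A e) (\<lambda>as. Prod V (factors R A as)) as) \<cdot> z"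
    using cocone_ex[OF SF_cocone[OF A e] X x] by blast
  then show ?thesis
    using uword(1)[OF A as(1)] felt_uword[OF A as(1)] prod_ob[OF factors_ob[OF A as(1)]]
    by (intro exI[of _ "Prod V (factors R A as)"] exI[of _ "uword A as"] exI[of _ z]) simp
qed

text \<open>On each summand the map is prescribed at the universal word, with the identity for
  \<open>z\<close>. The formula for all \<open>w\<close> and \<open>z\<close> follows, as every word
  is a restriction of the universal one and \<open>swd\<close> is dinatural.\<close>

lemma lam_ex:
  assumes A: "vg A" and e: "e \<in> objs A \<times> objs A"
  shows "\<exists>h. arr V h (fob S (homs (F A) e)) (homs (F (SG A)) e) \<and>
    (\<forall>X Y w z. Y \<in> Ob V \<longrightarrow> w \<in> words V R A Y e \<longrightarrow> arr V z X (fob S Y) \<longrightarrow>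
      h \<cdot> fmap S Y (homs (F A) e) (felt A Y w) \<cdot> z = felt (SG A) X (swd Y z A w))"
proof -
  let ?U = "\<lambda>as. Prod V (factors R A as)"
  let ?i = "Incl V (paths A e) ?U"
  let ?f = "\<lambda>as. felt (SG A) (fob S (?U as)) (swd (?U as) (Id V (fob S (?U as))) A (uword A as))"
  have vS: "vg (SG A)" by (rule star_vg[OF A])
  have U: "?U as \<in> Ob V" if "as \<in> paths A e" for as by (rule prod_ob[OF factors_ob[OF A that]])
  have w0: "swd (?U as) (Id V (fob S (?U as))) A (uword A as) \<in> words V R (SG A) (fob S (?U as)) e"
    if "as \<in> paths A e" for as
    by (rule swd_words[OF A uword(1)[OF A that] id_arr[OF S_ob[OF U[OF that]]] U[OF that]])
  have f: "arr V (?f as) (fob S (?U as)) (homs (F (SG A)) e)" if "as \<in> paths A e" for as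
    by (rule felt_arr[OF vS S_ob[OF U[OF that]] w0[OF that]])
  obtain h where h: "arr V h (fob S (homs (F A) e)) (homs (F (SG A)) e)"
    and hi: "\<And>as. as \<in> paths A e \<Longrightarrow> h \<cdot> fmap S (?U as) (homs (F A) e) (?i as) = ?f as"
    using cotuple[OF SF_cocone[OF A e] vgraphD'[OF F_vg[OF vS]] f] e by auto
  have "h \<cdot> fmap S Y (homs (F A) e) (felt A Y w) \<cdot> z = felt (SG A) X (swd Y z A w)"
    if Y: "Y \<in> Ob V" and w: "w \<in> words V R A Y e" and z: "arr V z X (fob S Y)" for X Y w z
  proof -
    let ?as = "fst w" and ?t = "word_elt V R A Y w"
    have as: "?as \<in> paths A e" using words_pathsD[OF w] by blast
    note t = word_elt_arr[OF A Y w] and i = cocone_arr[OF F_cocone[OF A e] as]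
    have tz: "arr V (fmap S Y (?U ?as) ?t \<cdot> z) X (fob S (?U ?as))" by (rule S_elt_arr[OF t z])
    \<comment> \<open>\<open>felt A Y w\<close> factors through the injection for the string of
      \<open>w\<close>, and on that summand \<open>h\<close> is known.\<close>
    have "h \<cdot> fmap S Y (homs (F A) e) (felt A Y w) \<cdot> z =
        h \<cdot> fmap S (?U ?as) (homs (F A) e) (?i ?as) \<cdot> fmap S Y (?U ?as) ?t \<cdot> z"
      unfolding felt_eq[OF w] by (simp add: S_comp_elt[OF t i z])
    also have "\<dots> = ?f ?as \<cdot> fmap S Y (?U ?as) ?t \<cdot> z"
      using assoc[OF tz S_arr[OF i] h] hi[OF as] by simp
    also have "\<dots> = felt (SG A) X (swd (?U ?as) (Id V (fob S (?U ?as)) \<cdot> fmap S Y (?U ?as) ?t \<cdot> z) A (uword A ?as))"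
      using felt_restr[OF vS w0[OF as] tz] swd_restr[OF A uword(1)[OF A as] id_arr[OF S_ob[OF U[OF as]]] U[OF as] tz]
      by simp
    also have "\<dots> = felt (SG A) X (swd Y z A w)"
      using id_left[OF tz] swd_restr2[OF A uword(1)[OF A as] z t] restr_uword[OF A Y w] by simp
    finally show ?thesis .
  qed
  with h show ?thesis by blast
qed

text \<open>By \<open>SF_surj\<close> the equation fixes the values on all probe elements, so there
  is only one map to choose.\<close>

definition lam_hom :: "'a elt obj \<Rightarrow> 'a elt \<times> 'a elt \<Rightarrow> 'a elt mor" where
  "lam_hom A e = (SOME h. arr V h (fob S (homs (F A) e)) (homs (F (SG A)) e) \<and>
    (\<forall>X Y w z. Y \<in> Ob V \<longrightarrow> w \<in> words V R A Y e \<longrightarrow> arr V z X (fob S Y) \<longrightarrow>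
      h \<cdot> fmap S Y (homs (F A) e) (felt A Y w) \<cdot> z = felt (SG A) X (swd Y z A w)))"

definition lam :: "'a elt obj \<Rightarrow> 'a elt mor" where
  "lam A = Gmor (objs A) (\<lambda>a\<in>objs A. a) (\<lambda>e\<in>objs A \<times> objs A. lam_hom A e)"

lemma lam_simps [simp]: "src (lam A) = objs A" "a \<in> objs A \<Longrightarrow> app (lam A) a = a"
  by (simp_all add: lam_def)

lemma lam_elt:
  assumes "vg A" "a \<in> objs A" "b \<in> objs A"
  shows "arr V (happ (lam A) (a, b)) (fob S (homs (F A) (a, b))) (homs (F (SG A)) (a, b))"
    "Y \<in> Ob V \<Longrightarrow> w \<in> words V R A Y (a, b) \<Longrightarrow> arr V z X (fob S Y) \<Longrightarrow>
      happ (lam A) (a, b) \<cdot> fmap S Y (homs (F A) (a, b)) (felt A Y w) \<cdot> z = felt (SG A) X (swd Y z A w)"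
proof -
  have "(a, b) \<in> objs A \<times> objs A" using assms by simp
  from someI_ex[OF lam_ex[OF assms(1) this], folded lam_hom_def]
  show "arr V (happ (lam A) (a, b)) (fob S (homs (F A) (a, b))) (homs (F (SG A)) (a, b))"
    "Y \<in> Ob V \<Longrightarrow> w \<in> words V R A Y (a, b) \<Longrightarrow> arr V z X (fob S Y) \<Longrightarrow>
      happ (lam A) (a, b) \<cdot> fmap S Y (homs (F A) (a, b)) (felt A Y w) \<cdot> z = felt (SG A) X (swd Y z A w)"
    using assms(2,3) by (cases w; auto simp: lam_def)+
qed

lemma lam_hom:
  assumes A: "vg A"
  shows "lam A \<in> gHom V (SG (F A)) (F (SG A))"
proof -
  have "Gmor (objs (SG (F A))) (restrict (\<lambda>a. a) (objs (SG (F A))))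
      (restrict (happ (lam A)) (objs (SG (F A)) \<times> objs (SG (F A)))) \<in> gHom V (SG (F A)) (F (SG A))"
    by (rule gHomI) (use lam_elt(1)[OF A] in auto)
  moreover have "restrict (happ (lam A)) (objs A \<times> objs A) = happ (lam A)"
    by (auto simp: lam_def)
  ultimately show ?thesis by (simp add: lam_def)
qed

lemma SF_gext:
  assumes "h \<in> gHom V (SG (F A)) B" "k \<in> gHom V (SG (F A)) B" and A: "vg A" and B: "vg B"
    and "\<And>a. a \<in> objs A \<Longrightarrow> app h a = app k a"
    and eq: "\<And>a b X Y w z. a \<in> objs A \<Longrightarrow> b \<in> objs A \<Longrightarrow> X \<in> Ob V \<Longrightarrow> Y \<in> Ob V \<Longrightarrow> w \<in> words V R A Y (a, b) \<Longrightarrow>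
      arr V z X (fob S Y) \<Longrightarrow> happ h (a, b) \<cdot> fmap S Y (homs (F A) (a, b)) (felt A Y w) \<cdot> z =
        happ k (a, b) \<cdot> fmap S Y (homs (F A) (a, b)) (felt A Y w) \<cdot> z"
  shows "h = k"
  using assms(1,2) star_vg[OF F_vg[OF A]] B
proof (rule gext)
  fix a b X x assume ab: "a \<in> objs (SG (F A))" "b \<in> objs (SG (F A))" and X: "X \<in> G"
    and x: "arr V x X (homs (SG (F A)) (a, b))"
  obtain Y w z where "Y \<in> Ob V" "w \<in> words V R A Y (a, b)" "arr V z X (fob S Y)"
     "x = fmap S Y (homs (F A) (a, b)) (felt A Y w) \<cdot> z"
    using SF_surj[OF A X, of x "(a, b)"] x ab by auto
  then show "happ h (a, b) \<cdot> x = happ k (a, b) \<cdot> x" using eq ab probeD[OF X] by simp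
qed (use assms(5) in simp)

lemma swd_map:
  assumes f: "f \<in> gHom V A B" and A: "vg A" and B: "vg B" and w: "w \<in> words V R A Y e"
    and Y: "Y \<in> Ob V" and z: "arr V z X (fob S Y)"
  shows "swd Y z B (map_word V f w) = map_word V (fmap (star S) A B f) (swd Y z A w)"
proof -
  obtain as p xs where w': "w = (as, p, xs)" by (metis prod.collapse)
  note d = w[unfolded w' words_iff[OF A Y]]
  have xs: "length xs = length as - 1" using d by (auto dest: list_all2_lengthD)
  have "map2 (\<lambda>d x. fmap S Y (homs B d) x \<cdot> z) (steps (map (app f) as)) (map2 (\<lambda>d x. happ f d \<cdot> x) (steps as) xs) =
     map2 (\<lambda>d x. happ (fmap (star S) A B f) d \<cdot> x) (steps as)
       (map2 (\<lambda>d x. fmap S Y (homs A d) x \<cdot> z) (steps as) xs)"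
    by (rule nth_equalityI)
      (use words_xs[OF A Y w[unfolded w']] xs S_comp_elt[OF _ happ_arr[OF f A B] z] in \<open>auto simp: steps_map\<close>)
  then show ?thesis by (simp add: w' swd_def map_word_def)
qed

lemma lam_natural:
  assumes f: "f \<in> gHom V A B" and A: "vg A" and B: "vg B"
  shows "gComp V (lam B) (fmap (star S) (F A) (F B) (fmap fcm A B f)) =
    gComp V (fmap fcm (SG A) (SG B) (fmap (star S) A B f)) (lam A)"
proof (rule SF_gext[OF _ _ A F_vg[OF star_vg[OF B]]])
  note v = F_vg[OF A] F_vg[OF B] star_vg[OF A] star_vg[OF B]
  note ff = fmap_fc[OF f A B] and sf = star_hom[OF f A B]
  note fsf = fmap_fc[OF sf v(3,4)] and sff = star_hom[OF ff(1) v(1,2)]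
  note lA = lam_hom[OF A] and lB = lam_hom[OF B]
  show "gComp V (lam B) (fmap (star S) (F A) (F B) (fmap fcm A B f)) \<in> gHom V (SG (F A)) (F (SG B))"
    by (rule gComp_hom[OF sff lB star_vg[OF v(1)] star_vg[OF v(2)] F_vg[OF v(4)]])
  show "gComp V (fmap fcm (SG A) (SG B) (fmap (star S) A B f)) (lam A) \<in> gHom V (SG (F A)) (F (SG B))"
    by (rule gComp_hom[OF lA fsf(1) star_vg[OF v(1)] F_vg[OF v(3)] F_vg[OF v(4)]])
  show "app (gComp V (lam B) (fmap (star S) (F A) (F B) (fmap fcm A B f))) a =
      app (gComp V (fmap fcm (SG A) (SG B) (fmap (star S) A B f)) (lam A)) a" if "a \<in> objs A" for a
    using that gHom_ob[OF f] by (simp add: fsf(2) ff(2))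
  fix a b X Y w z assume ab: "a \<in> objs A" "b \<in> objs A" and X: "X \<in> Ob V" and Y: "Y \<in> Ob V"
    and w: "w \<in> words V R A Y (a, b)" and z: "arr V z X (fob S Y)"
  let ?x = "fmap S Y (homs (F A) (a, b)) (felt A Y w) \<cdot> z"
  have x: "arr V ?x X (homs (SG (F A)) (a, b))"
    using S_elt_arr[OF felt_arr[OF A Y w] z] ab by simp
  have fab: "app f a \<in> objs B" "app f b \<in> objs B" using gHom_ob[OF f] ab by auto
  have mw: "map_word V f w \<in> words V R B Y (app f a, app f b)"
    using map_word_words[OF A B Y f w] by simp
  have hfw: "arr V (happ (fmap fcm A B f) (a, b)) (homs (F A) (a, b)) (homs (F B) (app f a, app f b))"
    using happ_arr[OF ff(1) v(1,2)] ab by (simp add: ff(2))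
  have "happ (gComp V (lam B) (fmap (star S) (F A) (F B) (fmap fcm A B f))) (a, b) \<cdot> ?x =
      happ (lam B) (app f a, app f b) \<cdot> fmap S (homs (F A) (a, b)) (homs (F B) (app f a, app f b))
        (happ (fmap fcm A B f) (a, b)) \<cdot> ?x"
    using happ_comp[OF sff lB star_vg[OF v(1)] star_vg[OF v(2)] F_vg[OF v(4)] _ _ x] ab by (simp add: ff(2))
  also have "\<dots> = happ (lam B) (app f a, app f b) \<cdot>
      fmap S Y (homs (F B) (app f a, app f b)) (felt B Y (map_word V f w)) \<cdot> z"
    using S_comp_elt[OF felt_arr[OF A Y w] hfw z] ff(3)[OF Y w] by simp
  also have "\<dots> = felt (SG B) X (map_word V (fmap (star S) A B f) (swd Y z A w))"
    using lam_elt(2)[OF B fab Y mw z] swd_map[OF f A B w Y z] by simp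
  also have "\<dots> = happ (gComp V (fmap fcm (SG A) (SG B) (fmap (star S) A B f)) (lam A)) (a, b) \<cdot> ?x"
    using happ_comp[OF lA fsf(1) star_vg[OF v(1)] F_vg[OF v(3)] F_vg[OF v(4)] _ _ x] ab
      lam_elt(2)[OF A ab Y w z] fsf(3)[OF X swd_words[OF A w z Y]] by simp
  finally show "happ (gComp V (lam B) (fmap (star S) (F A) (F B) (fmap fcm A B f))) (a, b) \<cdot> ?x =
      happ (gComp V (fmap fcm (SG A) (SG B) (fmap (star S) A B f)) (lam A)) (a, b) \<cdot> ?x" .
qed

text \<open>The unit gives a word with one letter, an identity. The operation is handled by
  \<open>al_unit\<close>, and the letter becomes \<open>x\<close> because \<open>S\<close> preserves
  identities.\<close>

lemma lam_eta_fc: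
  assumes A: "vg A"
  shows "gComp V (lam A) (fmap (star S) A (F A) (eta fcm A)) = eta fcm (SG A)"
proof (rule gext[OF _ _ star_vg[OF A] F_vg[OF star_vg[OF A]]])
  note e = eta_fc[OF A] and e' = eta_fc[OF star_vg[OF A]] and l = lam_hom[OF A]
  note v = star_vg[OF A] star_vg[OF F_vg[OF A]] F_vg[OF star_vg[OF A]]
  note se = star_hom[OF e(1) A F_vg[OF A]]
  show "gComp V (lam A) (fmap (star S) A (F A) (eta fcm A)) \<in> gHom V (SG A) (F (SG A))"
    by (rule gComp_hom[OF se l v])
  show "eta fcm (SG A) \<in> gHom V (SG A) (F (SG A))" by (rule e'(1))
  show "app (gComp V (lam A) (fmap (star S) A (F A) (eta fcm A))) a = app (eta fcm (SG A)) a"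
    if "a \<in> objs (SG A)" for a
    using that e(2) e'(2) by simp
  fix a b X x assume ab': "a \<in> objs (SG A)" "b \<in> objs (SG A)" and X: "X \<in> G"
    and x: "arr V x X (homs (SG A) (a, b))"
  let ?Y = "homs A (a, b)"
  have ab: "a \<in> objs A" "b \<in> objs A" using ab' by auto
  have Y: "?Y \<in> Ob V" by (rule vgraphD[OF A ab])
  have z: "arr V x X (fob S ?Y)" using x ab by simp
  have w: "([a, b], unit_elt V R ?Y, [Id V ?Y]) \<in> words V R A ?Y (a, b)"
    by (rule eta_word[OF A ab id_arr[OF Y]])
  \<comment> \<open>The component of the unit itself, not its value on an element, since
    \<open>S\<close> is about to be applied to it.\<close>
  have ee: "happ (eta fcm A) (a, b) = felt A ?Y ([a, b], unit_elt V R ?Y, [Id V ?Y])"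
    using e(3)[OF ab id_arr[OF Y]] id_right[OF happ_arr[OF e(1) A F_vg[OF A] ab]] e(2) ab
    by simp
  have "happ (gComp V (lam A) (fmap (star S) A (F A) (eta fcm A))) (a, b) \<cdot> x =
      happ (lam A) (a, b) \<cdot> fmap S ?Y (homs (F A) (a, b)) (felt A ?Y ([a, b], unit_elt V R ?Y, [Id V ?Y])) \<cdot> x"
    using happ_comp[OF se l v ab' x] ab by (simp add: ee e(2))
  also have "\<dots> = felt (SG A) X (swd ?Y x A ([a, b], unit_elt V R ?Y, [Id V ?Y]))"
    by (rule lam_elt(2)[OF A ab Y w z])
  also have "\<dots> = happ (eta fcm (SG A)) (a, b) \<cdot> x"
    using e'(3)[OF ab' x] al_unit[OF z Y] S_id[OF Y] id_left[OF z] by (simp add: swd_def opl_def)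
  finally show "happ (gComp V (lam A) (fmap (star S) A (F A) (eta fcm A))) (a, b) \<cdot> x =
      happ (eta fcm (SG A)) (a, b) \<cdot> x" .
qed

text \<open>Naturality of \<open>eta\<close> presents the element as \<open>S\<close> of the word
  applied to \<open>z = eta S X\<close>. The operation is then restored by \<open>al_eta\<close>,
  and each letter acquires a unit.\<close>

lemma lam_eta_S:
  assumes A: "vg A"
  shows "gComp V (lam A) (eta (star S) (F A)) = fmap fcm A (SG A) (eta (star S) A)"
proof (rule F_gext[OF _ _ A F_vg[OF star_vg[OF A]]])
  note l = lam_hom[OF A] and v = F_vg[OF A] star_vg[OF F_vg[OF A]] F_vg[OF star_vg[OF A]]
  have eF: "eta (star S) (F A) \<in> gHom V (F A) (SG (F A))"
    unfolding eta_star by (rule gpt_hom[OF v(1)]) (use eta_arr vgraphD[OF v(1)] in auto)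
  have eA: "eta (star S) A \<in> gHom V A (SG A)"
    unfolding eta_star by (rule gpt_hom[OF A]) (use eta_arr vgraphD[OF A] in auto)
  note f = fmap_fc[OF eA A star_vg[OF A]]
  show "gComp V (lam A) (eta (star S) (F A)) \<in> gHom V (F A) (F (SG A))"
    by (rule gComp_hom[OF eF l v])
  show "fmap fcm A (SG A) (eta (star S) A) \<in> gHom V (F A) (F (SG A))" by (rule f(1))
  show "app (gComp V (lam A) (eta (star S) (F A))) a = app (fmap fcm A (SG A) (eta (star S) A)) a"
    if "a \<in> objs A" for a
    using that by (simp add: f(2)[simplified])
  fix a b X w assume ab: "a \<in> objs A" "b \<in> objs A" and X: "X \<in> G" "X \<in> Ob V"
    and w: "w \<in> words V R A X (a, b)"
  obtain as p xs where w': "w = (as, p, xs)" by (metis prod.collapse)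
  note d = w[unfolded w' words_iff[OF A X(2)]]
  have xs: "length xs = length as - 1" using d by (auto dest: list_all2_lengthD)
  have p: "arr V p X (ar R (length as - 1))" using d by blast
  have "opl (length as - 1) X p (eta S X) = p"
    unfolding opl_def eta_nat[OF p, symmetric]
    using assoc[OF p eta_arr[OF ar_ob] al_arr] al_eta id_left[OF p] by simp
  moreover have "map2 (\<lambda>d x. fmap S X (homs A d) x \<cdot> eta S X) (steps as) xs =
      map2 (\<lambda>d x. happ (eta (star S) A) d \<cdot> x) (steps as) xs"
    by (rule nth_equalityI)
      (use words_xs[OF A X(2) w[unfolded w']] xs in \<open>auto simp: eta_nat[symmetric]\<close>)
  moreover have "map (app (eta (star S) A)) as = as"
    using pathsD[OF d[THEN conjunct1]] by (intro map_idI) auto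
  ultimately have sw: "swd X (eta S X) A w = map_word V (eta (star S) A) w"
    by (simp add: w' swd_def map_word_def)
  note fw = felt_arr[OF A X(2) w]
  have "happ (gComp V (lam A) (eta (star S) (F A))) (a, b) \<cdot> felt A X w =
      happ (lam A) (a, b) \<cdot> fmap S X (homs (F A) (a, b)) (felt A X w) \<cdot> eta S X"
    using happ_comp[OF eF l v _ _ fw] ab eta_nat[OF fw] by simp
  also have "\<dots> = felt (SG A) X (map_word V (eta (star S) A) w)"
    using lam_elt(2)[OF A ab X(2) w eta_arr[OF X(2)]] sw by simp
  also have "\<dots> = happ (fmap fcm A (SG A) (eta (star S) A)) (a, b) \<cdot> felt A X w"
    using f(3)[OF X(2) w] by simp
  finally show "happ (gComp V (lam A) (eta (star S) (F A))) (a, b) \<cdot> felt A X w =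
      happ (fmap fcm A (SG A) (eta (star S) A)) (a, b) \<cdot> felt A X w" .
qed

end

section \<open>Universal nested words\<close>

context operadic
begin

lemma restr_restr:
  assumes A: "vgraph V A" and w: "w \<in> words V P A Z e" and q: "arr V q Y Z" and y: "arr V y X Y"
  shows "restr_word V y (restr_word V q w) = restr_word V (q \<cdot> y) w"
proof -
  obtain as p xs where w': "w = (as, p, xs)" by (metis prod.collapse)
  note d = w[unfolded w' words_iff[OF A arr_ob2[OF q]]]
  have "(x \<cdot> q) \<cdot> y = x \<cdot> q \<cdot> y" if x: "x \<in> set xs" for x
  proof -
    have "list_all2 (\<lambda>d x. arr V x Z (homs A d)) (steps as) xs" using d by blast
    from list_all2_ex2[OF this x] obtain d' where "arr V x Z (homs A d')" by blast
    then show ?thesis by (rule assoc[OF y q])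
  qed
  then show ?thesis using d assoc[OF y q] by (auto simp: w' restr_word_def)
qed

text \<open>The universal nested word along given outer and inner strings.\<close>

definition nfac :: "'u obj \<Rightarrow> 'u list \<Rightarrow> 'u list list \<Rightarrow> 'u obj list" where
  "nfac A as bss = ar P (length as - 1) # map (\<lambda>bs. Prod V (factors P A bs)) bss"

definition unest :: "'u obj \<Rightarrow> 'u list \<Rightarrow> 'u list list \<Rightarrow> 'u nested" where
  "unest A as bss = (let ps = projs (nfac A as bss) in
     (as, hd ps, map2 (\<lambda>bs q. restr_word V q (uword A bs)) bss (tl ps)))"

lemma length_projs [simp]: "length (projs Bs) = length Bs"
  by (simp add: projs_def)

lemma nfac_ob:
  assumes "vgraph V A" "list_all2 (\<lambda>d bs. bs \<in> paths A d) ds bss"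
  shows "set (nfac A as bss) \<subseteq> Ob V"
proof -
  have "Prod V (factors P A bs) \<in> Ob V" if bs: "bs \<in> set bss" for bs
  proof -
    obtain d where "bs \<in> paths A d" using list_all2_ex2[OF assms(2) bs] by blast
    then show ?thesis by (rule prod_ob[OF factors_ob[OF assms(1)]])
  qed
  then show ?thesis using ar_ob by (auto simp: nfac_def)
qed

lemma unest_nth:
  assumes "i < length bss"
  shows "map2 (\<lambda>bs q. restr_word V q (uword A bs)) bss (tl (projs (nfac A as bss))) ! i =
    restr_word V (Proj V (nfac A as bss) (Suc i)) (uword A (bss ! i))"
  using assms by (simp add: nth_tl projs_def nfac_def del: upt_Suc)

lemma hd_projs: "Bs \<noteq> [] \<Longrightarrow> hd (projs Bs) = Proj V Bs 0"
  by (simp add: projs_def hd_map del: upt_Suc)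

lemma unest_nested:
  assumes A: "vgraph V A" and as: "as \<in> paths A e"
    and bss: "list_all2 (\<lambda>d bs. bs \<in> paths A d) (steps as) bss"
  shows "unest A as bss \<in> nested_words V P A (Prod V (nfac A as bss)) e"
proof -
  let ?Z = "Prod V (nfac A as bss)"
  note ob = nfac_ob[OF A bss, of as]
  have len: "length bss = length as - 1" using bss by (auto dest: list_all2_lengthD)
  have "arr V (hd (projs (nfac A as bss))) ?Z (ar P (length as - 1))"
    using hd_projs[of "nfac A as bss"] proj_arr[OF ob, of 0] by (simp add: nfac_def)
  moreover have "list_all2 (\<lambda>d w. w \<in> words V P A ?Z d) (steps as)
     (map2 (\<lambda>bs q. restr_word V q (uword A bs)) bss (tl (projs (nfac A as bss))))"
    unfolding list_all2_conv_all_nth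
  proof (intro conjI allI impI)
    show "length (steps as) = length (map2 (\<lambda>bs q. restr_word V q (uword A bs)) bss (tl (projs (nfac A as bss))))"
      using len by (simp add: nfac_def)
    fix i assume "i < length (steps as)"
    then have i: "i < length bss" "bss ! i \<in> paths A (steps as ! i)"
      using bss by (auto simp: list_all2_conv_all_nth)
    have "arr V (Proj V (nfac A as bss) (Suc i)) ?Z (Prod V (factors P A (bss ! i)))"
      using proj_arr[OF ob, of "Suc i"] i by (simp add: nfac_def)
    then show "map2 (\<lambda>bs q. restr_word V q (uword A bs)) bss (tl (projs (nfac A as bss))) ! i
        \<in> words V P A ?Z (steps as ! i)"
      unfolding unest_nth[OF i(1)] by (rule words_restr[OF A uword(1)[OF A i(2)]])
  qed
  ultimately show ?thesis
    using as by (simp add: unest_def Let_def nested_words_iff[OF prod_ob[OF ob]])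
qed

text \<open>All components of \<open>y\<close> can be read off from the restricted nested word, so
  they determine \<open>y\<close>; this yields uniqueness in \<open>FF_cocone\<close>.\<close>

lemma unest_restr:
  assumes A: "vgraph V A" and as: "as \<in> paths A e"
    and bss: "list_all2 (\<lambda>d bs. bs \<in> paths A d) (steps as) bss"
    and y: "arr V y X (Prod V (nfac A as bss))"
    and r: "restr_nested V y (unest A as bss) = (as', p, ws)"
  shows "as' = as" "p = Proj V (nfac A as bss) 0 \<cdot> y" "map fst ws = bss"
    "\<And>i. i < length bss \<Longrightarrow> word_elt V P A X (ws ! i) = Proj V (nfac A as bss) (Suc i) \<cdot> y"
proof -
  note ob = nfac_ob[OF A bss, of as]
  have len: "length bss = length as - 1" using bss by (auto dest: list_all2_lengthD)
  show "as' = as" "p = Proj V (nfac A as bss) 0 \<cdot> y"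
    using r hd_projs[of "nfac A as bss"] by (auto simp: restr_nested_def unest_def Let_def nfac_def)
  have ws: "ws = map (restr_word V y) (map2 (\<lambda>bs q. restr_word V q (uword A bs)) bss (tl (projs (nfac A as bss))))"
    using r by (auto simp: restr_nested_def unest_def Let_def)
  have lw: "length ws = length bss" unfolding ws by (simp add: nfac_def)
  have wi: "ws ! i = restr_word V (Proj V (nfac A as bss) (Suc i) \<cdot> y) (uword A (bss ! i)) \<and>
      arr V (Proj V (nfac A as bss) (Suc i) \<cdot> y) X (Prod V (factors P A (bss ! i))) \<and>
      bss ! i \<in> paths A (steps as ! i)" if i: "i < length bss" for i
  proof -
    have b: "bss ! i \<in> paths A (steps as ! i)"
      using bss i by (auto simp: list_all2_conv_all_nth)
    have q: "arr V (Proj V (nfac A as bss) (Suc i)) (Prod V (nfac A as bss)) (Prod V (factors P A (bss ! i)))"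
      using proj_arr[OF ob, of "Suc i"] i by (simp add: nfac_def)
    have "ws ! i = restr_word V y (restr_word V (Proj V (nfac A as bss) (Suc i)) (uword A (bss ! i)))"
      unfolding ws unest_nth[OF i, of A as, symmetric] using i
      by (intro nth_map) (simp add: nfac_def)
    then show ?thesis using restr_restr[OF A uword(1)[OF A b] q y] comp_arr[OF y q] b by simp
  qed
  show "map fst ws = bss"
    by (rule nth_equalityI) (use lw wi in \<open>auto simp: uword_def Let_def\<close>)
  fix i assume i: "i < length bss"
  from wi[OF i] have b: "bss ! i \<in> paths A (steps as ! i)"
    and q: "arr V (Proj V (nfac A as bss) (Suc i) \<cdot> y) X (Prod V (factors P A (bss ! i)))" by auto
  show "word_elt V P A X (ws ! i) = Proj V (nfac A as bss) (Suc i) \<cdot> y"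
    using word_elt_restr[OF A uword(1)[OF A b] q] uword(3)[OF A b] id_left[OF q] wi[OF i] by simp
qed

text \<open>The outer operation together with the classifying maps \<open>word_elt\<close> of the
  inner words forms the map \<open>g\<close> into the product.\<close>

lemma nested_factor:
  assumes A: "vgraph V A" and X: "X \<in> Ob V" and n: "n \<in> nested_words V P A X e"
  obtains as bss g where "as \<in> paths A e" "list_all2 (\<lambda>d bs. bs \<in> paths A d) (steps as) bss"
    "arr V g X (Prod V (nfac A as bss))" "n = restr_nested V g (unest A as bss)"
proof -
  obtain as p ws where n': "n = (as, p, ws)" by (metis prod.collapse)
  note d = n[unfolded n' nested_words_iff[OF X]]
  have ws: "list_all2 (\<lambda>d w. w \<in> words V P A X d) (steps as) ws" using d by blast
  note bss = nested_paths[OF ws]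
  let ?bss = "map fst ws" let ?B = "nfac A as ?bss"
  let ?g = "tuple V X ?B (p # map (word_elt V P A X) ws)"
  have "els X (map (word_elt V P A X) ws) (map (\<lambda>bs. Prod V (factors P A bs)) ?bss)"
    unfolding els_def list_all2_conv_all_nth
  proof (intro conjI allI impI)
    fix i assume "i < length (map (word_elt V P A X) ws)"
    then show "arr V (map (word_elt V P A X) ws ! i) X (map (\<lambda>bs. Prod V (factors P A bs)) ?bss ! i)"
      using word_elt_arr[OF A X, of "ws ! i" "steps as ! i"] ws by (auto simp: list_all2_conv_all_nth)
  qed (use X in auto)
  then have els: "els X (p # map (word_elt V P A X) ws) ?B" using d by (simp add: nfac_def)
  note g = tuple_arr[OF els]
  have as: "as \<in> paths A e" using d by blast
  obtain as' p' ws' where r: "restr_nested V ?g (unest A as ?bss) = (as', p', ws')"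
    by (metis prod.collapse)
  note u = unest_restr[OF A as bss g r]
  have n2: "(as', p', ws') \<in> nested_words V P A X e"
    using nested_restr[OF A unest_nested[OF A as bss] g] r by simp
  then have ws': "list_all2 (\<lambda>d w. w \<in> words V P A X d) (steps as) ws'"
    unfolding nested_words_iff[OF X] u(1) by blast
  have l: "length ws' = length ws" using u(3) by (metis length_map)
  have "ws' = ws"
  proof (rule nth_equalityI[OF l])
    fix i assume i: "i < length ws'"
    show "ws' ! i = ws ! i"
    proof (rule word_elt_inj[OF A X])
      show "ws' ! i \<in> words V P A X (steps as ! i)" "ws ! i \<in> words V P A X (steps as ! i)"
        using ws ws' i l by (auto simp: list_all2_conv_all_nth)
      show "fst (ws' ! i) = fst (ws ! i)" using u(3) i l by (metis nth_map)
      show "word_elt V P A X (ws' ! i) = word_elt V P A X (ws ! i)"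
        using u(4)[of i] proj_tuple[OF els, of "Suc i"] i l by (simp add: nfac_def)
    qed
  qed
  moreover have "p' = p" using u(2) proj_tuple[OF els, of 0] by (simp add: nfac_def)
  ultimately have "n = restr_nested V ?g (unest A as ?bss)" using r u(1) n' by simp
  then show ?thesis using that as bss g by blast
qed

end

context freecat
begin

text \<open>Presents the hom of \<open>F (F A)\<close> as one single coproduct, to which
  \<open>S\<close> can be applied. Applying \<open>S\<close> layer by layer would get stuck at the
  products between the layers, which \<open>S\<close> need not preserve.\<close>

lemma FF_cocone:
  assumes A: "vg A" and e: "e \<in> objs A \<times> objs A"
  shows "cocone V G {Tup as # map Tup bss | as bss. as \<in> paths A e \<and>
      list_all2 (\<lambda>d bs. bs \<in> paths A d) (steps as) bss}
    (\<lambda>\<nu>. Prod V (nfac A (untup (hd \<nu>)) (map untup (tl \<nu>))))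
    (\<lambda>\<nu>. nelt A (Prod V (nfac A (untup (hd \<nu>)) (map untup (tl \<nu>))))
      (unest A (untup (hd \<nu>)) (map untup (tl \<nu>)))) (homs (F (F A)) e)"
    (is "cocone V G ?I ?Z ?u ?B")
proof (rule coconeI)
  have ut: "map untup (map Tup bss) = bss" for bss :: "'a elt list list"
    by (simp add: comp_def)
  have I: "\<nu> \<in> ?I \<Longrightarrow> \<exists>as bss. \<nu> = Tup as # map Tup bss \<and> untup (hd \<nu>) = as \<and> map untup (tl \<nu>) = bss \<and>
      as \<in> paths A e \<and> list_all2 (\<lambda>d bs. bs \<in> paths A d) (steps as) bss" for \<nu>
    using ut by auto
  show "?B \<in> Ob V" using vgraphD'[OF F_vg[OF F_vg[OF A]]] e by simp
  show "arr V (?u \<nu>) (?Z \<nu>) ?B" if "\<nu> \<in> ?I" for \<nu>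
  proof -
    obtain as bss where n: "untup (hd \<nu>) = as" "map untup (tl \<nu>) = bss" "as \<in> paths A e"
      "list_all2 (\<lambda>d bs. bs \<in> paths A d) (steps as) bss" using I[OF \<open>\<nu> \<in> ?I\<close>] by blast
    show ?thesis unfolding n(1,2)
      by (rule nelt_arr[OF A prod_ob[OF nfac_ob[OF A n(4)]] unest_nested[OF A n(3,4)]])
  qed
  show "\<exists>\<nu> y. \<nu> \<in> ?I \<and> arr V y X (?Z \<nu>) \<and> x = ?u \<nu> \<cdot> y" if X: "X \<in> G" and x: "arr V x X ?B" for X x
  proof -
    obtain n where n: "n \<in> nested_words V R A X e" "x = nelt A X n"
      using nelt_surj[OF A X x e] by blast
    obtain as bss g where g: "as \<in> paths A e" "list_all2 (\<lambda>d bs. bs \<in> paths A d) (steps as) bss"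
      "arr V g X (Prod V (nfac A as bss))" "n = restr_nested V g (unest A as bss)"
      using nested_factor[OF A probeD[OF X] n(1)] by blast
    let ?\<nu> = "Tup as # map Tup bss"
    have e: "untup (hd ?\<nu>) = as" "map untup (tl ?\<nu>) = bss" using ut by auto
    have "?\<nu> \<in> ?I" using g by blast
    moreover have "arr V g X (?Z ?\<nu>)" unfolding e by (rule g(3))
    moreover have "x = ?u ?\<nu> \<cdot> g"
      unfolding e using nelt_restr[OF A unest_nested[OF A g(1,2)] g(3)] n g by simp
    ultimately show ?thesis by blast
  qed
  show "i = j \<and> y = z" if X: "X \<in> G" and ij: "i \<in> ?I" "j \<in> ?I" and y': "arr V y X (?Z i)"
    and z': "arr V z X (?Z j)" and eq: "?u i \<cdot> y = ?u j \<cdot> z" for X i y j z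
  proof -
    obtain as bss where i: "i = Tup as # map Tup bss" "untup (hd i) = as" "map untup (tl i) = bss"
      "as \<in> paths A e" "list_all2 (\<lambda>d bs. bs \<in> paths A d) (steps as) bss" using I[OF ij(1)] by blast
    obtain as' bss' where j: "j = Tup as' # map Tup bss'" "untup (hd j) = as'" "map untup (tl j) = bss'"
      "as' \<in> paths A e" "list_all2 (\<lambda>d bs. bs \<in> paths A d) (steps as') bss'" using I[OF ij(2)] by blast
    note y = y'[unfolded i(2,3)] and z = z'[unfolded j(2,3)]
    note ui = unest_nested[OF A i(4,5)] and uj = unest_nested[OF A j(4,5)]
    have "nelt A X (restr_nested V y (unest A as bss)) = nelt A X (restr_nested V z (unest A as' bss'))"
      using eq nelt_restr[OF A ui y] nelt_restr[OF A uj z] unfolding i(2,3) j(2,3) by simp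
    then have rr: "restr_nested V y (unest A as bss) = restr_nested V z (unest A as' bss')"
      by (rule nelt_inj[OF A X nested_restr[OF A ui y] nested_restr[OF A uj z]])
    obtain as0 p0 ws0 where r: "restr_nested V y (unest A as bss) = (as0, p0, ws0)"
      by (metis prod.collapse)
    note u1 = unest_restr[OF A i(4,5) y r] and u2 = unest_restr[OF A j(4,5) z r[unfolded rr]]
    have ab: "as = as'" "bss = bss'" using u1 u2 by auto
    have "y = z"
    proof (rule tuple_eqI[OF y z[folded ab] nfac_ob[OF A i(5)]])
      fix k assume "k < length (nfac A as bss)"
      then show "Proj V (nfac A as bss) k \<cdot> y = Proj V (nfac A as bss) k \<cdot> z"
        using u1(2) u2(2) u1(4) u2(4) ab by (cases k) (auto simp: nfac_def)
    qed
    then show ?thesis using ab i j by simp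
  qed
qed

end

section \<open>The multiplication axioms of the law\<close>

context opalg
begin

lemma SFF_surj:
  assumes A: "vg A" and X: "X \<in> G" and x: "arr V x X (fob S (homs (F (F A)) e))" and e: "e \<in> objs A \<times> objs A"
  shows "\<exists>Y n z. Y \<in> Ob V \<and> n \<in> nested_words V R A Y e \<and> arr V z X (fob S Y) \<and>
    x = fmap S Y (homs (F (F A)) e) (nelt A Y n) \<cdot> z"
proof -
  let ?Z = "\<lambda>\<nu>. Prod V (nfac A (untup (hd \<nu>)) (map untup (tl \<nu>)))"
  let ?u = "\<lambda>\<nu>. nelt A (?Z \<nu>) (unest A (untup (hd \<nu>)) (map untup (tl \<nu>)))"
  obtain \<nu> z where \<nu>: "\<nu> \<in> {Tup as # map Tup bss | as bss. as \<in> paths A e \<and>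
      list_all2 (\<lambda>d bs. bs \<in> paths A d) (steps as) bss}"
    and z: "arr V z X (fob S (?Z \<nu>))" and xz: "x = fmap S (?Z \<nu>) (homs (F (F A)) e) (?u \<nu>) \<cdot> z"
    using cocone_ex[OF presD[OF pr FF_cocone[OF A e]] X x] .
  obtain as bss where n: "\<nu> = Tup as # map Tup bss" and as: "as \<in> paths A e"
    "list_all2 (\<lambda>d bs. bs \<in> paths A d) (steps as) bss" using \<nu> by blast
  have e: "untup (hd \<nu>) = as" "map untup (tl \<nu>) = bss" unfolding n by (simp_all add: comp_def)
  show ?thesis
    using z xz unest_nested[OF A as] prod_ob[OF nfac_ob[OF A as(2)]] unfolding e by blast
qed

definition snest :: "'a elt obj \<Rightarrow> 'a elt mor \<Rightarrow> 'a elt obj \<Rightarrow> 'a elt nested \<Rightarrow> 'a elt nested" where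
  "snest Y z A = (\<lambda>(as, p, ws). (as, opl (length as - 1) Y p z, map (swd Y z A) ws))"

lemma snest_nested:
  assumes A: "vg A" and n: "n \<in> nested_words V R A Y e" and z: "arr V z X (fob S Y)" and Y: "Y \<in> Ob V"
  shows "snest Y z A n \<in> nested_words V R (SG A) X e"
proof -
  obtain as p ws where n': "n = (as, p, ws)" by (metis prod.collapse)
  show ?thesis
    using n[unfolded n' nested_words_iff[OF Y]] opl_arr[OF _ z] swd_words[OF A _ z Y]
    by (auto simp: n' snest_def nested_words_iff[OF arr_ob1[OF z]] list_all2_map2 elim!: list_all2_mono)
qed

text \<open>The law for the outer layer followed by the law for the letters treats both layers of a
  nested word; this evaluates the longer side of the axiom for \<open>mu fcm\<close>.\<close>

lemma swd_wnest:
  assumes A: "vg A" and n: "n \<in> nested_words V R A Y e" and z: "arr V z X (fob S Y)" and Y: "Y \<in> Ob V"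
  shows "map_word V (lam A) (swd Y z (F A) (wnest A Y n)) = wnest (SG A) X (snest Y z A n)"
proof -
  obtain as p ws where n': "n = (as, p, ws)" by (metis prod.collapse)
  note d = n[unfolded n' nested_words_iff[OF Y]]
  have ws: "list_all2 (\<lambda>d w. w \<in> words V R A Y d) (steps as) ws" using d by blast
  have "map2 (\<lambda>d x. happ (lam A) d \<cdot> x) (steps as)
      (map2 (\<lambda>d x. fmap S Y (homs (F A) d) x \<cdot> z) (steps as) (map (felt A Y) ws)) =
    map (felt (SG A) X) (map (swd Y z A) ws)"
  proof -
    have H: "happ (lam A) d \<cdot> fmap S Y (homs (F A) d) (felt A Y w) \<cdot> z = felt (SG A) X (swd Y z A w)"
      if "w \<in> words V R A Y d" for d w
      using lam_elt(2)[OF A _ _ Y, of "fst d" "snd d" w z X] words_pathsD[OF that] that z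
      by (cases d) auto
    show ?thesis using ws by (induction rule: list_all2_induct) (auto simp: H)
  qed
  moreover have "map (app (lam A)) as = as"
    using pathsD[OF d[THEN conjunct1]] by (intro map_idI) auto
  ultimately show ?thesis by (simp add: n' wnest_def snest_def swd_def map_word_def)
qed

text \<open>On operations this is \<open>al_comp\<close>, that composition in \<open>R\<close> is an
  algebra morphism; the letters are transformed one by one and only concatenated.\<close>

lemma swd_flatten:
  assumes A: "vg A" and n: "n \<in> nested_words V R A Y e" and z: "arr V z X (fob S Y)" and Y: "Y \<in> Ob V"
  shows "swd Y z A (flatten V R Y n) = flatten V R X (snest Y z A n)"
proof -
  obtain as p ws where n': "n = (as, p, ws)" by (metis prod.collapse)
  note d = n[unfolded n' nested_words_iff[OF Y]]
  have as: "as \<in> paths A e" and ws: "list_all2 (\<lambda>d w. w \<in> words V R A Y d) (steps as) ws" using d by auto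
  have f: "fits as (map fst ws)"
    using fits_paths[OF _ nested_paths[OF ws]] pathsD[OF as] by blast
  have len: "length ws = length as - 1" using ws by (auto dest: list_all2_lengthD)
  have l: "length (steps (fst w)) = length (snd (snd w))" if w: "w \<in> set ws" for w
  proof -
    obtain d where "w \<in> words V R A Y d" using list_all2_ex2[OF ws w] by blast
    then show ?thesis by (cases w) (auto simp: words_def dest: list_all2_lengthD)
  qed
  let ?ps = "map (\<lambda>w. (length (fst w) - 1, fst (snd w))) ws"
  have c: "opl (sum_list (map fst ?ps)) Y (comp_elt V R Y p ?ps) z =
      comp_elt V R X (opl (length as - 1) Y p z) (map (\<lambda>(k, q). (k, opl k Y q z)) ?ps)"
  proof -
    have p: "arr V p Y (ar R (length ?ps))" using d len by simp
    have q: "arr V q Y (ar R k)" if "(k, q) \<in> set ?ps" for k q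
      using that nested_arr[OF A Y ws] by auto
    show ?thesis using al_comp[OF p q z] len unfolding opl_def by simp
  qed
  have g: "length (graft as (map fst ws)) - 1 = sum_list (map fst ?ps)"
      "steps (graft as (map fst ws)) = concat (map steps (map fst ws))"
    using graft_props[OF f] by (auto simp: comp_def)
  have "concat (map (\<lambda>w. map2 (\<lambda>d x. fmap S Y (homs A d) x \<cdot> z) (steps (fst w)) (snd (snd w))) ws) =
     map2 (\<lambda>d x. fmap S Y (homs A d) x \<cdot> z) (concat (map steps (map fst ws))) (concat (map (snd \<circ> snd) ws))"
    using l by (induction ws) (auto simp: comp_def zip_append)
  then show ?thesis
    unfolding n' snest_def prod.case flatten_eq swd_def[of Y z A] split_beta fst_conv snd_conv g c
    by (simp add: comp_def case_prod_beta)
qed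

lemma lam_mu_fc:
  assumes A: "vg A"
  shows "gComp V (lam A) (fmap (star S) (F (F A)) (F A) (mu fcm A)) =
    gComp V (mu fcm (SG A)) (gComp V (fmap fcm (SG (F A)) (F (SG A)) (lam A)) (lam (F A)))"
proof (rule gext)
  note v = F_vg[OF A] F_vg[OF F_vg[OF A]] star_vg[OF A] star_vg[OF F_vg[OF A]] star_vg[OF F_vg[OF F_vg[OF A]]]
    F_vg[OF star_vg[OF A]] F_vg[OF star_vg[OF F_vg[OF A]]] F_vg[OF F_vg[OF star_vg[OF A]]]
  note m = mu_fc[OF A] and m' = mu_fc[OF v(3)] and l = lam_hom[OF A] and l' = lam_hom[OF v(1)]
  note sm = star_hom[OF m(1) v(2,1)] and fl = fmap_fc[OF l v(4,6)]
  note fll = gComp_hom[OF l' fl(1) v(5,7,8)]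
  show "gComp V (lam A) (fmap (star S) (F (F A)) (F A) (mu fcm A)) \<in> gHom V (SG (F (F A))) (F (SG A))"
    by (rule gComp_hom[OF sm l v(5,4,6)])
  show "gComp V (mu fcm (SG A)) (gComp V (fmap fcm (SG (F A)) (F (SG A)) (lam A)) (lam (F A)))
      \<in> gHom V (SG (F (F A))) (F (SG A))"
    by (rule gComp_hom[OF fll m'(1) v(5,8,6)])
  show "vg (SG (F (F A)))" "vg (F (SG A))" by (rule v)+
  show "app (gComp V (lam A) (fmap (star S) (F (F A)) (F A) (mu fcm A))) a =
      app (gComp V (mu fcm (SG A)) (gComp V (fmap fcm (SG (F A)) (F (SG A)) (lam A)) (lam (F A)))) a"
    if "a \<in> objs (SG (F (F A)))" for a
    using that by (simp add: m(2) m'(2) fl(2))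
  fix a b X x assume ab': "a \<in> objs (SG (F (F A)))" "b \<in> objs (SG (F (F A)))" and XG: "X \<in> G"
    and x': "arr V x X (homs (SG (F (F A))) (a, b))"
  note X = probeD[OF XG]
  have ab: "a \<in> objs A" "b \<in> objs A" using ab' by auto
  obtain Y n z where Y: "Y \<in> Ob V" and n: "n \<in> nested_words V R A Y (a, b)" and z: "arr V z X (fob S Y)"
     and x: "x = fmap S Y (homs (F (F A)) (a, b)) (nelt A Y n) \<cdot> z"
    using SFF_surj[OF A XG, of x "(a, b)"] x' ab by auto
  have fn: "flatten V R Y n \<in> words V R A Y (a, b)" using flatten_words[OF A Y] n by (cases n) auto
  have hm: "arr V (happ (mu fcm A) (a, b)) (homs (F (F A)) (a, b)) (homs (F A) (a, b))"
    using happ_arr[OF m(1) v(2,1)] ab by (simp add: m(2))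
  note sn = snest_nested[OF A n z Y] and wn = wnest_words[OF A Y n]
  have "happ (gComp V (lam A) (fmap (star S) (F (F A)) (F A) (mu fcm A))) (a, b) \<cdot> x =
      happ (lam A) (a, b) \<cdot> fmap S (homs (F (F A)) (a, b)) (homs (F A) (a, b)) (happ (mu fcm A) (a, b)) \<cdot> x"
    using happ_comp[OF sm l v(5,4,6) ab' x'] ab by (simp add: m(2))
  also have "\<dots> = happ (lam A) (a, b) \<cdot> fmap S Y (homs (F A) (a, b)) (felt A Y (flatten V R Y n)) \<cdot> z"
    using S_comp_elt[OF nelt_arr[OF A Y n] hm z] m(3)[OF Y n] x by simp
  also have "\<dots> = felt (SG A) X (flatten V R X (snest Y z A n))"
    using lam_elt(2)[OF A ab Y fn z] swd_flatten[OF A n z Y] by simp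
  also have "\<dots> = happ (mu fcm (SG A)) (a, b) \<cdot> felt (F (SG A)) X (map_word V (lam A) (swd Y z (F A) (wnest A Y n)))"
    using m'(3)[OF X sn] swd_wnest[OF A n z Y] by simp
  also have "\<dots> = happ (mu fcm (SG A)) (a, b) \<cdot> happ (fmap fcm (SG (F A)) (F (SG A)) (lam A)) (a, b) \<cdot>
      happ (lam (F A)) (a, b) \<cdot> x"
    using fl(3)[OF X swd_words[OF v(1) wn z Y]] lam_elt(2)[OF v(1) _ _ Y wn z] ab x by simp
  also have "\<dots> = happ (gComp V (mu fcm (SG A)) (gComp V (fmap fcm (SG (F A)) (F (SG A)) (lam A)) (lam (F A)))) (a, b) \<cdot> x"
    using happ_comp[OF fll m'(1) v(5,8,6) ab' x'] happ_comp[OF l' fl(1) v(5,7,8) ab' x'] ab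
    by (simp add: fl(2))
  finally show "happ (gComp V (lam A) (fmap (star S) (F (F A)) (F A) (mu fcm A))) (a, b) \<cdot> x =
      happ (gComp V (mu fcm (SG A)) (gComp V (fmap fcm (SG (F A)) (F (SG A)) (lam A)) (lam (F A)))) (a, b) \<cdot> x" .
qed

text \<open>The second monad \<open>S'\<close> is \<open>S\<close> itself in the axiom for
  \<open>mu S\<close>, and the other monad in the Yang--Baxter equation.\<close>

lemma SSF_surj:
  assumes A: "vg A" and X: "X \<in> G" and e: "e \<in> objs A \<times> objs A" and pr': "pres V G S'"
    and x: "arr V x X (fob S' (fob S (homs (F A) e)))"
  shows "\<exists>Y w z. Y \<in> Ob V \<and> w \<in> words V R A Y e \<and> arr V z X (fob S' (fob S Y)) \<and>
    x = fmap S' (fob S Y) (fob S (homs (F A) e)) (fmap S Y (homs (F A) e) (felt A Y w)) \<cdot> z"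
proof -
  obtain as z where as: "as \<in> paths A e" "arr V z X (fob S' (fob S (Prod V (factors R A as))))"
    "x = fmap S' (fob S (Prod V (factors R A as))) (fob S (homs (F A) e)) (fmap S (Prod V (factors R A as)) (homs (F A) e)
      (Incl V (paths A e) (\<lambda>as. Prod V (factors R A as)) as)) \<cdot> z"
    using cocone_ex[OF presD[OF pr' SF_cocone[OF A e]] X x] by blast
  then show ?thesis
    using uword(1)[OF A as(1)] felt_uword[OF A as(1)] prod_ob[OF factors_ob[OF A as(1)]]
    by (intro exI[of _ "Prod V (factors R A as)"] exI[of _ "uword A as"] exI[of _ z]) simp
qed

text \<open>The formula with the identity for \<open>z\<close>: it describes the law before it is
  evaluated at an element, as needed when a further functor is applied to it.\<close>

lemma lam_elt_id:
  assumes A: "vg A" and ab: "a \<in> objs A" "b \<in> objs A" and Y: "Y \<in> Ob V" and w: "w \<in> words V R A Y (a, b)"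
  shows "happ (lam A) (a, b) \<cdot> fmap S Y (homs (F A) (a, b)) (felt A Y w) =
    felt (SG A) (fob S Y) (swd Y (Id V (fob S Y)) A w)"
    "swd Y (Id V (fob S Y)) A w \<in> words V R (SG A) (fob S Y) (a, b)"
  using lam_elt(2)[OF A ab Y w id_arr[OF S_ob[OF Y]]] id_right[OF S_arr[OF felt_arr[OF A Y w]]]
    swd_words[OF A w id_arr[OF S_ob[OF Y]] Y] by simp_all

lemma opl_id: "arr V p Y (ar R k) \<Longrightarrow> opl k Y p (Id V (fob S Y)) = al k \<cdot> fmap S Y (ar R k) p"
  unfolding opl_def by (simp add: id_right[OF S_arr])

text \<open>Both sides amount to replacing \<open>z\<close> by \<open>mu S Y\<close> after
  \<open>z\<close>: on letters by naturality of \<open>mu\<close> (\<open>mun\<close>), on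
  operations by \<open>al_mu\<close>.\<close>

lemma lam_mu_S:
  assumes A: "vg A"
  shows "gComp V (lam A) (mu (star S) (F A)) =
    gComp V (fmap fcm (SG (SG A)) (SG A) (mu (star S) A)) (gComp V (lam (SG A)) (fmap (star S) (SG (F A)) (F (SG A)) (lam A)))"
proof (rule gext)
  note v = F_vg[OF A] star_vg[OF A] star_vg[OF F_vg[OF A]] star_vg[OF star_vg[OF F_vg[OF A]]]
    F_vg[OF star_vg[OF A]] star_vg[OF F_vg[OF star_vg[OF A]]] star_vg[OF star_vg[OF A]] F_vg[OF star_vg[OF star_vg[OF A]]]
  have mF: "mu (star S) (F A) \<in> gHom V (SG (SG (F A))) (SG (F A))"
    unfolding mu_star by (rule gpt_hom[OF v(1)]) (use mu_arr vgraphD[OF v(1)] in auto)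
  have mA: "mu (star S) A \<in> gHom V (SG (SG A)) (SG A)"
    unfolding mu_star by (rule gpt_hom[OF A]) (use mu_arr vgraphD[OF A] in auto)
  note l = lam_hom[OF A] and l' = lam_hom[OF v(2)]
  note sl = star_hom[OF l v(3,5)] and fm = fmap_fc[OF mA v(7,2)]
  note ll = gComp_hom[OF sl l' v(4,6,8)]
  show "gComp V (lam A) (mu (star S) (F A)) \<in> gHom V (SG (SG (F A))) (F (SG A))"
    by (rule gComp_hom[OF mF l v(4,3,5)])
  show "gComp V (fmap fcm (SG (SG A)) (SG A) (mu (star S) A)) (gComp V (lam (SG A)) (fmap (star S) (SG (F A)) (F (SG A)) (lam A)))
     \<in> gHom V (SG (SG (F A))) (F (SG A))"
    by (rule gComp_hom[OF ll fm(1) v(4,8,5)])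
  show "vg (SG (SG (F A)))" "vg (F (SG A))" by (rule v)+
  show "app (gComp V (lam A) (mu (star S) (F A))) a = app (gComp V (fmap fcm (SG (SG A)) (SG A) (mu (star S) A))
      (gComp V (lam (SG A)) (fmap (star S) (SG (F A)) (F (SG A)) (lam A)))) a"
    if "a \<in> objs (SG (SG (F A)))" for a
    using that by (simp add: fm(2)[simplified])
  fix a b X x assume ab': "a \<in> objs (SG (SG (F A)))" "b \<in> objs (SG (SG (F A)))" and XG: "X \<in> G"
    and x': "arr V x X (homs (SG (SG (F A))) (a, b))"
  note X = probeD[OF XG]
  have ab: "a \<in> objs A" "b \<in> objs A" using ab' by auto
  let ?H = "homs (F A) (a, b)"
  obtain Y w z where Y: "Y \<in> Ob V" and w: "w \<in> words V R A Y (a, b)" and z: "arr V z X (fob S (fob S Y))"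
     and x: "x = fmap S (fob S Y) (fob S ?H) (fmap S Y ?H (felt A Y w)) \<cdot> z"
    using SSF_surj[OF A XG _ pr, of "(a, b)" x] x' ab by auto
  note SY = S_ob[OF Y] and fw = felt_arr[OF A Y w]
  have mz: "arr V (mu S Y \<cdot> z) X (fob S Y)" by (rule comp_arr[OF z mu_arr[OF Y]])
  let ?i = "Id V (fob S Y)"
  note wi = lam_elt_id[OF A ab Y w]
  obtain as p xs where w': "w = (as, p, xs)" by (metis prod.collapse)
  note d = w[unfolded w' words_iff[OF A Y]]
  have xs: "length xs = length as - 1" using d by (auto dest: list_all2_lengthD)
  have p: "arr V p Y (ar R (length as - 1))" using d by blast
  have mun: "mu S C \<cdot> fmap S (fob S Y) (fob S C) (fmap S Y C f) \<cdot> z = fmap S Y C f \<cdot> mu S Y \<cdot> z"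
    if f: "arr V f Y C" for f C
    using mu_nat[OF f] assoc[OF z S_arr[OF S_arr[OF f]] mu_arr[OF arr_ob2[OF f]]]
      assoc[OF z mu_arr[OF Y] S_arr[OF f]] by simp
  have "opl (length as - 1) (fob S Y) (opl (length as - 1) Y p ?i) z =
      al (length as - 1) \<cdot> fmap S (fob S (ar R (length as - 1))) (ar R (length as - 1)) (al (length as - 1)) \<cdot>
        fmap S (fob S Y) (fob S (ar R (length as - 1))) (fmap S Y (ar R (length as - 1)) p) \<cdot> z"
    unfolding opl_id[OF p] unfolding opl_def using S_comp_elt[OF S_arr[OF p] al_arr z] by simp
  also have "\<dots> = al (length as - 1) \<cdot> mu S (ar R (length as - 1)) \<cdot>
      fmap S (fob S Y) (fob S (ar R (length as - 1))) (fmap S Y (ar R (length as - 1)) p) \<cdot> z"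
    using assoc[OF S_elt_arr[OF S_arr[OF p] z] S_arr[OF al_arr] al_arr]
      assoc[OF S_elt_arr[OF S_arr[OF p] z] mu_arr[OF ar_ob] al_arr] al_mu by simp
  also have "\<dots> = opl (length as - 1) Y p (mu S Y \<cdot> z)"
    unfolding opl_def mun[OF p] ..
  finally have pp: "opl (length as - 1) (fob S Y) (opl (length as - 1) Y p ?i) z =
      opl (length as - 1) Y p (mu S Y \<cdot> z)" .
  have "map2 (\<lambda>d x. happ (mu (star S) A) d \<cdot> x) (steps as)
      (map2 (\<lambda>d x. fmap S (fob S Y) (homs (SG A) d) x \<cdot> z) (steps as)
        (map2 (\<lambda>d x. fmap S Y (homs A d) x \<cdot> ?i) (steps as) xs)) =
     map2 (\<lambda>d x. fmap S Y (homs A d) x \<cdot> (mu S Y \<cdot> z)) (steps as) xs"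
    by (rule nth_equalityI)
      (use words_xs[OF A Y w[unfolded w']] xs mun in \<open>auto simp: id_right[OF S_arr]\<close>)
  moreover have "map (app (mu (star S) A)) as = as"
    using pathsD[OF d[THEN conjunct1]] by (intro map_idI) auto
  ultimately have sw: "map_word V (mu (star S) A) (swd (fob S Y) z (SG A) (swd Y ?i A w)) = swd Y (mu S Y \<cdot> z) A w"
    using pp by (simp add: w' swd_def map_word_def)
  have hl: "arr V (happ (lam A) (a, b)) (fob S ?H) (homs (F (SG A)) (a, b))" by (rule lam_elt(1)[OF A ab])
  have "happ (gComp V (lam A) (mu (star S) (F A))) (a, b) \<cdot> x = happ (lam A) (a, b) \<cdot> mu S ?H \<cdot> x"
    using happ_comp[OF mF l v(4,3,5) ab' x'] ab by simp
  also have "\<dots> = felt (SG A) X (swd Y (mu S Y \<cdot> z) A w)"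
    unfolding x mun[OF fw] by (rule lam_elt(2)[OF A ab Y w mz])
  also have "\<dots> = happ (fmap fcm (SG (SG A)) (SG A) (mu (star S) A)) (a, b) \<cdot>
      felt (SG (SG A)) X (swd (fob S Y) z (SG A) (swd Y ?i A w))"
    using fm(3)[OF X swd_words[OF v(2) wi(2) z SY]] sw by simp
  also have "\<dots> = happ (fmap fcm (SG (SG A)) (SG A) (mu (star S) A)) (a, b) \<cdot> happ (lam (SG A)) (a, b) \<cdot>
      fmap S (fob S Y) (homs (F (SG A)) (a, b)) (felt (SG A) (fob S Y) (swd Y ?i A w)) \<cdot> z"
    using lam_elt(2)[OF v(2) _ _ SY wi(2) z] ab by simp
  also have "\<dots> = happ (fmap fcm (SG (SG A)) (SG A) (mu (star S) A)) (a, b) \<cdot> happ (lam (SG A)) (a, b) \<cdot>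
      fmap S (fob S ?H) (homs (F (SG A)) (a, b)) (happ (lam A) (a, b)) \<cdot> x"
    using S_comp_elt[OF S_arr[OF fw] hl z] wi(1) x by simp
  also have "\<dots> = happ (gComp V (fmap fcm (SG (SG A)) (SG A) (mu (star S) A))
      (gComp V (lam (SG A)) (fmap (star S) (SG (F A)) (F (SG A)) (lam A)))) (a, b) \<cdot> x"
    using happ_comp[OF ll fm(1) v(4,8,5) ab' x'] happ_comp[OF sl l' v(4,6,8) ab' x'] ab by simp
  finally show "happ (gComp V (lam A) (mu (star S) (F A))) (a, b) \<cdot> x =
      happ (gComp V (fmap fcm (SG (SG A)) (SG A) (mu (star S) A))
        (gComp V (lam (SG A)) (fmap (star S) (SG (F A)) (F (SG A)) (lam A)))) (a, b) \<cdot> x" .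
qed

lemma lam_distributive: "distributive_law (gph V) (star S) fcm lam"
  unfolding distributive_law_def natural_def comp_endo_def gph_simps endo.simps fob_fc
  using lam_hom lam_natural lam_eta_fc lam_eta_S lam_mu_fc lam_mu_S gOb_vg by auto

end

text \<open>An element is given by a word \<open>w\<close> at \<open>Y\<close> and
  \<open>z : X -> S1 (S2 Y)\<close>. One side first swaps \<open>z\<close> by
  \<open>\<delta> Y\<close>, the other swaps the resulting letters at the end. Letters agree by
  naturality of \<open>\<delta>\<close>, operations by \<open>compat\<close>.\<close>

lemma lam_yang_baxter:
  assumes 1: "opalg V G R S1 al1" and 2: "opalg V G R S2 al2" and \<delta>: "distributive_law V S1 S2 \<delta>"
    and compat: "\<And>k. Comp V (al2 k) (Comp V (fmap S2 (fob S1 (ar R k)) (ar R k) (al1 k)) (\<delta> (ar R k))) =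
      Comp V (al1 k) (fmap S1 (fob S2 (ar R k)) (ar R k) (al2 k))"
    and AA: "A \<in> Ob (gph V)"
  shows "yb_at (gph V) (star S1) (star S2) (fc V R) (gpt \<delta>) (opalg.lam V R S1 al1) (opalg.lam V R S2 al2) A"
proof -
  interpret A: opalg V G R S1 al1 by fact
  interpret B: opalg V G R S2 al2 by fact
  note vA = A.gOb_vg[OF AA]
  have \<delta>a: "arr V (\<delta> C) (fob S1 (fob S2 C)) (fob S2 (fob S1 C))" if "C \<in> Ob V" for C
    using \<delta> that A.S_ob B.S_ob by (auto simp: distributive_law_def natural_def comp_endo_def arr_def)
  have \<delta>n: "Comp V (\<delta> C) (fmap S1 (fob S2 B) (fob S2 C) (fmap S2 B C f)) =
      Comp V (fmap S2 (fob S1 B) (fob S1 C) (fmap S1 B C f)) (\<delta> B)" if "arr V f B C" for f B C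
    using \<delta> that by (auto simp: distributive_law_def natural_def comp_endo_def arr_def)
  note fv = A.F_vg and s1 = A.star_vg and s2 = B.star_vg
  have \<delta>hom: "gpt \<delta> C \<in> gHom V (A.SG (B.SG C)) (B.SG (A.SG C))" if C: "vgraph V C" for C
    by (rule A.gpt_hom[OF C]) (use \<delta>a vgraphD[OF C] in auto)
  have \<delta>homF: "gpt \<delta> (A.F A) \<in> gHom V (A.SG (B.SG (A.F A))) (B.SG (A.SG (A.F A)))"
    by (rule \<delta>hom[OF fv[OF vA]])
  note l1 = A.lam_hom[OF vA] and l2 = B.lam_hom[OF vA]
  note l1' = A.lam_hom[OF s2[OF vA]] and l2' = B.lam_hom[OF s1[OF vA]]
  note sl1 = B.star_hom[OF l1 s1[OF fv[OF vA]] fv[OF s1[OF vA]]]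
  note sl2 = A.star_hom[OF l2 s2[OF fv[OF vA]] fv[OF s2[OF vA]]]
  note f\<delta> = A.fmap_fc[OF \<delta>hom[OF vA] s1[OF s2[OF vA]] s2[OF s1[OF vA]]]
  note v0 = s1[OF s2[OF fv[OF vA]]] and v1 = s2[OF s1[OF fv[OF vA]]] and v2 = s2[OF fv[OF s1[OF vA]]]
    and v3 = fv[OF s2[OF s1[OF vA]]] and v4 = s1[OF fv[OF s2[OF vA]]] and v5 = fv[OF s1[OF s2[OF vA]]]
  note c1 = A.gComp_hom[OF \<delta>homF sl1 v0 v1 v2] and c2 = A.gComp_hom[OF sl2 l1' v0 v4 v5]
  show ?thesis
    unfolding yb_at_def A.gph_simps A.fob_fc
  proof (rule A.gext)
    let ?L = "gComp V (B.lam (A.SG A)) (gComp V (fmap (star S2) (A.SG (A.F A)) (A.F (A.SG A)) (A.lam A)) (gpt \<delta> (A.F A)))"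
    let ?R = "gComp V (fmap A.fcm (A.SG (B.SG A)) (B.SG (A.SG A)) (gpt \<delta> A))
      (gComp V (A.lam (B.SG A)) (fmap (star S1) (B.SG (A.F A)) (A.F (B.SG A)) (B.lam A)))"
    show "?L \<in> gHom V (A.SG (B.SG (A.F A))) (A.F (B.SG (A.SG A)))"
      by (rule A.gComp_hom[OF c1 l2' v0 v2 v3])
    show "?R \<in> gHom V (A.SG (B.SG (A.F A))) (A.F (B.SG (A.SG A)))"
      by (rule A.gComp_hom[OF c2 f\<delta>(1) v0 v5 v3])
    show "vgraph V (A.SG (B.SG (A.F A)))" "vgraph V (A.F (B.SG (A.SG A)))" by (rule v0 v3)+
    show "app ?L a = app ?R a" if "a \<in> objs (A.SG (B.SG (A.F A)))" for a
      using that by (simp add: f\<delta>(2))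
    fix a b X x assume ab': "a \<in> objs (A.SG (B.SG (A.F A)))" "b \<in> objs (A.SG (B.SG (A.F A)))" and XG: "X \<in> G"
      and x': "arr V x X (homs (A.SG (B.SG (A.F A))) (a, b))"
    note X = A.probeD[OF XG]
    have ab: "a \<in> objs A" "b \<in> objs A" using ab' by auto
    let ?H = "homs (A.F A) (a, b)"
    obtain Y w z where Y: "Y \<in> Ob V" and w: "w \<in> words V R A Y (a, b)" and z: "arr V z X (fob S1 (fob S2 Y))"
      and x: "x = Comp V (fmap S1 (fob S2 Y) (fob S2 ?H) (fmap S2 Y ?H (A.felt A Y w))) z"
      using B.SSF_surj[OF vA XG _ A.pr, of "(a, b)" x] x' ab by auto
    note Y1 = A.S_ob[OF Y] and Y2 = B.S_ob[OF Y] and fw = A.felt_arr[OF vA Y w]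
    let ?z = "Comp V (\<delta> Y) z"
    have z2: "arr V ?z X (fob S2 (fob S1 Y))" by (rule A.comp_arr[OF z \<delta>a[OF Y]])
    have dn: "Comp V (\<delta> C) (Comp V (fmap S1 (fob S2 Y) (fob S2 C) (fmap S2 Y C f)) z) =
        Comp V (fmap S2 (fob S1 Y) (fob S1 C) (fmap S1 Y C f)) ?z" if f: "arr V f Y C" for f C
      using \<delta>n[OF f] A.assoc[OF z A.S_arr[OF B.S_arr[OF f]] \<delta>a[OF arr_ob2[OF f]]]
        A.assoc[OF z \<delta>a[OF Y] B.S_arr[OF A.S_arr[OF f]]] by simp
    note w1 = A.lam_elt_id[OF vA ab Y w] and w2 = B.lam_elt_id[OF vA ab Y w]
    let ?w1 = "A.swd Y (Id V (fob S1 Y)) A w" and ?w2 = "B.swd Y (Id V (fob S2 Y)) A w"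
    obtain as p xs where w': "w = (as, p, xs)" by (metis prod.collapse)
    note d = w[unfolded w' A.words_iff[OF vA Y]]
    have xs: "length xs = length as - 1" using d by (auto dest: list_all2_lengthD)
    define k where "k = length as - 1"
    have p: "arr V p Y (ar R k)" using d by (simp add: k_def)
    have rk: "arr V (fmap S1 (fob S2 Y) (fob S2 (ar R k)) (fmap S2 Y (ar R k) p)) (fob S1 (fob S2 Y)) (fob S1 (fob S2 (ar R k)))"
      by (rule A.S_arr[OF B.S_arr[OF p]])
    note rz = A.comp_arr[OF z rk]
    \<comment> \<open>On the operation, naturality moves \<open>\<delta>\<close> from
      \<open>Y\<close> to \<open>ar R k\<close>, where \<open>compat\<close> exchanges the two
      actions.\<close>
    have "B.opl k (fob S1 Y) (A.opl k Y p (Id V (fob S1 Y))) ?z =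
        Comp V (al2 k) (Comp V (fmap S2 (fob S1 (ar R k)) (ar R k) (al1 k))
          (Comp V (fmap S2 (fob S1 Y) (fob S1 (ar R k)) (fmap S1 Y (ar R k) p)) ?z))"
      unfolding A.opl_id[OF p] B.opl_def by (simp add: B.S_comp_elt[OF A.S_arr[OF p] A.al_arr z2])
    also have "\<dots> = Comp V (al2 k) (Comp V (fmap S2 (fob S1 (ar R k)) (ar R k) (al1 k)) (Comp V (\<delta> (ar R k))
        (Comp V (fmap S1 (fob S2 Y) (fob S2 (ar R k)) (fmap S2 Y (ar R k) p)) z)))"
      unfolding dn[OF p] ..
    also have "\<dots> = Comp V (Comp V (al2 k) (Comp V (fmap S2 (fob S1 (ar R k)) (ar R k) (al1 k)) (\<delta> (ar R k))))
        (Comp V (fmap S1 (fob S2 Y) (fob S2 (ar R k)) (fmap S2 Y (ar R k) p)) z)"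
      using A.assoc[OF rz \<delta>a[OF A.ar_ob] B.S_arr[OF A.al_arr]]
        A.assoc[OF rz A.comp_arr[OF \<delta>a[OF A.ar_ob] B.S_arr[OF A.al_arr]] B.al_arr] by simp
    also have "\<dots> = Comp V (al1 k) (Comp V (fmap S1 (fob S2 (ar R k)) (ar R k) (al2 k))
        (Comp V (fmap S1 (fob S2 Y) (fob S2 (ar R k)) (fmap S2 Y (ar R k) p)) z))"
      unfolding compat by (rule A.assoc[OF rz A.S_arr[OF B.al_arr] A.al_arr])
    also have "\<dots> = A.opl k (fob S2 Y) (B.opl k Y p (Id V (fob S2 Y))) z"
      unfolding B.opl_id[OF p] A.opl_def by (simp add: A.S_comp_elt[OF B.S_arr[OF p] B.al_arr z])
    finally have pp: "B.opl k (fob S1 Y) (A.opl k Y p (Id V (fob S1 Y))) ?z =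
      A.opl k (fob S2 Y) (B.opl k Y p (Id V (fob S2 Y))) z" .
    have "map2 (\<lambda>d x. Comp V (happ (gpt \<delta> A) d) x) (steps as)
        (map2 (\<lambda>d x. Comp V (fmap S1 (fob S2 Y) (homs (B.SG A) d) x) z) (steps as)
          (map2 (\<lambda>d x. Comp V (fmap S2 Y (homs A d) x) (Id V (fob S2 Y))) (steps as) xs)) =
       map2 (\<lambda>d x. Comp V (fmap S2 (fob S1 Y) (homs (A.SG A) d) x) ?z) (steps as)
          (map2 (\<lambda>d x. Comp V (fmap S1 Y (homs A d) x) (Id V (fob S1 Y))) (steps as) xs)"
      by (rule nth_equalityI) (use A.words_xs[OF vA Y w[unfolded w']] xs dn in
          \<open>auto simp: A.id_right[OF A.S_arr] A.id_right[OF B.S_arr]\<close>)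
    moreover have "map (app (gpt \<delta> A)) as = as"
      using pathsD[OF d[THEN conjunct1]] by (intro map_idI) auto
    ultimately have sw: "map_word V (gpt \<delta> A) (A.swd (fob S2 Y) z (B.SG A) ?w2) = B.swd (fob S1 Y) ?z (A.SG A) ?w1"
      using pp by (simp add: w' A.swd_def B.swd_def map_word_def k_def)
    have hl1: "arr V (happ (A.lam A) (a, b)) (fob S1 ?H) (homs (A.F (A.SG A)) (a, b))" by (rule A.lam_elt(1)[OF vA ab])
    have hl2: "arr V (happ (B.lam A) (a, b)) (fob S2 ?H) (homs (A.F (B.SG A)) (a, b))" by (rule B.lam_elt(1)[OF vA ab])
    have "Comp V (happ ?L (a, b)) x = Comp V (happ (B.lam (A.SG A)) (a, b))
        (Comp V (fmap S2 (fob S1 ?H) (homs (A.F (A.SG A)) (a, b)) (happ (A.lam A) (a, b))) (Comp V (\<delta> ?H) x))"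
      using A.happ_comp[OF c1 l2' v0 v2 v3 ab' x'] A.happ_comp[OF \<delta>homF sl1 v0 v1 v2 ab' x'] ab by simp
    also have "\<dots> = Comp V (happ (B.lam (A.SG A)) (a, b))
        (Comp V (fmap S2 (fob S1 Y) (homs (A.F (A.SG A)) (a, b)) (A.felt (A.SG A) (fob S1 Y) ?w1)) ?z)"
      unfolding x dn[OF fw] using B.S_comp_elt[OF A.S_arr[OF fw] hl1 z2] w1(1) by simp
    also have "\<dots> = A.felt (B.SG (A.SG A)) X (B.swd (fob S1 Y) ?z (A.SG A) ?w1)"
      using B.lam_elt(2)[OF s1[OF vA] _ _ Y1 w1(2) z2] ab by simp
    also have "\<dots> = Comp V (happ (fmap A.fcm (A.SG (B.SG A)) (B.SG (A.SG A)) (gpt \<delta> A)) (a, b))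
        (A.felt (A.SG (B.SG A)) X (A.swd (fob S2 Y) z (B.SG A) ?w2))"
      using f\<delta>(3)[OF X A.swd_words[OF s2[OF vA] w2(2) z Y2]] sw by simp
    also have "\<dots> = Comp V (happ (fmap A.fcm (A.SG (B.SG A)) (B.SG (A.SG A)) (gpt \<delta> A)) (a, b))
        (Comp V (happ (A.lam (B.SG A)) (a, b)) (Comp V (fmap S1 (fob S2 Y) (homs (A.F (B.SG A)) (a, b))
          (A.felt (B.SG A) (fob S2 Y) ?w2)) z))"
      using A.lam_elt(2)[OF s2[OF vA] _ _ Y2 w2(2) z] ab by simp
    also have "\<dots> = Comp V (happ (fmap A.fcm (A.SG (B.SG A)) (B.SG (A.SG A)) (gpt \<delta> A)) (a, b))
        (Comp V (happ (A.lam (B.SG A)) (a, b)) (Comp V (fmap S1 (fob S2 ?H) (homs (A.F (B.SG A)) (a, b))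
          (happ (B.lam A) (a, b))) x))"
      using A.S_comp_elt[OF B.S_arr[OF fw] hl2 z] w2(1) x by simp
    also have "\<dots> = Comp V (happ ?R (a, b)) x"
      using A.happ_comp[OF c2 f\<delta>(1) v0 v5 v3 ab' x'] A.happ_comp[OF sl2 l1' v0 v4 v5 ab' x'] ab by simp
    finally show "Comp V (happ ?L (a, b)) x = Comp V (happ ?R (a, b)) x" .
  qed
qed

section \<open>Forgetful functors and the transfer of operads\<close>

text \<open>A morphism of V_m is literally its underlying morphism, so compositions and identities
  are equal rather than corresponding, and chosen products are preserved strictly. As a consequence
  tuples in \<open>W\<close> are tuples in \<open>N\<close>.\<close>

locale underlying = W: prodcat W + N: prodcat N
  for W :: "('u obj, 'u mor, 'y) fpcat_scheme" and N :: "('u obj, 'u mor, 'z) fpcat_scheme" +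
  fixes U :: "'u obj \<Rightarrow> 'u obj"
  assumes U_ob: "A \<in> Ob W \<Longrightarrow> U A \<in> Ob N"
    and U_hom: "A \<in> Ob W \<Longrightarrow> B \<in> Ob W \<Longrightarrow> f \<in> Hom W A B \<Longrightarrow> f \<in> Hom N (U A) (U B)"
    and U_comp: "Comp W = Comp N"
    and U_id: "A \<in> Ob W \<Longrightarrow> Id W A = Id N (U A)"
    and U_prod: "set As \<subseteq> Ob W \<Longrightarrow> U (Prod W As) = Prod N (map U As)"
    and U_proj: "set As \<subseteq> Ob W \<Longrightarrow> i < length As \<Longrightarrow> Proj W As i = Proj N (map U As) i"
begin

notation N.comp (infixr "\<cdot>" 70)

lemma U_arr: "arr W f A B \<Longrightarrow> arr N f (U A) (U B)"
  using U_ob U_hom by (auto simp: arr_def)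

lemma U_els: "W.els X fs Bs \<Longrightarrow> N.els (U X) fs (map U Bs)"
  unfolding W.els_def N.els_def using U_ob U_arr
  by (auto simp: list_all2_map2 elim!: list_all2_mono)

lemma U_tuple:
  assumes "W.els X fs Bs"
  shows "tuple W X Bs fs = tuple N (U X) (map U Bs) fs"
proof (rule N.tuple_unique[OF _ U_els[OF assms]])
  note ob = W.els_ob[OF assms]
  show "arr N (tuple W X Bs fs) (U X) (Prod N (map U Bs))"
    using U_arr[OF W.tuple_arr[OF assms]] U_prod[OF ob] by simp
  fix i assume "i < length (map U Bs)"
  then show "Proj N (map U Bs) i \<cdot> tuple W X Bs fs = fs ! i"
    using W.proj_tuple[OF assms] U_proj[OF ob] by (simp add: U_comp)
qed

lemma U_projs: "set Bs \<subseteq> Ob W \<Longrightarrow> W.projs Bs = N.projs (map U Bs)"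
  unfolding W.projs_def N.projs_def by (auto simp: U_proj)

text \<open>Data \<open>d\<close> at a stage \<open>X\<close> of \<open>N\<close> is liftable if it is the restriction along some
  \<open>g : X \<rightarrow> U Z\<close> of data at a stage \<open>Z\<close> of \<open>W\<close>. Liftable data can be combined, by means of
  products of stages.\<close>

definition stable :: "('u obj \<Rightarrow> 'd \<Rightarrow> bool) \<Rightarrow> ('u mor \<Rightarrow> 'd \<Rightarrow> 'd) \<Rightarrow> bool" where
  "stable \<Psi> r \<longleftrightarrow> (\<forall>Z Z' t d. \<Psi> Z d \<longrightarrow> arr W t Z' Z \<longrightarrow> \<Psi> Z' (r t d) \<and>
     (\<forall>X g. arr N g X (U Z') \<longrightarrow> r g (r t d) = r (t \<cdot> g) d))"

definition liftable :: "('u obj \<Rightarrow> 'd \<Rightarrow> bool) \<Rightarrow> ('u mor \<Rightarrow> 'd \<Rightarrow> 'd) \<Rightarrow> 'u obj \<Rightarrow> 'd \<Rightarrow> bool" where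
  "liftable \<Psi> r X d \<longleftrightarrow> (\<exists>Z g d'. Z \<in> Ob W \<and> arr N g X (U Z) \<and> \<Psi> Z d' \<and> d = r g d')"

lemma stable_pair:
  assumes "stable \<Psi> r" "stable \<Psi>' r'"
  shows "stable (\<lambda>Z d. \<Psi> Z (fst d) \<and> \<Psi>' Z (snd d)) (\<lambda>g. map_prod (r g) (r' g))"
  using assms unfolding stable_def by (auto simp: prod_eq_iff)

lemma lift_pair:
  assumes s: "stable \<Psi> r" "stable \<Psi>' r'" and l: "liftable \<Psi> r X d" "liftable \<Psi>' r' X d'"
  shows "liftable (\<lambda>Z d. \<Psi> Z (fst d) \<and> \<Psi>' Z (snd d)) (\<lambda>g. map_prod (r g) (r' g)) X (d, d')"
proof -
  obtain Z1 g1 d1 where 1: "Z1 \<in> Ob W" "arr N g1 X (U Z1)" "\<Psi> Z1 d1" "d = r g1 d1"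
    using l(1) by (auto simp: liftable_def)
  obtain Z2 g2 d2 where 2: "Z2 \<in> Ob W" "arr N g2 X (U Z2)" "\<Psi>' Z2 d2" "d' = r' g2 d2"
    using l(2) by (auto simp: liftable_def)
  let ?B = "[Z1, Z2]"
  let ?Z = "Prod W ?B" and ?g = "tuple N X (map U ?B) [g1, g2]"
  have ob: "set ?B \<subseteq> Ob W" using 1 2 by simp
  have e: "N.els X [g1, g2] (map U ?B)" using 1 2 arr_ob1[OF 1(2)] by simp
  have g: "arr N ?g X (U ?Z)" using N.tuple_arr[OF e] U_prod[OF ob] by simp
  have p: "arr W (Proj W ?B 0) ?Z Z1" "arr W (Proj W ?B 1) ?Z Z2"
    using W.proj_arr[OF ob, of 0] W.proj_arr[OF ob, of 1] by simp_all
  have "Proj W ?B 0 \<cdot> ?g = g1" "Proj W ?B 1 \<cdot> ?g = g2"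
    using N.proj_tuple[OF e, of 0] N.proj_tuple[OF e, of 1] U_proj[OF ob, of 0] U_proj[OF ob, of 1]
    by simp_all
  then have "d = r ?g (r (Proj W ?B 0) d1)" "d' = r' ?g (r' (Proj W ?B 1) d2)"
      "\<Psi> ?Z (r (Proj W ?B 0) d1)" "\<Psi>' ?Z (r' (Proj W ?B 1) d2)"
    using s(1)[unfolded stable_def, rule_format, OF 1(3) p(1)] 1(4) g
      s(2)[unfolded stable_def, rule_format, OF 2(3) p(2)] 2(4) by auto
  then show ?thesis
    unfolding liftable_def using g W.prod_ob[OF ob]
    by (intro exI[of _ ?Z] exI[of _ ?g] exI[of _ "(r (Proj W ?B 0) d1, r' (Proj W ?B 1) d2)"]) simp
qed

lemma stable_list:
  assumes "stable \<Psi> r"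
  shows "stable (\<lambda>Z ds. \<forall>d\<in>set ds. \<Psi> Z d) (\<lambda>g. map (r g))"
  using assms unfolding stable_def by auto

lemma lift_list:
  assumes s: "stable \<Psi> r" and X: "X \<in> Ob N" and l: "\<And>d. d \<in> set ds \<Longrightarrow> liftable \<Psi> r X d"
  shows "liftable (\<lambda>Z ds. \<forall>d\<in>set ds. \<Psi> Z d) (\<lambda>g. map (r g)) X ds"
  using l
proof (induction ds)
  case Nil
  \<comment> \<open>For the empty list the stage is the terminal object
    \<open>Prod W []\<close>.\<close>
  have e: "N.els X [] (map U [])" using X by simp
  then show ?case
    using N.tuple_arr[OF e] U_prod[of "[]"] W.prod_ob[of "[]"]
    by (auto simp: liftable_def intro!: exI[of _ "Prod W []"] exI[of _ "tuple N X [] []"])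
next
  case (Cons d ds)
  have "liftable (\<lambda>Z d. \<Psi> Z (fst d) \<and> (\<forall>d\<in>set (snd d). \<Psi> Z d)) (\<lambda>g. map_prod (r g) (map (r g))) X (d, ds)"
    by (rule lift_pair[OF s stable_list[OF s]]) (use Cons in auto)
  then obtain Z g d1 ds1 where "Z \<in> Ob W" "arr N g X (U Z)" "\<Psi> Z d1" "\<forall>d\<in>set ds1. \<Psi> Z d"
      "d = r g d1" "ds = map (r g) ds1"
    unfolding liftable_def by auto
  then show ?case
    unfolding liftable_def by (intro exI[of _ Z] exI[of _ g] exI[of _ "d1 # ds1"]) auto
qed

lemma stable_elt: "stable (\<lambda>Z (k, q). arr W q Z (B k)) (\<lambda>g (k, q). (k, q \<cdot> g))"
proof -
  have "arr W (q \<cdot> t) Z' (B k) \<and> (\<forall>X g. arr N g X (U Z') \<longrightarrow> (q \<cdot> t) \<cdot> g = q \<cdot> t \<cdot> g)"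
    if "arr W q Z (B k)" "arr W t Z' Z" for Z Z' t q k
    using W.comp_arr[OF that(2,1)] N.assoc[OF _ U_arr[OF that(2)] U_arr[OF that(1)]]
    by (auto simp: U_comp)
  then show ?thesis unfolding stable_def by auto
qed

text \<open>The identity is the universal element of \<open>U (B k)\<close>, and \<open>q\<close> is
  its restriction along \<open>q\<close> itself.\<close>

lemma lift_elt:
  assumes "B k \<in> Ob W" "arr N q X (U (B k))"
  shows "liftable (\<lambda>Z (k, q). arr W q Z (B k)) (\<lambda>g (k, q). (k, q \<cdot> g)) X (k, q)"
  unfolding liftable_def
  using assms W.id_arr[OF assms(1)] N.id_left[OF assms(2)] U_id[OF assms(1)]
  by (intro exI[of _ "B k"] exI[of _ q] exI[of _ "(k, Id W (B k))"]) simp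

end

section \<open>The underlying operad\<close>

locale under_operad = underlying W N U + P: operadic W P
  for W :: "('u obj, 'u mor, 'y) fpcat_scheme" and N :: "('u obj, 'u mor, 'z) fpcat_scheme" and U and P
begin

definition "R = P\<lparr>ar := \<lambda>k. U (ar P k)\<rparr>"

lemma R_simps [simp]: "ar R = (\<lambda>k. U (ar P k))" "opunit R = opunit P" "opcomp R = opcomp P"
  by (simp_all add: R_def)

sublocale R: preoperad N R
proof
  show "ar R k \<in> Ob N" for k using U_ob P.ar_ob by simp
  show "arr N (opunit R) (Prod N []) (ar R 1)"
    using U_arr[OF P.opunit_arr] U_prod[of "[]"] by simp
  fix ks
  have "set (ar P (length ks) # map (ar P) ks) \<subseteq> Ob W" using P.ar_ob by auto
  then show "arr N (opcomp R ks) (Prod N (ar R (length ks) # map (ar R) ks)) (ar R (sum_list ks))"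
    using U_arr[OF P.opcomp_arr, of ks] U_prod by (simp add: comp_def)
qed

lemma U_unit_elt: "X \<in> Ob W \<Longrightarrow> unit_elt W P X = unit_elt N R (U X)"
  unfolding unit_elt_def using U_tuple[of X "[]" "[]"] by (simp add: U_comp)

lemma U_comp_elt:
  assumes "arr W p X (ar P (length ps))" "\<And>k q. (k, q) \<in> set ps \<Longrightarrow> arr W q X (ar P k)"
  shows "comp_elt W P X p ps = comp_elt N R (U X) p ps"
  using U_tuple[OF P.comp_els[OF assms]] by (simp add: comp_elt_def U_comp comp_def)

text \<open>The laws of \<open>P\<close> hold for the universal operation, the identity of
  \<open>ar P k\<close>; restriction along \<open>p\<close> gives them for \<open>p\<close> at an
  arbitrary stage of \<open>N\<close>.\<close>

lemma R_unit:
  assumes p: "arr N p X (ar R k)"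
  shows "comp_elt N R X (unit_elt N R X) [(k, p)] = p"
    "comp_elt N R X p (replicate k (1, unit_elt N R X)) = p"
proof -
  let ?Z = "ar P k" and ?i = "Id W (ar P k)"
  have Z: "?Z \<in> Ob W" by (rule P.ar_ob)
  have i: "arr W ?i ?Z ?Z" by (rule W.id_arr[OF Z])
  have p': "arr N p X (U ?Z)" using p by simp
  have ip: "?i \<cdot> p = p" using N.id_left[OF p'] U_id[OF Z] by simp
  note Ui = U_arr[OF i]
  have u: "arr W (unit_elt W P ?Z) ?Z (ar P 1)" by (rule P.unit_elt_arr[OF Z])
  have Uu: "arr N (unit_elt N R (U ?Z)) (U ?Z) (U (ar P 1))"
    using U_arr[OF u] U_unit_elt[OF Z] by simp
  have "?i = comp_elt N R (U ?Z) (unit_elt N R (U ?Z)) [(k, ?i)]"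
    using P.comp_unit_left[OF i] U_comp_elt[of "unit_elt W P ?Z" ?Z "[(k, ?i)]"] u i U_unit_elt[OF Z]
    by simp
  then have "p = comp_elt N R (U ?Z) (unit_elt N R (U ?Z)) [(k, ?i)] \<cdot> p" using ip by simp
  also have "\<dots> = comp_elt N R X (unit_elt N R (U ?Z) \<cdot> p) [(k, ?i \<cdot> p)]"
    using R.comp_elt_restr[of "unit_elt N R (U ?Z)" "U ?Z" "[(k, ?i)]" p X] Uu Ui p' by simp
  finally show "comp_elt N R X (unit_elt N R X) [(k, p)] = p"
    using ip R.unit_elt_restr[OF p'] by simp
  have "?i = comp_elt N R (U ?Z) ?i (replicate k (1, unit_elt N R (U ?Z)))"
    using P.comp_unit_right[OF i] U_comp_elt[of ?i ?Z "replicate k (1, unit_elt W P ?Z)"] u i U_unit_elt[OF Z]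
    by simp
  then have "p = comp_elt N R (U ?Z) ?i (replicate k (1, unit_elt N R (U ?Z))) \<cdot> p" using ip by simp
  also have "\<dots> = comp_elt N R X (?i \<cdot> p) (replicate k (1, unit_elt N R (U ?Z) \<cdot> p))"
    using R.comp_elt_restr[of ?i "U ?Z" "replicate k (1, unit_elt N R (U ?Z))" p X] Uu Ui p' by simp
  finally show "comp_elt N R X p (replicate k (1, unit_elt N R X)) = p"
    using ip R.unit_elt_restr[OF p'] by simp
qed

text \<open>Associativity of \<open>P\<close> speaks of stages of \<open>W\<close> only. All
  operations that occur are therefore lifted to one common stage \<open>Z\<close>, the law is used
  there, and the result is restricted along \<open>g\<close>.\<close>

lemma R_assoc:
  assumes p: "arr N p X (ar R (length ps))"
    and qs: "list_all2 (\<lambda>(k, q) qs. arr N q X (ar R k) \<and> length qs = k \<and>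
          (\<forall>(l, r)\<in>set qs. arr N r X (ar R l))) ps qss"
  shows "comp_elt N R X (comp_elt N R X p ps) (concat qss) = comp_elt N R X p
          (map2 (\<lambda>(k, q) qs. (sum_list (map fst qs), comp_elt N R X q qs)) ps qss)"
proof -
  note X = arr_ob1[OF p]
  define r where "r = (\<lambda>g (k :: nat, q). (k, q \<cdot> g))"
  define \<Psi> where "\<Psi> = (\<lambda>Z (k, q). arr W q Z (ar P k))"
  have s: "stable \<Psi> r" unfolding \<Psi>_def r_def by (rule stable_elt)
  have le: "liftable \<Psi> r X (k, q)" if "arr N q X (U (ar P k))" for k q
    unfolding \<Psi>_def r_def by (rule lift_elt[of "ar P", OF P.ar_ob that])
  let ?\<Psi>2 = "\<lambda>Z d. \<Psi> Z (fst d) \<and> (\<forall>d\<in>set (snd d). \<Psi> Z d)"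
  let ?r2 = "\<lambda>g. map_prod (r g) (map (r g))"
  have s2: "stable ?\<Psi>2 ?r2" by (rule stable_pair[OF s stable_list[OF s]])
  have l2: "liftable ?\<Psi>2 ?r2 X d" if d: "d \<in> set (zip ps qss)" for d
  proof -
    obtain k q qs' where d': "d = ((k, q), qs')" by (metis prod.collapse)
    have "arr N q X (U (ar P k)) \<and> (\<forall>(l, r)\<in>set qs'. arr N r X (U (ar P l)))"
      using qs d d' unfolding list_all2_iff by fastforce
    then show ?thesis unfolding d' by (intro lift_pair[OF s stable_list[OF s] le lift_list[OF s X]])
        (auto intro: le)
  qed
  \<comment> \<open>Zipping \<open>ps\<close> with \<open>qss\<close> keeps each operation paired
    with its block under the lifting; arities are carried along as first components.\<close>
  have "liftable (\<lambda>Z d. \<Psi> Z (fst d) \<and> (\<forall>d\<in>set (snd d). ?\<Psi>2 Z d)) (\<lambda>g. map_prod (r g) (map (?r2 g))) X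
      ((length ps, p), zip ps qss)"
    by (rule lift_pair[OF s stable_list[OF s2] le lift_list[OF s2 X l2]]) (use p in auto)
  then obtain Z g d ds where Z: "Z \<in> Ob W" and g: "arr N g X (U Z)" and d: "\<Psi> Z d"
    and ds: "\<forall>d\<in>set ds. ?\<Psi>2 Z d" and pd: "(length ps, p) = r g d" and zd: "zip ps qss = map (?r2 g) ds"
    unfolding liftable_def by auto
  obtain p' where d': "d = (length ps, p')" "p = p' \<cdot> g" using pd by (cases d) (auto simp: r_def)
  have lq: "length ps = length qss" using qs by (rule list_all2_lengthD)
  let ?ps = "map fst ds" and ?qss = "map snd ds"
  have ps: "ps = map (r g) ?ps" using arg_cong[OF zd, of "map fst"] lq by (simp add: comp_def)
  have qss: "qss = map (map (r g)) ?qss" using arg_cong[OF zd, of "map snd"] lq by (simp add: comp_def)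
  have lds: "length ds = length ps" using ps by (metis length_map)
  have fr: "fst (r g x) = fst x" for x by (cases x) (simp add: r_def)
  have p'a: "arr W p' Z (ar P (length ?ps))" using d d'(1) lds by (simp add: \<Psi>_def)
  have q'a: "arr W q Z (ar P k)" if "(k, q) \<in> set ?ps" for k q
    using ds that by (force simp: \<Psi>_def)
  have Q: "length (snd x) = fst (fst x)" if "x \<in> set (zip ps qss)" for x
    using qs that unfolding list_all2_iff by (auto simp: split_def)
  have q'b: "list_all2 (\<lambda>(k, q) qs. arr W q Z (ar P k) \<and> length qs = k \<and>
      (\<forall>(l, r)\<in>set qs. arr W r Z (ar P l))) ?ps ?qss"
  proof -
    have "length (snd x) = fst (fst x) \<and> \<Psi> Z (fst x) \<and> (\<forall>y\<in>set (snd x). \<Psi> Z y)" if x: "x \<in> set ds" for x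
    proof -
      have "?r2 g x \<in> set (zip ps qss)" unfolding zd using x by simp
      then have "length (snd (?r2 g x)) = fst (fst (?r2 g x))" by (rule Q)
      then show ?thesis using ds x by (simp add: fr)
    qed
    then show ?thesis by (force simp: list_all2_map1 list_all2_map2 \<Psi>_def intro!: list.rel_refl_strong)
  qed
  have c1: "arr W r Z (ar P l)" if "(l, r) \<in> set (concat ?qss)" for l r
    using ds that by (force simp: \<Psi>_def)
  let ?m = "map2 (\<lambda>(k, q) qs. (sum_list (map fst qs), comp_elt W P Z q qs)) ?ps ?qss"
  have mm: "?m = map (\<lambda>x. (sum_list (map fst (snd x)), comp_elt W P Z (snd (fst x)) (snd x))) ds"
    by (simp add: zip_map_map zip_same_conv_map case_prod_beta comp_def)
  have x: "length (snd x) = fst (fst x)" "arr W (snd (fst x)) Z (ar P (length (snd x)))"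
    "\<And>k q. (k, q) \<in> set (snd x) \<Longrightarrow> arr W q Z (ar P k)" if "x \<in> set ds" for x
    using q'b that unfolding list_all2_map1 list_all2_map2 list_all2_same
    by (auto simp: case_prod_beta) (metis fst_conv snd_conv)
  have m1: "arr W q Z (ar P k)" if kq: "(k, q) \<in> set ?m" for k q
  proof -
    obtain x where "x \<in> set ds" "k = sum_list (map fst (snd x))" "q = comp_elt W P Z (snd (fst x)) (snd x)"
      using kq unfolding mm by auto
    then show ?thesis using P.comp_elt_arr[of "snd (fst x)" Z "snd x"] x by blast
  qed
  have sl: "sum_list (map fst ?ps) = length (concat ?qss)"
    using x(1) by (induction ds) auto
  have ca: "arr W (comp_elt W P Z p' ?ps) Z (ar P (length (concat ?qss)))"
    using P.comp_elt_arr[OF p'a q'a] sl by simp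
  have restr: "comp_elt N R X (q \<cdot> g) (map (r g) qs) = comp_elt W P Z q qs \<cdot> g"
    if "arr W q Z (ar P (length qs))" "\<And>k r. (k, r) \<in> set qs \<Longrightarrow> arr W r Z (ar P k)" for q qs
  proof -
    have "comp_elt N R (U Z) q qs \<cdot> g = comp_elt N R X (q \<cdot> g) (map (r g) qs)"
      unfolding r_def by (rule R.comp_elt_restr[OF _ _ g]) (use U_arr that in auto)
    then show ?thesis using U_comp_elt[OF that] by simp
  qed
  have "comp_elt N R X (comp_elt N R X p ps) (concat qss) =
      comp_elt N R X (comp_elt W P Z p' ?ps \<cdot> g) (map (r g) (concat ?qss))"
    using restr[OF p'a q'a] ps qss d'(2) by (simp add: map_concat)
  also have "\<dots> = comp_elt W P Z (comp_elt W P Z p' ?ps) (concat ?qss) \<cdot> g" by (rule restr[OF ca c1])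
  also have "\<dots> = comp_elt W P Z p' ?m \<cdot> g" using P.comp_assoc[OF p'a q'b] by simp
  also have "\<dots> = comp_elt N R X (p' \<cdot> g) (map (r g) ?m)"
    using m1 p'a by (intro restr[symmetric]) (auto simp: lds)
  also have "map (r g) ?m = map2 (\<lambda>(k, q) qs. (sum_list (map fst qs), comp_elt N R X q qs)) ps qss"
  proof -
    have "r g (sum_list (map fst (snd y)), comp_elt W P Z (snd (fst y)) (snd y)) =
       (sum_list (map fst (map (r g) (snd y))), comp_elt N R X (snd (fst y) \<cdot> g) (map (r g) (snd y)))"
      if y: "y \<in> set ds" for y
      using restr[OF x(2,3)[OF y]] by (simp add: r_def comp_def case_prod_beta)
    moreover have "map2 (\<lambda>(k, q) qs. (sum_list (map fst qs), comp_elt N R X q qs)) ps qss =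
      map (\<lambda>y. (sum_list (map fst (map (r g) (snd y))), comp_elt N R X (snd (fst y) \<cdot> g) (map (r g) (snd y)))) ds"
      unfolding zd by (simp add: case_prod_beta comp_def r_def)
    ultimately show ?thesis unfolding mm by simp
  qed
  finally show ?thesis using d'(2) by simp
qed

lemma R_operad: "is_operad N R"
  unfolding is_operad_def
proof (intro conjI allI ballI impI)
  show "ar R k \<in> Ob N" for k by (rule R.ar_ob)
  show "opunit R \<in> Hom N (Prod N []) (ar R 1)" using R.opunit_arr by (simp only: arr_def)
  show "opcomp R ks \<in> Hom N (Prod N (ar R (length ks) # map (ar R) ks)) (ar R (sum_list ks))" for ks
    using R.opcomp_arr by (simp only: arr_def)
  fix X assume X: "X \<in> Ob N"
  show "comp_elt N R X (unit_elt N R X) [(k, p)] = p" "comp_elt N R X p (replicate k (1, unit_elt N R X)) = p"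
    if "p \<in> Hom N X (ar R k)" for k p
    by (rule R_unit; use that X R.ar_ob in \<open>simp only: arr_def\<close>)+
  fix p ps qss
  assume "p \<in> Hom N X (ar R (length ps)) \<and> list_all2 (\<lambda>(k, q) qs. q \<in> Hom N X (ar R k) \<and> length qs = k \<and>
      (\<forall>(l, r)\<in>set qs. r \<in> Hom N X (ar R l))) ps qss"
  then show "comp_elt N R X (comp_elt N R X p ps) (concat qss) = comp_elt N R X p
          (map2 (\<lambda>(k, q) qs. (sum_list (map fst qs), comp_elt N R X q qs)) ps qss)"
    using X R.ar_ob by (intro R_assoc) (auto simp: arr_def simp del: R_simps elim!: list_all2_mono)
qed

sublocale R: operadic N R
  by unfold_locales (rule R_operad)

end

section \<open>Natural algebra structures\<close>

text \<open>A lift of the functor \<open>K\<close> to the Eilenberg--Moore category of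
  \<open>S\<close>: the last clause makes every morphism of \<open>W\<close> an algebra
  morphism.\<close>

definition algs :: "('o, 'm, 'y) cat_scheme \<Rightarrow> ('o, 'm, 'z) cat_scheme \<Rightarrow> ('o \<Rightarrow> 'o) \<Rightarrow> ('o, 'm) monad \<Rightarrow>
    ('o \<Rightarrow> 'm) \<Rightarrow> bool" where
  "algs W N K S a \<longleftrightarrow> (\<forall>A\<in>Ob W. arr N (a A) (fob S (K A)) (K A) \<and>
     Comp N (a A) (eta S (K A)) = Id N (K A) \<and>
     Comp N (a A) (mu S (K A)) = Comp N (a A) (fmap S (fob S (K A)) (K A) (a A))) \<and>
     (\<forall>A B f. arr W f A B \<longrightarrow> Comp N f (a A) = Comp N (a B) (fmap S (K A) (K B) f))"

text \<open>Equivalently, \<open>b A\<close> is a morphism of \<open>S\<close>-algebras, where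
  \<open>T (K A)\<close> carries the structure induced by \<open>a A\<close> and \<open>l\<close>.
  Such a pair is an algebra for the composite monad \<open>T S\<close> determined by the
  law.\<close>

definition alg_compat :: "('o, 'm, 'y) cat_scheme \<Rightarrow> ('o, 'm, 'z) cat_scheme \<Rightarrow> ('o \<Rightarrow> 'o) \<Rightarrow> ('o, 'm) monad \<Rightarrow>
    ('o, 'm) monad \<Rightarrow> ('o \<Rightarrow> 'm) \<Rightarrow> ('o \<Rightarrow> 'm) \<Rightarrow> ('o \<Rightarrow> 'm) \<Rightarrow> bool" where
  "alg_compat W N K S T l a b \<longleftrightarrow> (\<forall>A\<in>Ob W.
     Comp N (b A) (Comp N (fmap T (fob S (K A)) (K A) (a A)) (l (K A))) =
     Comp N (a A) (fmap S (fob T (K A)) (K A) (b A)))"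

locale under_algs = underlying W N U + S: monad_on N S
  for W :: "('u obj, 'u mor, 'y) fpcat_scheme" and N :: "('u obj, 'u mor, 'z) fpcat_scheme" and U and S +
  fixes a
  assumes algs: "algs W N U S a"
begin

lemma a_arr: "A \<in> Ob W \<Longrightarrow> arr N (a A) (fob S (U A)) (U A)"
  and a_nat: "arr W f A B \<Longrightarrow> f \<cdot> a A = a B \<cdot> fmap S (U A) (U B) f"
  using algs by (auto simp: algs_def)

lemma a_nat_elt:
  assumes f: "arr W f A B" and h: "arr N h Y (U A)" and z: "arr N z X (fob S Y)"
  shows "a B \<cdot> fmap S Y (U B) (f \<cdot> h) \<cdot> z = f \<cdot> a A \<cdot> fmap S Y (U A) h \<cdot> z"
proof -
  note Uf = U_arr[OF f] and hz = S.S_elt_arr[OF h z]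
  have "a B \<cdot> fmap S Y (U B) (f \<cdot> h) \<cdot> z = (a B \<cdot> fmap S (U A) (U B) f) \<cdot> fmap S Y (U A) h \<cdot> z"
    using S.S_comp_elt[OF h Uf z] N.assoc[OF hz S.S_arr[OF Uf] a_arr[OF arr_ob2[OF f]]] by simp
  then show ?thesis
    using a_nat[OF f] N.assoc[OF hz a_arr[OF arr_ob1[OF f]] Uf] by simp
qed

text \<open>The projections are morphisms of \<open>W\<close>, hence algebra morphisms, so the
  structure on a product is componentwise.\<close>

lemma a_tuple:
  assumes e: "N.els Y fs (map U Bs)" and B: "set Bs \<subseteq> Ob W" and z: "arr N z X (fob S Y)"
  shows "a (Prod W Bs) \<cdot> fmap S Y (U (Prod W Bs)) (tuple N Y (map U Bs) fs) \<cdot> z =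
    tuple N X (map U Bs) (map2 (\<lambda>B f. a B \<cdot> fmap S Y (U B) f \<cdot> z) Bs fs)"
proof (rule N.tuple_unique)
  have t: "arr N (tuple N Y (map U Bs) fs) Y (U (Prod W Bs))" using N.tuple_arr[OF e] U_prod[OF B] by simp
  have len: "length fs = length Bs" using N.els_length[OF e] by simp
  show "arr N (a (Prod W Bs) \<cdot> fmap S Y (U (Prod W Bs)) (tuple N Y (map U Bs) fs) \<cdot> z) X (Prod N (map U Bs))"
    using N.comp_arr[OF S.S_elt_arr[OF t z] a_arr[OF W.prod_ob[OF B]]] U_prod[OF B] by simp
  show "N.els X (map2 (\<lambda>B f. a B \<cdot> fmap S Y (U B) f \<cdot> z) Bs fs) (map U Bs)"
    unfolding N.els_def list_all2_conv_all_nth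
  proof (intro conjI allI impI)
    show "X \<in> Ob N" by (rule arr_ob1[OF z])
    fix i assume "i < length (map2 (\<lambda>B f. a B \<cdot> fmap S Y (U B) f \<cdot> z) Bs fs)"
    then have i: "i < length Bs" by simp
    have "arr N (fs ! i) Y (U (Bs ! i))" using N.els_nth[OF e, of i] i by simp
    moreover have "Bs ! i \<in> Ob W" using B i by auto
    ultimately show "arr N (map2 (\<lambda>B f. a B \<cdot> fmap S Y (U B) f \<cdot> z) Bs fs ! i) X (map U Bs ! i)"
      using i len N.comp_arr[OF S.S_elt_arr[OF _ z] a_arr] by simp
  qed (use len in simp)
  fix i assume "i < length (map U Bs)"
  then have i: "i < length Bs" by simp
  have "Proj W Bs i \<cdot> a (Prod W Bs) \<cdot> fmap S Y (U (Prod W Bs)) (tuple N Y (map U Bs) fs) \<cdot> z =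
     a (Bs ! i) \<cdot> fmap S Y (U (Bs ! i)) (fs ! i) \<cdot> z"
    using a_nat_elt[OF W.proj_arr[OF B i] t z] N.proj_tuple[OF e, of i] U_proj[OF B i] i by simp
  then show "Proj N (map U Bs) i \<cdot> a (Prod W Bs) \<cdot> fmap S Y (U (Prod W Bs)) (tuple N Y (map U Bs) fs) \<cdot> z =
     map2 (\<lambda>B f. a B \<cdot> fmap S Y (U B) f \<cdot> z) Bs fs ! i"
    using i len U_proj[OF B i] by simp
qed

end

text \<open>Unit and composition of \<open>P\<close> are morphisms of \<open>W\<close>, hence
  algebra morphisms by naturality of \<open>a\<close>; \<open>a_tuple\<close> brings the structure
  on the product of arguments into the componentwise form of \<open>al_comp\<close>.\<close>

lemma algs_opalg:
  fixes N :: "'a gcat"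
  assumes u: "under_operad W N K P" and e: "enriching N G" and S: "is_monad N S" and pr: "pres N G S"
    and al: "algs W N K S a"
  shows "opalg N G (under_operad.R K P) S (\<lambda>k. a (ar P k))"
proof -
  interpret under_operad W N K P by fact
  interpret E: enriching N G by fact
  interpret S: under_algs W N K S a
    by (intro under_algs.intro monad_on.intro monad_on_axioms.intro under_algs_axioms.intro
        underlying_axioms N.prodcat_axioms S al)
  have a_k: "arr N (a (ar P k)) (fob S (K (ar P k))) (K (ar P k))" for k by (rule S.a_arr[OF P.ar_ob])
  show ?thesis
  proof
    show "pres N G S" by fact
    show "arr N (a (ar P k)) (fob S (ar R k)) (ar R k)" for k using a_k by simp
    show "a (ar P k) \<cdot> eta S (ar R k) = Id N (ar R k)"
      "a (ar P k) \<cdot> mu S (ar R k) = a (ar P k) \<cdot> fmap S (fob S (ar R k)) (ar R k) (a (ar P k))" for k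
      using al P.ar_ob[of k] by (auto simp: algs_def)
    show "a (ar P 1) \<cdot> fmap S Y (ar R 1) (unit_elt N R Y) \<cdot> z = unit_elt N R X"
      if z: "arr N z X (fob S Y)" and Y: "Y \<in> Ob N" for z X Y
    proof -
      have e: "N.els Y [] (map K [])" using Y by simp
      have t: "arr N (tuple N Y [] []) Y (K (Prod W []))" using N.tuple_arr[OF e] U_prod[of "[]"] by simp
      show ?thesis
        using S.a_nat_elt[OF P.opunit_arr t z] S.a_tuple[OF e _ z] by (simp add: unit_elt_def)
    qed
    fix p Y z X and ps :: "(nat \<times> 'a elt mor) list"
    assume p: "arr N p Y (ar R (length ps))" and q: "\<And>k q. (k, q) \<in> set ps \<Longrightarrow> arr N q Y (ar R k)"
      and z: "arr N z X (fob S Y)"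
    let ?ks = "map fst ps"
    let ?B = "ar P (length ps) # map (ar P) ?ks"
    have B: "set ?B \<subseteq> Ob W" using P.ar_ob by auto
    have UB: "map K ?B = ar R (length ps) # map (ar R \<circ> fst) ps" by simp
    have e: "N.els Y (p # map snd ps) (map K ?B)" unfolding UB by (rule R.comp_els[OF p q])
    have t: "arr N (tuple N Y (map K ?B) (p # map snd ps)) Y (K (Prod W ?B))"
      using N.tuple_arr[OF e] U_prod[OF B] by simp
    have oc: "arr W (opcomp P ?ks) (Prod W ?B) (ar P (sum_list ?ks))"
      using P.opcomp_arr[of ?ks] by simp
    have "a (ar P (sum_list ?ks)) \<cdot> fmap S Y (K (ar P (sum_list ?ks))) (opcomp P ?ks \<cdot> tuple N Y (map K ?B) (p # map snd ps)) \<cdot> z =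
      opcomp P ?ks \<cdot> tuple N X (map K ?B) (map2 (\<lambda>B f. a B \<cdot> fmap S Y (K B) f \<cdot> z) ?B (p # map snd ps))"
      using S.a_nat_elt[OF oc t z] S.a_tuple[OF e B z] by simp
    moreover have "map2 (\<lambda>B f. a B \<cdot> fmap S Y (K B) f \<cdot> z) ?B (p # map snd ps) =
      (a (ar P (length ps)) \<cdot> fmap S Y (K (ar P (length ps))) p \<cdot> z) #
      map snd (map (\<lambda>(k, q). (k, a (ar P k) \<cdot> fmap S Y (K (ar P k)) q \<cdot> z)) ps)"
      by (simp add: zip_map_map zip_same_conv_map case_prod_beta comp_def)
    moreover have "map fst (map (\<lambda>(k, q). (k, a (ar P k) \<cdot> fmap S Y (K (ar P k)) q \<cdot> z)) ps) = ?ks"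
      by (simp add: case_prod_beta comp_def)
    ultimately show "a (ar P (sum_list ?ks)) \<cdot> fmap S Y (ar R (sum_list ?ks)) (comp_elt N R Y p ps) \<cdot> z =
      comp_elt N R X (a (ar P (length ps)) \<cdot> fmap S Y (ar R (length ps)) p \<cdot> z)
        (map (\<lambda>(k, q). (k, a (ar P k) \<cdot> fmap S Y (ar R k) q \<cdot> z)) ps)"
      unfolding comp_elt_def by (simp add: comp_def case_prod_beta)
  qed
qed

section \<open>The category of \<open>(V, P)\<close>-categories\<close>

text \<open>Words see the underlying graph only, so an object with actions and its graph may be
  interchanged.\<close>

lemma words_cong:
  assumes "objs A = objs B" "homs A = homs B"
  shows "words W P A = words W P B" "nested_words W P A = nested_words W P B"
    "word_elt W P A = word_elt W P B" "factors P A = factors P B" "vgraph W A = vgraph W B"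
proof -
  have p: "paths A = paths B" by (rule paths_cong[OF assms(1)])
  show w: "words W P A = words W P B"
    by (auto simp: fun_eq_iff words_def p assms)
  show "nested_words W P A = nested_words W P B"
    by (auto simp: fun_eq_iff nested_words_def p w)
  show f: "factors P A = factors P B" by (simp add: fun_eq_iff factors_def assms)
  show "word_elt W P A = word_elt W P B" by (simp add: fun_eq_iff word_elt_def f)
  show "vgraph W A = vgraph W B" by (simp add: vgraph_def assms)
qed

locale vpcat = vgphs W + operadic W P for W :: "'a vcat" and P
begin

notation comp (infixr "\<cdot>" 70)

lemma vpD:
  assumes "A \<in> vpOb W P"
  shows "vg A" "A = Alg (objs A) (homs A) (acts A)" "acts A \<in> extensional (strings A)"
    "homs A \<in> extensional (objs A \<times> objs A)"
    "as \<in> paths A e \<Longrightarrow> arr W (acts A as) (Prod W (factors P A as)) (homs A e)"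
    "X \<in> Ob W \<Longrightarrow> a \<in> objs A \<Longrightarrow> b \<in> objs A \<Longrightarrow> arr W x X (homs A (a, b)) \<Longrightarrow>
      act W P A X ([a, b], unit_elt W P X, [x]) = x"
    "X \<in> Ob W \<Longrightarrow> (as, p, ws) \<in> nested_words W P A X e \<Longrightarrow>
      act W P A X (as, p, map (act W P A X) ws) = act W P A X (flatten W P X (as, p, ws))"
proof -
  obtain S H g where A: "A = Alg S H g" and H: "H \<in> S \<times> S \<rightarrow>\<^sub>E Ob W"
    and g: "g \<in> (\<Pi>\<^sub>E as\<in>strings A. Hom W (Prod W (factors P A as)) (H (hd as, last as)))"
    and u: "\<forall>X\<in>Ob W. \<forall>a\<in>S. \<forall>b\<in>S. \<forall>x\<in>Hom W X (H (a, b)). act W P A X ([a, b], unit_elt W P X, [x]) = x"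
    and as: "\<forall>X\<in>Ob W. \<forall>e\<in>S \<times> S. \<forall>(as, p, ws)\<in>nested_words W P A X e.
        act W P A X (as, p, map (act W P A X) ws) = act W P A X (flatten W P X (as, p, ws))"
    using assms unfolding vpOb_def mem_Collect_eq by (elim exE conjE)
  show v: "vg A" using H A by (auto simp: vgraph_def)
  show "A = Alg (objs A) (homs A) (acts A)" "acts A \<in> extensional (strings A)"
    "homs A \<in> extensional (objs A \<times> objs A)" using A H g by (auto simp: PiE_def)
  show "arr W (acts A as) (Prod W (factors P A as)) (homs A e)" if "as \<in> paths A e"
  proof -
    have "as \<in> strings A" using that by (simp add: paths_def)
    then show ?thesis
      using g A paths_e[OF that] prod_ob[OF factors_ob[OF v that]] pathsD[OF that] vgraphD'[OF v, of e]
      by (auto simp: arr_def PiE_def Pi_def)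
  qed
  show "act W P A X ([a, b], unit_elt W P X, [x]) = x"
    if "X \<in> Ob W" "a \<in> objs A" "b \<in> objs A" "arr W x X (homs A (a, b))"
    using u that A by (simp add: arr_def)
  show "act W P A X (as, p, map (act W P A X) ws) = act W P A X (flatten W P X (as, p, ws))"
    if "X \<in> Ob W" "(as, p, ws) \<in> nested_words W P A X e"
  proof -
    have "e \<in> S \<times> S" using that(2) pathsD[of as A e] A by (auto simp: nested_words_def)
    then show ?thesis using as that by blast
  qed
qed

lemma vpI:
  assumes "A = Alg S (restrict H (S \<times> S)) (restrict g (strings A))" and v: "vg A"
    and g: "\<And>as e. as \<in> paths A e \<Longrightarrow> arr W (g as) (Prod W (factors P A as)) (homs A e)"
    and u: "\<And>X a b x. X \<in> Ob W \<Longrightarrow> a \<in> objs A \<Longrightarrow> b \<in> objs A \<Longrightarrow> arr W x X (homs A (a, b)) \<Longrightarrow>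
      act W P A X ([a, b], unit_elt W P X, [x]) = x"
    and as: "\<And>X as p ws e. X \<in> Ob W \<Longrightarrow> (as, p, ws) \<in> nested_words W P A X e \<Longrightarrow>
      act W P A X (as, p, map (act W P A X) ws) = act W P A X (flatten W P X (as, p, ws))"
  shows "A \<in> vpOb W P"
  unfolding vpOb_def mem_Collect_eq
proof (intro exI conjI)
  have sA: "objs A = S" "homs A = restrict H (S \<times> S)" by (subst assms(1), simp)+
  show "A = Alg S (restrict H (S \<times> S)) (restrict g (strings A))" by fact
  show "restrict H (S \<times> S) \<in> S \<times> S \<rightarrow>\<^sub>E Ob W" using v sA by (auto simp: vgraph_def)
  show "restrict g (strings A) \<in> (\<Pi>\<^sub>E as\<in>strings A. Hom W (Prod W (factors P A as)) (restrict H (S \<times> S) (hd as, last as)))"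
  proof -
    have "g as \<in> Hom W (Prod W (factors P A as)) (homs A (hd as, last as))" if "as \<in> strings A" for as
      using g[of as "(hd as, last as)"] that by (simp add: paths_def arr_def)
    then show ?thesis using sA by auto
  qed
  show "\<forall>X\<in>Ob W. \<forall>a\<in>S. \<forall>b\<in>S. \<forall>x\<in>Hom W X (restrict H (S \<times> S) (a, b)). act W P A X ([a, b], unit_elt W P X, [x]) = x"
    using u vgraphD[OF v] sA by (simp add: arr_def)
  show "\<forall>X\<in>Ob W. \<forall>e\<in>S \<times> S. \<forall>(as, p, ws)\<in>nested_words W P A X e.
        act W P A X (as, p, map (act W P A X) ws) = act W P A X (flatten W P X (as, p, ws))"
    using as by blast
qed

lemma act_arr:
  assumes "A \<in> vpOb W P" "X \<in> Ob W" "w \<in> words W P A X e"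
  shows "arr W (act W P A X w) X (homs A e)"
proof -
  have "fst w \<in> paths A e" using assms(3) by (auto simp: words_def)
  then show ?thesis
    unfolding act_def
    by (rule comp_arr[OF word_elt_arr[OF vpD(1)[OF assms(1)] assms(2,3)] vpD(5)[OF assms(1)]])
qed

lemma act_restr:
  assumes A: "A \<in> vpOb W P" and w: "w \<in> words W P A X e" and g: "arr W g Y X"
  shows "act W P A X w \<cdot> g = act W P A Y (restr_word W g w)"
proof -
  have as: "fst w \<in> paths A e" using w by (auto simp: words_def)
  show ?thesis
    unfolding act_def
    using assoc[OF g word_elt_arr[OF vpD(1)[OF A] arr_ob2[OF g] w] vpD(5)[OF A as]]
      word_elt_restr[OF vpD(1)[OF A] w g] by simp
qed

lemma vpHomD:
  assumes "f \<in> vpHom W P A B" "X \<in> Ob W" "w \<in> words W P A X e"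
  shows "happ f e \<cdot> act W P A X w = act W P B X (map_word W f w)"
proof -
  have "e \<in> objs A \<times> objs A" using assms(3) pathsD[of "fst w" A e] by (auto simp: words_def)
  then show ?thesis using assms by (auto simp: vpHom_def)
qed

lemma vpHomI:
  assumes "f \<in> gHom W A B"
    and "\<And>X e w. X \<in> Ob W \<Longrightarrow> w \<in> words W P A X e \<Longrightarrow> happ f e \<cdot> act W P A X w = act W P B X (map_word W f w)"
  shows "f \<in> vpHom W P A B"
  using assms by (auto simp: vpHom_def)

lemma vpHom_gHom: "f \<in> vpHom W P A B \<Longrightarrow> f \<in> gHom W A B"
  by (simp add: vpHom_def)

lemma happ_comp':
  assumes "f \<in> gHom W A B" "g \<in> gHom W B D" "vg A" "vg B" "vg D" "e \<in> objs A \<times> objs A"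
    and "arr W x X (homs A e)"
  shows "happ (gComp W g f) e \<cdot> x = happ g (map_prod (app f) (app f) e) \<cdot> happ f e \<cdot> x"
proof -
  obtain a b where e: "e = (a, b)" and ab: "a \<in> objs A" "b \<in> objs A" using assms(6) by blast
  have "app f a \<in> objs B" "app f b \<in> objs B" using gHom_ob[OF assms(1)] ab by auto
  then show ?thesis
    using gHom_ob[OF assms(1)] ab assms(7)
      assoc[OF _ happ_arr[OF assms(1,3,4) ab] happ_arr[OF assms(2,4,5)]] unfolding e by simp
qed

lemma words_e: "w \<in> words W P A X e \<Longrightarrow> e \<in> objs A \<times> objs A"
  using pathsD[of "fst w" A e] by (auto simp: words_def)

lemma vpComp_hom:
  assumes A: "A \<in> vpOb W P" and B: "B \<in> vpOb W P" and D: "D \<in> vpOb W P"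
    and f: "f \<in> vpHom W P A B" and g: "g \<in> vpHom W P B D"
  shows "gComp W g f \<in> vpHom W P A D"
proof (rule vpHomI)
  note v = vpD(1)[OF A] vpD(1)[OF B] vpD(1)[OF D] and fh = vpHom_gHom[OF f] and gh = vpHom_gHom[OF g]
  show "gComp W g f \<in> gHom W A D" by (rule gComp_hom[OF fh gh v])
  fix X e w assume X: "X \<in> Ob W" and w: "w \<in> words W P A X e"
  show "happ (gComp W g f) e \<cdot> act W P A X w = act W P D X (map_word W (gComp W g f) w)"
    using happ_comp'[OF fh gh v words_e[OF w] act_arr[OF A X w]] vpHomD[OF f X w]
      vpHomD[OF g X map_word_words[OF v(1,2) X fh w]] map_word_comp[OF operadic_axioms v X fh gh w] by simp
qed

lemma vpId_hom:
  assumes A: "A \<in> vpOb W P"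
  shows "gId W A \<in> vpHom W P A A"
proof (rule vpHomI)
  note v = vpD(1)[OF A]
  show "gId W A \<in> gHom W A A" by (rule gId_hom[OF v])
  fix X e w assume X: "X \<in> Ob W" and w: "w \<in> words W P A X e"
  have "happ (gId W A) e = Id W (homs A e)" using words_e[OF w] by (simp add: gId_def)
  then show "happ (gId W A) e \<cdot> act W P A X w = act W P A X (map_word W (gId W A) w)"
    using id_left[OF act_arr[OF A X w]] map_word_id[OF operadic_axioms v X w] by simp
qed

lemma vp_category: "category (vp_cat W P)"
  unfolding category_def vp_cat_def cat.simps
  using vpComp_hom vpId_hom gComp_id[OF vpHom_gHom] gComp_assoc[OF vpHom_gHom vpHom_gHom vpHom_gHom] vpD(1)
  by auto

end

section \<open>Products of \<open>(V, P)\<close>-categories\<close>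

locale vpprod = vpcat W P for W :: "'a vcat" and P +
  fixes As assumes As: "set As \<subseteq> vpOb W P"
begin

abbreviation "D \<equiv> gProd W As"

lemma As_nth: "i < length As \<Longrightarrow> As ! i \<in> vpOb W P"
  using As by auto

lemma As_vg: "A \<in> set As \<Longrightarrow> vg A"
  using As vpD(1) by blast

lemma D_vg: "vg D"
  by (rule gProd_vg[OF As_vg])

lemma pi_hom: "i < length As \<Longrightarrow> gProj W As i \<in> gHom W D (As ! i)"
  by (rule gProj_hom[OF As_vg])

lemma mw_words:
  assumes "i < length As" "X \<in> Ob W" "w \<in> words W P D X e"
  shows "map_word W (gProj W As i) w \<in>
    words W P (As ! i) X (map_prod (app (gProj W As i)) (app (gProj W As i)) e)"
  by (rule map_word_words[OF D_vg vpD(1)[OF As_nth[OF assms(1)]] assms(2) pi_hom[OF assms(1)] assms(3)])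

definition pact :: "'a elt obj \<Rightarrow> 'a elt \<times> 'a elt \<Rightarrow> 'a elt word \<Rightarrow> 'a elt mor" where
  "pact X e w = tuple W X (hom_list As e)
     (map (\<lambda>i. act W P (As ! i) X (map_word W (gProj W As i) w)) [0..<length As])"

text \<open>The structure map for \<open>as\<close> is the componentwise action on the universal
  word: a map out of the product of the factors equals its value there.\<close>

definition palg :: "'a elt obj" where
  "palg = Alg (objs D) (restrict (homs D) (objs D \<times> objs D))
     (\<lambda>as\<in>strings D. pact (Prod W (factors P D as)) (hd as, last as) (uword D as))"

lemma hom_list_D:
  assumes "e \<in> objs D \<times> objs D"
  shows "homs D e = Prod W (hom_list As e)" "set (hom_list As e) \<subseteq> Ob W"
    "i < length As \<Longrightarrow> hom_list As e ! i = homs (As ! i) (map_prod (app (gProj W As i)) (app (gProj W As i)) e)"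
    "i < length As \<Longrightarrow> happ (gProj W As i) e = Proj W (hom_list As e) i"
  using assms hom_list_ob[OF As_vg] by auto

lemma pact_els:
  assumes X: "X \<in> Ob W" and w: "w \<in> words W P D X e"
  shows "els X (map (\<lambda>i. act W P (As ! i) X (map_word W (gProj W As i) w)) [0..<length As]) (hom_list As e)"
  unfolding els_def list_all2_conv_all_nth
  using X act_arr[OF As_nth X mw_words[OF _ X w]] hom_list_D(3)[OF words_e[OF w]] by auto

lemma pact_arr: "X \<in> Ob W \<Longrightarrow> w \<in> words W P D X e \<Longrightarrow> arr W (pact X e w) X (homs D e)"
  unfolding pact_def using tuple_arr[OF pact_els] hom_list_D(1)[OF words_e] by simp

lemma proj_pact: "X \<in> Ob W \<Longrightarrow> w \<in> words W P D X e \<Longrightarrow> i < length As \<Longrightarrow>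
    happ (gProj W As i) e \<cdot> pact X e w = act W P (As ! i) X (map_word W (gProj W As i) w)"
  unfolding pact_def using proj_tuple[OF pact_els, of X w e i] hom_list_D(4)[OF words_e] by simp

lemma pact_eqI:
  assumes "arr W h X (homs D e)" "arr W k X (homs D e)" "e \<in> objs D \<times> objs D"
    and "\<And>i. i < length As \<Longrightarrow> happ (gProj W As i) e \<cdot> h = happ (gProj W As i) e \<cdot> k"
  shows "h = k"
  using assms(1,2) unfolding hom_list_D(1)[OF assms(3)]
  by (rule tuple_eqI[OF _ _ hom_list_D(2)[OF assms(3)]]) (use assms(4) hom_list_D(4)[OF assms(3)] in auto)

lemma pact_restr:
  assumes w: "w \<in> words W P D X e" and g: "arr W g Y X"
  shows "pact X e w \<cdot> g = pact Y e (restr_word W g w)"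
proof -
  note X = arr_ob2[OF g]
  have "act W P (As ! i) X (map_word W (gProj W As i) w) \<cdot> g =
      act W P (As ! i) Y (map_word W (gProj W As i) (restr_word W g w))" if i: "i < length As" for i
    using act_restr[OF As_nth[OF i] mw_words[OF i X w] g]
      map_word_restr[OF D_vg vpD(1)[OF As_nth[OF i]] pi_hom[OF i] w g] by simp
  then show ?thesis
    unfolding pact_def tuple_comp[OF pact_els[OF X w] g] by (auto simp: comp_def intro!: arg_cong[of _ _ "tuple W Y _"])
qed

lemma palg_simps [simp]: "objs palg = objs D" "homs palg = homs D"
  "acts palg = (\<lambda>as\<in>strings D. pact (Prod W (factors P D as)) (hd as, last as) (uword D as))"
  by (simp_all add: palg_def gProd_def Let_def)

lemmas palg_cong = words_cong[of palg D, OF palg_simps(1,2)]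

text \<open>For universal words this is the definition of \<open>palg\<close>; every other word is a
  restriction of one of them.\<close>

lemma act_palg:
  assumes X: "X \<in> Ob W" and w: "w \<in> words W P D X e"
  shows "act W P palg X w = pact X e w"
proof -
  have as: "fst w \<in> paths D e" using w by (auto simp: words_def)
  then have s: "fst w \<in> strings D" by (simp add: paths_def)
  note t = word_elt_arr[OF D_vg X w]
  show ?thesis
    unfolding act_def palg_cong
    using s paths_e[OF as] pact_restr[OF uword(1)[OF D_vg as] t] restr_uword[OF D_vg X w] by simp
qed

lemma map_unit:
  "map_word W f ([a, b], u, [x]) = ([app f a, app f b], u, [happ f (a, b) \<cdot> x])"
  by (simp add: map_word_def)

text \<open>Each axiom is an equation of maps into a product of homs. After the projection with
  index \<open>i\<close> it becomes the same axiom for \<open>As ! i\<close>.\<close>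

lemma palg_ob: "palg \<in> vpOb W P"
proof (rule vpI)
  show "palg = Alg (objs D) (restrict (homs D) (objs D \<times> objs D))
      (restrict (\<lambda>as. pact (Prod W (factors P D as)) (hd as, last as) (uword D as)) (strings palg))"
    unfolding strings_cong[of palg D, OF palg_simps(1)] by (simp add: palg_def)
  show "vg palg" unfolding palg_cong by (rule D_vg)
  show "arr W (pact (Prod W (factors P D as)) (hd as, last as) (uword D as)) (Prod W (factors P palg as)) (homs palg e)"
    if "as \<in> paths palg e" for as e
  proof -
    have as: "as \<in> paths D e" using that paths_cong[of palg D] by simp
    show ?thesis
      using pact_arr[OF prod_ob[OF factors_ob[OF D_vg as]] uword(1)[OF D_vg as]] paths_e[OF as]
      by (simp add: palg_cong)
  qed
  show "act W P palg X ([a, b], unit_elt W P X, [x]) = x"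
    if X: "X \<in> Ob W" and ab: "a \<in> objs palg" "b \<in> objs palg" and x: "arr W x X (homs palg (a, b))" for X a b x
  proof -
    have x: "arr W x X (homs D (a, b))" and ab: "a \<in> objs D" "b \<in> objs D" using x ab by auto
    have w: "([a, b], unit_elt W P X, [x]) \<in> words W P D X (a, b)"
      unfolding words_iff[OF D_vg X] using ab x unit_elt_arr[OF X] by (auto intro!: pathsI)
    have "pact X (a, b) ([a, b], unit_elt W P X, [x]) = x"
    proof (rule pact_eqI[OF pact_arr[OF X w] x])
      fix i assume i: "i < length As"
      have "app (gProj W As i) a \<in> objs (As ! i)" "app (gProj W As i) b \<in> objs (As ! i)"
        using gHom_ob(2)[OF pi_hom[OF i]] ab by auto
      then show "happ (gProj W As i) (a, b) \<cdot> pact X (a, b) ([a, b], unit_elt W P X, [x]) =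
          happ (gProj W As i) (a, b) \<cdot> x"
        using proj_pact[OF X w i] comp_arr[OF x happ_arr[OF pi_hom[OF i] D_vg vpD(1)[OF As_nth[OF i]] ab]]
          vpD(6)[OF As_nth[OF i] X] by (simp add: map_unit)
    qed (use ab in auto)
    then show ?thesis using act_palg[OF X w] by simp
  qed
  fix X as p ws e assume X: "X \<in> Ob W" and n': "(as, p, ws) \<in> nested_words W P palg X e"
  have n: "(as, p, ws) \<in> nested_words W P D X e" using n' by (simp add: palg_cong)
  note d = n[unfolded nested_words_iff[OF X]]
  have ws: "list_all2 (\<lambda>d w. w \<in> words W P D X d) (steps as) ws" using d by blast
  have w1: "(as, p, map (act W P palg X) ws) \<in> words W P D X e"
    unfolding words_iff[OF D_vg X] using d act_palg[OF X] pact_arr[OF X]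
    by (auto simp: list_all2_map2 elim!: list_all2_mono)
  note w2 = flatten_words[OF D_vg X n]
  have "pact X e (as, p, map (act W P palg X) ws) = pact X e (flatten W P X (as, p, ws))"
  proof (rule pact_eqI[OF pact_arr[OF X w1] pact_arr[OF X w2] words_e[OF w1]])
    fix i assume i: "i < length As"
    let ?f = "gProj W As i"
    note vi = vpD(1)[OF As_nth[OF i]]
    have "map2 (\<lambda>d x. happ ?f d \<cdot> x) (steps as) (map (act W P palg X) ws) =
        map (act W P (As ! i) X) (map (map_word W ?f) ws)"
      using ws by (induction rule: list_all2_induct) (auto simp: act_palg[OF X] proj_pact[OF X _ i])
    then have m: "map_word W ?f (as, p, map (act W P palg X) ws) =
        (map (app ?f) as, p, map (act W P (As ! i) X) (map (map_word W ?f) ws))"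
      by (simp add: map_word_def)
    have mn: "(map (app ?f) as, p, map (map_word W ?f) ws) \<in> nested_words W P (As ! i) X (map_prod (app ?f) (app ?f) e)"
      using map_nested_words[OF D_vg vi X pi_hom[OF i] n] by (simp add: map_nested_def)
    have "act W P (As ! i) X (map_word W ?f (as, p, map (act W P palg X) ws)) =
        act W P (As ! i) X (map_word W ?f (flatten W P X (as, p, ws)))"
      using vpD(7)[OF As_nth[OF i] X mn] flatten_map[OF D_vg X n, of ?f] by (simp add: m map_nested_def)
    then show "happ ?f e \<cdot> pact X e (as, p, map (act W P palg X) ws) = happ ?f e \<cdot> pact X e (flatten W P X (as, p, ws))"
      using proj_pact[OF X w1 i] proj_pact[OF X w2 i] by simp
  qed
  then show "act W P palg X (as, p, map (act W P palg X) ws) = act W P palg X (flatten W P X (as, p, ws))"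
    using act_palg[OF X w1] act_palg[OF X w2] by simp
qed

lemma gHom_palg: "gHom W X palg = gHom W X D" "gHom W palg X = gHom W D X"
  by (auto simp: gHom_def)

lemma pi_vp: "i < length As \<Longrightarrow> gProj W As i \<in> vpHom W P palg (As ! i)"
  by (rule vpHomI) (simp_all add: pi_hom act_palg proj_pact gHom_palg palg_cong)

text \<open>Justifies the definite description in \<open>vpProd\<close>. If the projections are
  morphisms, they determine every component of the action on universal words, hence every structure
  map.\<close>

lemma vpProd_eq: "vpProd W P As = palg"
  unfolding vpProd_def
proof (rule the_equality)
  show "palg \<in> vpOb W P \<and> gr palg = D \<and> (\<forall>i<length As. gProj W As i \<in> vpHom W P palg (As ! i))"
    using palg_ob pi_vp by (auto simp: gr_def gProd_def Let_def)
  fix A assume A: "A \<in> vpOb W P \<and> gr A = D \<and> (\<forall>i<length As. gProj W As i \<in> vpHom W P A (As ! i))"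
  then have AO: "A \<in> vpOb W P" and oh: "objs A = objs D" "homs A = homs D"
    and pi: "\<And>i. i < length As \<Longrightarrow> gProj W As i \<in> vpHom W P A (As ! i)"
    by (auto simp: gr_def gProd_def Let_def)
  note c = words_cong[OF oh]
  have sA: "strings A = strings D" by (rule strings_cong[OF oh(1)])
  have "acts A = acts palg"
  proof (rule extensionalityI[of _ "strings D"])
    show "acts A \<in> extensional (strings D)" using vpD(3)[OF AO] sA by simp
    show "acts palg \<in> extensional (strings D)" by simp
    fix as assume s: "as \<in> strings D"
    define e where "e = (hd as, last as)"
    have as: "as \<in> paths D e" using s by (simp add: paths_def e_def)
    let ?Z = "Prod W (factors P D as)"
    note Z = prod_ob[OF factors_ob[OF D_vg as]] and u = uword(1)[OF D_vg as]
    have uA: "uword D as \<in> words W P A ?Z e" using u by (simp add: c)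
    have aa: "arr W (acts A as) ?Z (homs D e)"
      using vpD(5)[OF AO, of as e] as c oh paths_cong[OF oh(1)] by simp
    \<comment> \<open>A structure map is recovered as the action on the universal word, whose
      classifying map is the identity.\<close>
    have "act W P A ?Z (uword D as) = acts A as"
      unfolding act_def c uword(2,3)[OF D_vg as] using id_right[OF aa] by simp
    then have "acts A as = pact ?Z e (uword D as)"
      using pact_eqI[OF aa pact_arr[OF Z u] words_e[OF u]] vpHomD[OF pi Z uA] proj_pact[OF Z u] by simp
    then show "acts A as = acts palg as" using s by (simp add: e_def)
  qed
  then show "A = palg"
    using vpD(2)[OF AO] vpD(2)[OF palg_ob] oh by simp
qed

lemma gtuple_vp:
  assumes X: "X \<in> vpOb W P" and fs: "list_all2 (\<lambda>f A. f \<in> vpHom W P X A) fs As"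
  shows "gtuple X As fs \<in> vpHom W P X palg"
proof (rule vpHomI)
  have g: "ghoms X fs As"
    unfolding ghoms_def using fs As_vg vpHom_gHom by (auto simp: list_all2_conv_all_nth)
  note vX = vpD(1)[OF X] and h = gtuple_hom[OF g vpD(1)[OF X]]
  let ?h = "gtuple X As fs"
  show "?h \<in> gHom W X palg" using h by (simp add: gHom_palg)
  fix Y e w assume Y: "Y \<in> Ob W" and w: "w \<in> words W P X Y e"
  note e = words_e[OF w] and a = act_arr[OF X Y w]
  let ?e = "map_prod (app ?h) (app ?h) e"
  have mw: "map_word W ?h w \<in> words W P D Y ?e" by (rule map_word_words[OF vX D_vg Y h w])
  have "happ ?h e \<cdot> act W P X Y w = pact Y ?e (map_word W ?h w)"
  proof (rule pact_eqI[OF comp_arr[OF a gHomD(4)[OF h vX D_vg e]] pact_arr[OF Y mw] words_e[OF mw]])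
    fix i assume i: "i < length As"
    note vi = vpD(1)[OF As_nth[OF i]]
    have f: "gComp W (gProj W As i) ?h = fs ! i" by (rule gProj_gtuple[OF g vX i])
    have fi: "fs ! i \<in> vpHom W P X (As ! i)" using fs i by (auto simp: list_all2_conv_all_nth)
    have "happ (gProj W As i) ?e \<cdot> happ ?h e \<cdot> act W P X Y w = act W P (As ! i) Y (map_word W (fs ! i) w)"
      using happ_comp'[OF h pi_hom[OF i] vX D_vg vi e a] vpHomD[OF fi Y w] f by simp
    also have "\<dots> = act W P (As ! i) Y (map_word W (gProj W As i) (map_word W ?h w))"
      using map_word_comp[OF operadic_axioms vX D_vg vi Y h pi_hom[OF i] w] f by simp
    finally show "happ (gProj W As i) ?e \<cdot> happ ?h e \<cdot> act W P X Y w = happ (gProj W As i) ?e \<cdot> pact Y ?e (map_word W ?h w)"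
      using proj_pact[OF Y mw i] by simp
  qed
  then show "happ ?h e \<cdot> act W P X Y w = act W P palg Y (map_word W ?h w)"
    using act_palg[OF Y mw] by simp
qed

end

context vpcat
begin

lemma vp_simps [simp]: "Ob (vp_cat W P) = vpOb W P" "Hom (vp_cat W P) = vpHom W P"
  "Id (vp_cat W P) = gId W" "Comp (vp_cat W P) = gComp W" "Prod (vp_cat W P) = vpProd W P"
  "Proj (vp_cat W P) = gProj W"
  by (simp_all add: vp_cat_def)

lemma vpprodI: "set As \<subseteq> vpOb W P \<Longrightarrow> vpprod W P As"
  by unfold_locales

lemma vp_prodcat: "prodcat (vp_cat W P)"
proof
  show "category (vp_cat W P)" by (rule vp_category)
  show "Prod (vp_cat W P) As \<in> Ob (vp_cat W P)" if "set As \<subseteq> Ob (vp_cat W P)" for As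
    using that vpprod.palg_ob[OF vpprodI] vpprod.vpProd_eq[OF vpprodI] by simp
  show "Proj (vp_cat W P) As i \<in> Hom (vp_cat W P) (Prod (vp_cat W P) As) (As ! i)"
    if "set As \<subseteq> Ob (vp_cat W P)" "i < length As" for As i
    using that vpprod.pi_vp[OF vpprodI] vpprod.vpProd_eq[OF vpprodI] by simp
  fix X fs As assume X': "X \<in> Ob (vp_cat W P)" and fs': "list_all2 (\<lambda>f A. arr (vp_cat W P) f X A) fs As"
  have X: "X \<in> vpOb W P" using X' by simp
  have fs: "list_all2 (\<lambda>f A. f \<in> vpHom W P X A) fs As" and As: "set As \<subseteq> vpOb W P"
    using fs' by (auto simp: arr_def elim!: list_all2_mono dest: list_all2_ex2)
  interpret p: vpprod W P As by (rule vpprodI[OF As])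
  note vX = vpD(1)[OF X]
  have g: "ghoms X fs As"
    unfolding ghoms_def using fs p.As_vg vpHom_gHom by (auto simp: list_all2_conv_all_nth)
  show "\<exists>!h. h \<in> Hom (vp_cat W P) X (Prod (vp_cat W P) As) \<and>
      (\<forall>i<length As. Comp (vp_cat W P) (Proj (vp_cat W P) As i) h = fs ! i)"
    unfolding vp_simps p.vpProd_eq
  proof (rule ex1I[of _ "gtuple X As fs"])
    show "gtuple X As fs \<in> vpHom W P X p.palg \<and> (\<forall>i<length As. gComp W (gProj W As i) (gtuple X As fs) = fs ! i)"
      using p.gtuple_vp[OF X fs] gProj_gtuple[OF g vX] by blast
    fix h assume "h \<in> vpHom W P X p.palg \<and> (\<forall>i<length As. gComp W (gProj W As i) h = fs ! i)"
    then show "h = gtuple X As fs"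
      using gProj_gtuple[OF g vX] vpHom_gHom[of h X p.palg] p.gHom_palg(1)
      by (intro gProd_eqI[OF _ gtuple_hom[OF g vX] vX p.As_vg]) auto
  qed
qed

end

section \<open>Passing to the next dimension\<close>

definition Ug :: "('u obj \<Rightarrow> 'u obj) \<Rightarrow> 'u obj \<Rightarrow> 'u obj" where
  "Ug K A = Graph (objs A) (\<lambda>e\<in>objs A \<times> objs A. K (homs A e))"

lemma objs_Ug [simp]: "objs (Ug K A) = objs A"
  and homs_Ug [simp]: "a \<in> objs A \<Longrightarrow> b \<in> objs A \<Longrightarrow> homs (Ug K A) (a, b) = K (homs A (a, b))"
  by (simp_all add: Ug_def)

lemma homs_Ug': "e \<in> objs A \<times> objs A \<Longrightarrow> homs (Ug K A) e = K (homs A e)"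
  by (simp add: Ug_def)

lemma paths_Ug [simp]: "paths (Ug K A) = paths A"
  by (rule paths_cong) simp

text \<open>\<open>W\<close>, \<open>N\<close> and \<open>P\<close> stand for V_m, the m-globular
  sets and P_m. The results compare \<open>vp_cat W P\<close> with \<open>gph N\<close>, their
  counterparts in the next dimension.\<close>

locale step = under_operad W N U P + vp: vpcat W P + E: enriching N G
  for W :: "'a vcat" and N :: "'a gcat" and U and P and G
begin

sublocale F: freecat N G R
  by unfold_locales

abbreviation "U' \<equiv> Ug U"
abbreviation "Fc \<equiv> fc_ob N R"
abbreviation "fcM \<equiv> fc N R"

lemma U'_vg: "vgraph W A \<Longrightarrow> vgraph N (U' A)"
  unfolding vgraph_def using U_ob by (auto simp: homs_Ug')

lemma U'_ob: "vgraph W A \<Longrightarrow> U' A \<in> Ob (gph N)"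
  unfolding Ug_def by (rule E.gOb_I[OF refl]) (use U_ob vgraphD[of W A] in blast)

lemma U'_hom:
  assumes f: "f \<in> gHom W A B" and A: "vgraph W A" and B: "vgraph W B"
  shows "f \<in> gHom N (U' A) (U' B)"
proof -
  have "Gmor (objs (U' A)) (app f) (restrict (happ f) (objs (U' A) \<times> objs (U' A))) \<in> gHom N (U' A) (U' B)"
    by (rule gHomI') (use gHomD(3)[OF f A B] U_arr[OF happ_arr[OF f A B]] gHom_ob[OF f] in auto)
  moreover have "restrict (happ f) (objs A \<times> objs A) = happ f"
    using gHomD(5)[OF f A B] by (rule extensional_restrict)
  ultimately show ?thesis using gHomD(1,6)[OF f A B] by simp
qed

lemma hom_list_Ug:
  assumes "z \<in> tuples (map objs As)" "z' \<in> tuples (map objs As)"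
  shows "hom_list (map U' As) (z, z') = map U (hom_list As (z, z'))"
  using tuples_nth[OF assms(1)] tuples_nth[OF assms(2)] by (auto simp: hom_list_def)

text \<open>By \<open>vpProd_eq\<close> a product of \<open>(W, P)\<close>-categories lives on the
  product graph, whose homs are products in \<open>W\<close>, and these are preserved strictly by
  \<open>U\<close>.\<close>

lemma underlying_step: "underlying (vp_cat W P) (gph N) U'"
proof -
  interpret vc: prodcat "vp_cat W P" by (rule vp.vp_prodcat)
  interpret gc: prodcat "gph N" by (rule E.gph_prodcat)
  have o: "map objs (map U' As) = map objs As" for As by simp
  show ?thesis
  proof
    show "U' A \<in> Ob (gph N)" if "A \<in> Ob (vp_cat W P)" for A
      using that U'_ob vp.vpD(1) by simp
    show "f \<in> Hom (gph N) (U' A) (U' B)"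
      if "A \<in> Ob (vp_cat W P)" "B \<in> Ob (vp_cat W P)" "f \<in> Hom (vp_cat W P) A B" for A B f
      using that U'_hom vp.vpD(1) vp.vpHom_gHom by simp
    show "Comp (vp_cat W P) = Comp (gph N)"
      by (simp add: gComp_def fun_eq_iff U_comp)
    show "Id (vp_cat W P) A = Id (gph N) (U' A)" if "A \<in> Ob (vp_cat W P)" for A
      using that U_id vgraphD'[OF vp.vpD(1)] by (auto simp: gId_def homs_Ug' intro!: restrict_ext)
    fix As assume As: "set As \<subseteq> Ob (vp_cat W P)"
    then have v: "vpprod W P As" by (simp add: vp.vpprodI)
    note hl = vp.hom_list_ob[OF vpprod.As_vg[OF v]]
    show "U' (Prod (vp_cat W P) As) = Prod (gph N) (map U' As)"
      unfolding vp.vp_simps E.gph_simps vpprod.vpProd_eq[OF v] Ug_def[of U "vpprod.palg W P As"]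
        gProd_def[of N] Let_def o vpprod.palg_simps[OF v] vp.objs_gProd
      using U_prod[OF hl] hom_list_Ug by (auto intro!: restrict_ext)
    show "Proj (vp_cat W P) As i = Proj (gph N) (map U' As) i" if "i < length As" for i
      unfolding vp.vp_simps E.gph_simps gProj_def Let_def o
      using U_proj[OF hl] hom_list_Ug that by (auto intro!: restrict_ext)
  qed
qed

section \<open>Categories acting on words at globular stages\<close>

lemma factors_U:
  assumes "as \<in> paths A e"
  shows "factors R (U' A) as = map U (factors P A as)"
  using paths_steps[OF assms] by (auto simp: factors_def rev_map homs_Ug')

lemma words_U:
  assumes A: "vgraph W A" and Z: "Z \<in> Ob W" and w: "w \<in> words W P A Z e"
  shows "w \<in> words N R (U' A) (U Z) e"
proof -
  obtain as p xs where w': "w = (as, p, xs)" by (metis prod.collapse)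
  note d = w[unfolded w' P.words_iff[OF A Z]]
  have "list_all2 (\<lambda>d x. arr N x (U Z) (homs (U' A) d)) (steps as) xs"
    unfolding list_all2_conv_all_nth
  proof (intro conjI allI impI)
    show "length (steps as) = length xs" using d by (auto dest: list_all2_lengthD)
    fix i assume i: "i < length (steps as)"
    then have "arr W (xs ! i) Z (homs A (steps as ! i))" using d by (auto simp: list_all2_conv_all_nth)
    moreover have "steps as ! i \<in> objs A \<times> objs A" using i paths_steps d nth_mem by blast
    ultimately show "arr N (xs ! i) (U Z) (homs (U' A) (steps as ! i))"
      using U_arr by (simp add: homs_Ug')
  qed
  then show ?thesis
    using d U_arr unfolding w' R.words_iff[OF U'_vg[OF A] U_ob[OF Z]] by simp
qed

text \<open>Universal words consist of projections, which \<open>U\<close> leaves unchanged.\<close>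

lemma uword_U:
  assumes A: "vgraph W A" and as: "as \<in> paths A e"
  shows "R.uword (U' A) as = P.uword A as"
  unfolding R.uword_def P.uword_def factors_U[OF as] U_projs[OF P.factors_ob[OF A as]] ..

lemma nfac_U:
  assumes as: "as \<in> paths A e" and A: "vgraph W A"
    and bss: "list_all2 (\<lambda>d bs. bs \<in> paths A d) (steps as) bss"
  shows "R.nfac (U' A) as bss = map U (P.nfac A as bss)" "R.unest (U' A) as bss = P.unest A as bss"
proof -
  have b: "R.uword (U' A) bs = P.uword A bs \<and> Prod N (factors R (U' A) bs) = U (Prod W (factors P A bs))"
    if bs: "bs \<in> set bss" for bs
  proof -
    obtain d where d: "bs \<in> paths A d" using list_all2_ex2[OF bss bs] by blast
    show ?thesis
      using uword_U[OF A d] factors_U[OF d] U_prod[OF P.factors_ob[OF A d]] by simp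
  qed
  show nf: "R.nfac (U' A) as bss = map U (P.nfac A as bss)"
    using b by (simp add: R.nfac_def P.nfac_def)
  have "map2 (\<lambda>bs q. restr_word N q (R.uword (U' A) bs)) bss qs =
      map2 (\<lambda>bs q. restr_word W q (P.uword A bs)) bss qs" for qs
    using b by (auto simp: restr_word_def U_comp dest!: set_zip_leftD)
  then show "R.unest (U' A) as bss = P.unest A as bss"
    unfolding R.unest_def P.unest_def nf U_projs[OF P.nfac_ob[OF A bss]] Let_def by simp
qed

text \<open>Extends the action of a \<open>(W, P)\<close>-category from words at stages of
  \<open>W\<close> to words at all stages of \<open>N\<close>, including those not of the form
  \<open>U Z\<close>.\<close>

definition actN :: "'a elt obj \<Rightarrow> 'a elt obj \<Rightarrow> 'a elt word \<Rightarrow> 'a elt mor" where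
  "actN A X w = Comp N (acts A (fst w)) (word_elt N R (U' A) X w)"

lemma words_path: "w \<in> words N R A X e \<Longrightarrow> fst w \<in> paths A e"
  by (auto simp: words_def)

lemma acts_arr:
  assumes A: "A \<in> vpOb W P" and as: "as \<in> paths A e"
  shows "arr N (acts A as) (Prod N (factors R (U' A) as)) (homs (U' A) e)"
  using U_arr[OF vp.vpD(5)[OF A as]] U_prod[OF P.factors_ob[OF vp.vpD(1)[OF A] as]] factors_U[OF as]
    pathsD[OF as] by (simp add: homs_Ug')

lemma act_actN:
  assumes A: "A \<in> vpOb W P" and Z: "Z \<in> Ob W" and w: "w \<in> words W P A Z e"
  shows "act W P A Z w = actN A (U Z) w"
proof -
  obtain as p xs where w': "w = (as, p, xs)" by (metis prod.collapse)
  have as: "as \<in> paths A e" using w w' by (auto simp: words_def)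
  have "W.els Z (p # rev xs) (factors P A as)"
    using P.word_els[OF vp.vpD(1)[OF A] Z] w w' by blast
  from U_tuple[OF this] show ?thesis
    by (simp add: w' act_def actN_def word_elt_def factors_U[OF as] U_comp)
qed

lemma actN_arr:
  assumes A: "A \<in> vpOb W P" and X: "X \<in> Ob N" and w: "w \<in> words N R (U' A) X e"
  shows "arr N (actN A X w) X (homs (U' A) e)"
  unfolding actN_def using words_path[OF w]
  by (intro N.comp_arr[OF R.word_elt_arr[OF U'_vg[OF vp.vpD(1)[OF A]] X w] acts_arr[OF A]]) simp

lemma actN_restr:
  assumes A: "A \<in> vpOb W P" and w: "w \<in> words N R (U' A) X e" and g: "arr N g Y X"
  shows "actN A X w \<cdot> g = actN A Y (restr_word N g w)"
proof -
  note v = U'_vg[OF vp.vpD(1)[OF A]]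
  have "fst w \<in> paths A e" using words_path[OF w] by simp
  then show ?thesis
    unfolding actN_def
    using N.assoc[OF g R.word_elt_arr[OF v arr_ob2[OF g] w] acts_arr[OF A]]
      R.word_elt_restr[OF v w g] by simp
qed

text \<open>The universal word lives at a stage of \<open>W\<close>, and \<open>w\<close> is its
  restriction along the map classifying \<open>w\<close>.\<close>

lemma lift_word:
  assumes A: "vgraph W A" and X: "X \<in> Ob N" and w: "w \<in> words N R (U' A) X e"
  obtains Z g v where "Z \<in> Ob W" "arr N g X (U Z)" "v \<in> words W P A Z e" "w = restr_word N g v"
proof
  have as: "fst w \<in> paths A e" using words_path[OF w] by simp
  note f = P.factors_ob[OF A as]
  show "Prod W (factors P A (fst w)) \<in> Ob W" by (rule W.prod_ob[OF f])
  show "arr N (word_elt N R (U' A) X w) X (U (Prod W (factors P A (fst w))))"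
    using R.word_elt_arr[OF U'_vg[OF A] X w] by (simp add: U_prod[OF f] factors_U[OF as])
  show "P.uword A (fst w) \<in> words W P A (Prod W (factors P A (fst w))) e"
    by (rule P.uword(1)[OF A as])
  show "w = restr_word N (word_elt N R (U' A) X w) (P.uword A (fst w))"
    using R.restr_uword[OF U'_vg[OF A] X w] uword_U[OF A as] by simp
qed

lemma lift_nested:
  assumes A: "vgraph W A" and X: "X \<in> Ob N" and n: "n \<in> nested_words N R (U' A) X e"
  obtains Z g m where "Z \<in> Ob W" "arr N g X (U Z)" "m \<in> nested_words W P A Z e" "n = restr_nested N g m"
proof -
  obtain as bss g where as: "as \<in> paths A e" and bss: "list_all2 (\<lambda>d bs. bs \<in> paths A d) (steps as) bss"
    and g: "arr N g X (Prod N (R.nfac (U' A) as bss))" and n': "n = restr_nested N g (R.unest (U' A) as bss)"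
    using R.nested_factor[OF U'_vg[OF A] X n] by auto
  note u = nfac_U[OF as A bss] and ob = P.nfac_ob[OF A bss, of as]
  show ?thesis
    by (rule that[OF W.prod_ob[OF ob] _ P.unest_nested[OF A as bss]])
      (use g n' in \<open>auto simp: u U_prod[OF ob]\<close>)
qed

lemma nested_U:
  assumes A: "vgraph W A" and Z: "Z \<in> Ob W" and n: "n \<in> nested_words W P A Z e"
  shows "n \<in> nested_words N R (U' A) (U Z) e"
proof -
  obtain as p ws where n': "n = (as, p, ws)" by (metis prod.collapse)
  show ?thesis
    using n U_arr words_U[OF A Z] unfolding n' P.nested_words_iff[OF Z] R.nested_words_iff[OF U_ob[OF Z]]
    by (auto elim!: list_all2_mono)
qed

lemma flatten_U:
  assumes A: "vgraph W A" and Z: "Z \<in> Ob W" and n: "n \<in> nested_words W P A Z e"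
  shows "flatten W P Z n = flatten N R (U Z) n"
proof -
  obtain as p ws where n': "n = (as, p, ws)" by (metis prod.collapse)
  note d = n[unfolded n' P.nested_words_iff[OF Z]]
  have ws: "list_all2 (\<lambda>d w. w \<in> words W P A Z d) (steps as) ws" using d by blast
  have "length ws = length as - 1" using ws by (auto dest: list_all2_lengthD)
  then have "comp_elt W P Z p (map (\<lambda>w. (length (fst w) - 1, fst (snd w))) ws) =
      comp_elt N R (U Z) p (map (\<lambda>w. (length (fst w) - 1, fst (snd w))) ws)"
    using d P.nested_arr[OF A Z ws] by (intro U_comp_elt) auto
  then show ?thesis by (simp add: n' P.flatten_eq R.flatten_eq)
qed

text \<open>The axiom is used for the universal letter, the identity of the hom, and then restricted
  along \<open>x\<close>.\<close>

lemma actN_unit: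
  assumes A: "A \<in> vpOb W P" and ab: "a \<in> objs A" "b \<in> objs A" and x: "arr N x X (homs (U' A) (a, b))"
  shows "actN A X ([a, b], unit_elt N R X, [x]) = x"
proof -
  let ?Z = "homs A (a, b)" and ?i = "Id W (homs A (a, b))"
  note vA = vp.vpD(1)[OF A]
  have Z: "?Z \<in> Ob W" by (rule vgraphD[OF vA ab])
  have i: "arr W ?i ?Z (homs A (a, b))" by (rule W.id_arr[OF Z])
  have x': "arr N x X (U ?Z)" using x ab by simp
  have w: "([a, b], unit_elt W P ?Z, [?i]) \<in> words W P A ?Z (a, b)"
    unfolding P.words_iff[OF vA Z] using ab i P.unit_elt_arr[OF Z] by (auto intro!: pathsI)
  have "?i = actN A (U ?Z) ([a, b], unit_elt N R (U ?Z), [?i])"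
    using vp.vpD(6)[OF A Z ab i] act_actN[OF A Z w] U_unit_elt[OF Z] by simp
  then have "?i \<cdot> x = actN A X (restr_word N x ([a, b], unit_elt N R (U ?Z), [?i]))"
    using actN_restr[OF A words_U[OF vA Z w] x'] U_unit_elt[OF Z] by simp
  moreover have "?i \<cdot> x = x" using N.id_left[OF x'] U_id[OF Z] by simp
  ultimately show ?thesis using R.unit_elt_restr[OF x'] by (simp add: restr_word_def)
qed

text \<open>The axiom holds in \<open>W\<close> for the lifted nested word \<open>m\<close> and is
  then restricted along \<open>g\<close>; \<open>flatten_U\<close> makes flattening in
  \<open>W\<close> and in \<open>N\<close> agree.\<close>

lemma actN_assoc:
  assumes A: "A \<in> vpOb W P" and X: "X \<in> Ob N" and n: "(as, p, ws) \<in> nested_words N R (U' A) X e"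
  shows "actN A X (as, p, map (actN A X) ws) = actN A X (flatten N R X (as, p, ws))"
proof -
  note vA = vp.vpD(1)[OF A] and v' = U'_vg[OF vp.vpD(1)[OF A]]
  obtain Z g m where Z: "Z \<in> Ob W" and g: "arr N g X (U Z)" and m: "m \<in> nested_words W P A Z e"
    and nm: "(as, p, ws) = restr_nested N g m" using lift_nested[OF vA X n] by blast
  obtain p' vs where m': "m = (as, p', vs)" "p = p' \<cdot> g" "ws = map (restr_word N g) vs"
    using nm by (cases m) (auto simp: restr_nested_def)
  note d = m[unfolded m' P.nested_words_iff[OF Z]]
  have vs: "list_all2 (\<lambda>d w. w \<in> words W P A Z d) (steps as) vs" using d by blast
  have v: "actN A (U Z) v \<cdot> g = actN A X (restr_word N g v) \<and> act W P A Z v = actN A (U Z) v"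
    if "v \<in> set vs" for v
  proof -
    obtain d' where "v \<in> words W P A Z d'" using list_all2_ex2[OF vs \<open>v \<in> set vs\<close>] by blast
    then show ?thesis using actN_restr[OF A words_U[OF vA Z] g] act_actN[OF A Z] by blast
  qed
  have w1: "(as, p', map (act W P A Z) vs) \<in> words W P A Z e"
    unfolding P.words_iff[OF vA Z] using d vp.act_arr[OF A Z] by (auto simp: list_all2_map2 elim!: list_all2_mono)
  have w2: "flatten W P Z m \<in> words W P A Z e" using P.flatten_words[OF vA Z] m m' by simp
  have "map (actN A X) ws = map (\<lambda>x. x \<cdot> g) (map (act W P A Z) vs)"
    using v m'(3) by simp
  then have "actN A X (as, p, map (actN A X) ws) = actN A X (restr_word N g (as, p', map (act W P A Z) vs))"
    using m'(2) by (simp add: restr_word_def)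
  also have "\<dots> = act W P A Z (as, p', map (act W P A Z) vs) \<cdot> g"
    using actN_restr[OF A words_U[OF vA Z w1] g] act_actN[OF A Z w1] by simp
  also have "\<dots> = actN A X (restr_word N g (flatten N R (U Z) m))"
    using vp.vpD(7)[OF A Z m[unfolded m']] actN_restr[OF A words_U[OF vA Z w2] g] act_actN[OF A Z w2]
      flatten_U[OF vA Z m] m' by simp
  also have "\<dots> = actN A X (flatten N R X (as, p, ws))"
    using R.flatten_restr[OF v' nested_U[OF vA Z m] g] nm by simp
  finally show ?thesis .
qed

lemma map_word_U: "map_word W f = map_word N f"
  by (simp add: map_word_def U_comp)

lemma actN_hom:
  assumes A: "A \<in> vpOb W P" and B: "B \<in> vpOb W P" and f: "f \<in> vpHom W P A B" and X: "X \<in> Ob N"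
    and w: "w \<in> words N R (U' A) X e"
  shows "happ f e \<cdot> actN A X w = actN B X (map_word N f w)"
proof -
  note v = vp.vpD(1)[OF A] vp.vpD(1)[OF B] and fh = vp.vpHom_gHom[OF f]
  note v' = U'_vg[OF v(1)] U'_vg[OF v(2)]
  obtain Z g u where Z: "Z \<in> Ob W" and g: "arr N g X (U Z)" and u: "u \<in> words W P A Z e"
    and wu: "w = restr_word N g u" using lift_word[OF v(1) X w] by blast
  note u' = words_U[OF v(1) Z u] and fu = P.map_word_words[OF v Z fh u]
  have hf: "arr N (happ f e) (homs (U' A) e) (homs (U' B) (map_prod (app f) (app f) e))"
    by (rule gHomD(4)[OF U'_hom[OF fh v] v']) (use vp.words_e[OF u] in simp)
  have "happ f e \<cdot> actN A X w = (happ f e \<cdot> actN A (U Z) u) \<cdot> g"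
    using N.assoc[OF g actN_arr[OF A U_ob[OF Z] u'] hf] actN_restr[OF A u' g] wu by simp
  also have "\<dots> = actN B (U Z) (map_word N f u) \<cdot> g"
    using vp.vpHomD[OF f Z u] act_actN[OF A Z u] act_actN[OF B Z fu] by (simp add: U_comp map_word_U)
  also have "\<dots> = actN B X (map_word N f w)"
    using actN_restr[OF B words_U[OF v(2) Z fu] g] R.map_word_restr[OF v' U'_hom[OF fh v] u' g] wu
    by (simp add: map_word_U)
  finally show ?thesis .
qed

section \<open>Algebra structures in the next dimension\<close>

definition al0 :: "'a elt obj \<Rightarrow> 'a elt mor" where
  "al0 A = Gmor (objs A) (\<lambda>a\<in>objs A. a) (\<lambda>e\<in>objs A \<times> objs A.
     THE h. h \<in> Hom N (homs (Fc (U' A)) e) (homs (U' A) e) \<and>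
       (\<forall>X\<in>Ob N. \<forall>w\<in>words N R (U' A) X e. h \<cdot> fc_elt N R (U' A) X w = actN A X w))"

lemma al0:
  assumes A: "A \<in> vpOb W P"
  shows "al0 A \<in> gHom N (Fc (U' A)) (U' A)" "a \<in> objs A \<Longrightarrow> app (al0 A) a = a" "src (al0 A) = objs A"
    "X \<in> Ob N \<Longrightarrow> w \<in> words N R (U' A) X e \<Longrightarrow> happ (al0 A) e \<cdot> fc_elt N R (U' A) X w = actN A X w"
proof -
  note v' = U'_vg[OF vp.vpD(1)[OF A]]
  have h: "\<exists>!h. h \<in> Hom N (homs (Fc (U' A)) e) (homs (U' A) e) \<and>
       (\<forall>X\<in>Ob N. \<forall>w\<in>words N R (U' A) X e. h \<cdot> fc_elt N R (U' A) X w = actN A X w)"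
    if e: "e \<in> objs A \<times> objs A" for e
    by (rule F.F_rec[OF v']) (use e vgraphD'[OF v'] actN_arr[OF A] actN_restr[OF A] in auto)
  have H: "happ (al0 A) e \<in> Hom N (homs (Fc (U' A)) e) (homs (U' A) e) \<and>
       (\<forall>X\<in>Ob N. \<forall>w\<in>words N R (U' A) X e. happ (al0 A) e \<cdot> fc_elt N R (U' A) X w = actN A X w)"
    if e: "e \<in> objs A \<times> objs A" for e
    using theI'[OF h[OF e]] e by (simp add: al0_def)
  show "src (al0 A) = objs A" "a \<in> objs A \<Longrightarrow> app (al0 A) a = a" by (simp_all add: al0_def)
  show "happ (al0 A) e \<cdot> fc_elt N R (U' A) X w = actN A X w" if "X \<in> Ob N" "w \<in> words N R (U' A) X e"
    using H[of e] that F.words_pathsD[OF that(2)] by simp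
  show "al0 A \<in> gHom N (Fc (U' A)) (U' A)"
    using H by (auto simp: gHom_def al0_def)
qed

text \<open>The algebra axioms for \<open>fc\<close> are the unit and associativity axioms of a
  \<open>(W, P)\<close>-category, in the form \<open>actN_unit\<close> and
  \<open>actN_assoc\<close>; naturality is \<open>actN_hom\<close>, i.e. that functors preserve
  composition.\<close>

lemma algs_al0: "algs (vp_cat W P) (gph N) U' fcM al0"
  unfolding algs_def E.gph_simps vp.vp_simps F.fob_fc
proof (intro conjI ballI allI impI)
  fix A assume A: "A \<in> vpOb W P"
  note v = U'_vg[OF vp.vpD(1)[OF A]] and a = al0[OF A]
  note Fv = F.F_vg[OF v]
  show "arr (gph N) (al0 A) (Fc (U' A)) (U' A)"
    using a(1) F.F_ob[OF v] U'_ob[OF vp.vpD(1)[OF A]] by (simp add: E.garr_iff)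
  note e = F.eta_fc[OF v] and m = F.mu_fc[OF v] and f = F.fmap_fc[OF a(1) Fv v]
  show "gComp N (al0 A) (eta fcM (U' A)) = gId N (U' A)"
  proof (rule E.gext[OF E.gComp_hom[OF e(1) a(1) v Fv v] E.gId_hom[OF v] v v])
    show "app (gComp N (al0 A) (eta fcM (U' A))) x = app (gId N (U' A)) x" if "x \<in> objs (U' A)" for x
      using that gHom_ob[OF e(1)] e(2) a(2) by simp
    fix x y X h assume xy': "x \<in> objs (U' A)" "y \<in> objs (U' A)" and X: "X \<in> G" and h: "arr N h X (homs (U' A) (x, y))"
    have xy: "x \<in> objs A" "y \<in> objs A" using xy' by auto
    show "happ (gComp N (al0 A) (eta fcM (U' A))) (x, y) \<cdot> h = happ (gId N (U' A)) (x, y) \<cdot> h"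
      using E.happ_comp[OF e(1) a(1) v Fv v xy' h] e(2)[OF xy'(1)] e(2)[OF xy'(2)] e(3)[OF xy' h]
        a(4)[OF E.probeD[OF X] F.eta_word[OF v xy' h]] actN_unit[OF A xy h] N.id_left[OF h] xy by simp
  qed
  show "gComp N (al0 A) (mu fcM (U' A)) = gComp N (al0 A) (fmap fcM (Fc (U' A)) (U' A) (al0 A))"
  proof (rule F.FF_gext[OF E.gComp_hom[OF m(1) a(1)] E.gComp_hom[OF f(1) a(1)] v v])
    show "vgraph N (Fc (Fc (U' A)))" "vgraph N (Fc (U' A))" "vgraph N (U' A)"
      "vgraph N (Fc (Fc (U' A)))" "vgraph N (Fc (U' A))" "vgraph N (U' A)"
      by (rule F.F_vg[OF Fv] Fv v)+
    show "app (gComp N (al0 A) (mu fcM (U' A))) x = app (gComp N (al0 A) (fmap fcM (Fc (U' A)) (U' A) (al0 A))) x"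
      if "x \<in> objs (U' A)" for x
      using that gHom_ob[OF m(1)] gHom_ob[OF f(1)] m(2) f(2) a(2) by simp
    fix x y X n assume xy: "x \<in> objs (U' A)" "y \<in> objs (U' A)" and X: "X \<in> G" "X \<in> Ob N"
      and n: "n \<in> nested_words N R (U' A) X (x, y)"
    obtain as p ws where n': "n = (as, p, ws)" by (metis prod.collapse)
    note d = n[unfolded n' R.nested_words_iff[OF X(2)]]
    note ne = F.nelt_arr[OF v X(2) n]
    have ws: "list_all2 (\<lambda>d w. w \<in> words N R (U' A) X d) (steps as) ws" using d by blast
    have "map2 (\<lambda>d x. happ (al0 A) d \<cdot> x) (steps as) (map (fc_elt N R (U' A) X) ws) = map (actN A X) ws"
      using ws by (induction rule: list_all2_induct) (auto simp: a(4)[OF X(2)])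
    moreover have "map (app (al0 A)) as = as"
      using pathsD[OF d[THEN conjunct1]] a(2) by (intro map_idI) auto
    ultimately have mw: "map_word N (al0 A) (F.wnest (U' A) X n) = (as, p, map (actN A X) ws)"
      by (simp add: n' F.wnest_def map_word_def)
    have w2: "(as, p, map (actN A X) ws) \<in> words N R (U' A) X (x, y)"
      unfolding R.words_iff[OF v X(2)] using d actN_arr[OF A X(2)] by (auto simp: list_all2_map2 elim!: list_all2_mono)
    have fl: "flatten N R X n \<in> words N R (U' A) X (x, y)" using R.flatten_words[OF v X(2)] n n' by simp
    have "happ (gComp N (al0 A) (mu fcM (U' A))) (x, y) \<cdot> F.nelt (U' A) X n = actN A X (flatten N R X n)"
      using E.happ_comp[OF m(1) a(1) F.F_vg[OF Fv] Fv v _ _ ne] xy m(2) m(3)[OF X(2) n] a(4)[OF X(2) fl] by simp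
    moreover have "happ (gComp N (al0 A) (fmap fcM (Fc (U' A)) (U' A) (al0 A))) (x, y) \<cdot> F.nelt (U' A) X n =
        actN A X (as, p, map (actN A X) ws)"
      using E.happ_comp[OF f(1) a(1) F.F_vg[OF Fv] Fv v _ _ ne] xy f(2) a(2)
        f(3)[OF X(2) F.wnest_words[OF v X(2) n]] mw a(4)[OF X(2) w2] by simp
    ultimately show "happ (gComp N (al0 A) (mu fcM (U' A))) (x, y) \<cdot> F.nelt (U' A) X n =
        happ (gComp N (al0 A) (fmap fcM (Fc (U' A)) (U' A) (al0 A))) (x, y) \<cdot> F.nelt (U' A) X n"
      using actN_assoc[OF A X(2)] n n' by simp
  qed
next
  fix A B f assume "arr (vp_cat W P) f A B"
  then have A: "A \<in> vpOb W P" and B: "B \<in> vpOb W P" and f: "f \<in> vpHom W P A B"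
    by (simp_all add: arr_def)
  note vA = vp.vpD(1)[OF A] and vB = vp.vpD(1)[OF B] and fh = vp.vpHom_gHom[OF f]
  note v = U'_vg[OF vA] U'_vg[OF vB] and f' = U'_hom[OF fh vA vB]
  note aA = al0[OF A] and aB = al0[OF B] and ff = F.fmap_fc[OF f' v]
  show "gComp N f (al0 A) = gComp N (al0 B) (fmap fcM (U' A) (U' B) f)"
  proof (rule F.F_gext[OF E.gComp_hom[OF aA(1) f'] E.gComp_hom[OF ff(1) aB(1)] v])
    show "vgraph N (Fc (U' A))" "vgraph N (U' A)" "vgraph N (U' B)" "vgraph N (Fc (U' A))"
      "vgraph N (Fc (U' B))" "vgraph N (U' B)" by (rule F.F_vg v)+
    show "app (gComp N f (al0 A)) x = app (gComp N (al0 B) (fmap fcM (U' A) (U' B) f)) x" if "x \<in> objs (U' A)" for x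
      using that gHom_ob[OF ff(1)] aA aB ff(2) gHom_ob[OF f'] by simp
    fix x y X w assume xy: "x \<in> objs (U' A)" "y \<in> objs (U' A)" and X: "X \<in> G" "X \<in> Ob N"
      and w: "w \<in> words N R (U' A) X (x, y)"
    have fxy: "app f x \<in> objs B" "app f y \<in> objs B" using gHom_ob[OF f'] xy by auto
    have mw: "map_word N f w \<in> words N R (U' B) X (app f x, app f y)"
      using R.map_word_words[OF v X(2) f' w] by simp
    show "happ (gComp N f (al0 A)) (x, y) \<cdot> fc_elt N R (U' A) X w =
        happ (gComp N (al0 B) (fmap fcM (U' A) (U' B) f)) (x, y) \<cdot> fc_elt N R (U' A) X w"
      using E.happ_comp[OF aA(1) f' F.F_vg[OF v(1)] v _ _ F.felt_arr[OF v(1) X(2) w]]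
        E.happ_comp[OF ff(1) aB(1) F.F_vg[OF v(1)] F.F_vg[OF v(2)] v(2) _ _ F.felt_arr[OF v(1) X(2) w]]
        xy aA(2,4) aB(4) ff(2,3) X w mw actN_hom[OF A B f X(2) w] by simp
  qed
qed

lemma algs_star:
  assumes S: "is_monad N S" and a: "algs W N U S a"
  shows "algs (vp_cat W P) (gph N) U' (star S) (gpt a)"
  unfolding algs_def E.gph_simps vp.vp_simps eta_star mu_star
proof (intro conjI ballI allI impI)
  interpret S: enriched_monad N G S by unfold_locales (rule S)
  note aD = a[unfolded algs_def]
  have gA: "gpt a A = Gmor (objs A) (\<lambda>a\<in>objs A. a) (\<lambda>e\<in>objs A \<times> objs A. a (homs A e))" for A
    by (simp add: gpt_def)
  fix A assume A: "A \<in> vpOb W P"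
  note vA = vp.vpD(1)[OF A] and v = U'_vg[OF vp.vpD(1)[OF A]] and H = vgraphD[OF vp.vpD(1)[OF A]]
  show "arr (gph N) (gpt a A) (fob (star S) (U' A)) (U' A)"
  proof -
    have "Gmor (objs (fob (star S) (U' A))) (restrict (\<lambda>a. a) (objs (fob (star S) (U' A))))
        (restrict (\<lambda>e. a (homs A e)) (objs (fob (star S) (U' A)) \<times> objs (fob (star S) (U' A))))
      \<in> gHom N (fob (star S) (U' A)) (U' A)"
      by (rule gHomI) (use aD H in auto)
    then show ?thesis using S.star_ob[OF v] U'_ob[OF vA] by (simp add: E.garr_iff gA)
  qed
  show "gComp N (gpt a A) (gpt (eta S) (U' A)) = gId N (U' A)"
    unfolding gId_gpt by (rule gComp_eq_gptI) (use aD H in auto)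
  show "gComp N (gpt a A) (gpt (mu S) (U' A)) =
      gComp N (gpt a A) (fmap (star S) (fob (star S) (U' A)) (U' A) (gpt a A))"
    by (rule gComp_eqI) (use aD H in auto)
next
  note aD = a[unfolded algs_def]
  fix A B f assume "arr (vp_cat W P) f A B"
  then have A: "A \<in> vpOb W P" and B: "B \<in> vpOb W P" and f: "f \<in> vpHom W P A B"
    by (simp_all add: arr_def)
  note vA = vp.vpD(1)[OF A] and vB = vp.vpD(1)[OF B] and fh = vp.vpHom_gHom[OF f]
  show "gComp N f (gpt a A) = gComp N (gpt a B) (fmap (star S) (U' A) (U' B) f)"
    by (rule gComp_eqI) (use aD happ_arr[OF fh vA vB] gHom_ob[OF fh] in auto)
qed

lemma compat_star:
  assumes c: "alg_compat W N U S T l a b"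
  shows "alg_compat (vp_cat W P) (gph N) U' (star S) (star T) (gpt l) (gpt a) (gpt b)"
  unfolding alg_compat_def E.gph_simps vp.vp_simps
proof
  fix A assume A: "A \<in> vpOb W P"
  note H = vgraphD[OF vp.vpD(1)[OF A]]
  show "gComp N (gpt b A) (gComp N (fmap (star T) (fob (star S) (U' A)) (U' A) (gpt a A)) (gpt l (U' A))) =
      gComp N (gpt a A) (fmap (star S) (fob (star T) (U' A)) (U' A) (gpt b A))"
    by (rule gComp_eqI) (use c[unfolded alg_compat_def] H in auto)
qed

text \<open>Evaluated on a word and some \<open>z\<close>, the claim is that
  \<open>acts A as\<close> commutes with the structures \<open>a\<close>. On the product of the
  factors these are componentwise by \<open>a_tuple\<close>, which is precisely how
  \<open>lam\<close> and \<open>gpt a\<close> treat a word.\<close>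

lemma compat_lam:
  assumes S: "is_monad N S" and pr: "pres N G S" and a: "algs W N U S a"
  shows "alg_compat (vp_cat W P) (gph N) U' (star S) fcM (opalg.lam N R S (\<lambda>k. a (ar P k))) (gpt a) al0"
  unfolding alg_compat_def E.gph_simps vp.vp_simps
proof
  interpret O: opalg N G R S "\<lambda>k. a (ar P k)"
    by (rule algs_opalg[OF under_operad_axioms E.enriching_axioms S pr a])
  interpret S: under_algs W N U S a
    by (intro under_algs.intro monad_on.intro monad_on_axioms.intro under_algs_axioms.intro
        underlying_axioms N.prodcat_axioms S a)
  fix A assume A: "A \<in> vpOb W P"
  note vA = vp.vpD(1)[OF A] and v = U'_vg[OF vp.vpD(1)[OF A]] and a0 = al0[OF A]
  note Fv = F.F_vg[OF v] and Sv = O.star_vg[OF v]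
  note FSv = F.F_vg[OF Sv] and SFv = O.star_vg[OF Fv]
  have ga: "gpt a A \<in> gHom N (O.SG (U' A)) (U' A)"
    using algs_star[OF S a] A by (simp add: algs_def E.garr_iff)
  note l = O.lam_hom[OF v] and fa = F.fmap_fc[OF ga Sv v] and sa = O.star_hom[OF a0(1) Fv v]
  note fal = E.gComp_hom[OF l fa(1) SFv FSv Fv]
  show "gComp N (al0 A) (gComp N (fmap fcM (O.SG (U' A)) (U' A) (gpt a A)) (O.lam (U' A))) =
      gComp N (gpt a A) (fmap (star S) (fob fcM (U' A)) (U' A) (al0 A))"
    unfolding F.fob_fc
  proof (rule O.SF_gext[OF E.gComp_hom[OF fal a0(1) SFv Fv v] E.gComp_hom[OF sa ga SFv Sv v] v v])
    show "app (gComp N (al0 A) (gComp N (fmap fcM (O.SG (U' A)) (U' A) (gpt a A)) (O.lam (U' A)))) x =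
        app (gComp N (gpt a A) (fmap (star S) (Fc (U' A)) (U' A) (al0 A))) x" if "x \<in> objs (U' A)" for x
      using that a0(2) fa(2) by simp
    fix x y X Y w z assume xy: "x \<in> objs (U' A)" "y \<in> objs (U' A)" and X: "X \<in> Ob N" and Y: "Y \<in> Ob N"
      and w: "w \<in> words N R (U' A) Y (x, y)" and z: "arr N z X (fob S Y)"
    let ?h = "fmap S Y (homs (Fc (U' A)) (x, y)) (F.felt (U' A) Y w) \<cdot> z"
    have xyA: "x \<in> objs A" "y \<in> objs A" using xy by auto
    note fw = F.felt_arr[OF v Y w]
    have h: "arr N ?h X (homs (O.SG (Fc (U' A))) (x, y))" using O.S_elt_arr[OF fw z] xy by simp
    obtain as p xs where w': "w = (as, p, xs)" by (metis prod.collapse)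
    note d = w[unfolded w' R.words_iff[OF v Y]]
    have as: "as \<in> paths A (x, y)" using d by simp
    have xs: "length xs = length as - 1" using d by (auto dest: list_all2_lengthD)
    note B = P.factors_ob[OF vA as]
    have els: "N.els Y (p # rev xs) (map U (factors P A as))"
      using R.word_els[OF v Y] w w' factors_U[OF as] by metis
    have wt: "word_elt N R (U' A) Y w = tuple N Y (map U (factors P A as)) (p # rev xs)"
      by (simp add: w' word_elt_def factors_U[OF as])
    have t: "arr N (tuple N Y (map U (factors P A as)) (p # rev xs)) Y (U (Prod W (factors P A as)))"
      using N.tuple_arr[OF els] U_prod[OF B] by simp
    have "map2 (\<lambda>d x. happ (gpt a A) d \<cdot> x) (steps as)
        (map2 (\<lambda>d x. fmap S Y (homs (U' A) d) x \<cdot> z) (steps as) xs) =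
       map2 (\<lambda>B f. a B \<cdot> fmap S Y (U B) f \<cdot> z) (map (homs A) (steps as)) xs"
      by (rule nth_equalityI) (use F.words_xs[OF v Y w[unfolded w']] xs in auto)
    moreover have "map (app (gpt a A)) as = as"
      using pathsD[OF as] by (intro map_idI) auto
    ultimately have mw: "map_word N (gpt a A) (O.swd Y z (U' A) w) = (as, a (ar P (length as - 1)) \<cdot>
        fmap S Y (U (ar P (length as - 1))) p \<cdot> z, map2 (\<lambda>B f. a B \<cdot> fmap S Y (U B) f \<cdot> z) (map (homs A) (steps as)) xs)"
      by (simp add: w' O.swd_def O.opl_def map_word_def)
    \<comment> \<open>Needed because \<open>factors\<close> runs against the order of the
      letters.\<close>
    have rz: "rev (map2 f us vs) = map2 f (rev us) (rev vs)" if "length us = length vs"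
      for f :: "'a elt obj \<Rightarrow> 'a elt mor \<Rightarrow> 'a elt mor" and us vs
      using that by (simp add: rev_map[symmetric] zip_rev)
    have sw: "O.swd Y z (U' A) w \<in> words N R (O.SG (U' A)) X (x, y)" by (rule O.swd_words[OF v w z Y])
    have mwv: "map_word N (gpt a A) (O.swd Y z (U' A) w) \<in> words N R (U' A) X (x, y)"
      using R.map_word_words[OF Sv v X ga sw] xyA by simp
    have "happ (gComp N (al0 A) (gComp N (fmap fcM (O.SG (U' A)) (U' A) (gpt a A)) (O.lam (U' A)))) (x, y) \<cdot> ?h =
        actN A X (map_word N (gpt a A) (O.swd Y z (U' A) w))"
      using E.happ_comp[OF fal a0(1) SFv Fv v _ _ h] E.happ_comp[OF l fa(1) SFv FSv Fv _ _ h] xy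
        O.lam_elt(2)[OF v xy Y w z] fa(3)[OF X sw] a0(4)[OF X mwv] fa(2) by simp
    also have "\<dots> = acts A as \<cdot> tuple N X (map U (factors P A as))
        (map2 (\<lambda>B f. a B \<cdot> fmap S Y (U B) f \<cdot> z) (factors P A as) (p # rev xs))"
      unfolding actN_def mw word_elt_def
      using xs by (simp add: factors_U[OF as] rz) (simp add: factors_def)
    also have "\<dots> = acts A as \<cdot> a (Prod W (factors P A as)) \<cdot>
        fmap S Y (U (Prod W (factors P A as))) (word_elt N R (U' A) Y w) \<cdot> z"
      using S.a_tuple[OF els B z] wt by simp
    \<comment> \<open>Naturality of \<open>a\<close> at the morphism \<open>acts A as\<close> of
      \<open>W\<close>.\<close>
    also have "\<dots> = a (homs A (x, y)) \<cdot> fmap S Y (U (homs A (x, y))) (actN A Y w) \<cdot> z"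
      using S.a_nat_elt[OF vp.vpD(5)[OF A as] _ z] t wt by (simp add: actN_def w')
    also have "\<dots> = a (homs A (x, y)) \<cdot> fmap S (homs (Fc (U' A)) (x, y)) (U (homs A (x, y))) (happ (al0 A) (x, y)) \<cdot> ?h"
    proof -
      have "arr N (happ (al0 A) (x, y)) (homs (Fc (U' A)) (x, y)) (U (homs A (x, y)))"
        using happ_arr[OF a0(1) Fv v] xyA a0(2) by simp
      from O.S_comp_elt[OF fw this z] show ?thesis using a0(4)[OF Y w] by simp
    qed
    also have "\<dots> = happ (gComp N (gpt a A) (fmap (star S) (Fc (U' A)) (U' A) (al0 A))) (x, y) \<cdot> ?h"
      using E.happ_comp[OF sa ga SFv Sv v _ _ h] xyA a0(2) by simp
    finally show "happ (gComp N (al0 A) (gComp N (fmap fcM (O.SG (U' A)) (U' A) (gpt a A)) (O.lam (U' A)))) (x, y) \<cdot> ?h =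
        happ (gComp N (gpt a A) (fmap (star S) (Fc (U' A)) (U' A) (al0 A))) (x, y) \<cdot> ?h" .
  qed
qed

end

section \<open>Induction on the dimension\<close>

lemma nGSet_Suc: "nGSet (Suc m) = gph (nGSet m)"
  by (simp add: nGSet_def)

lemma U_Suc: "U (Suc m) = Ug (U m)"
  by (simp add: Ug_def fun_eq_iff)

lemma Q_0: "Q P (Suc m) 0 = fc (nGSet m) (U_operad m (P m))"
  and Q_Suc: "Q P (Suc m) (Suc i) = star (Q P m i)"
  by (simp_all add: Q_def Let_def)

text \<open>The induction carries along the algebra structures \<open>a i\<close> for the monads \<open>Q P m i\<close> on the
  objects of \<open>V\<^sub>m\<close>: at the next level they turn the operad \<open>P m\<close> into an operad of algebras.\<close>

definition level :: "(nat \<Rightarrow> ('a elt obj, 'a elt mor) operad) \<Rightarrow> nat \<Rightarrow> 'a elt obj set \<Rightarrow>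
    (nat \<Rightarrow> 'a elt obj \<Rightarrow> 'a elt mor) \<Rightarrow> (nat \<Rightarrow> nat \<Rightarrow> 'a elt obj \<Rightarrow> 'a elt mor) \<Rightarrow> bool" where
  "level P m G a l \<longleftrightarrow> nice (nGSet m) G \<and> underlying (VV P m) (nGSet m) (U m) \<and>
    (\<forall>i<m. is_monad (nGSet m) (Q P m i) \<and> pres (nGSet m) G (Q P m i) \<and>
      algs (VV P m) (nGSet m) (U m) (Q P m i) (a i)) \<and>
    (\<forall>i j. j < i \<and> i < m \<longrightarrow> distributive_law (nGSet m) (Q P m i) (Q P m j) (l i j) \<and>
      alg_compat (VV P m) (nGSet m) (U m) (Q P m i) (Q P m j) (l i j) (a i) (a j)) \<and>
    (\<forall>i j k. k < j \<and> j < i \<and> i < m \<longrightarrow> (\<forall>A\<in>Ob (nGSet m).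
      yb_at (nGSet m) (Q P m i) (Q P m j) (Q P m k) (l i j) (l i k) (l j k) A))"

lemma truncate_simps:
  "Ob (fpcat.truncate C) = Ob C" "Hom (fpcat.truncate C) = Hom C" "Id (fpcat.truncate C) = Id C"
  "Comp (fpcat.truncate C) = Comp C" "Prod (fpcat.truncate C) = Prod C" "Proj (fpcat.truncate C) = Proj C"
  by (simp_all add: fpcat.truncate_def)

text \<open>In dimension 0 there are no monads; what remains concerns the category of sets, its
  one-point probe and the identity functor.\<close>

lemma level_0:
  fixes P :: "nat \<Rightarrow> ('a elt obj, 'a elt mor) operad"
  shows "level P 0 {Disc {Tup []}} a l"
proof -
  interpret nice "set_cat :: 'a gcat" "{Disc {Tup []}}" by (rule set_cat_nice)
  have "prodcat (fpcat.truncate (set_cat :: 'a gcat))"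
    using prodcat_axioms unfolding prodcat_def category_def arr_def truncate_simps .
  moreover have "U 0 = (\<lambda>A :: 'a elt obj. A)" by (simp add: fun_eq_iff)
  ultimately have "underlying (VV P 0) (nGSet 0) (U 0)"
    by (intro underlying.intro underlying_axioms.intro)
      (auto simp: nGSet_def truncate_simps prodcat_axioms)
  then show ?thesis by (simp add: level_def nGSet_def set_cat_nice)
qed

lemma level_Suc:
  fixes P :: "nat \<Rightarrow> ('a elt obj, 'a elt mor) operad"
  assumes L: "level P m G a l" and op: "is_operad (VV P m) (P m)"
  shows "\<exists>G' a' l'. level P (Suc m) G' a' l'"
proof -
  let ?W = "VV P m" and ?N = "nGSet m :: 'a gcat"
  note L' = L[unfolded level_def]
  have nice: "nice ?N G" and und: "underlying ?W ?N (U m)" using L' by blast+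
  have mon: "is_monad ?N (Q P m i)" and pr: "pres ?N G (Q P m i)"
    and al: "algs ?W ?N (U m) (Q P m i) (a i)" if "i < m" for i using L' that by blast+
  have dl: "distributive_law ?N (Q P m i) (Q P m j) (l i j)"
    and co: "alg_compat ?W ?N (U m) (Q P m i) (Q P m j) (l i j) (a i) (a j)" if "j < i" "i < m" for i j
    using L' that by blast+
  have yb: "yb_at ?N (Q P m i) (Q P m j) (Q P m k) (l i j) (l i k) (l j k) A"
    if "k < j" "j < i" "i < m" "A \<in> Ob ?N" for i j k A
    using L' that by blast
  interpret und: underlying ?W ?N "U m" by (rule und)
  interpret nice: nice ?N G by (rule nice)
  interpret s: step ?W ?N "U m" "P m" G by unfold_locales (rule op)
  have R: "U_operad m (P m) = s.R" by (simp add: U_operad_def s.R_def)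
  let ?lam = "\<lambda>i. opalg.lam ?N s.R (Q P m i) (\<lambda>k. a i (ar (P m) k))"
  have oa: "opalg ?N G s.R (Q P m i) (\<lambda>k. a i (ar (P m) k))" if "i < m" for i
    by (rule algs_opalg[OF s.under_operad_axioms s.E.enriching_axioms mon[OF that] pr[OF that] al[OF that]])
  have em: "enriched_monad ?N G (Q P m i)" if "i < m" for i
    by unfold_locales (rule mon[OF that])
  \<comment> \<open>The new monad \<open>fc\<close> receives index 0 and acts by composition; all
    old indices move up by one, and the old structures act homwise.\<close>
  define a' where "a' = (\<lambda>i. case i of 0 \<Rightarrow> s.al0 | Suc i \<Rightarrow> gpt (a i))"
  \<comment> \<open>Laws over index 0 come from the actions of the old monads on the objects of
    operations of \<open>P m\<close>; the others are the old laws applied homwise.\<close>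
  define l' where "l' = (\<lambda>i j. case i of 0 \<Rightarrow> undefined | Suc i \<Rightarrow>
    (case j of 0 \<Rightarrow> ?lam i | Suc j \<Rightarrow> gpt (l i j)))"
  have "level P (Suc m) s.E.gprobes a' l'"
    unfolding level_def nGSet_Suc U_Suc VV.simps
  proof (intro conjI allI impI)
    show "nice (gph ?N) s.E.gprobes" by (rule s.E.gph_nice)
    show "underlying (vp_cat ?W (P m)) (gph ?N) (Ug (U m))" by (rule s.underlying_step)
  next
    fix i assume i: "i < Suc m"
    show "is_monad (gph ?N) (Q P (Suc m) i)" "pres (gph ?N) s.E.gprobes (Q P (Suc m) i)"
      "algs (vp_cat ?W (P m)) (gph ?N) (Ug (U m)) (Q P (Suc m) i) (a' i)"
      using i s.F.fc_monad s.F.fc_pres s.algs_al0 enriched_monad.star_monad[OF em] pr mon al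
        enriched_monad.star_pres[OF em] s.algs_star
      by (cases i; simp add: Q_0 Q_Suc R a'_def)+
  next
    fix i j assume ij: "j < i \<and> i < Suc m"
    then obtain i' where i: "i = Suc i'" "i' < m" by (cases i) auto
    show "distributive_law (gph ?N) (Q P (Suc m) i) (Q P (Suc m) j) (l' i j)"
      "alg_compat (vp_cat ?W (P m)) (gph ?N) (Ug (U m)) (Q P (Suc m) i) (Q P (Suc m) j) (l' i j) (a' i) (a' j)"
      using ij i opalg.lam_distributive[OF oa] s.compat_lam[OF mon pr al]
        s.E.star_distributive[OF mon mon dl] s.compat_star[OF co]
      by (cases j; simp add: Q_0 Q_Suc R a'_def l'_def)+
  next
    fix i j k assume ijk: "k < j \<and> j < i \<and> i < Suc m"
    then obtain i' j' where i: "i = Suc i'" "i' < m" and j: "j = Suc j'" "j' < i'"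
      by (cases i; cases j) auto
    have j': "j' < m" using i j by simp
    show "\<forall>A\<in>Ob (gph ?N). yb_at (gph ?N) (Q P (Suc m) i) (Q P (Suc m) j) (Q P (Suc m) k) (l' i j) (l' i k) (l' j k) A"
    proof
      fix A assume A: "A \<in> Ob (gph ?N)"
      show "yb_at (gph ?N) (Q P (Suc m) i) (Q P (Suc m) j) (Q P (Suc m) k) (l' i j) (l' i k) (l' j k) A"
      proof (cases k)
        case 0
        \<comment> \<open>The compatibility carried by the induction holds at all objects of V_m;
          here it is used at the objects \<open>ar (P m) k\<close>.\<close>
        have "yb_at (gph ?N) (star (Q P m i')) (star (Q P m j')) (fc ?N s.R) (gpt (l i' j')) (?lam i') (?lam j') A"
          by (rule lam_yang_baxter[OF oa[OF i(2)] oa[OF j'] dl[OF j(2) i(2)] _ A])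
            (use co[OF j(2) i(2)] s.P.ar_ob in \<open>simp add: alg_compat_def\<close>)
        then show ?thesis by (simp add: 0 i j Q_0 Q_Suc R l'_def)
      next
        case (Suc k')
        then have "k' < j'" using ijk j by simp
        then show ?thesis
          using s.E.star_yb[OF yb[OF _ j(2) i(2)] A] by (simp add: Suc i j Q_Suc l'_def)
      qed
    qed
  qed
  then show ?thesis by blast
qed

lemma levels:
  assumes "iterative_operadic_theory P"
  shows "\<exists>G a l. level P m G a l"
proof (induction m)
  case 0
  show ?case using level_0 by blast
next
  case (Suc m)
  then show ?case using level_Suc assms unfolding iterative_operadic_theory_def by blast
qed

theorem theorem4p14:
  fixes P :: "nat \<Rightarrow> ('a elt obj, 'a elt mor) operad" and n :: nat
  assumes "iterative_operadic_theory P"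
    and "n \<ge> 3"
  shows "\<exists>l. distributive_series (nGSet n) n (Q P n) l"
proof -
  obtain G a l where L: "level P n G a l" using levels[OF assms(1)] by blast
  then interpret nice "nGSet n" G by (simp add: level_def)
  have "distributive_series (nGSet n) n (Q P n) l"
    using L cat unfolding distributive_series_def yang_baxter_iff level_def by blast
  then show ?thesis by blast
qed

end
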